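(* Let $H$ be a discrete commutative hypergroup of Pontryagin type, let $H_0$ be a closed subhypergroup of $H$, of strong type, such that $H_0^\perp$ is compact in $\hat H$, and let $0<q\le1$. Then the dual of the commutative hypergroup $\mathcal{K}(\hat H\cup\widehat{H_0},\mathbb{Z}_q(2))$ satisfies, as hypergroups, $$\hat{\mathcal{K}}(\hat H\cup\widehat{H_0},\mathbb{Z}_q(2))\cong\mathcal{K}(\mathbb{Z}_q(2),\hat\varphi,H),$$ where $\hat\varphi$ is the hyperfield of $\mathbb{Z}_q(2)=\{\ell_0,\ell_1\}$ based on $H$ given by $\hat\varphi(h)=\{\ell_0\}$ if $h\in H_0$ and $\hat\varphi(h)=\mathbb{Z}_q(2)$ otherwise.
   Context: Hypergroup: a locally compact (Hausdorff) space $K$ with an associative bilinear convolution $*$ on the space $M^b(K)$ of bounded Radon measures making it a Banach algebra, such that: (i) convolution is weakly continuous in the usual sense of Jewett and Bloom–Heyer (in particular $(x,y)\mapsto \delta_x*\delta_y$ is weakly continuous); (ii) $\delta_x*\delta_y$ is a probability measure with compact support for all $x,y\in K$; (iii) there is a unit $e\in K$ with $\delta_e*\delta_x=\delta_x*\delta_e=\delta_x$, and an involution (homeomorphism) $x\mapsto x^-$ with $\delta_{x^-}*\delta_{y^-}=(\delta_y*\delta_x)^-$, and $e\in\operatorname{supp}(\delta_x*\delta_y)$ if and only if $x=y^-$; (iv) $(x,y)\mapsto\operatorname{supp}(\delta_x*\delta_y)$ is continuous from $K\times K$ into the space of compact subsets of $K$ with the Michael topology. It is commutative if $*$ is. A subhypergroup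 is a nonempty closed subset closed under the involution and containing $\operatorname{supp}(\delta_x*\delta_y)$ for all its elements $x,y$; $[A*B]$ is the subhypergroup generated by $A$ and $B$. An isomorphism of hypergroups is a homeomorphism preserving units whose linear extension to bounded measures respects convolution and involution. Dual: for a commutative hypergroup $K$, $\hat K$ is the set of bounded continuous functions $\chi\neq0$ on $K$ with $\int\chi\,d(\delta_x*\delta_y)=\chi(x)\chi(y)$ and $\chi(x^-)=\overline{\chi(x)}$, with the topology of uniform convergence on compact sets. $K$ is strong (of strong type) if $\hat K$ is a hypergroup under the convolution corresponding to pointwise multiplication of characters, i.e. $\chi(x)\chi'(x)=\int_{\hat K}\sigma(x)\,(\varepsilon_\chi*\varepsilon_{\chi'})(d\sigma)$, with unit the constant $1$ and involution complex conjugation. A strong $K$ is Pontryagin (of Pontryagin type) if $\hat K$ is also strong and $\hat{\hat K}\cong K$ canonically. For a closed subhypergroup $H_0$ of $H$, $H_0^\perp=\{\chi\in\hat H:\chi(h)=1\text{ for all }h\in H_0\}$. $\mathbb{Z}_q(2)=\{\ell_0,\ell_1\}$ is the two-point hypergroup with unit $\ell_0$, identity involution and $\varepsilon_{\ell_1}\bullet\varepsilon_{\ell_1}=q\,\varepsilon_{\ell_0}+(1-q)\,\varepsilon_{\ell_1}$. Characters, restriction and induction: for $\pi\in\hat H$ (resp. $\tau\in\widehat{H_0}$), $ch(\pi)$ (resp. $ch(\tau)$) denotes the character $\pi$ (resp. $\tau$), regarded as the point measure at $\pi$ on $\hat H$ (resp. at $\tau$ on $\widehat{H_0}$); the product $\cdot$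 is the pointwise product of characters, i.e. the convolution of measures on $\hat H$ (resp. $\widehat{H_0}$). Thus $ch(\tau_i)\cdot ch(\tau_j)=\int_C ch(\tau)\,\nu(d\tau)$ with $\nu$ a probability measure on $\widehat{H_0}$ with compact support $C$. $\mathrm{res}^H_{H_0}$ is restriction of characters to $H_0$, extended linearly to measures. Let $\omega_{H_0^\perp}$ be the normalized Haar measure of $H_0^\perp$. For $\tau\in\widehat{H_0}$ let $A(\tau)=\{\chi\in\hat H:\mathrm{res}^H_{H_0}\chi=\tau\}$. The paper uses that there is a unique $H_0^\perp$-invariant probability measure $\mu_{A(\tau)}$ on $A(\tau)$, given by $\mu_{A(\tau)}=ch(\tilde\tau)\cdot\omega_{H_0^\perp}$ for some $\tilde\tau\in A(\tau)$. Define $$\mathrm{ind}_{H_0}^H ch(\tau):=\mu_{A(\tau)},\qquad \mathrm{ind}_{H_0}^H(ch(\tau_i)\cdot ch(\tau_j)):=\int_C\mathrm{ind}_{H_0}^H ch(\tau)\,\nu(d\tau).$$ The hypergroup $\mathcal{K}(\hat H\cup\widehat{H_0},\mathbb{Z}_q(2)):=\{(ch(\pi),\circ),(ch(\tau),\bullet):\pi\in\hat H,\tau\in\widehat{H_0}\}$ is the disjoint union of $\hat H$ and $\widehat{H_0}$, with convolution (where $(\mu,\circ)$, $(\nu,\bullet)$ denote measures $\mu$ on $\hat H$, $\nu$ on $\widehat{H_0}$ viewed on the respective component) 1. $(ch(\pi_i),\circ)*(ch(\pi_j),\circ):=(ch(\pi_i)\cdot ch(\pi_j),\circ)$, 2.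 $(ch(\pi),\circ)*(ch(\tau),\bullet):=((\mathrm{res}_{H_0}^Hch(\pi))\cdot ch(\tau),\bullet)$, 3. $(ch(\tau),\bullet)*(ch(\pi),\circ):=(ch(\tau)\cdot(\mathrm{res}_{H_0}^Hch(\pi)),\bullet)$, 4. $(ch(\tau_i),\bullet)*(ch(\tau_j),\bullet):=q(\mathrm{ind}_{H_0}^H(ch(\tau_i)\cdot ch(\tau_j)),\circ)+(1-q)(ch(\tau_i)\cdot ch(\tau_j),\bullet)$. It is a commutative hypergroup. Hyperfields: let $(G,* )$ be a commutative hypergroup with unit $g_0$ and $(L,\bullet)$ a discrete commutative hypergroup with unit $\ell_0$. A hyperfield of $G$ based on $L$ is a map $\psi:\ell\mapsto G(\ell)$ to compact subhypergroups of $G$ with $G(\ell_0)=\{g_0\}$, $G(\ell^-)=G(\ell)$, and $[G(\ell_i)*G(\ell_j)]\supset G(\ell_k)$ whenever $\ell_k\in\operatorname{supp}(\varepsilon_{\ell_i}\bullet\varepsilon_{\ell_j})$. With $e(\ell)$ the normalized Haar measure of $G(\ell)$, $$\mathcal{K}(G,\psi,L):=\{(\delta_g*e(\ell))\otimes\varepsilon_\ell\in M^b(G)\otimes M^b(L):g\in G,\ell\in L\},$$ topologized as the disjoint union of the quotients $G/G(\ell)$, with convolution $((\delta_{g}*e(\ell_i))\otimes\varepsilon_{\ell_i})\circ((\delta_{g'}*e(\ell_j))\otimes\varepsilon_{\ell_j})=(\delta_g*\delta_{g'}*e(\ell_i)*e(\ell_j))\otimes(\varepsilon_{\ell_i}\bullet\varepsilon_{\ell_j})$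 and involution $((\delta_g*e(\ell))\otimes\varepsilon_\ell)^-=(\delta_{g^-}*e(\ell))\otimes\varepsilon_{\ell^-}$; it is a commutative hypergroup. In the claim it is applied with $G=\mathbb{Z}_q(2)$, base $L=H$ and $\psi=\hat\varphi$. ($\hat\varphi$ is the dual of the hyperfield $\varphi$ of $\hat H$ based on $\mathbb{Z}_q(2)$ with $\varphi(\ell_0)=\{\chi_0\}$, $\varphi(\ell_1)=H_0^\perp$, $\chi_0$ being the unit character.) *)

theory Defs
  imports "HOL-Analysis.Analysis"
begin

unbundle no vec_syntax

section \<open>Bounded complex Radon measures\<close>

text \<open>
  A complex measure on a space \<open>X\<close> is a countably additive set function on the Borel sets of \<open>X\<close>.
  It is normalised to vanish on all other sets, so that equality of measures is equality
  of functions.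
\<close>

type_synonym 'a cmeasure = "'a set \<Rightarrow> complex"

definition borel_sets :: "'a topology \<Rightarrow> 'a set set" where
  "borel_sets X = sigma_sets (topspace X) {U. openin X U}"

definition total_variation :: "'a topology \<Rightarrow> 'a cmeasure \<Rightarrow> 'a set \<Rightarrow> ennreal" where
  "total_variation X \<mu> A =
    (SUP P\<in>{P. finite P \<and> disjoint P \<and> P \<subseteq> borel_sets X \<and> \<Union>P \<subseteq> A}. \<Sum>B\<in>P. ennreal (cmod (\<mu> B)))"

definition complex_measure :: "'a topology \<Rightarrow> 'a cmeasure \<Rightarrow> bool" where
  "complex_measure X \<mu> \<longleftrightarrow>
    (\<forall>A. A \<notin> borel_sets X \<longrightarrow> \<mu> A = 0) \<and>
    (\<forall>F :: nat \<Rightarrow> 'a set. range F \<subseteq> borel_sets X \<longrightarrow> disjoint_family F \<longrightarrow>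
       (\<lambda>n. \<mu> (F n)) sums \<mu> (\<Union>n. F n))"

text \<open>\<open>Mb X\<close> is the space of bounded Radon measures; a complex measure is automatically bounded.\<close>

definition Mb :: "'a topology \<Rightarrow> 'a cmeasure set" where
  "Mb X = {\<mu>. complex_measure X \<mu> \<and>
    (\<forall>A\<in>borel_sets X. \<forall>\<epsilon>>0. \<exists>C. compactin X C \<and> C \<subseteq> A \<and>
       total_variation X \<mu> (A - C) < ennreal \<epsilon>)}"

definition Mb_norm :: "'a topology \<Rightarrow> 'a cmeasure \<Rightarrow> real" where
  "Mb_norm X \<mu> = enn2real (total_variation X \<mu> (topspace X))"

definition Mb_pos :: "'a topology \<Rightarrow> 'a cmeasure set" where
  "Mb_pos X = {\<mu> \<in> Mb X. \<forall>A. \<mu> A \<in> \<real>\<^sub>\<ge>\<^sub>0}"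

definition M_prob :: "'a topology \<Rightarrow> 'a cmeasure set" where
  "M_prob X = {\<mu> \<in> Mb_pos X. \<mu> (topspace X) = 1}"

definition dirac :: "'a topology \<Rightarrow> 'a \<Rightarrow> 'a cmeasure" where
  "dirac X x = (\<lambda>A. of_bool (A \<in> borel_sets X \<and> x \<in> A))"

definition supp :: "'a topology \<Rightarrow> 'a cmeasure \<Rightarrow> 'a set" where
  "supp X \<mu> = {x \<in> topspace X. \<forall>U. openin X U \<longrightarrow> x \<in> U \<longrightarrow> total_variation X \<mu> U \<noteq> 0}"

definition push :: "'a topology \<Rightarrow> 'b topology \<Rightarrow> ('a \<Rightarrow> 'b) \<Rightarrow> 'a cmeasure \<Rightarrow> 'b cmeasure" where
  "push X Y f \<mu> = (\<lambda>B. if B \<in> borel_sets Y then \<mu> (f -` B \<inter> topspace X) else 0)"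

text \<open>
  The upper variation \<open>\<nu>\<^sup>+\<close> of a real measure; the lower variation \<open>\<nu>\<^sup>-\<close> is the upper variation
  of \<open>-\<nu>\<close>.  Note that \<^const>\<open>ennreal\<close> sends negative numbers to 0.
\<close>

definition upper_variation :: "'a topology \<Rightarrow> ('a set \<Rightarrow> real) \<Rightarrow> 'a measure" where
  "upper_variation X \<nu> = measure_of (topspace X) {U. openin X U}
     (\<lambda>A. SUP B\<in>{B \<in> borel_sets X. B \<subseteq> A}. ennreal (\<nu> B))"

definition cintegral :: "'a topology \<Rightarrow> ('a \<Rightarrow> complex) \<Rightarrow> 'a cmeasure \<Rightarrow> complex" where
  "cintegral X f \<mu> =
      (LINT x|upper_variation X (\<lambda>A. Re (\<mu> A)). f x)
    - (LINT x|upper_variation X (\<lambda>A. - Re (\<mu> A)). f x)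
    + \<i> * ((LINT x|upper_variation X (\<lambda>A. Im (\<mu> A)). f x)
         - (LINT x|upper_variation X (\<lambda>A. - Im (\<mu> A)). f x))"

text \<open>
  The extension of a convolution of point measures to all bounded measures:
  \<open>\<mu> * \<nu> = \<integral>\<integral> c x y \<nu>(dy) \<mu>(dx)\<close>.
\<close>

definition bilinear_ext ::
    "'a topology \<Rightarrow> ('a \<Rightarrow> 'a \<Rightarrow> 'a cmeasure) \<Rightarrow> 'a cmeasure \<Rightarrow> 'a cmeasure \<Rightarrow> 'a cmeasure" where
  "bilinear_ext X c \<mu> \<nu> = (\<lambda>A. if A \<in> borel_sets X
     then cintegral X (\<lambda>x. cintegral X (\<lambda>y. c x y A) \<nu>) \<mu> else 0)"


section \<open>Topologies\<close>

definition bounded_continuous :: "'a topology \<Rightarrow> ('a \<Rightarrow> complex) set" where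
  "bounded_continuous X = {f. continuous_map X euclidean f \<and> bounded (f ` topspace X)}"

definition weak_topology :: "'a topology \<Rightarrow> 'a cmeasure topology" where
  "weak_topology X = topology_generated_by
     {{\<mu> \<in> Mb_pos X. cintegral X f \<mu> \<in> U} | f U. f \<in> bounded_continuous X \<and> open U}"

definition Michael_topology :: "'a topology \<Rightarrow> 'a set topology" where
  "Michael_topology X = topology_generated_by
     {{C. compactin X C \<and> C \<inter> U \<noteq> {} \<and> C \<subseteq> V} | U V. openin X U \<and> openin X V}"

definition quotient_topology :: "'a topology \<Rightarrow> ('a \<Rightarrow> 'b) \<Rightarrow> 'b topology" where
  "quotient_topology X f =
     topology (\<lambda>U. U \<subseteq> f ` topspace X \<and> openin X {x \<in> topspace X. f x \<in> U})"

definition compact_convergence_topology ::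
    "'a topology \<Rightarrow> ('a \<Rightarrow> complex) set \<Rightarrow> ('a \<Rightarrow> complex) topology" where
  "compact_convergence_topology X S = topology (\<lambda>W. W \<subseteq> S \<and>
     (\<forall>f\<in>W. \<exists>C \<epsilon>. compactin X C \<and> 0 < \<epsilon> \<and> {g \<in> S. \<forall>x\<in>C. dist (f x) (g x) < \<epsilon>} \<subseteq> W))"

lemma openin_quotient_topology:
  "openin (quotient_topology X f) U \<longleftrightarrow>
     U \<subseteq> f ` topspace X \<and> openin X {x \<in> topspace X. f x \<in> U}"
proof -
  have 1: "{x \<in> topspace X. f x \<in> S \<inter> T} = {x \<in> topspace X. f x \<in> S} \<inter> {x \<in> topspace X. f x \<in> T}"
    and 2: "{x \<in> topspace X. f x \<in> \<Union>\<K>} = (\<Union>U\<in>\<K>. {x \<in> topspace X. f x \<in> U})" for S T \<K>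
    by auto
  have "istopology (\<lambda>U. U \<subseteq> f ` topspace X \<and> openin X {x \<in> topspace X. f x \<in> U})"
    unfolding istopology_def 1 2 by (blast intro: openin_Int openin_Union)
  then show ?thesis
    by (simp add: quotient_topology_def topology_inverse')
qed

lemma openin_compact_convergence_topology:
  "openin (compact_convergence_topology X S) W \<longleftrightarrow> W \<subseteq> S \<and>
     (\<forall>f\<in>W. \<exists>C \<epsilon>. compactin X C \<and> 0 < \<epsilon> \<and> {g \<in> S. \<forall>x\<in>C. dist (f x) (g x) < \<epsilon>} \<subseteq> W)"
proof -
  let ?N = "\<lambda>f W. \<exists>C \<epsilon>. compactin X C \<and> 0 < \<epsilon> \<and> {g \<in> S. \<forall>x\<in>C. dist (f x) (g x) < \<epsilon>} \<subseteq> W"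
  have Int: "?N f (V \<inter> W)" if V: "?N f V" and W: "?N f W" for f V W
  proof -
    obtain C \<epsilon> D \<delta> where "compactin X C" "0 < \<epsilon>" "{g \<in> S. \<forall>x\<in>C. dist (f x) (g x) < \<epsilon>} \<subseteq> V"
      "compactin X D" "0 < \<delta>" "{g \<in> S. \<forall>x\<in>D. dist (f x) (g x) < \<delta>} \<subseteq> W"
      using V W by blast
    then have "compactin X (C \<union> D) \<and> 0 < min \<epsilon> \<delta> \<and>
        {g \<in> S. \<forall>x\<in>C \<union> D. dist (f x) (g x) < min \<epsilon> \<delta>} \<subseteq> V \<inter> W"
      by (auto simp: compactin_Un)
    then show ?thesis by blast
  qed
  have mono: "?N f W" if "?N f V" "V \<subseteq> W" for f V W
    using that by (meson subset_trans)
  have "istopology (\<lambda>W. W \<subseteq> S \<and> (\<forall>f\<in>W. ?N f W))"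
    unfolding istopology_def
  proof (intro conjI allI impI)
    fix V W assume *: "V \<subseteq> S \<and> (\<forall>f\<in>V. ?N f V)" "W \<subseteq> S \<and> (\<forall>f\<in>W. ?N f W)"
    then show "V \<inter> W \<subseteq> S" by blast
    show "\<forall>f\<in>V \<inter> W. ?N f (V \<inter> W)"
    proof
      fix f assume "f \<in> V \<inter> W"
      then have "?N f V" "?N f W" using * by simp_all
      then show "?N f (V \<inter> W)" by (rule Int)
    qed
  next
    fix \<K> assume *: "\<forall>K\<in>\<K>. K \<subseteq> S \<and> (\<forall>f\<in>K. ?N f K)"
    then show "\<Union>\<K> \<subseteq> S" by blast
    show "\<forall>f\<in>\<Union>\<K>. ?N f (\<Union>\<K>)"
    proof
      fix f assume "f \<in> \<Union>\<K>"
      then obtain K where K: "K \<in> \<K>" "f \<in> K" by blast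
      then have "?N f K" using * by blast
      then show "?N f (\<Union>\<K>)" by (rule mono) (use K in blast)
    qed
  qed
  then show ?thesis
    by (simp add: compact_convergence_topology_def topology_inverse')
qed


section \<open>Hypergroups\<close>

record 'a hypergroup_data =
  htop :: "'a topology"
  hconv :: "'a cmeasure \<Rightarrow> 'a cmeasure \<Rightarrow> 'a cmeasure"
  hunit :: 'a
  hinv :: "'a \<Rightarrow> 'a"

abbreviation carrier_of :: "('a, 'b) hypergroup_data_scheme \<Rightarrow> 'a set" where
  "carrier_of K \<equiv> topspace (htop K)"

abbreviation point :: "('a, 'b) hypergroup_data_scheme \<Rightarrow> 'a \<Rightarrow> 'a cmeasure" where
  "point K x \<equiv> dirac (htop K) x"

definition pconv :: "('a, 'b) hypergroup_data_scheme \<Rightarrow> 'a \<Rightarrow> 'a \<Rightarrow> 'a cmeasure" where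
  "pconv K x y = hconv K (point K x) (point K y)"

definition measure_inv :: "('a, 'b) hypergroup_data_scheme \<Rightarrow> 'a cmeasure \<Rightarrow> 'a cmeasure" where
  "measure_inv K = push (htop K) (htop K) (hinv K)"

text \<open>
  In the Banach algebra axiom completeness is not listed, since \<^term>\<open>Mb X\<close> is complete in the
  variation norm for every \<open>X\<close>.  Weak continuity is Jewett's positive continuity:
  joint continuity on the cone of positive measures with the weak topology.
\<close>

locale hypergroup =
  fixes K :: "'a hypergroup_data"
  assumes locally_compact: "locally_compact_space (htop K)"
    and Hausdorff: "Hausdorff_space (htop K)"
    and conv_closed: "\<lbrakk>\<mu> \<in> Mb (htop K); \<nu> \<in> Mb (htop K)\<rbrakk> \<Longrightarrow> hconv K \<mu> \<nu> \<in> Mb (htop K)"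
    and conv_add_left: "\<lbrakk>\<mu> \<in> Mb (htop K); \<mu>' \<in> Mb (htop K); \<nu> \<in> Mb (htop K)\<rbrakk> \<Longrightarrow>
      hconv K (\<lambda>A. \<mu> A + \<mu>' A) \<nu> = (\<lambda>A. hconv K \<mu> \<nu> A + hconv K \<mu>' \<nu> A)"
    and conv_add_right: "\<lbrakk>\<mu> \<in> Mb (htop K); \<nu> \<in> Mb (htop K); \<nu>' \<in> Mb (htop K)\<rbrakk> \<Longrightarrow>
      hconv K \<mu> (\<lambda>A. \<nu> A + \<nu>' A) = (\<lambda>A. hconv K \<mu> \<nu> A + hconv K \<mu> \<nu>' A)"
    and conv_scale_left: "\<lbrakk>\<mu> \<in> Mb (htop K); \<nu> \<in> Mb (htop K)\<rbrakk> \<Longrightarrow>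
      hconv K (\<lambda>A. a * \<mu> A) \<nu> = (\<lambda>A. a * hconv K \<mu> \<nu> A)"
    and conv_scale_right: "\<lbrakk>\<mu> \<in> Mb (htop K); \<nu> \<in> Mb (htop K)\<rbrakk> \<Longrightarrow>
      hconv K \<mu> (\<lambda>A. a * \<nu> A) = (\<lambda>A. a * hconv K \<mu> \<nu> A)"
    and conv_assoc: "\<lbrakk>\<mu> \<in> Mb (htop K); \<nu> \<in> Mb (htop K); \<rho> \<in> Mb (htop K)\<rbrakk> \<Longrightarrow>
      hconv K (hconv K \<mu> \<nu>) \<rho> = hconv K \<mu> (hconv K \<nu> \<rho>)"
    and conv_norm: "\<lbrakk>\<mu> \<in> Mb (htop K); \<nu> \<in> Mb (htop K)\<rbrakk> \<Longrightarrow>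
      Mb_norm (htop K) (hconv K \<mu> \<nu>) \<le> Mb_norm (htop K) \<mu> * Mb_norm (htop K) \<nu>"
    and conv_weakly_continuous:
      "continuous_map (prod_topology (weak_topology (htop K)) (weak_topology (htop K)))
         (weak_topology (htop K)) (\<lambda>(\<mu>, \<nu>). hconv K \<mu> \<nu>)"
    and pconv_prob: "\<lbrakk>x \<in> carrier_of K; y \<in> carrier_of K\<rbrakk> \<Longrightarrow> pconv K x y \<in> M_prob (htop K)"
    and compact_supp: "\<lbrakk>x \<in> carrier_of K; y \<in> carrier_of K\<rbrakk> \<Longrightarrow>
      compactin (htop K) (supp (htop K) (pconv K x y))"
    and unit_carrier: "hunit K \<in> carrier_of K"
    and unit_left: "x \<in> carrier_of K \<Longrightarrow> pconv K (hunit K) x = point K x"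
    and unit_right: "x \<in> carrier_of K \<Longrightarrow> pconv K x (hunit K) = point K x"
    and inv_homeomorphism: "homeomorphic_maps (htop K) (htop K) (hinv K) (hinv K)"
    and inv_pconv: "\<lbrakk>x \<in> carrier_of K; y \<in> carrier_of K\<rbrakk> \<Longrightarrow>
      pconv K (hinv K x) (hinv K y) = measure_inv K (pconv K y x)"
    and unit_in_supp_iff: "\<lbrakk>x \<in> carrier_of K; y \<in> carrier_of K\<rbrakk> \<Longrightarrow>
      hunit K \<in> supp (htop K) (pconv K x y) \<longleftrightarrow> x = hinv K y"
    and supp_continuous: "continuous_map (prod_topology (htop K) (htop K))
      (Michael_topology (htop K)) (\<lambda>(x, y). supp (htop K) (pconv K x y))"

locale comm_hypergroup = hypergroup +
  assumes conv_commute: "\<lbrakk>\<mu> \<in> Mb (htop K); \<nu> \<in> Mb (htop K)\<rbrakk> \<Longrightarrow> hconv K \<mu> \<nu> = hconv K \<nu> \<mu>"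

definition discrete_hypergroup :: "'a hypergroup_data \<Rightarrow> bool" where
  "discrete_hypergroup K \<longleftrightarrow> htop K = discrete_topology (carrier_of K)"

definition subhypergroup :: "'a hypergroup_data \<Rightarrow> 'a set \<Rightarrow> bool" where
  "subhypergroup K S \<longleftrightarrow> S \<noteq> {} \<and> closedin (htop K) S \<and> (\<forall>x\<in>S. hinv K x \<in> S) \<and>
     (\<forall>x\<in>S. \<forall>y\<in>S. supp (htop K) (pconv K x y) \<subseteq> S)"

definition generated_subhypergroup :: "'a hypergroup_data \<Rightarrow> 'a set \<Rightarrow> 'a set \<Rightarrow> 'a set" where
  "generated_subhypergroup K A B = \<Inter>{S. subhypergroup K S \<and> A \<subseteq> S \<and> B \<subseteq> S}"

text \<open>
  A subhypergroup as a hypergroup in its own right: measures on \<open>S\<close> are convolved in \<open>K\<close>, and the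
  result, which is concentrated on \<open>S\<close>, is regarded as a measure on \<open>S\<close> again.
\<close>

definition subhypergroup_of :: "'a hypergroup_data \<Rightarrow> 'a set \<Rightarrow> 'a hypergroup_data" where
  "subhypergroup_of K S = (let Y = subtopology (htop K) S; \<iota> = push Y (htop K) (\<lambda>x. x) in
     \<lparr>htop = Y,
      hconv = (\<lambda>\<mu> \<nu> A. if A \<in> borel_sets Y then hconv K (\<iota> \<mu>) (\<iota> \<nu>) A else 0),
      hunit = hunit K,
      hinv = hinv K\<rparr>)"

definition normalized_Haar :: "'a hypergroup_data \<Rightarrow> 'a set \<Rightarrow> 'a cmeasure" where
  "normalized_Haar K S = (THE \<omega>. \<omega> \<in> M_prob (htop K) \<and> \<omega> (carrier_of K - S) = 0 \<and>
     (\<forall>x\<in>S. hconv K (point K x) \<omega> = \<omega>))"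

definition hypergroup_iso ::
    "('a \<Rightarrow> 'b) \<Rightarrow> 'a hypergroup_data \<Rightarrow> 'b hypergroup_data \<Rightarrow> bool" where
  "hypergroup_iso f K L \<longleftrightarrow> homeomorphic_map (htop K) (htop L) f \<and> f (hunit K) = hunit L \<and>
     (\<forall>\<mu>\<in>Mb (htop K). \<forall>\<nu>\<in>Mb (htop K). push (htop K) (htop L) f (hconv K \<mu> \<nu>) =
        hconv L (push (htop K) (htop L) f \<mu>) (push (htop K) (htop L) f \<nu>)) \<and>
     (\<forall>\<mu>\<in>Mb (htop K). push (htop K) (htop L) f (measure_inv K \<mu>) =
        measure_inv L (push (htop K) (htop L) f \<mu>))"

definition hypergroup_isomorphic ::
    "'a hypergroup_data \<Rightarrow> 'b hypergroup_data \<Rightarrow> bool" (infix \<open>\<cong>\<^sub>h\<close> 50) where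
  "K \<cong>\<^sub>h L \<longleftrightarrow> (\<exists>f. hypergroup_iso f K L)"


section \<open>Duality\<close>

definition characters :: "'a hypergroup_data \<Rightarrow> ('a \<Rightarrow> complex) set" where
  "characters K = {\<chi> \<in> extensional (carrier_of K).
     \<chi> \<in> bounded_continuous (htop K) \<and> (\<exists>x\<in>carrier_of K. \<chi> x \<noteq> 0) \<and>
     (\<forall>x\<in>carrier_of K. \<forall>y\<in>carrier_of K. cintegral (htop K) \<chi> (pconv K x y) = \<chi> x * \<chi> y) \<and>
     (\<forall>x\<in>carrier_of K. \<chi> (hinv K x) = cnj (\<chi> x))}"

definition dual_with ::
    "'a hypergroup_data \<Rightarrow>
     (('a \<Rightarrow> complex) cmeasure \<Rightarrow> ('a \<Rightarrow> complex) cmeasure \<Rightarrow> ('a \<Rightarrow> complex) cmeasure) \<Rightarrow>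
     ('a \<Rightarrow> complex) hypergroup_data" where
  "dual_with K c =
     \<lparr>htop = compact_convergence_topology (htop K) (characters K),
      hconv = c,
      hunit = (\<lambda>x\<in>carrier_of K. 1),
      hinv = (\<lambda>\<chi>. \<lambda>x\<in>carrier_of K. cnj (\<chi> x))\<rparr>"

definition dual_convolution ::
    "'a hypergroup_data \<Rightarrow>
     (('a \<Rightarrow> complex) cmeasure \<Rightarrow> ('a \<Rightarrow> complex) cmeasure \<Rightarrow> ('a \<Rightarrow> complex) cmeasure) \<Rightarrow> bool"
  where
  "dual_convolution K c \<longleftrightarrow> hypergroup (dual_with K c) \<and>
     (\<forall>\<chi>\<in>characters K. \<forall>\<chi>'\<in>characters K. \<forall>x\<in>carrier_of K.
        \<chi> x * \<chi>' x = cintegral (htop (dual_with K c)) (\<lambda>\<sigma>. \<sigma> x) (pconv (dual_with K c) \<chi> \<chi>'))"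

definition strong :: "'a hypergroup_data \<Rightarrow> bool" where
  "strong K \<longleftrightarrow> comm_hypergroup K \<and> (\<exists>c. dual_convolution K c)"

text \<open>
  A dual convolution is unique on bounded measures, because a bounded measure \<open>\<mu>\<close> on the dual is
  determined by the function \<open>x \<mapsto> \<integral> \<sigma>(x) \<mu>(d\<sigma>)\<close>; the choice only fixes values outside
  \<^const>\<open>Mb\<close>.  It is meaningful only if \<open>K\<close> is strong.
\<close>

definition dual :: "'a hypergroup_data \<Rightarrow> ('a \<Rightarrow> complex) hypergroup_data" where
  "dual K = dual_with K (SOME c. dual_convolution K c)"

definition pontryagin :: "'a hypergroup_data \<Rightarrow> bool" where
  "pontryagin K \<longleftrightarrow> strong K \<and> strong (dual K) \<and>
     hypergroup_iso (\<lambda>x. \<lambda>\<chi>\<in>characters K. \<chi> x) K (dual (dual K))"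

definition annihilator :: "'a hypergroup_data \<Rightarrow> 'a set \<Rightarrow> ('a \<Rightarrow> complex) set" where
  "annihilator H H\<^sub>0 = {\<chi> \<in> characters H. \<forall>h\<in>H\<^sub>0. \<chi> h = 1}"


section \<open>The two-point hypergroup\<close>

datatype two_point = Ell0 | Ell1

definition Zq2 :: "real \<Rightarrow> two_point hypergroup_data" where
  "Zq2 q = (let X = discrete_topology UNIV in
     \<lparr>htop = X,
      hconv = bilinear_ext X (\<lambda>x y.
        if x = Ell0 then dirac X y
        else if y = Ell0 then dirac X x
        else (\<lambda>A. of_real q * dirac X Ell0 A + of_real (1 - q) * dirac X Ell1 A)),
      hunit = Ell0,
      hinv = (\<lambda>x. x)\<rparr>)"


section \<open>Restriction, induction, and the hypergroup on the union of two duals\<close>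

definition restr ::
    "'a hypergroup_data \<Rightarrow> 'a set \<Rightarrow> ('a \<Rightarrow> complex) cmeasure \<Rightarrow> ('a \<Rightarrow> complex) cmeasure" where
  "restr H H\<^sub>0 = push (htop (dual H)) (htop (dual (subhypergroup_of H H\<^sub>0))) (\<lambda>\<chi>. restrict \<chi> H\<^sub>0)"

definition extensions :: "'a hypergroup_data \<Rightarrow> 'a set \<Rightarrow> ('a \<Rightarrow> complex) \<Rightarrow> ('a \<Rightarrow> complex) set" where
  "extensions H H\<^sub>0 \<tau> = {\<chi> \<in> characters H. restrict \<chi> H\<^sub>0 = \<tau>}"

text \<open>The invariant probability measure on the set of extensions of \<open>\<tau>\<close>.\<close>

definition induced_point ::
    "'a hypergroup_data \<Rightarrow> 'a set \<Rightarrow> ('a \<Rightarrow> complex) \<Rightarrow> ('a \<Rightarrow> complex) cmeasure" where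
  "induced_point H H\<^sub>0 \<tau> = (THE \<mu>.
     \<mu> \<in> M_prob (htop (dual H)) \<and> \<mu> (carrier_of (dual H) - extensions H H\<^sub>0 \<tau>) = 0 \<and>
     (\<forall>\<sigma>\<in>annihilator H H\<^sub>0. hconv (dual H) (point (dual H) \<sigma>) \<mu> = \<mu>) \<and>
     (\<exists>\<chi>\<in>extensions H H\<^sub>0 \<tau>.
        \<mu> = hconv (dual H) (point (dual H) \<chi>) (normalized_Haar (dual H) (annihilator H H\<^sub>0))))"

definition induced ::
    "'a hypergroup_data \<Rightarrow> 'a set \<Rightarrow> ('a \<Rightarrow> complex) cmeasure \<Rightarrow> ('a \<Rightarrow> complex) cmeasure" where
  "induced H H\<^sub>0 \<nu> = (\<lambda>A. if A \<in> borel_sets (htop (dual H))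
     then cintegral (htop (dual (subhypergroup_of H H\<^sub>0))) (\<lambda>\<tau>. induced_point H H\<^sub>0 \<tau> A) \<nu>
     else 0)"

datatype tag = Circ | Bullet

text \<open>
  \<open>(Circ, \<pi>)\<close> and \<open>(Bullet, \<tau>)\<close> are the points \<open>(ch(\<pi>), \<circ>)\<close> and \<open>(ch(\<tau>), \<bullet>)\<close>.  A measure on the
  disjoint union is the sum of its two parts; \<open>put s \<mu>\<close> is \<open>(\<mu>, s)\<close>.
\<close>

definition union_component :: "'a hypergroup_data \<Rightarrow> 'a set \<Rightarrow> tag \<Rightarrow> ('a \<Rightarrow> complex) topology" where
  "union_component H H\<^sub>0 s =
     (case s of Circ \<Rightarrow> htop (dual H) | Bullet \<Rightarrow> htop (dual (subhypergroup_of H H\<^sub>0)))"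

definition union_topology :: "'a hypergroup_data \<Rightarrow> 'a set \<Rightarrow> (tag \<times> ('a \<Rightarrow> complex)) topology" where
  "union_topology H H\<^sub>0 = sum_topology (union_component H H\<^sub>0) UNIV"

definition put ::
    "'a hypergroup_data \<Rightarrow> 'a set \<Rightarrow> tag \<Rightarrow> ('a \<Rightarrow> complex) cmeasure \<Rightarrow>
     (tag \<times> ('a \<Rightarrow> complex)) cmeasure" where
  "put H H\<^sub>0 s = push (union_component H H\<^sub>0 s) (union_topology H H\<^sub>0) (Pair s)"

definition part ::
    "'a hypergroup_data \<Rightarrow> 'a set \<Rightarrow> tag \<Rightarrow> (tag \<times> ('a \<Rightarrow> complex)) cmeasure \<Rightarrow>
     ('a \<Rightarrow> complex) cmeasure" where
  "part H H\<^sub>0 s M = (\<lambda>A. if A \<in> borel_sets (union_component H H\<^sub>0 s) then M (Pair s ` A) else 0)"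

fun tagged_conv ::
    "'a hypergroup_data \<Rightarrow> 'a set \<Rightarrow> real \<Rightarrow> tag \<Rightarrow> tag \<Rightarrow>
     ('a \<Rightarrow> complex) cmeasure \<Rightarrow> ('a \<Rightarrow> complex) cmeasure \<Rightarrow> (tag \<times> ('a \<Rightarrow> complex)) cmeasure" where
  "tagged_conv H H\<^sub>0 q Circ Circ \<mu> \<nu> = put H H\<^sub>0 Circ (hconv (dual H) \<mu> \<nu>)"
| "tagged_conv H H\<^sub>0 q Circ Bullet \<mu> \<nu> =
     put H H\<^sub>0 Bullet (hconv (dual (subhypergroup_of H H\<^sub>0)) (restr H H\<^sub>0 \<mu>) \<nu>)"
| "tagged_conv H H\<^sub>0 q Bullet Circ \<mu> \<nu> =
     put H H\<^sub>0 Bullet (hconv (dual (subhypergroup_of H H\<^sub>0)) \<mu> (restr H H\<^sub>0 \<nu>))"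
| "tagged_conv H H\<^sub>0 q Bullet Bullet \<mu> \<nu> =
     (let \<rho> = hconv (dual (subhypergroup_of H H\<^sub>0)) \<mu> \<nu> in
      (\<lambda>A. of_real q * put H H\<^sub>0 Circ (induced H H\<^sub>0 \<rho>) A
         + of_real (1 - q) * put H H\<^sub>0 Bullet \<rho> A))"

definition dual_union_hypergroup ::
    "'a hypergroup_data \<Rightarrow> 'a set \<Rightarrow> real \<Rightarrow> (tag \<times> ('a \<Rightarrow> complex)) hypergroup_data" where
  "dual_union_hypergroup H H\<^sub>0 q =
     \<lparr>htop = union_topology H H\<^sub>0,
      hconv = (\<lambda>M N A. \<Sum>s\<in>{Circ, Bullet}. \<Sum>t\<in>{Circ, Bullet}.
        tagged_conv H H\<^sub>0 q s t (part H H\<^sub>0 s M) (part H H\<^sub>0 t N) A),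
      hunit = (Circ, hunit (dual H)),
      hinv = (\<lambda>(s, \<chi>). (s, case s of
        Circ \<Rightarrow> hinv (dual H) \<chi> | Bullet \<Rightarrow> hinv (dual (subhypergroup_of H H\<^sub>0)) \<chi>))\<rparr>"


section \<open>Hyperfields\<close>

locale hyperfield = G: comm_hypergroup G + L: comm_hypergroup L
  for G :: "'g hypergroup_data" and \<psi> :: "'l \<Rightarrow> 'g set" and L :: "'l hypergroup_data" +
  assumes discrete: "discrete_hypergroup L"
    and subhypergroup: "l \<in> carrier_of L \<Longrightarrow> subhypergroup G (\<psi> l)"
    and compact: "l \<in> carrier_of L \<Longrightarrow> compactin (htop G) (\<psi> l)"
    and unit: "\<psi> (hunit L) = {hunit G}"
    and inv: "l \<in> carrier_of L \<Longrightarrow> \<psi> (hinv L l) = \<psi> l"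
    and generated: "\<lbrakk>i \<in> carrier_of L; j \<in> carrier_of L; k \<in> supp (htop L) (pconv L i j)\<rbrakk> \<Longrightarrow>
      \<psi> k \<subseteq> generated_subhypergroup G (\<psi> i) (\<psi> j)"

definition coset_measure ::
    "'g hypergroup_data \<Rightarrow> ('l \<Rightarrow> 'g set) \<Rightarrow> 'l \<Rightarrow> 'g \<Rightarrow> 'g cmeasure" where
  "coset_measure G \<psi> l g = hconv G (point G g) (normalized_Haar G (\<psi> l))"

definition hyperfield_topology ::
    "'g hypergroup_data \<Rightarrow> ('l \<Rightarrow> 'g set) \<Rightarrow> 'l hypergroup_data \<Rightarrow> ('l \<times> 'g cmeasure) topology" where
  "hyperfield_topology G \<psi> L =
     sum_topology (\<lambda>l. quotient_topology (htop G) (coset_measure G \<psi> l)) (carrier_of L)"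

text \<open>
  The pair \<open>(l, \<mu>)\<close> with \<open>\<mu> = \<delta>\<^sub>g * e(l)\<close> encodes the point \<open>\<mu> \<otimes> \<epsilon>\<^sub>l\<close>.  The convolution of two points is an
  element of \<open>M\<^sup>b(G) \<otimes> M\<^sup>b(L)\<close>; it is read as the measure \<open>P\<close> on the set of points whose
  barycentre \<open>\<integral> p P(dp)\<close> is that element.  The involution uses
  \<open>\<delta>\<^sub>h * e(l) = (\<delta>\<^sub>g * e(l))\<^sup>-\<close> for \<open>h = g\<^sup>-\<close>.
\<close>

definition hyperfield_pconv ::
    "'g hypergroup_data \<Rightarrow> ('l \<Rightarrow> 'g set) \<Rightarrow> 'l hypergroup_data \<Rightarrow>
     'l \<times> 'g cmeasure \<Rightarrow> 'l \<times> 'g cmeasure \<Rightarrow> ('l \<times> 'g cmeasure) cmeasure" where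
  "hyperfield_pconv G \<psi> L = (\<lambda>(i, \<mu>) (j, \<nu>).
     THE P. P \<in> Mb (hyperfield_topology G \<psi> L) \<and>
       (\<forall>k\<in>carrier_of L. \<forall>A\<in>borel_sets (htop G).
          cintegral (hyperfield_topology G \<psi> L) (\<lambda>(l, \<rho>). if l = k then \<rho> A else 0) P =
          hconv G \<mu> \<nu> A * pconv L i j {k}))"

definition hyperfield_hypergroup ::
    "'g hypergroup_data \<Rightarrow> ('l \<Rightarrow> 'g set) \<Rightarrow> 'l hypergroup_data \<Rightarrow>
     ('l \<times> 'g cmeasure) hypergroup_data" where
  "hyperfield_hypergroup G \<psi> L =
     \<lparr>htop = hyperfield_topology G \<psi> L,
      hconv = bilinear_ext (hyperfield_topology G \<psi> L) (hyperfield_pconv G \<psi> L),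
      hunit = (hunit L, coset_measure G \<psi> (hunit L) (hunit G)),
      hinv = (\<lambda>(l, \<mu>). (hinv L l, measure_inv G \<mu>))\<rparr>"

definition phi_hat :: "'a set \<Rightarrow> 'a \<Rightarrow> two_point set" where
  "phi_hat H\<^sub>0 h = (if h \<in> H\<^sub>0 then {Ell0} else {Ell0, Ell1})"

end

theory Submission
  imports Defs
begin

text \<open>
  The dual of a discrete strong hypergroup is compact, and a measure \<open>\<mu>\<close> on it is determined by its transform
  \<open>h \<mapsto> \<integral> \<chi> h \<mu>(d\<chi>)\<close>.  Transforms turn convolution into multiplication, since this holds for point measures, whose
  combinations are weakly dense.  Weak limits yield the Haar measure of the dual of \<open>H\<close> and, for each character
  \<open>\<tau>\<close> of \<open>H\<^sub>0\<close>, a probability measure whose transform is \<open>\<tau>\<close> on \<open>H\<^sub>0\<close> and 0 elsewhere.  It is the invariant measure on the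
  extensions of \<open>\<tau>\<close>, and its existence shows that restriction of characters is surjective and open.

  On the union \<open>K\<close> of the two duals the functions \<open>\<pi> \<mapsto> \<pi> h\<close>, \<open>\<tau> \<mapsto> c \<tau> h\<close> are multiplicative if \<open>h \<in> H\<^sub>0\<close> and
  \<open>c\<^sup>2 = q + (1 - q) c\<close>, that is \<open>c = 1\<close> or \<open>c = -q\<close>, or if \<open>h \<notin> H\<^sub>0\<close> and \<open>c = 0\<close>.  By Pontryagin duality for \<open>H\<close> there are no
  other characters of \<open>K\<close>.  They are isolated, by orthogonality with respect to the Haar measure, and a product of two of
  them is a finite convex combination of such functions, which is the dual convolution.  Reading \<open>c\<close> as the value
  of the nontrivial character of the two-point hypergroup at a measure of total mass 1, the character with index \<open>(h, c)\<close>
  is the point of the hyperfield hypergroup over \<open>h\<close>.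
\<close>

text \<open>No space here is assumed metrizable or countable, and this shapes the measure theory:
  regularity replaces countability arguments, limits run along filters of finite sets of transforms,
  and \<open>induced\<close>, which integrates set by set the value on \<open>A\<close> of the
  invariant measure over \<tau>, requires that this value be Borel in \<tau>, although weak
  continuity controls only integrals of continuous functions. An isomorphism must respect
  convolution of all bounded measures, while a dual convolution is prescribed only on points;
  bounded bilinearity bridges the gap on discrete spaces, weak continuity on compact ones. The
  equation for \<open>c\<close> is the fourth convolution rule at the trivial character of
  \<open>H\<^sub>0\<close>. Inducing that point gives a measure with transform 1 on
  \<open>H\<^sub>0\<close> and 0 elsewhere, so a character with value \<open>c\<close> there
  satisfies \<open>c * c = q + (1 - q) * c\<close> over \<open>H\<^sub>0\<close>. Outside
  \<open>H\<^sub>0\<close> the value is 0 because some element of the annihilator fixes that point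
  while multiplying the value by a factor other than 1. Pontryagin duality enters through two facts:
  evaluations separate the points of \<open>H\<close>, and they exhaust the characters of its
  dual.\<close>

abbreviation pts :: "'a topology \<Rightarrow> 'a set" where "pts \<equiv> topspace"

abbreviation bor :: "'a topology \<Rightarrow> 'a set set" where "bor \<equiv> borel_sets"

abbreviation cint :: "'a topology \<Rightarrow> ('a \<Rightarrow> complex) \<Rightarrow> 'a cmeasure \<Rightarrow> complex" where "cint \<equiv> cintegral"

abbreviation cmeas :: "'a topology \<Rightarrow> 'a cmeasure \<Rightarrow> bool" where "cmeas \<equiv> complex_measure"

abbreviation cplx :: "('a \<Rightarrow> real) \<Rightarrow> 'a \<Rightarrow> complex" where "cplx f \<equiv> \<lambda>x. complex_of_real (f x)"

abbreviation cmap :: "'a topology \<Rightarrow> ('a \<Rightarrow> 'b::topological_space) \<Rightarrow> bool" where "cmap X \<equiv> continuous_map X euclidean"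

abbreviation rmap :: "'a topology \<Rightarrow> ('a \<Rightarrow> real) \<Rightarrow> bool" where "rmap X \<equiv> continuous_map X euclideanreal"

abbreviation disc :: "'a set \<Rightarrow> 'a topology" where "disc \<equiv> discrete_topology"

section \<open>Complex measures\<close>

abbreviation borel_space :: "'a topology \<Rightarrow> 'a measure" where
 "borel_space X \<equiv> sigma (pts X) {U. openin X U}"

lemma opens_subset_Pow: "{U. openin X U} <= Pow (pts X)"
 by (auto dest: openin_subset)

lemma sigma_algebra_borel_sets: "sigma_algebra (pts X) (bor X)"
 unfolding borel_sets_def by (rule sigma_algebra_sigma_sets[OF opens_subset_Pow])

lemma sets_borel_space [simp]: "sets (borel_space X) = bor X"
 by (simp add: borel_sets_def opens_subset_Pow)

lemma bor_sub: "A\<in>bor X ==> A <= pts X"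
 using sets.sets_into_space[of A "borel_space X"] by (simp add: space_measure_of[OF opens_subset_Pow])

lemma space_borel_space [simp]: "space (borel_space X) = pts X"
 by (simp add: space_measure_of[OF opens_subset_Pow])

lemma open_bor: "openin X U ==> U\<in>bor X"
 by (simp add: borel_sets_def sigma_sets.Basic)

lemma bor_top [simp]: "pts X\<in>bor X"
 by (simp add: open_bor)

lemma bor_empty [simp]: "{}\<in>bor X"
 by (simp add: open_bor)

lemma bor_Diff: "A\<in>bor X ==> B\<in>bor X ==> A - B\<in>bor X"
 using sets.Diff[of A "borel_space X" B] by simp

lemma bor_Int: "A\<in>bor X ==> B\<in>bor X ==> A\<inter>B\<in>bor X"
 using sets.Int[of A "borel_space X" B] by simp

lemma bor_Un: "A\<in>bor X ==> B\<in>bor X ==> A\<union>B\<in>bor X"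
 using sets.Un[of A "borel_space X" B] by simp

lemma bor_UN:
 "(!!i::nat. F i\<in>bor X) ==> (\<Union>i. F i)\<in>bor X"
 using sets.countable_UN[where M = "borel_space X" and A = F] by auto

lemma bor_finite_UN:
 "finite I ==> (!!i. i\<in>I ==> F i\<in>bor X) ==> (\<Union>i\<in>I. F i)\<in>bor X"
 using sets.finite_Union[of "F ` I" "borel_space X"] by auto

lemma closed_bor: "closedin X C ==> C\<in>bor X"
 using bor_Diff[OF bor_top[of X] open_bor[of X "pts X - C"]]
 by (simp add: closedin_def double_diff)

text \<open>Only Borel sets matter, so no normalisation is imposed elsewhere; real parts, imaginary
  parts and their negatives all qualify.\<close>

definition signed_measure :: "'a topology \<Rightarrow> ('a set \<Rightarrow> real) \<Rightarrow> bool" where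
 "signed_measure X w \<longleftrightarrow> (\<forall>F :: nat \<Rightarrow> 'a set. range F <= bor X --> disjoint_family F -->
    (%n. w (F n)) sums w (\<Union>n. F n))"

lemma sm_minus: "signed_measure X w ==> signed_measure X (%A. - w A)"
 unfolding signed_measure_def by (auto intro: sums_minus)

lemma sm_Re: "cmeas X u ==> signed_measure X (%A. Re (u A))"
 unfolding signed_measure_def complex_measure_def by (auto intro: sums_Re)

lemma sm_Im: "cmeas X u ==> signed_measure X (%A. Im (u A))"
 unfolding signed_measure_def complex_measure_def by (auto intro: sums_Im)

text \<open>A constant series converges only if its terms vanish.\<close>

lemma sm_empty: assumes "signed_measure X w" shows "w {} = 0"
proof -
 have "(%n::nat. w {}) sums w {}"
  using assms[unfolded signed_measure_def, rule_format, of "%_. {}"] by (auto simp: disjoint_family_on_def)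
 then show ?thesis using summable_const_iff sums_summable by blast
qed

lemma sm_Un:
 assumes "signed_measure X w" "A\<in>bor X" "B\<in>bor X" "A\<inter>B = {}"
 shows "w (A\<union>B) = w A + w B"
proof -
 have "(%n. w (binaryset A B n)) sums w (\<Union>n. binaryset A B n)"
  by (rule assms(1)[unfolded signed_measure_def, rule_format])
    (use assms in \<open>auto simp: range_binaryset_eq disjoint_family_on_def binaryset_def\<close>)
 moreover have "(%n. w (binaryset A B n)) sums (w A + w B)"
  by (rule binaryset_sums) (rule sm_empty[OF assms(1)])
 ultimately show ?thesis by (metis UN_binaryset_eq sums_unique2)
qed

lemma sm_Diff:
 assumes "signed_measure X w" "A\<in>bor X" "B\<in>bor X" "B <= A"
 shows "w (A - B) = w A - w B"
 using sm_Un[OF assms(1,3) bor_Diff[OF assms(2,3)]] assms(4)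
 by (simp add: Un_absorb1)

lemma cm_empty: "cmeas X u ==> u {} = 0"
 using sm_empty[OF sm_Re[of X u]] sm_empty[OF sm_Im[of X u]]
 by (simp add: complex_eq_iff)

lemma cm_Un:
 "cmeas X u ==> A\<in>bor X ==> B\<in>bor X ==> A\<inter>B = {} ==> u (A\<union>B) = u A + u B"
 using sm_Un[OF sm_Re[of X u]] sm_Un[OF sm_Im[of X u]]
 by (simp add: complex_eq_iff)

lemma cm_Diff:
 "cmeas X u ==> A\<in>bor X ==> B\<in>bor X ==> B <= A ==> u (A - B) = u A - u B"
 using sm_Diff[OF sm_Re[of X u]] sm_Diff[OF sm_Im[of X u]]
 by (simp add: complex_eq_iff)

lemma cm_finite_UN:
 assumes "cmeas X u" "finite I" "!!i. i\<in>I ==> F i\<in>bor X" "disjoint_family_on F I"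
 shows "u (\<Union>i\<in>I. F i) = (\<Sum>i\<in>I. u (F i))"
 using assms(2,3,4)
proof (induction I)
 case empty then show ?case by (simp add: cm_empty[OF assms(1)])
next
 case (insert i I)
 have "u (F i\<union>(\<Union>i\<in>I. F i)) = u (F i) + u (\<Union>i\<in>I. F i)"
  using insert by (intro cm_Un[OF assms(1)] bor_finite_UN)
   (auto simp: disjoint_family_on_def)
 moreover have "u (\<Union>i\<in>I. F i) = (\<Sum>i\<in>I. u (F i))"
  using insert by (intro insert.IH) (auto simp: disjoint_family_on_def)
 ultimately show ?case using insert by simp
qed

lemma cm_outside: "cmeas X u ==> A\<notin>bor X ==> u A = 0"
 by (simp add: complex_measure_def)

lemma ennreal_plus_le: "ennreal (a + b) <= ennreal a + ennreal b"
 by (cases "a\<ge>0"; cases "b\<ge>0")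
   (auto simp: ennreal_neg simp flip: ennreal_plus intro!: ennreal_leI)

lemma ennreal_sum_le: "finite I ==> ennreal (\<Sum>i\<in>I. f i) <= (\<Sum>i\<in>I. ennreal (f i))"
 by (induction I rule: finite_induct) (auto intro: order_trans[OF ennreal_plus_le] add_left_mono)

lemma ennreal_sums_le: assumes "f sums s" shows "ennreal s <= (\<Sum>n. ennreal (f n))"
proof (rule LIMSEQ_le_const2)
 show "(%n. ennreal (\<Sum>i<n. f i)) \<longlonglongrightarrow> ennreal s"
  using assms unfolding sums_def by (rule tendsto_ennrealI)
 show "\<exists>N. \<forall>n\<ge>N. ennreal (\<Sum>i<n. f i) <= (\<Sum>n. ennreal (f n))"
  by (auto intro!: order_trans[OF ennreal_sum_le] sum_le_suminf)
qed

section \<open>The Jordan decomposition of a real measure\<close>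

abbreviation upper :: "'a topology \<Rightarrow> ('a set \<Rightarrow> real) \<Rightarrow> 'a set \<Rightarrow> ennreal" where
 "upper X w A \<equiv> SUP B\<in>{B\<in>bor X. B <= A}. ennreal (w B)"

text \<open>Nearly optimal Borel subsets of the two sets are united. Since \<open>ennreal\<close>
  truncates at 0, a negative value contributes nothing, and then the other subset alone gives the
  bound.\<close>

lemma upper_add:
 assumes "signed_measure X w" "A\<inter>B = {}"
 shows "upper X w A + upper X w B <= upper X w (A\<union>B)"
proof -
 have ne: "{B\<in>bor X. B <= A} ~= {}" for A using bor_empty by blast
 have "ennreal (w C) + ennreal (w D) <= upper X w (A\<union>B)"
  if CD: "C\<in>bor X" "C <= A" "D\<in>bor X" "D <= B" for C D
 proof (cases "w C\<ge>0\<and>w D\<ge>0")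
  case True
  moreover have "C\<inter>D = {}" using CD assms(2) by blast
  ultimately have "ennreal (w C) + ennreal (w D) = ennreal (w (C\<union>D))"
   using sm_Un[OF assms(1) CD(1,3)] by simp
  also have "\<dots> <= upper X w (A\<union>B)" using CD by (intro SUP_upper) (auto intro: bor_Un)
  finally show ?thesis .
 next
  case False
  then have "ennreal (w C) = 0\<or>ennreal (w D) = 0" by (auto simp: ennreal_neg)
  moreover have "ennreal (w C) <= upper X w (A\<union>B)" "ennreal (w D) <= upper X w (A\<union>B)"
   using CD by (auto intro!: SUP_upper)
  ultimately show ?thesis by auto
 qed
 then have "(SUP C\<in>{B\<in>bor X. B <= A}. SUP D\<in>{C\<in>bor X. C <= B}. ennreal (w C) + ennreal (w D)) <= upper X w (A\<union>B)"
  by (auto intro!: SUP_least)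
 then show ?thesis
  by (simp only: ennreal_SUP_add_left[OF ne, symmetric] ennreal_SUP_add_right[OF ne, symmetric])
qed

text \<open>Upper bound: a Borel subset of the union is cut by the \<open>F n\<close>. Lower bound:
  superadditivity gives it for finite unions, and the series is the supremum of its partial
  sums.\<close>

lemma upper_countably_additive:
 assumes "signed_measure X w"
 shows "countably_additive (bor X) (upper X w)"
 unfolding countably_additive_def
proof (intro allI impI antisym)
 fix F :: "nat \<Rightarrow> 'a set" assume F: "range F <= bor X" "disjoint_family F"
 show "upper X w (\<Union>n. F n) <= (\<Sum>n. upper X w (F n))"
 proof (rule SUP_least, clarify)
  fix B assume B: "B\<in>bor X" "B <= (\<Union>n. F n)"
  have "(%n. w (B\<inter>F n)) sums w (\<Union>n. B\<inter>F n)"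
   using F B by (intro assms[unfolded signed_measure_def, rule_format])
    (auto intro: bor_Int simp: disjoint_family_on_def)
  moreover have "(\<Union>n. B\<inter>F n) = B" using B by blast
  ultimately have "(%n. w (B\<inter>F n)) sums w B" by simp
  then have "ennreal (w B) <= (\<Sum>n. ennreal (w (B\<inter>F n)))" by (rule ennreal_sums_le)
  also have "\<dots> <= (\<Sum>n. upper X w (F n))"
   using F B by (intro suminf_le SUP_upper) (auto intro!: bor_Int)
  finally show "ennreal (w B) <= (\<Sum>n. upper X w (F n))" .
 qed
 have "(\<Sum>i<n. upper X w (F i)) <= upper X w (\<Union>i<n. F i)" for n
 proof (induction n)
  case (Suc n)
  have "(\<Sum>i<Suc n. upper X w (F i)) <= upper X w (\<Union>i<n. F i) + upper X w (F n)"
   using Suc by (simp add: add_right_mono)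
  also have "\<dots> <= upper X w ((\<Union>i<n. F i)\<union>F n)"
  proof (rule upper_add[OF assms])
   have "F i\<inter>F n = {}" if "i < n" for i using F(2) that by (intro disjoint_family_onD[of F UNIV]) auto
   then show "(\<Union>i<n. F i)\<inter>F n = {}" by blast
  qed
  finally show ?case by (simp add: lessThan_Suc Un_commute)
 qed simp
 also have "upper X w (\<Union>i<n. F i) <= upper X w (\<Union>n. F n)" for n
  by (rule SUP_subset_mono) auto
 finally show "(\<Sum>n. upper X w (F n)) <= upper X w (\<Union>n. F n)"
  unfolding suminf_eq_SUP by (rule SUP_least)
qed

lemma sets_upper_variation [simp]: "sets (upper_variation X w) = bor X"
 and space_upper_variation [simp]: "space (upper_variation X w) = pts X"
 by (simp_all add: upper_variation_def borel_sets_def opens_subset_Pow space_measure_of)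

lemma emeasure_upper:
 assumes "signed_measure X w" "A\<in>bor X"
 shows "emeasure (upper_variation X w) A = upper X w A"
proof (rule emeasure_measure_of[OF upper_variation_def opens_subset_Pow])
 show "positive (sets (upper_variation X w)) (upper X w)"
  using sm_empty[OF assms(1)] by (simp add: positive_def cong: conj_cong)
qed (use assms upper_countably_additive in auto)

text \<open>Otherwise, repeatedly splitting a set of infinite upper variation would yield a
  decreasing sequence whose disjoint differences all have measure at least 1 in absolute value, and
  the corresponding series could not converge.\<close>

lemma upper_finite:
 assumes "signed_measure X w"
 shows "emeasure (upper_variation X w) (pts X) < \<infinity>"
proof (rule ccontr)
 let ?M = "emeasure (upper_variation X w)"
 assume "\<not> ?M (pts X) < \<infinity>"
 then have top: "?M (pts X) = \<infinity>" by (metis infinity_ennreal_def top.not_eq_extremum)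
 define Q where "Q A \<longleftrightarrow> A\<in>bor X\<and>?M A = \<infinity>" for A
 have step: "\<exists>A'. Q A'\<and>A' <= A\<and>1 <= \<bar>w (A - A')\<bar>" if "Q A" for A
 proof -
  have A: "A\<in>bor X" "?M A = \<infinity>" using that by (auto simp: Q_def)
  then have "upper X w A = top" by (simp only: emeasure_upper[OF assms] infinity_ennreal_def)
  \<comment> \<open>The margin \<open>1 + \<bar>w A\<bar>\<close> gives both \<open>E\<close> and
    \<open>A - E\<close> absolute measure above 1, so it does not matter which of them is
    discarded.\<close>
  then have "ennreal (1 + \<bar>w A\<bar>) < upper X w A" by (simp only: ennreal_less_top)
  then obtain E where E: "E\<in>bor X" "E <= A" "ennreal (1 + \<bar>w A\<bar>) < ennreal (w E)"
   by (auto simp: less_SUP_iff)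
  then have gt: "1 + \<bar>w A\<bar> < w E" using ennreal_leI leD linorder_le_less_linear by blast
  have d: "w (A - E) = w A - w E" using sm_Diff[OF assms A(1) E(1,2)] .
  have AE: "A - E\<in>bor X" using A E bor_Diff by auto
  have "?M E + ?M (A - E) = ?M (E\<union>(A - E))"
   by (rule plus_emeasure) (use E AE in auto)
  also have "E\<union>(A - E) = A" using E by auto
  finally have "?M E = \<infinity>\<or>?M (A - E) = \<infinity>" using A(2) by auto
  then show ?thesis
  proof
   assume "?M E = \<infinity>" then show ?thesis using E d gt by (intro exI[of _ E]) (auto simp: Q_def)
  next
   assume "?M (A - E) = \<infinity>"
   moreover have "A - (A - E) = E" using E by auto
   ultimately show ?thesis using AE gt by (intro exI[of _ "A - E"]) (auto simp: Q_def)
  qed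
 qed
 have "\<exists>f. \<forall>n. Q (f n)\<and>(f (Suc n) <= f n\<and>1 <= \<bar>w (f n - f (Suc n))\<bar>)"
 proof (rule dependent_nat_choice)
  show "\<exists>A. Q A" using top by (auto simp: Q_def intro!: exI[of _ "pts X"])
 qed (use step in blast)
 then obtain f where f: "!!n. Q (f n)" "!!n. f (Suc n) <= f n" "!!n. 1 <= \<bar>w (f n - f (Suc n))\<bar>"
  by blast
 have dec: "f n <= f m" if "m <= n" for m n using lift_Suc_antimono_le[of f, OF f(2)] that by auto
 have "disjoint_family (%n. f n - f (Suc n))"
  unfolding disjoint_family_on_def
 proof (intro ballI impI)
  fix m n :: nat assume "m ~= n"
  then have "Suc m <= n\<or>Suc n <= m" by auto
  then show "(f m - f (Suc m))\<inter>(f n - f (Suc n)) = {}" using dec[of "Suc m" n] dec[of "Suc n" m] by auto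
 qed
 moreover have "range (%n. f n - f (Suc n)) <= bor X" using f(1) by (auto simp: Q_def intro: bor_Diff)
 ultimately have "(%n. w (f n - f (Suc n))) sums w (\<Union>n. f n - f (Suc n))"
  using assms unfolding signed_measure_def by blast
 then have "(%n. w (f n - f (Suc n))) \<longlonglongrightarrow> 0" using sums_summable summable_LIMSEQ_zero by blast
 then have "eventually (%n. dist (w (f n - f (Suc n))) 0 < 1) sequentially" by (rule tendstoD) simp
 then obtain n where "\<bar>w (f n - f (Suc n))\<bar> < 1" by (auto simp: eventually_sequentially)
 then show False using f(3)[of n] by simp
qed

lemma finite_upper:
 "signed_measure X w ==> finite_measure (upper_variation X w)"
 using upper_finite by (intro finite_measureI) (auto simp: top.not_eq_extremum)

text \<open>For \<open>B\<close> inside \<open>A\<close>, \<open>w B = w A - w (A - B)\<close> is at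
  most \<open>w A\<close> plus the lower variation of \<open>A\<close>. The supremum over
  \<open>B\<close> is one inequality; the other is the same statement for \<open>-w\<close>.\<close>

lemma Jordan_decomposition:
 assumes "signed_measure X w" "A\<in>bor X"
 shows "w A = measure (upper_variation X w) A - measure (upper_variation X (%A. - w A)) A"
proof -
 have le: "measure (upper_variation X w) A <= w A + measure (upper_variation X (%A. - w A)) A"
  if s: "signed_measure X w" for w
 proof -
  note s' = sm_minus[OF s]
  interpret N: finite_measure "upper_variation X (%A. - w A)" by (rule finite_upper[OF s'])
  let ?n = "measure (upper_variation X (%A. - w A)) A"
  have lower: "- w B <= ?n" if B: "B\<in>bor X" "B <= A" for B
  proof -
   have "ennreal (- w B) <= upper X (%A. - w A) A" using B by (intro SUP_upper) auto
   also have "\<dots> = ennreal ?n"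
    by (metis N.emeasure_eq_measure assms(2) emeasure_upper s')
   finally show ?thesis by (simp add: ennreal_le_iff)
  qed
  have "ennreal (w B) <= ennreal (w A + ?n)" if B: "B\<in>bor X" "B <= A" for B
  proof -
   have "w B = w A - w (A - B)" using sm_Diff[OF s assms(2) B] by simp
   then show ?thesis using lower[of "A - B"] B bor_Diff[OF assms(2) B(1)] by (intro ennreal_leI) auto
  qed
  then have "upper X w A <= ennreal (w A + ?n)" by (intro SUP_least) auto
  moreover have "0 <= w A + ?n" using lower[OF assms(2)] by simp
  ultimately show ?thesis
   by (simp add: measure_def emeasure_upper[OF s assms(2)] enn2real_leI)
 qed
 show ?thesis using le[OF assms(1)] le[OF sm_minus[OF assms(1)]] by simp
qed

section \<open>Integration of bounded Borel functions\<close>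

text \<open>The integrands for which all four integrals in \<open>cintegral\<close> exist, whatever
  the complex measure; only values on the space itself count.\<close>

definition bmf :: "'a topology \<Rightarrow> ('a \<Rightarrow> complex) set" where
 "bmf X = {f. f\<in>borel_measurable (borel_space X)\<and>bounded (f ` pts X)}"

lemma bmf_bound:
 assumes "f\<in>bmf X" obtains c where "0 <= c" "!!x. x\<in>pts X ==> cmod (f x) <= c"
proof -
 obtain c where c: "\<forall>y\<in>f ` pts X. norm y <= c" using assms by (auto simp: bmf_def bounded_iff)
 show thesis by (rule that[of "max c 0"]) (use c in \<open>auto intro: max.coboundedI1\<close>)
qed

lemma bmfI:
 "f\<in>borel_measurable (borel_space X) ==> (!!x. x\<in>pts X ==> cmod (f x) <= c) ==> f\<in>bmf X"
 unfolding bmf_def bounded_iff by auto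

lemma bmf_const [simp]: "(%_. c)\<in>bmf X"
 by (rule bmfI[of _ _ "cmod c"]) auto

lemma bmf_add: "f\<in>bmf X ==> g\<in>bmf X ==> (%x. f x + g x)\<in>bmf X"
proof -
 assume f: "f\<in>bmf X" and g: "g\<in>bmf X"
 obtain c where c: "!!x. x\<in>pts X ==> cmod (f x) <= c" using bmf_bound[OF f] by metis
 obtain d where d: "!!x. x\<in>pts X ==> cmod (g x) <= d" using bmf_bound[OF g] by metis
 show ?thesis
  by (rule bmfI[of _ _ "c + d"]) (use f g c d in \<open>auto simp: bmf_def intro: norm_triangle_le add_mono\<close>)
qed

lemma bmf_mult: "f\<in>bmf X ==> g\<in>bmf X ==> (%x. f x * g x)\<in>bmf X"
proof -
 assume f: "f\<in>bmf X" and g: "g\<in>bmf X"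
 obtain c where c: "0 <= c" "!!x. x\<in>pts X ==> cmod (f x) <= c" using bmf_bound[OF f] by metis
 obtain d where d: "!!x. x\<in>pts X ==> cmod (g x) <= d" using bmf_bound[OF g] by metis
 show ?thesis
  by (rule bmfI[of _ _ "c * d"]) (use f g c d in \<open>auto simp: bmf_def norm_mult intro: mult_mono\<close>)
qed

lemma bmf_minus: "f\<in>bmf X ==> (%x. - f x)\<in>bmf X"
 using bmf_mult[OF bmf_const[of "-1"], of f X] by simp

lemma bmf_diff: "f\<in>bmf X ==> g\<in>bmf X ==> (%x. f x - g x)\<in>bmf X"
 using bmf_add[OF _ bmf_minus, of f X g] by simp

lemma bmf_sum: "(!!i. i\<in>I ==> f i\<in>bmf X) ==> (%x. \<Sum>i\<in>I. f i x)\<in>bmf X"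
 by (induction I rule: infinite_finite_induct) (auto intro: bmf_add)

lemma bmf_indicator: "A\<in>bor X ==> (%x. of_bool (x\<in>A))\<in>bmf X"
proof (rule bmfI[of _ _ 1])
 assume A: "A\<in>bor X"
 have "(%x. of_bool (x\<in>A) :: complex) = indicator A" by (auto simp: indicator_def)
 then show "(%x. of_bool (x\<in>A) :: complex)\<in>borel_measurable (borel_space X)"
  using A by (metis borel_measurable_indicator sets_borel_space)
qed auto

lemma bmf_cong: "(!!x. x\<in>pts X ==> f x = g x) ==> f\<in>bmf X \<longleftrightarrow> g\<in>bmf X"
 using measurable_cong[of "borel_space X" f g borel] image_cong[of "pts X" "pts X" f g]
 by (simp add: bmf_def)

lemma cont_measurable:
 fixes f :: "'a \<Rightarrow> 'b::topological_space"
 assumes "cmap X f"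
 shows "f\<in>borel_measurable (borel_space X)"
proof (rule borel_measurableI)
 fix S :: "'b set" assume "open S"
 then have "openin X {x\<in>pts X. f x\<in>S}"
  by (intro openin_continuous_map_preimage[OF assms]) (simp add: open_openin[symmetric])
 moreover have "f -` S\<inter>space (borel_space X) = {x\<in>pts X. f x\<in>S}" by auto
 ultimately show "f -` S\<inter>space (borel_space X)\<in>sets (borel_space X)" by (simp add: open_bor)
qed

lemma bc_bmf: "bounded_continuous X <= bmf X"
 by (auto simp: bounded_continuous_def bmf_def cont_measurable)

lemma compact_bc:
 assumes "compact_space X" "cmap X f"
 shows "f\<in>bounded_continuous X"
proof -
 have "compactin euclidean (f ` pts X)"
  using image_compactin[of X "pts X" euclidean f] assms by (simp add: compact_space_def)
 then show ?thesis using assms by (simp add: bounded_continuous_def compact_imp_bounded)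
qed

lemma integrable_bmf:
 assumes "finite_measure M" "sets M = bor X" "f\<in>bmf X"
 shows "integrable M f"
proof -
 interpret finite_measure M by fact
 obtain c where c: "!!x. x\<in>pts X ==> cmod (f x) <= c" using bmf_bound[OF assms(3)] by metis
 have sp: "space M = pts X" using sets_eq_imp_space_eq[of M "borel_space X"] assms(2) by simp
 show ?thesis
 proof (rule integrable_const_bound)
  show "AE x in M. cmod (f x) <= c" by (rule AE_I2) (simp add: c sp)
  show "f\<in>borel_measurable M"
   using assms(3) measurable_cong_sets[of M "borel_space X" "borel :: complex measure" borel] by (simp add: bmf_def assms(2))
 qed
qed

lemma norm_integral_bmf:
 assumes "finite_measure M" "sets M = bor X" "f\<in>bmf X"
  "!!x. x\<in>pts X ==> cmod (f x) <= c"
 shows "cmod (LINT x|M. f x) <= c * measure M (pts X)"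
proof -
 interpret finite_measure M by fact
 have sp: "space M = pts X" using sets_eq_imp_space_eq[of M "borel_space X"] assms(2) by simp
 have "cmod (LINT x|M. f x) <= (LINT x|M. cmod (f x))" by (rule integral_norm_bound)
 also have "\<dots> <= (LINT x|M. c)"
  by (rule integral_mono) (use integrable_bmf[OF assms(1-3)] assms(4) sp in auto)
 finally show ?thesis by (simp add: sp mult.commute)
qed

lemma cm_parts:
 assumes "cmeas X u"
 shows "finite_measure (upper_variation X (%A. Re (u A)))" "finite_measure (upper_variation X (%A. - Re (u A)))"
  "finite_measure (upper_variation X (%A. Im (u A)))" "finite_measure (upper_variation X (%A. - Im (u A)))"
 using sm_Re[OF assms] sm_Im[OF assms]
 by (auto intro!: finite_upper sm_minus)

text \<open>A crude bound for the total variation, good enough to show that it is finite.\<close>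

definition crude :: "'a topology \<Rightarrow> 'a cmeasure \<Rightarrow> 'a set \<Rightarrow> real" where
 "crude X u A = measure (upper_variation X (%A. Re (u A))) A + measure (upper_variation X (%A. - Re (u A))) A
   + measure (upper_variation X (%A. Im (u A))) A + measure (upper_variation X (%A. - Im (u A))) A"

lemma cint_crude:
 assumes "cmeas X u" "f\<in>bmf X" "!!x. x\<in>pts X ==> cmod (f x) <= c"
 shows "cmod (cint X f u) <= c * crude X u (pts X)"
proof -
 have 4: "cmod (a - b + \<i> * (p - r)) <= cmod a + cmod b + cmod p + cmod r" for a b p r
  using norm_triangle_ineq[of "a - b" "\<i> * (p - r)"] norm_triangle_ineq4[of a b] norm_triangle_ineq4[of p r]
  by (simp add: norm_mult)
 show ?thesis unfolding cintegral_def crude_def distrib_left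
  by (rule order_trans[OF 4]) (intro add_mono norm_integral_bmf cm_parts assms; simp)
qed

lemma cint_add:
 assumes "cmeas X u" "f\<in>bmf X" "g\<in>bmf X"
 shows "cint X (%x. f x + g x) u = cint X f u + cint X g u"
 unfolding cintegral_def
 by (simp add: integrable_bmf[OF cm_parts(1)[OF assms(1)]] integrable_bmf[OF cm_parts(2)[OF assms(1)]]
   integrable_bmf[OF cm_parts(3)[OF assms(1)]] integrable_bmf[OF cm_parts(4)[OF assms(1)]]
   assms algebra_simps)

lemma cint_scale:
 assumes "cmeas X u" "f\<in>bmf X"
 shows "cint X (%x. a * f x) u = a * cint X f u"
 unfolding cintegral_def by (simp add: algebra_simps)

lemma cint_zero [simp]: "cint X (%x. 0) u = 0"
 by (simp add: cintegral_def)

lemma cint_sum: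
 assumes "cmeas X u" "!!i. i\<in>I ==> f i\<in>bmf X"
 shows "cint X (%x. \<Sum>i\<in>I. f i x) u = (\<Sum>i\<in>I. cint X (f i) u)"
 using assms(2)
proof (induction I rule: infinite_finite_induct)
 case (insert i I)
 have "cint X (%x. f i x + (\<Sum>i\<in>I. f i x)) u = cint X (f i) u + cint X (%x. \<Sum>i\<in>I. f i x) u"
  by (rule cint_add[OF assms(1)]) (use insert.prems in \<open>auto intro: bmf_sum\<close>)
 then show ?case using insert by simp
qed auto

lemma cint_diff:
 assumes "cmeas X u" "f\<in>bmf X" "g\<in>bmf X"
 shows "cint X (%x. f x - g x) u = cint X f u - cint X g u"
 using cint_add[OF assms(1,2) bmf_minus[OF assms(3)]] cint_scale[OF assms(1,3), of "-1"] by simp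

lemma cint_cong:
 assumes "!!x. x\<in>pts X ==> f x = g x"
 shows "cint X f u = cint X g u"
proof -
 have "integral\<^sup>L (upper_variation X w) f = integral\<^sup>L (upper_variation X w) g" for w
  by (rule Bochner_Integration.integral_cong) (simp_all add: assms)
 then show ?thesis by (simp add: cintegral_def)
qed

lemma cint_indicator:
 assumes "cmeas X u" "A\<in>bor X"
 shows "cint X (%x. of_bool (x\<in>A)) u = u A"
proof -
 have "(LINT x|M. of_bool (x\<in>A) :: complex) = of_real (measure M A)" if "finite_measure M" "sets M = bor X" for M
 proof -
  interpret finite_measure M by fact
  have "(%x. of_bool (x\<in>A) :: complex) = (%x. indicator A x *\<^sub>R 1)" by (auto simp: indicator_def)
  moreover have "(LINT x|M. indicator A x *\<^sub>R (1::complex)) = measure M A *\<^sub>R 1"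
   using assms(2) that by (intro has_bochner_integral_integral_eq has_bochner_integral_indicator) (auto simp: emeasure_eq_measure)
  ultimately show ?thesis by (simp add: scaleR_conv_of_real)
 qed
 note * = this
 note p = cm_parts[OF assms(1)]
 show ?thesis
  unfolding cintegral_def
  using Jordan_decomposition[OF sm_Re[OF assms(1)] assms(2)]
   Jordan_decomposition[OF sm_Im[OF assms(1)] assms(2)]
  by (simp add: *[OF p(1)] *[OF p(2)] *[OF p(3)] *[OF p(4)] complex_eq_iff)
qed

lemma cint_const: "cmeas X u ==> cint X (%_. c) u = c * u (pts X)"
 using cint_scale[OF _ bmf_indicator[OF bor_top], of X u c] cint_indicator[of X u "pts X"]
  cint_cong[of X "%_. c" "%x. c * of_bool (x\<in>pts X)"] by simp

text \<open>A finite Borel partition on which \<open>f\<close> is nearly constant. It is an indexed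
  family, so that it can be pulled back along a map even if several preimages are empty. Integrals
  with respect to different measures are compared through the finite sums it provides.\<close>

definition step_approx :: "'a topology \<Rightarrow> ('a \<Rightarrow> complex) \<Rightarrow> real \<Rightarrow> 'i set \<Rightarrow> ('i \<Rightarrow> 'a set) \<Rightarrow> ('i \<Rightarrow> complex) \<Rightarrow> bool" where
 "step_approx X f eps I B a \<longleftrightarrow> finite I\<and>disjoint_family_on B I\<and>B ` I <= bor X\<and>(\<Union>i\<in>I. B i) = pts X
  \<and>(\<forall>i\<in>I. \<forall>x\<in>B i. cmod (f x - a i) <= eps)"

lemma cint_step_crude:
 assumes mu: "cmeas X u" and f: "f\<in>bmf X" and "step_approx X f eps I B a"
 shows "cmod (cint X f u - (\<Sum>i\<in>I. a i * u (B i))) <= eps * crude X u (pts X)"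
proof -
 have I: "finite I" "disjoint_family_on B I" "!!i. i\<in>I ==> B i\<in>bor X" "(\<Union>i\<in>I. B i) = pts X"
  "!!i x. i\<in>I ==> x\<in>B i ==> cmod (f x - a i) <= eps"
  using assms(3) by (auto simp: step_approx_def)
 let ?g = "%x. \<Sum>i\<in>I. a i * of_bool (x\<in>B i)"
 have g1: "(%x. a i * of_bool (x\<in>B i))\<in>bmf X" if "i\<in>I" for i
  using that I by (intro bmf_mult bmf_const bmf_indicator)
 then have g: "?g\<in>bmf X" by (rule bmf_sum)
 have "cint X ?g u = (\<Sum>i\<in>I. cint X (%x. a i * of_bool (x\<in>B i)) u)"
  by (rule cint_sum[OF mu g1])
 also have "\<dots> = (\<Sum>i\<in>I. a i * u (B i))"
  using I by (intro sum.cong refl) (simp add: cint_scale[OF mu bmf_indicator] cint_indicator[OF mu])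
 finally have "cint X f u - (\<Sum>i\<in>I. a i * u (B i)) = cint X (%x. f x - ?g x) u"
  by (simp add: cint_diff[OF mu f g])
 moreover have "cmod (f x - ?g x) <= eps" if "x\<in>pts X" for x
 proof -
  obtain i where i: "i\<in>I" "x\<in>B i" using I(4) \<open>x\<in>pts X\<close> by blast
  have "?g x = (\<Sum>j\<in>I. if j = i then a i else 0)"
   using i I(2) by (intro sum.cong) (auto simp: disjoint_family_on_def)
  then show ?thesis using i I by simp
 qed
 ultimately show ?thesis using cint_crude[OF mu bmf_diff[OF f g]] by simp
qed

text \<open>Points are classified by the grid cells that contain the values of all members of
  \<open>F\<close>. Boundedness leaves finitely many classes, and one partition serves the whole
  family.\<close>

lemma step_approx_exists:
 assumes "finite F" "F <= bmf X" "eps > 0"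
 obtains P s where "!!f. f\<in>F ==> step_approx X f eps P (%B. B) (%B. f (s B))" "!!B. B\<in>P ==> s B\<in>B"
proof -
 \<comment> \<open>Two points of one class differ by at most \<open>d\<close> in the real and in the
   imaginary part, hence by at most \<open>2 * d = eps\<close>.\<close>
 define d where "d = eps / 2"
 have d: "d > 0" using assms by (simp add: d_def)
 define sig where "sig x = (\<lambda>f\<in>F. (\<lfloor>Re (f x) / d\<rfloor>, \<lfloor>Im (f x) / d\<rfloor>))" for x
 define cell where "cell v = {x\<in>pts X. sig x = v}" for v
 define P where "P = cell ` sig ` pts X"
 have "\<exists>c. \<forall>x\<in>pts X. \<forall>f\<in>F. cmod (f x) <= c"
 proof -
  have "\<exists>c. \<forall>x\<in>pts X. cmod (f x) <= c" if "f\<in>F" for f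
   by (rule bmf_bound[of f X]) (use that assms(2) in auto)
  then obtain c where c: "!!f x. f\<in>F ==> x\<in>pts X ==> cmod (f x) <= c f" by metis
  have "cmod (f x) <= (\<Sum>f\<in>F. \<bar>c f\<bar>)" if "f\<in>F" "x\<in>pts X" for f x
   using c[OF that] member_le_sum[OF that(1), of "%f. \<bar>c f\<bar>"] assms(1) by fastforce
  then show ?thesis by blast
 qed
 then obtain c where c: "!!f x. f\<in>F ==> x\<in>pts X ==> cmod (f x) <= c" by blast
 define J where "J = {\<lfloor>- (c / d)\<rfloor>..\<lfloor>c / d\<rfloor>}"
 have fl: "\<lfloor>t / d\<rfloor>\<in>J" if "\<bar>t\<bar> <= c" for t
 proof -
  have "- c / d <= t / d" "t / d <= c / d" using d that divide_right_mono[of "- c" t d] divide_right_mono[of t c d] by auto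
  then show ?thesis by (simp add: J_def floor_mono)
 qed
 have "sig ` pts X <= PiE F (%_. J\<times>J)"
  using c by (auto simp: sig_def intro!: fl order_trans[OF abs_Re_le_cmod] order_trans[OF abs_Im_le_cmod])
 then have finP: "finite P"
  unfolding P_def using finite_subset[OF _ finite_PiE[OF assms(1), of "%_. J\<times>J"]] by (auto simp: J_def)
 have cell: "cell v\<in>bor X" if v: "v\<in>sig ` pts X" for v
 proof -
  have vext: "v\<in>extensional F" using v by (auto simp: sig_def)
  have "cell v = pts X\<inter>(\<Inter>f\<in>F. {x\<in>pts X. (\<lfloor>Re (f x) / d\<rfloor>, \<lfloor>Im (f x) / d\<rfloor>) = v f})"
   using vext by (auto simp: cell_def sig_def fun_eq_iff extensional_def)
  moreover have "{x\<in>pts X. (\<lfloor>Re (f x) / d\<rfloor>, \<lfloor>Im (f x) / d\<rfloor>) = v f}\<in>bor X" if "f\<in>F" for f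
  proof -
   have f[measurable]: "f\<in>borel_measurable (borel_space X)" using assms that by (auto simp: bmf_def)
   have "{x\<in>space (borel_space X). \<lfloor>Re (f x) / d\<rfloor> = fst (v f)\<and>\<lfloor>Im (f x) / d\<rfloor> = snd (v f)}\<in>sets (borel_space X)"
    by measurable
   moreover have "{x\<in>space (borel_space X). \<lfloor>Re (f x) / d\<rfloor> = fst (v f)\<and>\<lfloor>Im (f x) / d\<rfloor> = snd (v f)}
    = {x\<in>pts X. (\<lfloor>Re (f x) / d\<rfloor>, \<lfloor>Im (f x) / d\<rfloor>) = v f}" by (auto simp: prod_eq_iff)
   ultimately show ?thesis by simp
  qed
  ultimately show ?thesis
   using assms(1) sets.finite_INT[of F _ "borel_space X"]
   by (cases "F = {}") (auto intro!: bor_Int)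
 qed
 have osc: "cmod (f x - f y) <= eps" if "sig x = sig y" "f\<in>F" for f x y
 proof -
  have "\<lfloor>Re (f x) / d\<rfloor> = \<lfloor>Re (f y) / d\<rfloor>" "\<lfloor>Im (f x) / d\<rfloor> = \<lfloor>Im (f y) / d\<rfloor>"
   using fun_cong[OF that(1), of f] that(2) by (auto simp: sig_def)
  then have "\<bar>Re (f x) / d - Re (f y) / d\<bar> <= 1" "\<bar>Im (f x) / d - Im (f y) / d\<bar> <= 1" by linarith+
  then have "\<bar>Re (f x - f y)\<bar> <= d" "\<bar>Im (f x - f y)\<bar> <= d"
   using d by (simp_all add: diff_divide_distrib[symmetric] abs_divide divide_le_eq)
  then show ?thesis using cmod_le[of "f x - f y"] by (simp add: d_def)
 qed
 define s where "s B = (SOME x. x\<in>B)" for B :: "'a set"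
 have s: "s B\<in>B" if B: "B\<in>P" for B
 proof -
  have "B ~= {}" using B by (auto simp: P_def cell_def)
  then show ?thesis by (simp add: s_def some_in_eq)
 qed
 show thesis
 proof (rule that[of P s])
  fix f assume f: "f\<in>F"
  have "\<forall>B\<in>P. \<forall>x\<in>B. cmod (f x - f (s B)) <= eps"
  proof (intro ballI)
   fix B x assume B: "B\<in>P" "x\<in>B"
   then show "cmod (f x - f (s B)) <= eps" using s[OF B(1)] by (intro osc[OF _ f]) (auto simp: P_def cell_def)
  qed
  moreover have "disjoint_family_on (%B. B) P" by (auto simp: disjoint_family_on_def P_def cell_def)
  moreover have "(%B. B) ` P <= bor X" using cell by (auto simp: P_def)
  moreover have "(\<Union>B\<in>P. B) = pts X" by (auto simp: P_def cell_def)
  ultimately show "step_approx X f eps P (%B. B) (%B. f (s B))" using finP by (simp add: step_approx_def)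
 qed (rule s)
qed

section \<open>Total variation\<close>

abbreviation tv :: "'a topology \<Rightarrow> 'a cmeasure \<Rightarrow> 'a set \<Rightarrow> real" where
 "tv X u A \<equiv> enn2real (total_variation X u A)"

lemma cm_sums:
 assumes "cmeas X u" "!!n::nat. F n\<in>bor X" "disjoint_family F"
 shows "(%n. u (F n)) sums u (\<Union>n. F n)"
 using assms unfolding complex_measure_def by (simp add: image_subset_iff)

lemma crude_nonneg: "0 <= crude X u A"
 by (simp add: crude_def)

lemma norm_le_crude:
 assumes "cmeas X u" "A\<in>bor X"
 shows "cmod (u A) <= crude X u A"
proof -
 have "cmod (u A) <= \<bar>Re (u A)\<bar> + \<bar>Im (u A)\<bar>" by (rule cmod_le)
 also have "\<dots> <= crude X u A"
  using Jordan_decomposition[OF sm_Re[OF assms(1)] assms(2)]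
   Jordan_decomposition[OF sm_Im[OF assms(1)] assms(2)]
   measure_nonneg[of "upper_variation X (%A. Re (u A))" A] measure_nonneg[of "upper_variation X (%A. - Re (u A))" A]
   measure_nonneg[of "upper_variation X (%A. Im (u A))" A] measure_nonneg[of "upper_variation X (%A. - Im (u A))" A]
  unfolding crude_def by linarith
 finally show ?thesis .
qed

lemma crude_sum:
 assumes "cmeas X u" "finite P" "disjoint P" "P <= bor X"
 shows "(\<Sum>B\<in>P. crude X u B) <= crude X u (pts X)"
proof -
 have "(\<Sum>B\<in>P. measure M B) <= measure M (pts X)" if "finite_measure M" "sets M = bor X" for M
 proof -
  interpret finite_measure M by fact
  have sp: "space M = pts X" using sets_eq_imp_space_eq[of M "borel_space X"] that(2) by simp
  have "(\<Sum>B\<in>P. measure M B) = measure M (\<Union>B\<in>P. B)"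
   using assms that by (intro finite_measure_finite_Union[symmetric])
    (auto simp: disjoint_family_on_def pairwise_def disjnt_def)
  also have "\<dots> <= measure M (pts X)" by (metis bounded_measure sp)
  finally show ?thesis .
 qed
 note * = this
 note p = cm_parts[OF assms(1)]
 show ?thesis unfolding crude_def sum.distrib
  by (intro add_mono *[OF p(1)] *[OF p(2)] *[OF p(3)] *[OF p(4)]) auto
qed

lemma total_variation_le:
 assumes "!!P. finite P ==> disjoint P ==> P <= bor X ==> \<Union>P <= A ==> (\<Sum>B\<in>P. cmod (u B)) <= c"
 shows "total_variation X u A <= ennreal c"
 unfolding total_variation_def by (rule SUP_least) (use assms in \<open>auto simp: sum_ennreal intro: ennreal_leI\<close>)

lemma tv_le:
 assumes "!!P. finite P ==> disjoint P ==> P <= bor X ==> \<Union>P <= A ==> (\<Sum>B\<in>P. cmod (u B)) <= c"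
 shows "tv X u A <= c"
proof -
 have "0 <= c" using assms[of "{}"] by (simp add: disjoint_def)
 then show ?thesis using total_variation_le[OF assms] by (intro enn2real_leI) auto
qed

text \<open>The sum of the four variations dominates the modulus of the measure on every Borel set
  and is finite and additive.\<close>

lemma tv_finite:
 assumes "cmeas X u"
 shows "total_variation X u A = ennreal (tv X u A)"
proof -
 have "total_variation X u A <= ennreal (crude X u (pts X))"
 proof (rule total_variation_le)
  fix P assume P: "finite P" "disjoint P" "P <= bor X"
  have "(\<Sum>B\<in>P. cmod (u B)) <= (\<Sum>B\<in>P. crude X u B)"
   using P by (intro sum_mono norm_le_crude assms) auto
  also have "\<dots> <= crude X u (pts X)" by (rule crude_sum[OF assms P])
  finally show "(\<Sum>B\<in>P. cmod (u B)) <= crude X u (pts X)" .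
 qed
 then show ?thesis by (metis ennreal_enn2real ennreal_less_top infinity_ennreal_def le_less_trans)
qed

lemma total_variation_less_iff:
 "cmeas X u ==> 0 < eps ==> total_variation X u A < ennreal eps \<longleftrightarrow> tv X u A < eps"
 by (subst tv_finite) (auto simp: ennreal_less_iff)

text \<open>Indexed form of the defining supremum: two indices with the same set do no harm, since
  disjointness makes that set empty.\<close>

lemma tv_upper:
 assumes "cmeas X u" "finite I" "disjoint_family_on B I" "!!i. i\<in>I ==> B i\<in>bor X" "!!i. i\<in>I ==> B i <= A"
 shows "(\<Sum>i\<in>I. cmod (u (B i))) <= tv X u A"
proof -
 have "(\<Sum>i\<in>I. cmod (u (B i))) = (\<Sum>D\<in>B ` I. cmod (u D))"
 proof (rule sum.reindex_nontrivial[symmetric, unfolded o_def])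
  fix i j assume "i\<in>I" "j\<in>I" "i ~= j" "B i = B j"
  then have "B i = {}" using assms(3) by (auto simp: disjoint_family_on_def)
  then show "cmod (u (B i)) = 0" using cm_empty[OF assms(1)] by simp
 qed fact
 moreover have "ennreal (\<Sum>D\<in>B ` I. cmod (u D)) <= total_variation X u A"
  unfolding total_variation_def sum_ennreal[OF norm_ge_zero, symmetric]
  by (rule SUP_upper) (use assms in \<open>auto intro: disjoint_family_on_disjoint_image dest: subsetD\<close>)
 then have "ennreal (\<Sum>D\<in>B ` I. cmod (u D)) <= ennreal (tv X u A)"
  by (subst tv_finite[OF assms(1), symmetric])
 ultimately show ?thesis by simp
qed

lemma tv_nonneg: "0 <= tv X u A" by simp

lemma norm_le_tv: "cmeas X u ==> A\<in>bor X ==> cmod (u A) <= tv X u A"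
 using tv_upper[of X u "{()}" "%_. A" A] by (simp add: disjoint_family_on_def)

lemma tv_upper_set:
 assumes "cmeas X u" "finite P" "disjoint P" "P <= bor X" "\<Union>P <= A"
 shows "(\<Sum>B\<in>P. cmod (u B)) <= tv X u A"
 using assms by (intro tv_upper) (auto simp: disjoint_family_on_def disjoint_def)

lemma tv_mono: assumes "cmeas X u" "A <= B" shows "tv X u A <= tv X u B"
 by (rule tv_le, rule tv_upper_set[OF assms(1)]) (use assms(2) in auto)

lemma tv_Un:
 assumes "cmeas X u" "A\<in>bor X" "B\<in>bor X"
 shows "tv X u (A\<union>B) <= tv X u A + tv X u B"
proof (rule tv_le)
 fix P assume P: "finite P" "disjoint P" "P <= bor X" "\<Union>P <= A\<union>B"
 have "cmod (u D) <= cmod (u (D\<inter>A)) + cmod (u (D - A))" if "D\<in>P" for D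
 proof -
  have "u ((D\<inter>A)\<union>(D - A)) = u (D\<inter>A) + u (D - A)"
   using P that assms by (intro cm_Un[OF assms(1)]) (auto intro: bor_Int bor_Diff)
  moreover have "(D\<inter>A)\<union>(D - A) = D" by auto
  ultimately show ?thesis by (metis norm_triangle_ineq)
 qed
 then have "(\<Sum>D\<in>P. cmod (u D)) <= (\<Sum>D\<in>P. cmod (u (D\<inter>A))) + (\<Sum>D\<in>P. cmod (u (D - A)))"
  by (simp add: sum.distrib[symmetric] sum_mono)
 also have "\<dots> <= tv X u A + tv X u B"
  by (intro add_mono tv_upper assms)
    (use P assms in \<open>auto simp: disjoint_family_on_def disjoint_def intro!: bor_Int bor_Diff\<close>)
 finally show "(\<Sum>D\<in>P. cmod (u D)) <= tv X u A + tv X u B" .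
qed

lemma cm_add:
 "cmeas X u ==> cmeas X w ==> cmeas X (%A. u A + w A)"
 unfolding complex_measure_def by (auto intro: sums_add)

lemma cm_scale: "cmeas X u ==> cmeas X (%A. a * u A)"
 unfolding complex_measure_def by (auto intro: sums_mult)

lemma cm_zero: "cmeas X (%A. 0)"
 unfolding complex_measure_def by auto

lemma tv_add:
 assumes "cmeas X u" "cmeas X w"
 shows "tv X (%A. u A + w A) A <= tv X u A + tv X w A"
proof (rule tv_le)
 fix P assume P: "finite P" "disjoint P" "P <= bor X" "\<Union>P <= A"
 have "(\<Sum>D\<in>P. cmod (u D + w D)) <= (\<Sum>D\<in>P. cmod (u D)) + (\<Sum>D\<in>P. cmod (w D))"
  by (simp add: sum.distrib[symmetric] sum_mono norm_triangle_ineq)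
 then show "(\<Sum>D\<in>P. cmod (u D + w D)) <= tv X u A + tv X w A"
  using tv_upper_set[OF assms(1) P] tv_upper_set[OF assms(2) P] by linarith
qed

lemma tv_scale:
 assumes "cmeas X u"
 shows "tv X (%A. a * u A) A <= cmod a * tv X u A"
proof (rule tv_le)
 fix P assume P: "finite P" "disjoint P" "P <= bor X" "\<Union>P <= A"
 show "(\<Sum>D\<in>P. cmod (a * u D)) <= cmod a * tv X u A"
  using tv_upper_set[OF assms P] by (simp add: norm_mult sum_distrib_left[symmetric] mult_left_mono)
qed

lemma continuous_map_measurable:
 assumes "continuous_map X Y g" shows "g\<in>measurable (borel_space X) (borel_space Y)"
proof (rule measurable_measure_of[OF opens_subset_Pow])
 show "g\<in>space (borel_space X) \<rightarrow> pts Y" using assms by (simp add: continuous_map_def)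
 fix y assume "y\<in>{U. openin Y U}"
 then have "openin X {x\<in>pts X. g x\<in>y}" using assms by (simp add: continuous_map_def)
 moreover have "g -` y\<inter>space (borel_space X) = {x\<in>pts X. g x\<in>y}" by auto
 ultimately show "g -` y\<inter>space (borel_space X)\<in>sets (borel_space X)" by (simp add: open_bor)
qed

lemma bor_vimage:
 "continuous_map X Y g ==> B\<in>bor Y ==> g -` B\<inter>pts X\<in>bor X"
 using measurable_sets[OF continuous_map_measurable, of X Y g B] by simp

lemma push_apply: "B\<in>bor Y ==> push X Y g u B = u (g -` B\<inter>pts X)"
 by (simp add: push_def)

lemma cm_push:
 assumes "cmeas X u" "continuous_map X Y g"
 shows "cmeas Y (push X Y g u)"
 unfolding complex_measure_def
proof (intro conjI allI impI)
 fix F :: "nat \<Rightarrow> 'b set" assume F: "range F <= bor Y" "disjoint_family F"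
 have "(%n. u (g -` F n\<inter>pts X)) sums u (\<Union>n. g -` F n\<inter>pts X)"
 proof (rule cm_sums[OF assms(1)])
  show "g -` F n\<inter>pts X\<in>bor X" for n using F bor_vimage[OF assms(2)] by blast
  show "disjoint_family (%n. g -` F n\<inter>pts X)" using F(2) unfolding disjoint_family_on_def by blast
 qed
 moreover have "(\<Union>n. g -` F n\<inter>pts X) = g -` (\<Union>n. F n)\<inter>pts X" by auto
 ultimately show "(%n. push X Y g u (F n)) sums push X Y g u (\<Union>n. F n)"
  using F by (simp add: push_def bor_UN image_subset_iff)
qed (simp add: push_def)

lemma tv_push:
 assumes "cmeas X u" "continuous_map X Y g"
 shows "tv Y (push X Y g u) A <= tv X u (g -` A\<inter>pts X)"
proof (rule tv_le)
 fix P assume P: "finite P" "disjoint P" "P <= bor Y" "\<Union>P <= A"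
 have "(\<Sum>D\<in>P. cmod (push X Y g u D)) = (\<Sum>D\<in>P. cmod (u (g -` D\<inter>pts X)))"
  using P by (intro sum.cong) (auto simp: push_def)
 also have "\<dots> <= tv X u (g -` A\<inter>pts X)"
  using P by (intro tv_upper assms bor_vimage[OF assms(2)])
   (auto simp: disjoint_family_on_def disjoint_def)
 finally show "(\<Sum>D\<in>P. cmod (push X Y g u D)) <= tv X u (g -` A\<inter>pts X)" .
qed

lemma le_by_eps:
 fixes x y k :: real
 assumes "!!eps. 0 < eps ==> eps < 1 ==> x <= y + eps * k" "0 <= k"
 shows "x <= y"
proof (rule field_le_epsilon)
 fix e :: real assume e: "0 < e"
 define eps where "eps = min (1/2) (e / (k + 1))"
 have "0 < eps" "eps < 1" using e assms(2) by (auto simp: eps_def min_def)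
 then have "x <= y + eps * k" by (rule assms(1))
 also have "eps * k <= e / (k + 1) * k" using assms(2) by (intro mult_right_mono) (auto simp: eps_def)
 also have "\<dots> <= e" using e assms(2) by (simp add: field_simps)
 finally show "x <= y + e" by simp
qed

text \<open>One partition approximates \<open>f\<close> and the indicator of \<open>S\<close>
  together. As \<open>eps < 1\<close>, a cell whose representative lies in \<open>S\<close> is
  contained in \<open>S\<close>, and the other cells contribute 0, so only the variation on
  \<open>S\<close> enters.\<close>

lemma cint_norm_on:
 assumes mu: "cmeas X u" and f: "f\<in>bmf X" and S: "S\<in>bor X" and c: "0 <= c"
  "!!x. x\<in>S ==> cmod (f x) <= c" "!!x. x\<in>pts X ==> x\<notin>S ==> f x = 0"
 shows "cmod (cint X f u) <= c * tv X u S"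
proof (rule le_by_eps[OF _ crude_nonneg])
 fix eps :: real assume eps: "0 < eps" "eps < 1"
 let ?F = "{f, %x. of_bool (x\<in>S)}"
 obtain P s where P: "!!f. f\<in>?F ==> step_approx X f eps P (%B. B) (%B. f (s B))" and s: "!!B. B\<in>P ==> s B\<in>B"
  by (rule step_approx_exists[of ?F X eps]) (use f bmf_indicator[OF S] eps in auto)
 have sf: "step_approx X f eps P (%B. B) (%B. f (s B))" using P by blast
 have sS: "step_approx X (%x. of_bool (x\<in>S)) eps P (%B. B) (%B. of_bool (s B\<in>S))" using P by blast
 have fin: "finite P" and PB: "P <= bor X" and dj: "disjoint_family_on (%B. B) P" and top: "\<Union>P = pts X"
  using sf by (auto simp: step_approx_def)
 have dich: "B <= S" if "B\<in>P" "s B\<in>S" for B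
 proof
  fix x assume "x\<in>B"
  then have "cmod (of_bool (x\<in>S) - of_bool (s B\<in>S)) <= eps" using sS that(1) by (auto simp: step_approx_def)
  then show "x\<in>S" using that(2) eps by (cases "x\<in>S") auto
 qed
 have "cmod (\<Sum>B\<in>P. f (s B) * u B) = cmod (\<Sum>B | B\<in>P\<and>s B\<in>S. f (s B) * u B)"
  by (rule arg_cong[of _ _ cmod], rule sum.mono_neutral_right) (use fin c(3) s top in auto)
 also have "\<dots> <= (\<Sum>B | B\<in>P\<and>s B\<in>S. c * cmod (u B))"
  by (rule sum_norm_le) (auto simp: norm_mult intro: mult_right_mono c)
 also have "\<dots> <= c * tv X u S" unfolding sum_distrib_left[symmetric]
  by (intro mult_left_mono tv_upper mu c) (use fin PB dj dich in \<open>auto simp: disjoint_family_on_def\<close>)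
 finally have "cmod (\<Sum>B\<in>P. f (s B) * u B) <= c * tv X u S" .
 moreover have "cmod (cint X f u - (\<Sum>B\<in>P. f (s B) * u B)) <= eps * crude X u (pts X)"
  by (rule cint_step_crude[OF mu f sf])
 ultimately show "cmod (cint X f u) <= c * tv X u S + eps * crude X u (pts X)"
  using norm_triangle_sub[of "cint X f u" "\<Sum>B\<in>P. f (s B) * u B"] by linarith
qed

lemma cint_norm:
 assumes "cmeas X u" "f\<in>bmf X" "0 <= c" "!!x. x\<in>pts X ==> cmod (f x) <= c"
 shows "cmod (cint X f u) <= c * tv X u (pts X)"
 using assms by (intro cint_norm_on) auto

text \<open>Upper variations are not additive in the measure, so linearity in the measure cannot be
  read off from \<open>cintegral\<close>. This characterisation by finite sums, with an error linear
  in \<open>eps\<close>, yields it, and the change of variables as well.\<close>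

lemma cint_eqI:
 assumes mu: "cmeas X u" and f: "f\<in>bmf X" and k: "0 <= k"
  and L: "!!eps P s. 0 < eps ==> step_approx X f eps P (%B. B) (%B. f (s B)) ==> (!!B. B\<in>P ==> s B\<in>B)
   ==> cmod (L - (\<Sum>B\<in>P. f (s B) * u B)) <= eps * k"
 shows "L = cint X f u"
proof -
 have "cmod (L - cint X f u) <= 0"
 proof (rule le_by_eps[OF _ add_nonneg_nonneg[OF k crude_nonneg[of X u "pts X"]]])
  fix eps :: real assume eps: "0 < eps" "eps < 1"
  obtain P s where P: "!!g. g\<in>{f} ==> step_approx X g eps P (%B. B) (%B. g (s B))" and s: "!!B. B\<in>P ==> s B\<in>B"
   by (rule step_approx_exists[of "{f}" X eps]) (use f eps in auto)
  have sf: "step_approx X f eps P (%B. B) (%B. f (s B))" using P by blast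
  show "cmod (L - cint X f u) <= 0 + eps * (k + crude X u (pts X))"
   using L[OF eps(1) sf s] cint_step_crude[OF mu f sf]
    norm_diff_triangle_ineq[of L "\<Sum>B\<in>P. f (s B) * u B" "\<Sum>B\<in>P. f (s B) * u B" "cint X f u"]
   by (simp add: distrib_left norm_minus_commute)
 qed
 then show ?thesis by simp
qed

lemma cint_madd:
 assumes "cmeas X u" "cmeas X w" "f\<in>bmf X"
 shows "cint X f (%A. u A + w A) = cint X f u + cint X f w"
proof (rule cint_eqI[OF cm_add[OF assms(1,2)] assms(3), symmetric])
 show "0 <= crude X u (pts X) + crude X w (pts X)" by (simp add: crude_nonneg)
 fix eps :: real and P s assume P: "step_approx X f eps P (%B. B) (%B. f (s B))"
 show "cmod (cint X f u + cint X f w - (\<Sum>B\<in>P. f (s B) * (u B + w B))) <= eps * (crude X u (pts X) + crude X w (pts X))"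
  using cint_step_crude[OF assms(1,3) P] cint_step_crude[OF assms(2,3) P]
   norm_diff_triangle_ineq[of "cint X f u" "cint X f w" "\<Sum>B\<in>P. f (s B) * u B" "\<Sum>B\<in>P. f (s B) * w B"]
  by (simp add: distrib_left sum.distrib)
qed

lemma cint_mscale:
 assumes "cmeas X u" "f\<in>bmf X"
 shows "cint X f (%A. a * u A) = a * cint X f u"
proof (rule cint_eqI[OF cm_scale[OF assms(1)] assms(2), symmetric])
 show "0 <= cmod a * crude X u (pts X)" by (simp add: crude_nonneg)
 fix eps :: real and P s assume P: "step_approx X f eps P (%B. B) (%B. f (s B))"
 have "a * cint X f u - (\<Sum>B\<in>P. f (s B) * (a * u B)) = a * (cint X f u - (\<Sum>B\<in>P. f (s B) * u B))"
  by (simp add: algebra_simps sum_distrib_left)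
 then show "cmod (a * cint X f u - (\<Sum>B\<in>P. f (s B) * (a * u B))) <= eps * (cmod a * crude X u (pts X))"
  using mult_left_mono[OF cint_step_crude[OF assms P] norm_ge_zero[of a]]
  by (simp only: norm_mult mult.left_commute)
qed

lemma cint_mzero [simp]: "f\<in>bmf X ==> cint X f (%A. 0) = 0"
 using cint_mscale[OF cm_zero, of f X 0] by simp

lemma complex_measure_sum:
 "(!!i. i\<in>I ==> cmeas X (u i)) ==> cmeas X (%A. \<Sum>i\<in>I. u i A)"
 by (induction I rule: infinite_finite_induct) (auto intro: cm_zero cm_add)

lemma cint_msum:
 assumes "!!i. i\<in>I ==> cmeas X (u i)" "f\<in>bmf X"
 shows "cint X f (%A. \<Sum>i\<in>I. u i A) = (\<Sum>i\<in>I. cint X f (u i))"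
 using assms
proof (induction I rule: infinite_finite_induct)
 case (insert i I)
 then show ?case using cint_madd[of X "u i" "%A. \<Sum>i\<in>I. u i A" f] by (simp add: complex_measure_sum)
qed auto

lemma bmf_compose: assumes "continuous_map X Y g" "f\<in>bmf Y" shows "(%x. f (g x))\<in>bmf X"
proof -
 obtain c where c: "!!x. x\<in>pts Y ==> cmod (f x) <= c" by (rule bmf_bound[OF assms(2)]) (rule that)
 show ?thesis
 proof (rule bmfI)
  show "(%x. f (g x))\<in>borel_measurable (borel_space X)"
   using measurable_compose[OF continuous_map_measurable[OF assms(1)], of f borel] assms(2) by (simp add: bmf_def)
  show "cmod (f (g x)) <= c" if "x\<in>pts X" for x
   using c[of "g x"] assms(1) that by (auto simp: continuous_map_def Pi_iff)
 qed
qed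

lemma cint_push:
 assumes "cmeas X u" "continuous_map X Y g" "f\<in>bmf Y"
 shows "cint Y f (push X Y g u) = cint X (%x. f (g x)) u"
proof (rule cint_eqI[OF cm_push[OF assms(1,2)] assms(3) crude_nonneg, symmetric])
 fix eps :: real and P s assume P: "step_approx Y f eps P (%B. B) (%B. f (s B))"
 have "step_approx X (%x. f (g x)) eps P (%B. g -` B\<inter>pts X) (%B. f (s B))"
  unfolding step_approx_def
 proof (intro conjI)
  have P': "finite P" "disjoint_family_on (%B. B) P" "P <= bor Y" "\<Union>P = pts Y"
   "!!B y. B\<in>P ==> y\<in>B ==> cmod (f y - f (s B)) <= eps" using P by (auto simp: step_approx_def)
  show "finite P" by (rule P')
  show "disjoint_family_on (%B. g -` B\<inter>pts X) P" using P'(2) unfolding disjoint_family_on_def by blast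
  show "(%B. g -` B\<inter>pts X) ` P <= bor X" using P'(3) bor_vimage[OF assms(2)] by blast
  have "g ` pts X <= \<Union>P" using assms(2) P'(4) by (simp add: continuous_map_image_subset_topspace)
  then show "(\<Union>B\<in>P. g -` B\<inter>pts X) = pts X" by blast
  show "\<forall>B\<in>P. \<forall>x\<in>g -` B\<inter>pts X. cmod (f (g x) - f (s B)) <= eps" using P'(5) by blast
 qed
 from cint_step_crude[OF assms(1) bmf_compose[OF assms(2,3)] this]
 have "cmod (cint X (%x. f (g x)) u - (\<Sum>B\<in>P. f (s B) * u (g -` B\<inter>pts X))) <= eps * crude X u (pts X)" .
 moreover have "(\<Sum>B\<in>P. f (s B) * push X Y g u B) = (\<Sum>B\<in>P. f (s B) * u (g -` B\<inter>pts X))"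
  using P by (intro sum.cong) (auto simp: push_def step_approx_def)
 ultimately show "cmod (cint X (%x. f (g x)) u - (\<Sum>B\<in>P. f (s B) * push X Y g u B)) <= eps * crude X u (pts X)"
  by simp
qed

lemma cm_dirac: "cmeas X (dirac X x)"
 unfolding complex_measure_def dirac_def
proof (intro conjI allI impI)
 fix F :: "nat \<Rightarrow> 'a set" assume F: "range F <= bor X" "disjoint_family F"
 show "(%n. of_bool (F n\<in>bor X\<and>x\<in>F n) :: complex) sums of_bool ((\<Union>n. F n)\<in>bor X\<and>x\<in>(\<Union>n. F n))"
 proof (cases "\<exists>n. x\<in>F n")
  case True
  then obtain n where n: "x\<in>F n" by blast
  have "(%m. of_bool (F m\<in>bor X\<and>x\<in>F m) :: complex) = (%m. if m = n then 1 else 0)"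
   using F n by (fastforce simp: disjoint_family_on_def)
  moreover have "(\<Union>n. F n)\<in>bor X" using F bor_UN[of F X] by blast
  moreover have "x\<in>(\<Union>n. F n)" using n by blast
  ultimately show ?thesis using sums_single[of n "%_. 1::complex"] by simp
 next
  case False
  then show ?thesis by simp
 qed
qed simp

lemma cint_dirac: assumes "x\<in>pts X" "f\<in>bmf X" shows "cint X f (dirac X x) = f x"
proof (rule cint_eqI[OF cm_dirac assms(2), symmetric])
 fix eps :: real and P s assume P: "step_approx X f eps P (%B. B) (%B. f (s B))"
 then have "x\<in>(\<Union>B\<in>P. B)" using assms(1) unfolding step_approx_def by simp
 then obtain B where B: "B\<in>P" "x\<in>B" by blast
 have "(\<Sum>B\<in>P. f (s B) * dirac X x B) = (\<Sum>D\<in>P. if D = B then f (s B) else 0)"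
  using P B by (intro sum.cong) (auto simp: dirac_def step_approx_def disjoint_family_on_def)
 then show "cmod (f x - (\<Sum>B\<in>P. f (s B) * dirac X x B)) <= eps * 1"
  using P B by (auto simp: step_approx_def)
qed simp

section \<open>Radon measures\<close>

lemma Mb_cm: "u\<in>Mb X ==> cmeas X u"
 by (simp add: Mb_def)

lemma MbI:
 assumes "cmeas X u" "!!A eps. A\<in>bor X ==> 0 < eps ==> \<exists>C. compactin X C\<and>C <= A\<and>tv X u (A - C) < eps"
 shows "u\<in>Mb X"
 using assms unfolding Mb_def by (simp add: total_variation_less_iff)

lemma MbE:
 assumes "u\<in>Mb X" "A\<in>bor X" "0 < eps"
 obtains C where "compactin X C" "C <= A" "tv X u (A - C) < eps"
proof -
 have "\<exists>C. compactin X C\<and>C <= A\<and>tv X u (A - C) < eps"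
  using assms unfolding Mb_def by (auto simp: total_variation_less_iff)
 then show thesis using that by blast
qed

lemma Mb_zero: "(%A. 0)\<in>Mb X"
proof (rule MbI[OF cm_zero])
 fix A :: "'a set" and eps :: real assume "0 < eps"
 moreover have "tv X (%A. 0) (A - {}) <= 0" by (rule tv_le) auto
 ultimately show "\<exists>C. compactin X C\<and>C <= A\<and>tv X (%A. 0) (A - C) < eps" by (intro exI[of _ "{}"]) auto
qed

lemma Mb_add: assumes "u\<in>Mb X" "w\<in>Mb X" shows "(%A. u A + w A)\<in>Mb X"
proof (rule MbI)
 note cm = Mb_cm[OF assms(1)] Mb_cm[OF assms(2)]
 show "cmeas X (%A. u A + w A)" using cm by (rule cm_add)
 fix A eps assume A: "A\<in>bor X" "(0::real) < eps"
 obtain C where C: "compactin X C" "C <= A" "tv X u (A - C) < eps/2"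
  by (rule MbE[OF assms(1) A(1), of "eps/2"]) (use A in auto)
 obtain D where D: "compactin X D" "D <= A" "tv X w (A - D) < eps/2"
  by (rule MbE[OF assms(2) A(1), of "eps/2"]) (use A in auto)
 have "tv X (%A. u A + w A) (A - (C\<union>D)) <= tv X u (A - (C\<union>D)) + tv X w (A - (C\<union>D))"
  by (rule tv_add[OF cm])
 also have "\<dots> <= tv X u (A - C) + tv X w (A - D)" by (intro add_mono tv_mono cm) auto
 finally have "tv X (%A. u A + w A) (A - (C\<union>D)) < eps" using C D by simp
 then show "\<exists>C. compactin X C\<and>C <= A\<and>tv X (%A. u A + w A) (A - C) < eps"
  using C D by (intro exI[of _ "C\<union>D"]) (auto intro: compactin_Un)
qed

lemma Mb_scale: assumes "u\<in>Mb X" shows "(%A. a * u A)\<in>Mb X"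
proof (rule MbI)
 note cm = Mb_cm[OF assms]
 show "cmeas X (%A. a * u A)" using cm by (rule cm_scale)
 fix A eps assume A: "A\<in>bor X" "(0::real) < eps"
 have "0 < eps / (cmod a + 1)" using A by (simp add: add_nonneg_pos)
 then obtain C where C: "compactin X C" "C <= A" "tv X u (A - C) < eps / (cmod a + 1)"
  by (rule MbE[OF assms A(1)])
 have "tv X (%A. a * u A) (A - C) <= cmod a * tv X u (A - C)" by (rule tv_scale[OF cm])
 also have "\<dots> <= (cmod a + 1) * tv X u (A - C)" by (intro mult_right_mono) auto
 also have "\<dots> < eps" using C(3) by (simp add: pos_less_divide_eq add_nonneg_pos mult.commute)
 finally show "\<exists>C. compactin X C\<and>C <= A\<and>tv X (%A. a * u A) (A - C) < eps" using C by blast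
qed

lemma Mb_sum: "(!!i. i\<in>I ==> u i\<in>Mb X) ==> (%A. \<Sum>i\<in>I. u i A)\<in>Mb X"
 by (induction I rule: infinite_finite_induct) (auto intro: Mb_zero Mb_add)

lemma Mb_push: assumes "u\<in>Mb X" "continuous_map X Y g" shows "push X Y g u\<in>Mb Y"
proof (rule MbI)
 note cm = Mb_cm[OF assms(1)]
 show "cmeas Y (push X Y g u)" by (rule cm_push[OF cm assms(2)])
 fix A eps assume A: "A\<in>bor Y" "(0::real) < eps"
 obtain C where C: "compactin X C" "C <= g -` A\<inter>pts X" "tv X u (g -` A\<inter>pts X - C) < eps"
  by (rule MbE[OF assms(1) bor_vimage[OF assms(2) A(1)] A(2)])
 have "tv Y (push X Y g u) (A - g ` C) <= tv X u (g -` (A - g ` C)\<inter>pts X)"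
  by (rule tv_push[OF cm assms(2)])
 also have "\<dots> <= tv X u (g -` A\<inter>pts X - C)" by (rule tv_mono[OF cm]) auto
 finally have "tv Y (push X Y g u) (A - g ` C) < eps" using C by simp
 then show "\<exists>C. compactin Y C\<and>C <= A\<and>tv Y (push X Y g u) (A - C) < eps"
  using C image_compactin[OF C(1) assms(2)] by (intro exI[of _ "g ` C"]) auto
qed

lemma Mb_dirac: assumes "x\<in>pts X" shows "dirac X x\<in>Mb X"
proof (rule MbI[OF cm_dirac])
 fix A eps assume A: "A\<in>bor X" "(0::real) < eps"
 have "tv X (dirac X x) (A - A\<inter>{x}) <= 0"
 proof (rule tv_le)
  fix P assume "\<Union>P <= A - A\<inter>{x}"
  then have "dirac X x B = 0" if "B\<in>P" for B using that by (auto simp: dirac_def)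
  then show "(\<Sum>B\<in>P. cmod (dirac X x B)) <= 0" by simp
 qed
 then show "\<exists>C. compactin X C\<and>C <= A\<and>tv X (dirac X x) (A - C) < eps"
  using A assms by (intro exI[of _ "A\<inter>{x}"]) (auto intro: finite_imp_compactin)
qed

section \<open>Positive measures\<close>

definition of_measure :: "'a topology \<Rightarrow> 'a measure \<Rightarrow> 'a cmeasure" where
 "of_measure X M = (%A. if A\<in>bor X then complex_of_real (measure M A) else 0)"

lemma cm_of_measure:
 assumes "finite_measure M" "sets M = bor X"
 shows "cmeas X (of_measure X M)"
 unfolding complex_measure_def
proof (intro conjI allI impI)
 interpret finite_measure M by fact
 fix F :: "nat \<Rightarrow> 'a set" assume F: "range F <= bor X" "disjoint_family F"
 have "(%n. complex_of_real (measure M (F n))) sums complex_of_real (measure M (\<Union>n. F n))"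
  using F assms(2) by (intro sums_of_real finite_measure_UNION) auto
 moreover have "(\<Union>n. F n)\<in>bor X" "!!n. F n\<in>bor X" using F bor_UN[of F X] by blast+
 ultimately show "(%n. of_measure X M (F n)) sums of_measure X M (\<Union>n. F n)" by (simp add: of_measure_def)
qed (simp add: of_measure_def)

definition pos_measure :: "'a topology \<Rightarrow> 'a cmeasure \<Rightarrow> bool" where
 "pos_measure X u \<longleftrightarrow> cmeas X u\<and>(\<forall>A. u A\<in>\<real>\<^sub>\<ge>\<^sub>0)"

lemma pos_measureD:
 assumes "pos_measure X u"
 shows "cmeas X u" "0 <= Re (u A)" "Im (u A) = 0" "u A = of_real (Re (u A))"
 using assms by (auto simp: pos_measure_def complex_nonneg_Reals_iff complex_eq_iff)

lemma Mb_posD: "u\<in>Mb_pos X ==> pos_measure X u"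
 by (simp add: Mb_pos_def Mb_def pos_measure_def)

lemma Mb_posI: "u\<in>Mb X ==> pos_measure X u ==> u\<in>Mb_pos X"
 by (simp add: Mb_pos_def pos_measure_def)

lemma pos_Mb: "u\<in>Mb_pos X ==> u\<in>Mb X"
 by (simp add: Mb_pos_def)

lemma prob_pos: "u\<in>M_prob X ==> u\<in>Mb_pos X"
 by (simp add: M_prob_def)

lemma prob_Mb: "u\<in>M_prob X ==> u\<in>Mb X"
 by (simp add: M_prob_def Mb_pos_def)

lemma prob_top: "u\<in>M_prob X ==> u (pts X) = 1"
 by (simp add: M_prob_def)

lemma positive_of_measure:
 "finite_measure M ==> sets M = bor X ==> pos_measure X (of_measure X M)"
 unfolding pos_measure_def by (rule conjI, rule cm_of_measure) (simp_all add: of_measure_def)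

lemma upper_variation_nonpos:
 assumes "signed_measure X w" "!!A. w A <= 0"
 shows "A\<in>bor X ==> measure (upper_variation X w) A = 0"
  and "f\<in>bmf X ==> (LINT x|upper_variation X w. f x :: complex) = 0"
proof -
 have ne: "{B\<in>bor X. B <= A} ~= {}" for A using bor_empty by blast
 have m: "measure (upper_variation X w) A = 0" if "A\<in>bor X" for A
  unfolding measure_def emeasure_upper[OF assms(1) that] using assms(2) ne by (simp add: ennreal_neg)
 then show "A\<in>bor X ==> measure (upper_variation X w) A = 0" .
 show "(LINT x|upper_variation X w. f x :: complex) = 0" if f: "f\<in>bmf X"
 proof -
  obtain c where c: "!!x. x\<in>pts X ==> cmod (f x) <= c" by (rule bmf_bound[OF f]) (rule that)
  have "cmod (LINT x|upper_variation X w. f x) <= c * measure (upper_variation X w) (pts X)"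
   by (intro norm_integral_bmf finite_upper assms f c) simp
  then show ?thesis by (simp add: m)
 qed
qed

lemma upper_variation_of_measure:
 assumes "finite_measure M" "sets M = bor X"
 shows "upper_variation X (%A. Re (of_measure X M A)) = M"
proof (rule measure_eqI)
 interpret finite_measure M by fact
 fix A assume "A\<in>sets (upper_variation X (%A. Re (of_measure X M A)))"
 then have A: "A\<in>bor X" by simp
 have "emeasure (upper_variation X (%A. Re (of_measure X M A))) A = upper X (%A. Re (of_measure X M A)) A"
  by (intro emeasure_upper sm_Re cm_of_measure assms A)
 also have "\<dots> = (SUP B\<in>{B\<in>bor X. B <= A}. emeasure M B)"
  by (intro SUP_cong) (auto simp: of_measure_def emeasure_eq_measure)
 also have "\<dots> = emeasure M A"
  by (intro antisym SUP_least SUP_upper) (use A assms(2) in \<open>auto intro: emeasure_mono\<close>)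
 finally show "emeasure (upper_variation X (%A. Re (of_measure X M A))) A = emeasure M A" .
qed (simp add: assms)

lemma cint_of_measure:
 assumes "finite_measure M" "sets M = bor X" "f\<in>bmf X"
 shows "cint X f (of_measure X M) = (LINT x|M. f x)"
proof -
 note c = cm_of_measure[OF assms(1,2)]
 have "(LINT x|upper_variation X (%A. - Re (of_measure X M A)). f x) = 0"
  by (rule upper_variation_nonpos(2)[OF sm_minus[OF sm_Re[OF c]] _ assms(3)])
   (simp add: of_measure_def)
 moreover have "(LINT x|upper_variation X (%A. - Im (of_measure X M A)). f x) = 0"
  by (rule upper_variation_nonpos(2)[OF sm_minus[OF sm_Im[OF c]] _ assms(3)])
   (simp add: of_measure_def)
 moreover have "(LINT x|upper_variation X (%A. Im (of_measure X M A)). f x) = 0"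
  by (rule upper_variation_nonpos(2)[OF sm_Im[OF c] _ assms(3)])
   (simp add: of_measure_def)
 ultimately show ?thesis by (simp add: cintegral_def upper_variation_of_measure[OF assms(1,2)])
qed

definition pmeas :: "'a topology \<Rightarrow> 'a cmeasure \<Rightarrow> 'a measure" where
 "pmeas X u = upper_variation X (%A. Re (u A))"

lemma sets_pmeas [simp]: "sets (pmeas X u) = bor X"
 and space_pmeas [simp]: "space (pmeas X u) = pts X"
 by (simp_all add: pmeas_def)

lemma finite_measure_pmeas: "cmeas X u ==> finite_measure (pmeas X u)"
 by (simp add: pmeas_def cm_parts)

lemma of_measure_pmeas:
 assumes "pos_measure X u"
 shows "of_measure X (pmeas X u) = u"
proof
 fix A
 note c = pos_measureD(1)[OF assms]
 note s = sm_Re[OF c]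
 show "of_measure X (pmeas X u) A = u A"
 proof (cases "A\<in>bor X")
  case True
  have "measure (upper_variation X (%A. - Re (u A))) A = 0"
   by (rule upper_variation_nonpos(1)[OF sm_minus[OF s] _ True])
    (simp add: pos_measureD(2)[OF assms])
  then have "Re (u A) = measure (pmeas X u) A" using Jordan_decomposition[OF s True] by (simp add: pmeas_def)
  then show ?thesis using True pos_measureD(4)[OF assms, of A] by (simp add: of_measure_def)
 qed (simp add: of_measure_def cm_outside[OF c])
qed

lemma cint_pmeas: "pos_measure X u ==> f\<in>bmf X ==> cint X f u = (LINT x|pmeas X u. f x)"
 using cint_of_measure[OF finite_measure_pmeas[OF pos_measureD(1)] sets_pmeas, of X u f] by (simp add: of_measure_pmeas)

lemma cint_nonneg:
 assumes "pos_measure X u" "(cplx g)\<in>bmf X" "!!x. x\<in>pts X ==> 0 <= g x"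
 shows "cint X (cplx g) u\<in>\<real>\<^sub>\<ge>\<^sub>0"
proof -
 have "cint X (cplx g) u = complex_of_real (LINT x|pmeas X u. g x)"
  by (simp add: cint_pmeas[OF assms(1,2)])
 moreover have "0 <= (LINT x|pmeas X u. g x)"
  by (rule Bochner_Integration.integral_nonneg_AE, rule AE_I2) (use assms(3) in simp)
 ultimately show ?thesis by simp
qed

lemma positive_measure_mono:
 assumes "pos_measure X u" "A\<in>bor X" "B\<in>bor X" "A <= B"
 shows "Re (u A) <= Re (u B)"
 using cm_Diff[OF pos_measureD(1)[OF assms(1)] assms(3,2,4)] pos_measureD(2)[OF assms(1), of "B - A"] by simp

lemma tv_positive:
 assumes "pos_measure X u" "A\<in>bor X"
 shows "tv X u A = Re (u A)"
proof (rule antisym)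
 have c: "cmod (u B) = Re (u B)" for B
  using pos_measureD(2,4)[OF assms(1), of B] by (metis abs_of_nonneg norm_of_real)
 note cm = pos_measureD(1)[OF assms(1)]
 show "tv X u A <= Re (u A)"
 proof (rule tv_le)
  fix P assume P: "finite P" "disjoint P" "P <= bor X" "\<Union>P <= A"
  have "(\<Sum>B\<in>P. cmod (u B)) = Re (u (\<Union>B\<in>P. B))"
   using P by (subst cm_finite_UN[OF cm]) (auto simp: c disjoint_family_on_def disjoint_def)
  also have "\<dots> <= Re (u A)"
   using P assms by (intro positive_measure_mono[OF assms(1)] bor_finite_UN) auto
  finally show "(\<Sum>B\<in>P. cmod (u B)) <= Re (u A)" .
 qed
 show "Re (u A) <= tv X u A" using norm_le_tv[OF cm assms(2)] by (simp add: c)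
qed

lemma positive_measure_add:
 "pos_measure X u ==> pos_measure X w ==> pos_measure X (%A. u A + w A)"
 unfolding pos_measure_def by (auto intro: cm_add nonneg_Reals_add_I)

lemma positive_measure_scale:
 "pos_measure X u ==> a\<in>\<real>\<^sub>\<ge>\<^sub>0 ==> pos_measure X (%A. a * u A)"
 unfolding pos_measure_def by (auto intro: cm_scale nonneg_Reals_mult_I)

lemma positive_measure_push:
 "pos_measure X u ==> continuous_map X Y g ==> pos_measure Y (push X Y g u)"
 unfolding pos_measure_def by (auto intro: cm_push) (simp add: push_def)

lemma positive_measure_dirac: "pos_measure X (dirac X x)"
 unfolding pos_measure_def by (rule conjI, rule cm_dirac) (simp add: dirac_def)

lemma prob_dirac: "x\<in>pts X ==> dirac X x\<in>M_prob X"
 by (auto simp: M_prob_def intro!: Mb_posI Mb_dirac positive_measure_dirac) (simp add: dirac_def)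

lemma Mb_pos_scale: "u\<in>Mb_pos X ==> a\<in>\<real>\<^sub>\<ge>\<^sub>0 ==> (%A. a * u A)\<in>Mb_pos X"
 by (auto intro: Mb_posI Mb_scale positive_measure_scale pos_Mb Mb_posD)

lemma Mb_pos_add: "u\<in>Mb_pos X ==> w\<in>Mb_pos X ==> (%A. u A + w A)\<in>Mb_pos X"
 by (auto intro: Mb_posI Mb_add positive_measure_add pos_Mb Mb_posD)

lemma Mb_pos_zero: "(%A. 0)\<in>Mb_pos X"
 by (auto simp: Mb_pos_def Mb_zero)

lemma Mb_pos_sum: "(!!i. i\<in>I ==> u i\<in>Mb_pos X) ==> (%A. \<Sum>i\<in>I. u i A)\<in>Mb_pos X"
 by (induction I rule: infinite_finite_induct) (auto intro: Mb_pos_zero Mb_pos_add)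

lemma pos_push: "u\<in>Mb_pos X ==> continuous_map X Y g ==> push X Y g u\<in>Mb_pos Y"
 by (auto intro: Mb_posI Mb_push positive_measure_push pos_Mb Mb_posD)

lemma prob_push: assumes "u\<in>M_prob X" "continuous_map X Y g" shows "push X Y g u\<in>M_prob Y"
proof -
 have "g -` pts Y\<inter>pts X = pts X" using assms(2) by (auto simp: continuous_map_def)
 then show ?thesis using assms by (simp add: M_prob_def pos_push push_apply)
qed

lemma Mb_pos_of_measureI:
 assumes X: "Hausdorff_space X" and M: "finite_measure M" "sets M = bor X"
  and R: "!!A eps. A\<in>bor X ==> 0 < eps ==> \<exists>C. compactin X C\<and>C <= A\<and>measure M (A - C) < eps"
 shows "of_measure X M\<in>Mb_pos X"
proof (rule Mb_posI[OF MbI[OF cm_of_measure[OF M]] positive_of_measure[OF M]])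
 fix A eps assume A: "A\<in>bor X" "(0::real) < eps"
 obtain C where C: "compactin X C" "C <= A" "measure M (A - C) < eps" using R[OF A] by blast
 have "A - C\<in>bor X"
  using A(1) closed_bor[OF compactin_imp_closedin[OF X C(1)]] by (rule bor_Diff)
 then have "tv X (of_measure X M) (A - C) = measure M (A - C)"
  by (subst tv_positive[OF positive_of_measure[OF M]]) (simp_all add: of_measure_def)
 then show "\<exists>C. compactin X C\<and>C <= A\<and>tv X (of_measure X M) (A - C) < eps" using C by auto
qed

text \<open>The upper variation of \<open>w\<close> on a set is at most the total variation of
  \<open>u\<close> there, so a compact set that nearly exhausts \<open>A\<close> for
  \<open>u\<close> also does so for it.\<close>

lemma Mb_pos_upper_variation:
 assumes X: "Hausdorff_space X" and mu: "u\<in>Mb X" and nu: "signed_measure X w" "!!A. A\<in>bor X ==> w A <= cmod (u A)"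
 shows "of_measure X (upper_variation X w)\<in>Mb_pos X"
proof (rule Mb_pos_of_measureI[OF X finite_upper[OF nu(1)] sets_upper_variation])
 fix A eps assume A: "A\<in>bor X" "(0::real) < eps"
 obtain C where C: "compactin X C" "C <= A" "tv X u (A - C) < eps" by (rule MbE[OF mu A])
 have AC: "A - C\<in>bor X"
  using A(1) closed_bor[OF compactin_imp_closedin[OF X C(1)]] by (rule bor_Diff)
 have "upper X w (A - C) <= ennreal (tv X u (A - C))"
 proof (rule SUP_least, clarify)
  fix B assume B: "B\<in>bor X" "B <= A - C"
  have "w B <= cmod (u B)" by (rule nu(2)[OF B(1)])
  also have "\<dots> <= tv X u B" by (rule norm_le_tv[OF Mb_cm[OF mu] B(1)])
  also have "\<dots> <= tv X u (A - C)" by (rule tv_mono[OF Mb_cm[OF mu] B(2)])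
  finally show "ennreal (w B) <= ennreal (tv X u (A - C))" by (rule ennreal_leI)
 qed
 then have "measure (upper_variation X w) (A - C) <= tv X u (A - C)"
  unfolding measure_def emeasure_upper[OF nu(1) AC] by (rule enn2real_leI[rotated]) simp
 then show "\<exists>C. compactin X C\<and>C <= A\<and>measure (upper_variation X w) (A - C) < eps" using C by fastforce
qed

text \<open>The Jordan parts of the real and imaginary parts are again Radon, so every bounded Radon
  measure is a combination of four positive ones.\<close>

lemma Mb_pos_induct:
 assumes X: "Hausdorff_space X" and mu: "u\<in>Mb X"
  and pos: "!!u. u\<in>Mb_pos X ==> Q u"
  and add: "!!u w. u\<in>Mb X ==> w\<in>Mb X ==> Q u ==> Q w ==> Q (%A. u A + w A)"
  and scale: "!!u a. u\<in>Mb X ==> Q u ==> Q (%A. a * u A)"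
 shows "Q u"
proof -
 note cm = Mb_cm[OF mu]
 note sR = sm_Re[OF cm] and sI = sm_Im[OF cm]
 let ?m = "%w. of_measure X (upper_variation X w)"
 have p: "?m (%A. Re (u A))\<in>Mb_pos X" "?m (%A. - Re (u A))\<in>Mb_pos X"
  "?m (%A. Im (u A))\<in>Mb_pos X" "?m (%A. - Im (u A))\<in>Mb_pos X"
  using abs_Re_le_cmod abs_Im_le_cmod
  by (auto intro!: Mb_pos_upper_variation[OF X mu] sR sI sm_minus intro: order_trans[OF abs_ge_self] order_trans[OF abs_ge_minus_self])
 have S: "Q (%A. a * w A)\<and>(%A. a * w A)\<in>Mb X" if "w\<in>Mb_pos X" for a w
  using that by (simp add: scale pos pos_Mb Mb_scale)
 have A: "Q (%A. u A + w A)\<and>(%A. u A + w A)\<in>Mb X" if "Q u\<and>u\<in>Mb X" "Q w\<and>w\<in>Mb X" for u w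
  using that by (simp add: add Mb_add)
 have "u = (%A. (1 * ?m (%A. Re (u A)) A + (- 1) * ?m (%A. - Re (u A)) A) + (\<i> * ?m (%A. Im (u A)) A + (- \<i>) * ?m (%A. - Im (u A)) A))"
  (is "_ = ?R")
 proof
  fix A show "u A = ?R A"
   using Jordan_decomposition[OF sR, of A] Jordan_decomposition[OF sI, of A] cm_outside[OF cm, of A]
   by (cases "A\<in>bor X") (simp_all add: of_measure_def complex_eq_iff)
 qed
 moreover have "Q ?R" using A[OF A[OF S[OF p(1)] S[OF p(2)]] A[OF S[OF p(3)] S[OF p(4)]]] by blast
 ultimately show ?thesis by metis
qed

section \<open>The weak topology\<close>

lemma topspace_weak_topology [simp]: "pts (weak_topology X) = Mb_pos X"
proof -
 have "(%_. 0)\<in>bounded_continuous X" by (simp add: bounded_continuous_def image_constant_conv)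
 then show ?thesis unfolding weak_topology_def topology_generated_by_topspace by (auto intro!: exI[of _ UNIV])
qed

lemma continuous_map_cint:
 assumes "f\<in>bounded_continuous X"
 shows "continuous_map (weak_topology X) euclidean (cint X f)"
 unfolding continuous_map_def
proof (intro conjI allI impI)
 fix U :: "complex set" assume "openin euclidean U"
 then have U: "open U" by (simp only: open_openin)
 have "openin (weak_topology X) {u\<in>Mb_pos X. cint X f u\<in>U}"
  unfolding weak_topology_def by (rule topology_generated_by_Basis) (use assms U in blast)
 then show "openin (weak_topology X) {u\<in>pts (weak_topology X). cint X f u\<in>U}"
  unfolding topspace_weak_topology .
qed simp

lemma weak_topology_neighborhood:
 assumes "openin (weak_topology X) U" "u\<in>U"
 shows "\<exists>F d. finite F\<and>F <= bounded_continuous X\<and>0 < d \<and>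
  (\<forall>w\<in>Mb_pos X. (\<forall>f\<in>F. cmod (cint X f w - cint X f u) < d) --> w\<in>U)"
proof -
 let ?N = "%F d u U. finite F\<and>F <= bounded_continuous X\<and>0 < d \<and>
  (\<forall>w\<in>Mb_pos X. (\<forall>f\<in>F. cmod (cint X f w - cint X f u) < d) --> w\<in>U)"
 have "generate_topology_on {{u\<in>Mb_pos X. cint X f u\<in>U} | f U. f\<in>bounded_continuous X\<and>open U} U"
  using assms(1) by (simp add: weak_topology_def openin_topology_generated_by_iff)
 then have "\<forall>u\<in>U. \<exists>F d. ?N F d u U"
 proof induction
  case (Int a b)
  show ?case
  proof
   fix u assume "u\<in>a\<inter>b"
   then obtain F d F' d' where "?N F d u a" "?N F' d' u b" using Int.IH by auto metis
   then have "?N (F\<union>F') (min d d') u (a\<inter>b)" by auto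
   then show "\<exists>F d. ?N F d u (a\<inter>b)" by metis
  qed
 next
  case (UN K)
  show ?case
  proof
   fix u assume "u\<in>\<Union>K"
   then obtain k where k: "k\<in>K" "u\<in>k" by blast
   then obtain F d where "?N F d u k" using UN.IH by meson
   then have "?N F d u (\<Union>K)" using k by auto
   then show "\<exists>F d. ?N F d u (\<Union>K)" by metis
  qed
 next
  case (Basis s)
  then obtain f V where s: "s = {u\<in>Mb_pos X. cint X f u\<in>V}" "f\<in>bounded_continuous X" "open V" by blast
  show ?case
  proof
   fix u assume "u\<in>s"
   then obtain d where d: "0 < d" "!!z. dist z (cint X f u) < d ==> z\<in>V"
    using s open_dist[of V] by auto
   have "?N {f} d u s" using d s by (auto simp: dist_norm)
   then show "\<exists>F d. ?N F d u s" by metis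
  qed
 qed auto
 then show ?thesis using assms(2) by metis
qed

text \<open>Riemann sums: a partition adapted to the finitely many test functions is chosen, and
  each cell is replaced by its measure placed at a representative point.\<close>

lemma dirac_combination_dense:
 fixes X :: "'a topology"
 assumes U: "openin (weak_topology X) U" "u\<in>U"
 obtains P :: "'a set set" and s c where "finite P" "!!i. i\<in>P ==> s i\<in>pts X" "!!i. i\<in>P ==> c i\<in>\<real>\<^sub>\<ge>\<^sub>0"
  "(%A. \<Sum>i\<in>P. c i * dirac X (s i) A)\<in>U"
proof -
 obtain F d where F: "finite F" "F <= bounded_continuous X" "0 < d"
  and N: "!!w. w\<in>Mb_pos X ==> (!!f. f\<in>F ==> cmod (cint X f w - cint X f u) < d) ==> w\<in>U"
  using weak_topology_neighborhood[OF U] by meson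
 have mu: "u\<in>Mb_pos X" using U openin_subset[OF U(1)] by auto
 note pm = Mb_posD[OF mu]
 note cm = pos_measureD(1)[OF pm]
 let ?k = "crude X u (pts X)"
 define eps where "eps = d / (?k + 1)"
 have k: "0 <= ?k" by (rule crude_nonneg)
 then have eps: "0 < eps" using F(3) by (simp add: eps_def)
 have Fb: "F <= bmf X" using F(2) bc_bmf by blast
 obtain P s where P: "!!f. f\<in>F ==> step_approx X f eps P (%B. B) (%B. f (s B))" "!!B. B\<in>P ==> s B\<in>B"
   and fin: "finite P" "P <= bor X"
 proof -
  \<comment> \<open>The zero function is added so that a partition is obtained even if
    \<open>F\<close> is empty.\<close>
  have ins: "finite (insert (%_. 0) F)" "insert (%_. 0) F <= bmf X" using F Fb by auto
  obtain P s where *: "!!f. f\<in>insert (%_. 0) F ==> step_approx X f eps P (%B. B) (%B. f (s B))" "!!B. B\<in>P ==> s B\<in>B"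
   by (rule step_approx_exists[OF ins eps]) (rule that)
  have "step_approx X (%_. 0) eps P (%B. B) (%B. 0)" using *(1)[of "%_. 0"] by simp
  then show thesis using * by (intro that[of P s]) (auto simp: step_approx_def)
 qed
 have s: "s B\<in>pts X" if "B\<in>P" for B using P(2)[OF that] fin(2) that bor_sub by blast
 let ?w = "%A. \<Sum>B\<in>P. u B * dirac X (s B) A"
 have c: "u B\<in>\<real>\<^sub>\<ge>\<^sub>0" for B using pm by (simp add: pos_measure_def)
 have "?w\<in>U"
 proof (rule N)
  show "?w\<in>Mb_pos X"
   by (rule Mb_pos_sum, rule Mb_pos_scale[OF prob_pos[OF prob_dirac] c]) (rule s)
  fix f assume f: "f\<in>F"
  have fb: "f\<in>bmf X" using f Fb by blast
  have "cint X f ?w = (\<Sum>B\<in>P. cint X f (%A. u B * dirac X (s B) A))"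
   by (rule cint_msum[OF _ fb]) (rule cm_scale[OF cm_dirac])
  also have "\<dots> = (\<Sum>B\<in>P. f (s B) * u B)"
   by (rule sum.cong) (simp_all add: cint_mscale[OF cm_dirac fb] cint_dirac[OF s fb])
  finally have "cmod (cint X f ?w - cint X f u) <= eps * ?k"
   using cint_step_crude[OF cm fb P(1)[OF f]] by (simp add: norm_minus_commute)
  also have "\<dots> < d" using F(3) k by (simp add: eps_def field_simps)
  finally show "cmod (cint X f ?w - cint X f u) < d" .
 qed
 then show thesis using that[of P s u] fin(1) s c by blast
qed

section \<open>Compact Hausdorff spaces\<close>

locale compact_Hausdorff =
 fixes X :: "'a topology"
 assumes compact_space: "compact_space X" and Hausdorff_space: "Hausdorff_space X"

begin

lemma closed_compact: "closedin X C \<longleftrightarrow> compactin X C"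
 using closedin_compact_space[OF compact_space] compactin_imp_closedin[OF Hausdorff_space] by blast

lemma Urysohn:
 assumes "closedin X S" "closedin X T" "S\<inter>T = {}"
 obtains f where "rmap X f" "!!x. x\<in>pts X ==> 0 <= f x\<and>f x <= 1"
  "!!x. x\<in>S ==> f x = 0" "!!x. x\<in>T ==> f x = 1"
proof -
 have n: "normal_space X" using compact_Hausdorff_or_regular_imp_normal_space compact_space Hausdorff_space by blast
 obtain f where f: "continuous_map X (top_of_set {0..1::real}) f" "f ` S <= {0}" "f ` T <= {1}"
  by (rule Urysohn_lemma[OF n assms(1,2), of 0 1]) (use assms(3) in \<open>auto simp: disjnt_def\<close>)
 show thesis
  by (rule that[of f]) (use f in \<open>auto simp: continuous_map_in_subtopology\<close>)
qed

lemma bump: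
 assumes "openin X U" "x\<in>U"
 obtains f where "rmap X f" "!!x. x\<in>pts X ==> 0 <= f x\<and>f x <= 1"
  "!!y. y\<in>pts X ==> y\<notin>U ==> f y = 0" "f x = 1"
proof -
 have x: "x\<in>pts X" using assms openin_subset by blast
 show thesis
  by (rule Urysohn[of "pts X - U" "{x}"])
   (use assms x that closedin_Hausdorff_singleton[OF Hausdorff_space x] in auto)
qed

lemma cont_bmf: "cmap X f ==> f\<in>bmf X"
 using compact_bc[OF compact_space] bc_bmf by blast

lemma cont_of_real: "rmap X g ==> cmap X (cplx g)"
 by (rule continuous_map_compose[of X euclideanreal g euclidean complex_of_real, unfolded o_def])
  (simp_all add: continuous_on_of_real continuous_on_id)

lemma bmf_of_real: "rmap X g ==> (cplx g)\<in>bmf X"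
 by (intro cont_bmf cont_of_real)

lemma continuous_bound:
 assumes "cmap X (f :: 'a \<Rightarrow> complex)"
 obtains c where "0 <= c" "!!x. x\<in>pts X ==> cmod (f x) <= c"
 by (rule bmf_bound[OF cont_bmf[OF assms]]) (rule that)

text \<open>Compact sets nearly exhaust \<open>A\<close> and its complement. A Urysohn function that
  is 1 on the first and 0 on the second differs from the indicator of \<open>A\<close> only on a set
  of small variation.\<close>

lemma measure_approx_cint:
 assumes mu: "u\<in>Mb X" and A: "A\<in>bor X" and e: "0 < e"
 obtains g where "rmap X g" "!!x. x\<in>pts X ==> 0 <= g x\<and>g x <= 1"
  "cmod (u A - cint X (cplx g) u) < e"
proof -
 note cm = Mb_cm[OF mu]
 define eps where "eps = e / 2"
 have eps: "0 < eps" using e by (simp add: eps_def)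
 let ?B = "pts X - A"
 have B: "?B\<in>bor X" by (rule bor_Diff[OF bor_top A])
 obtain C where C: "compactin X C" "C <= A" "tv X u (A - C) < eps" by (rule MbE[OF mu A eps])
 obtain D where D: "compactin X D" "D <= ?B" "tv X u (?B - D) < eps" by (rule MbE[OF mu B eps])
 have cl: "closedin X C" "closedin X D" using C D closed_compact by auto
 obtain g where g: "rmap X g" "!!x. x\<in>pts X ==> 0 <= g x\<and>g x <= 1"
  "!!x. x\<in>D ==> g x = 0" "!!x. x\<in>C ==> g x = 1"
  by (rule Urysohn[OF cl(2,1)]) (use C D in blast, rule that)
 let ?S = "(A - C)\<union>(?B - D)"
 have CD: "A - C\<in>bor X" "?B - D\<in>bor X"
  by (rule bor_Diff[OF A closed_bor[OF cl(1)]]) (rule bor_Diff[OF B closed_bor[OF cl(2)]])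
 let ?h = "%x. of_bool (x\<in>A) - complex_of_real (g x)"
 have "cint X ?h u = u A - cint X (cplx g) u"
  using cint_diff[OF cm bmf_indicator[OF A] bmf_of_real[OF g(1)]] cint_indicator[OF cm A] by simp
 then have "cmod (u A - cint X (cplx g) u) = cmod (cint X ?h u)" by simp
 also have "\<dots> <= 1 * tv X u ?S"
 proof (rule cint_norm_on[OF cm])
  show "?h\<in>bmf X" by (rule bmf_diff[OF bmf_indicator[OF A] bmf_of_real[OF g(1)]])
  show "?S\<in>bor X" by (rule bor_Un[OF CD])
  show "cmod (?h x) <= 1" if "x\<in>?S" for x
  proof -
   have x: "x\<in>pts X" using that bor_sub[OF A] by auto
   have "?h x = complex_of_real (of_bool (x\<in>A) - g x)" by simp
   moreover have "\<bar>of_bool (x\<in>A) - g x\<bar> <= 1" using g(2)[OF x] by auto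
   ultimately show ?thesis by (metis norm_of_real)
  qed
  show "?h x = 0" if "x\<in>pts X" "x\<notin>?S" for x using that g(3,4) C D by auto
 qed simp
 also have "\<dots> <= tv X u (A - C) + tv X u (?B - D)" using tv_Un[OF cm CD] by simp
 also have "\<dots> < e" using C(3) D(3) by (simp add: eps_def)
 finally show thesis using that[OF g(1,2)] by blast
qed

lemma Mb_eq_zeroI:
 assumes mu: "u\<in>Mb X" and 0: "!!g. rmap X g ==> cint X (cplx g) u = 0"
 shows "u = (%A. 0)"
proof
 fix A
 show "u A = 0"
 proof (cases "A\<in>bor X")
  case A: True
  have "cmod (u A) <= 0"
  proof (rule field_le_epsilon)
   fix e :: real assume e: "0 < e"
   obtain g where g: "rmap X g" "cmod (u A - cint X (cplx g) u) < e"
    by (rule measure_approx_cint[OF mu A e]) (rule that)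
   then show "cmod (u A) <= 0 + e" using 0[OF g(1)] by simp
  qed
  then show ?thesis by simp
 qed (rule cm_outside[OF Mb_cm[OF mu]])
qed

lemma Mb_eqI:
 assumes "u\<in>Mb X" "w\<in>Mb X" "!!f. cmap X f ==> cint X f u = cint X f w"
 shows "u = w"
proof -
 note cm = Mb_cm[OF assms(1)] Mb_cm[OF assms(2)]
 have "(%A. u A + (-1) * w A) = (%A. 0)"
 proof (rule Mb_eq_zeroI[OF Mb_add[OF assms(1) Mb_scale[OF assms(2)]]])
  fix g assume g: "rmap X g"
  show "cint X (cplx g) (%A. u A + (-1) * w A) = 0"
   using cint_madd[OF cm(1) cm_scale[OF cm(2)] bmf_of_real[OF g], of "-1"]
    cint_mscale[OF cm(2) bmf_of_real[OF g], of "-1"] assms(3)[OF cont_of_real[OF g]] by simp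
 qed
 then show ?thesis by (auto simp: fun_eq_iff)
qed

text \<open>Near \<open>x\<close> the function exceeds half its value at \<open>x\<close>, and that
  open neighbourhood has positive measure.\<close>

lemma supp_integral_pos:
 assumes mu: "u\<in>Mb_pos X" and x: "x\<in>supp X u"
  and g: "rmap X g" "!!x. x\<in>pts X ==> 0 <= g x" "0 < g x"
 shows "0 < Re (cint X (cplx g) u)"
proof -
 note pm = Mb_posD[OF mu] and cm = pos_measureD(1)[OF Mb_posD[OF mu]]
 define U where "U = {y\<in>pts X. g y\<in>{g x / 2<..}}"
 have U: "openin X U" unfolding U_def by (rule openin_continuous_map_preimage[OF g(1)]) simp
 have xU: "x\<in>U" using x g(3) by (simp add: U_def supp_def)
 have UB: "U\<in>bor X" by (rule open_bor[OF U])
 have "total_variation X u U ~= 0" using x xU U by (simp add: supp_def)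
 then have "tv X u U ~= 0" using tv_finite[OF cm, of U] by (metis ennreal_0)
 then have pos: "0 < Re (u U)" using tv_positive[OF pm UB] pos_measureD(2)[OF pm, of U] by simp
 let ?h = "%y. complex_of_real (g y) - complex_of_real (g x / 2) * of_bool (y\<in>U)"
 have "(%y. complex_of_real (g y - g x / 2 * of_bool (y\<in>U))) = ?h" by auto
 moreover have hb: "?h\<in>bmf X" by (intro bmf_diff bmf_of_real g bmf_mult bmf_const bmf_indicator UB)
 ultimately have "cint X ?h u\<in>\<real>\<^sub>\<ge>\<^sub>0"
  using cint_nonneg[OF pm, of "%y. g y - g x / 2 * of_bool (y\<in>U)"] g(2) by (auto simp: U_def)
 moreover have "cint X ?h u = cint X (cplx g) u - complex_of_real (g x / 2) * u U"
  using cint_diff[OF cm bmf_of_real[OF g(1)] bmf_mult[OF bmf_const[of "complex_of_real (g x / 2)"] bmf_indicator[OF UB]]]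
   cint_scale[OF cm bmf_indicator[OF UB], of "complex_of_real (g x / 2)"] cint_indicator[OF cm UB] by simp
 ultimately have "g x / 2 * Re (u U) <= Re (cint X (cplx g) u)"
  by (simp add: complex_nonneg_Reals_iff)
 moreover have "0 < g x / 2 * Re (u U)" using pos g(3) by simp
 ultimately show ?thesis by linarith
qed

text \<open>A bump function inside a neighbourhood of \<open>x\<close> has nonzero integral, which
  bounds the variation of that neighbourhood from below.\<close>

lemma suppI:
 assumes mu: "u\<in>Mb X" and x: "x\<in>pts X"
  and *: "!!g. rmap X g ==> (!!x. x\<in>pts X ==> 0 <= g x) ==> 0 < g x ==>
   cint X (cplx g) u ~= 0"
 shows "x\<in>supp X u"
 unfolding supp_def
proof (intro CollectI conjI allI impI x)
 fix U assume U: "openin X U" "x\<in>U"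
 obtain g where g: "rmap X g" "!!x. x\<in>pts X ==> 0 <= g x\<and>g x <= 1"
  "!!y. y\<in>pts X ==> y\<notin>U ==> g y = 0" "g x = 1" by (rule bump[OF U]) (rule that)
 have "cint X (cplx g) u ~= 0" by (rule *[OF g(1)]) (simp_all add: g)
 moreover have "cmod (cint X (cplx g) u) <= 1 * tv X u U"
  by (rule cint_norm_on[OF Mb_cm[OF mu] bmf_of_real[OF g(1)] open_bor[OF U(1)]])
   (use g(2,3) openin_subset[OF U(1)] in auto)
 ultimately show "total_variation X u U ~= 0" by auto
qed

lemma tv_zero_iff: "cmeas X u ==> total_variation X u A = 0 \<longleftrightarrow> tv X u A = 0"
 by (metis enn2real_0 ennreal_0 tv_finite)

text \<open>The null open sets outside the support may be uncountably many. Inner regularity reduces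
  the claim to a compact subset, which finitely many of them cover.\<close>

lemma null_if_disjoint_supp:
 assumes mu: "u\<in>Mb X" and V: "V\<in>bor X" "V\<inter>supp X u = {}"
 shows "u V = 0"
proof -
 note cm = Mb_cm[OF mu]
 have "cmod (u V) <= 0"
 proof (rule le_by_eps[of _ _ 1])
  fix eps :: real assume eps: "0 < eps"
  obtain C where C: "compactin X C" "C <= V" "tv X u (V - C) < eps" by (rule MbE[OF mu V(1) eps])
  have CB: "C\<in>bor X" using C closed_compact closed_bor by blast
  let ?\<U> = "{U. openin X U\<and>total_variation X u U = 0}"
  have "C <= \<Union>?\<U>"
  proof
   fix x assume "x\<in>C"
   then have "x\<in>pts X" "x\<notin>supp X u" using C V bor_sub[OF CB] by auto
   then show "x\<in>\<Union>?\<U>" by (auto simp: supp_def)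
  qed
  then obtain \<F> where F: "finite \<F>" "\<F> <= ?\<U>" "C <= \<Union>\<F>" using C(1) unfolding compactin_def by (metis (lifting) mem_Collect_eq)
  have "tv X u (\<Union>\<F>) = 0\<and>openin X (\<Union>\<F>)" using F(1,2)
  proof (induction \<F>)
   case empty
   have "tv X u {} <= 0" using cm_empty[OF cm] by (intro tv_le sum_nonpos) auto
   then show ?case using tv_nonneg[of X u "{}"] by (auto intro: antisym)
  next
   case (insert U \<F>)
   then have "openin X U" "openin X (\<Union>\<F>)" "tv X u U = 0" "tv X u (\<Union>\<F>) = 0" by auto
   then show ?case using tv_Un[OF cm open_bor open_bor, of U "\<Union>\<F>"] tv_nonneg[of X u "U\<union>\<Union>\<F>"] by auto
  qed
  then have "tv X u C <= 0" using tv_mono[OF cm F(3)] by simp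
  moreover have "tv X u V <= tv X u C + tv X u (V - C)"
   using tv_Un[OF cm CB bor_Diff[OF V(1) CB]] C(2) by (simp add: Un_absorb1)
  ultimately show "cmod (u V) <= 0 + eps * 1" using norm_le_tv[OF cm V(1)] C(3) by linarith
 qed simp
 then show ?thesis by simp
qed

lemma closedin_supp: "closedin X (supp X u)"
proof -
 have "pts X - supp X u = \<Union>{U. openin X U\<and>total_variation X u U = 0}"
  unfolding supp_def by (auto dest: openin_subset)
 then have "openin X (pts X - supp X u)" by auto
 then show ?thesis by (auto simp: closedin_def supp_def)
qed

lemma compactin_supp: "compactin X (supp X u)"
 using closedin_supp closed_compact by blast

lemma supp_nonempty: "u\<in>M_prob X ==> supp X u ~= {}"
 using null_if_disjoint_supp[OF prob_Mb, of u "pts X"] by (auto simp: prob_top)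

lemma supp_subset_closed:
 assumes "u\<in>Mb_pos X" "closedin X F" "u (pts X - F) = 0"
 shows "supp X u <= F"
proof
 fix x assume x: "x\<in>supp X u"
 note pm = Mb_posD[OF assms(1)]
 have o: "openin X (pts X - F)" using assms(2) by (simp add: closedin_def)
 have "tv X u (pts X - F) = 0" using tv_positive[OF pm open_bor[OF o]] assms(3) by simp
 then show "x\<in>F" using x o tv_zero_iff[OF pos_measureD(1)[OF pm]] by (auto simp: supp_def)
qed

end

section \<open>The Riesz representation theorem\<close>

locale riesz_functional = compact_Hausdorff X for X :: "'a topology" +
 fixes \<Lambda> :: "('a \<Rightarrow> real) \<Rightarrow> real"
 assumes L_add: "rmap X f ==> rmap X g ==> \<Lambda> (%x. f x + g x) = \<Lambda> f + \<Lambda> g"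
  and L_scale: "rmap X f ==> \<Lambda> (%x. c * f x) = c * \<Lambda> f"
  and L_pos: "rmap X f ==> (!!x. x\<in>pts X ==> 0 <= f x) ==> 0 <= \<Lambda> f"

begin

abbreviation cont :: "('a \<Rightarrow> real) \<Rightarrow> bool" where
 "cont f \<equiv> rmap X f"

lemma L_mono:
 assumes "cont f" "cont g" "!!x. x\<in>pts X ==> f x <= g x"
 shows "\<Lambda> f <= \<Lambda> g"
proof -
 have "0 <= \<Lambda> (%x. g x + (-1) * f x)"
  by (rule L_pos) (use assms in \<open>auto intro!: continuous_intros\<close>)
 also have "\<dots> = \<Lambda> g + (-1) * \<Lambda> f"
  using assms by (subst L_add) (auto intro!: continuous_intros simp: L_scale[of f "-1", simplified])
 finally show ?thesis by simp
qed

lemma L_const: "\<Lambda> (%x. c) = c * \<Lambda> (%x. 1)"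
 using L_scale[of "%x. 1" c] by simp

lemma L_sum: "(!!i. i\<in>I ==> cont (f i)) ==> \<Lambda> (%x. \<Sum>i\<in>I. f i x) = (\<Sum>i\<in>I. \<Lambda> (f i))"
proof (induction I rule: infinite_finite_induct)
 case (insert i I)
 then show ?case by (simp add: L_add continuous_map_sum)
qed (simp_all add: L_const[of 0])

section \<open>The set function of a positive functional on open sets\<close>

definition adm :: "'a set \<Rightarrow> ('a \<Rightarrow> real) set" where
 "adm U = {f. cont f\<and>(\<forall>x\<in>pts X. 0 <= f x\<and>f x <= 1)\<and>(\<forall>x\<in>pts X - U. f x = 0)}"

lemma adm_mono: "U <= V ==> adm U <= adm V"
 by (auto simp: adm_def)

definition lam :: "'a set \<Rightarrow> ennreal" where
 "lam U = (SUP f\<in>adm U. ennreal (\<Lambda> f))"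

lemma lam_mono: "U <= V ==> lam U <= lam V"
 unfolding lam_def by (rule SUP_subset_mono[OF adm_mono]) auto

lemma lam_upper: "f\<in>adm U ==> ennreal (\<Lambda> f) <= lam U"
 unfolding lam_def by (rule SUP_upper)

lemma zero_adm: "(%_. 0)\<in>adm U"
 by (simp add: adm_def)

lemma lam_le_total: "lam U <= ennreal (\<Lambda> (%_. 1))"
 unfolding lam_def by (rule SUP_least, rule ennreal_leI, rule L_mono) (auto simp: adm_def)

lemma lam_top: "lam (pts X) = ennreal (\<Lambda> (%_. 1))"
 by (rule antisym[OF lam_le_total lam_upper]) (simp add: adm_def)

lemma lam_empty: "lam {} = 0"
proof -
 have "ennreal (\<Lambda> f) <= 0" if "f\<in>adm {}" for f
 proof -
  have "\<Lambda> f <= \<Lambda> (%_. 0)" by (rule L_mono) (use that in \<open>auto simp: adm_def\<close>)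
  then show ?thesis using L_const[of 0] by (simp add: ennreal_neg)
 qed
 then have "lam {} <= 0" unfolding lam_def by (rule SUP_least)
 then show ?thesis by simp
qed

lemma cont_cut: "cont f ==> cont (%x. max (f x - eps) 0)"
 by (intro continuous_intros continuous_map_real_max) auto

lemma adm_cut: "f\<in>adm U ==> 0 < eps ==> (%x. max (f x - eps) 0)\<in>adm U"
 by (auto simp: adm_def cont_cut)

lemma L_cut:
 assumes "cont f"
 shows "\<Lambda> f <= \<Lambda> (%x. max (f x - eps) 0) + eps * \<Lambda> (%_. 1)"
proof -
 have "\<Lambda> f <= \<Lambda> (%x. max (f x - eps) 0 + eps)"
  by (rule L_mono) (use assms cont_cut in \<open>auto intro!: continuous_map_add\<close>)
 also have "\<dots> = \<Lambda> (%x. max (f x - eps) 0) + eps * \<Lambda> (%_. 1)"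
  using assms by (subst L_add) (auto simp: cont_cut L_const[of eps])
 finally show ?thesis .
qed

lemma closedin_superlevel: "cont f ==> closedin X {x\<in>pts X. eps <= f x}"
 using closedin_continuous_map_preimage[of X euclideanreal f "{eps..}"] by simp

lemma total_nonneg: "0 <= \<Lambda> (%_. 1)"
 by (rule L_pos) auto

text \<open>Members of \<open>adm U\<close> vanish off \<open>U\<close>, but their supports need not
  lie in \<open>U\<close>. Cutting off at height \<open>eps\<close> confines the function to the
  compact set where \<open>f\<close> is at least \<open>eps\<close>, at the price of
  \<open>eps\<close> times the total mass.\<close>

lemma lam_leI:
 assumes "!!f eps. f\<in>adm U ==> 0 < eps ==> ennreal (\<Lambda> (%x. max (f x - eps) 0)) <= c"
 shows "lam U <= c"
 unfolding lam_def
proof (rule SUP_least, rule ennreal_le_epsilon)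
 fix f and e :: real assume f: "f\<in>adm U" and e: "0 < e"
 define eps where "eps = e / (\<Lambda> (%_. 1) + 1)"
 have eps: "0 < eps" "eps * \<Lambda> (%_. 1) <= e" using e total_nonneg by (auto simp: eps_def field_simps)
 have cf: "cont f" using f by (simp add: adm_def)
 have "\<Lambda> f <= \<Lambda> (%x. max (f x - eps) 0) + e" using L_cut[OF cf, of eps] eps by linarith
 then have "ennreal (\<Lambda> f) <= ennreal (\<Lambda> (%x. max (f x - eps) 0)) + ennreal e"
  by (rule order_trans[OF ennreal_leI ennreal_plus_le])
 also have "\<dots> <= c + ennreal e" by (rule add_right_mono) (rule assms[OF f eps(1)])
 finally show "ennreal (\<Lambda> f) <= c + ennreal e" .
qed

lemma lam_Un:
 assumes "openin X U" "openin X V"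
 shows "lam (U\<union>V) <= lam U + lam V"
proof (rule lam_leI)
 fix f and eps :: real assume f: "f\<in>adm (U\<union>V)" and eps: "0 < eps"
 have cf: "cont f" using f by (simp add: adm_def)
 let ?f = "%x. max (f x - eps) 0"
 define C where "C = {x\<in>pts X. eps <= f x}"
 have C: "closedin X C" unfolding C_def by (rule closedin_superlevel[OF cf])
 have sub: "C <= U\<union>V"
 proof
  fix x assume "x\<in>C"
  then have "x\<in>pts X" "f x ~= 0" using eps by (auto simp: C_def)
  then show "x\<in>U\<union>V" using f by (auto simp: adm_def)
 qed
 \<comment> \<open>\<open>h\<close> splits the cut function: it vanishes off \<open>U\<close>, and
   it is 1 on the part of the level set \<open>C\<close> that misses \<open>V\<close>, so the factor
   \<open>1 - h\<close> removes what lies outside \<open>V\<close>.\<close>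
 obtain h where h: "cont h" "!!x. x\<in>pts X ==> 0 <= h x\<and>h x <= 1" "!!x. x\<in>pts X - U ==> h x = 0"
  "!!x. x\<in>C - V ==> h x = 1"
  by (rule Urysohn[of "pts X - U" "C - V"]) (use C assms sub closedin_diff in \<open>blast+\<close>)
 have f01: "0 <= ?f x" "?f x <= 1" if "x\<in>pts X" for x using f that eps by (auto simp: adm_def)
 have fC: "?f x = 0" if "x\<in>pts X" "x\<notin>C" for x using that by (auto simp: C_def)
 have 1: "(%x. ?f x * h x)\<in>adm U"
  unfolding adm_def using f01 h cont_cut[OF cf] by (auto intro!: continuous_map_real_mult mult_le_one)
 have 2: "(%x. ?f x * (1 - h x))\<in>adm V"
 proof -
  have "?f x * (1 - h x) = 0" if "x\<in>pts X" "x\<notin>V" for x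
   using fC[OF that(1)] h(4)[of x] that by (cases "x\<in>C") auto
  moreover have "0 <= ?f x * (1 - h x)" "?f x * (1 - h x) <= 1" if "x\<in>pts X" for x
   using f01[OF that] h(2)[OF that] by (auto intro!: mult_le_one)
  ultimately show ?thesis
   unfolding adm_def using h(1) cont_cut[OF cf] by (auto intro!: continuous_map_real_mult continuous_map_diff)
 qed
 have c: "cont (%x. ?f x * h x)" "cont (%x. ?f x * (1 - h x))" using 1 2 by (auto simp: adm_def)
 have "\<Lambda> ?f = \<Lambda> (%x. ?f x * h x + ?f x * (1 - h x))" by (rule arg_cong[of _ _ \<Lambda>]) (auto simp: algebra_simps)
 also have "\<dots> = \<Lambda> (%x. ?f x * h x) + \<Lambda> (%x. ?f x * (1 - h x))" by (rule L_add[OF c])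
 finally have "ennreal (\<Lambda> ?f) <= ennreal (\<Lambda> (%x. ?f x * h x)) + ennreal (\<Lambda> (%x. ?f x * (1 - h x)))"
  by (simp add: ennreal_plus_le)
 also have "\<dots> <= lam U + lam V" by (intro add_mono lam_upper 1 2)
 finally show "ennreal (\<Lambda> ?f) <= lam U + lam V" .
qed

text \<open>The cut function lives on a compact level set, which finitely many of the
  \<open>U n\<close> cover; finite subadditivity then suffices.\<close>

lemma lam_UN:
 assumes "!!n::nat. openin X (U n)"
 shows "lam (\<Union>n. U n) <= (\<Sum>n. lam (U n))"
proof (rule lam_leI)
 fix f and eps :: real assume f: "f\<in>adm (\<Union>n. U n)" and eps: "0 < eps"
 have cf: "cont f" using f by (simp add: adm_def)
 define C where "C = {x\<in>pts X. eps <= f x}"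
 have C: "compactin X C" unfolding C_def using closedin_superlevel[OF cf] closed_compact by blast
 have sub: "C <= (\<Union>n. U n)"
 proof
  fix x assume "x\<in>C"
  then have "x\<in>pts X" "f x ~= 0" using eps by (auto simp: C_def)
  then show "x\<in>(\<Union>n. U n)" using f by (auto simp: adm_def)
 qed
 obtain \<F> where F: "finite \<F>" "\<F> <= range U" "C <= \<Union>\<F>"
  using C sub assms unfolding compactin_def by (metis (no_types, lifting) imageE)
 obtain J where J: "finite J" "\<F> = U ` J" using finite_subset_image[OF F(1,2)] by blast
 obtain N where N: "J <= {..<N}" using J(1) finite_nat_iff_bounded by blast
 have "(%x. max (f x - eps) 0)\<in>adm (\<Union>n<N. U n)"
 proof -
  have "max (f x - eps) 0 = 0" if "x\<in>pts X" "x\<notin>(\<Union>n<N. U n)" for x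
  proof -
   have "x\<notin>C" using that F(3) J N by auto
   then show ?thesis using that by (auto simp: C_def)
  qed
  then show ?thesis using adm_cut[OF f eps] by (auto simp: adm_def)
 qed
 then have "ennreal (\<Lambda> (%x. max (f x - eps) 0)) <= lam (\<Union>n<N. U n)" by (rule lam_upper)
 also have "\<dots> <= (\<Sum>n<N. lam (U n))"
 proof (induction N)
  case (Suc N)
  have "lam ((\<Union>n<N. U n)\<union>U N) <= lam (\<Union>n<N. U n) + lam (U N)" by (rule lam_Un) (auto simp: assms)
  also have "\<dots> <= (\<Sum>n<N. lam (U n)) + lam (U N)" using Suc by (rule add_right_mono)
  finally show ?case by (simp add: lessThan_Suc Un_commute add.commute)
 qed (simp add: lam_empty)
 also have "\<dots> <= (\<Sum>n. lam (U n))" by (rule sum_le_suminf) auto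
 finally show "ennreal (\<Lambda> (%x. max (f x - eps) 0)) <= (\<Sum>n. lam (U n))" .
qed

section \<open>Outer measure and Caratheodory extension\<close>

definition outer :: "'a set \<Rightarrow> ennreal" where
 "outer A = (INF U\<in>{U. openin X U\<and>A <= U}. lam U)"

lemma outer_le: "openin X U ==> A <= U ==> outer A <= lam U"
 unfolding outer_def by (rule INF_lower) simp

lemma outer_open: "openin X U ==> outer U = lam U"
 by (rule antisym[OF outer_le]) (auto simp: outer_def intro!: INF_greatest lam_mono)

lemma outer_mono: "A <= B ==> outer A <= outer B"
 unfolding outer_def by (rule INF_superset_mono) auto

lemma outer_finite: "A <= pts X ==> outer A < \<infinity>"
 using outer_le[of "pts X" A] lam_top by (simp add: le_less_trans)

lemma outer_approx:
 assumes "A <= pts X" "0 < (e::real)"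
 obtains U where "openin X U" "A <= U" "lam U <= outer A + ennreal e"
proof -
 have "\<exists>U\<in>{U. openin X U\<and>A <= U}. lam U < outer A + ennreal e"
  by (rule INF_approx_ennreal[OF assms(2) outer_def]) (use outer_finite[OF assms(1)] in auto)
 then show thesis using that by (auto intro: less_imp_le)
qed

lemma outer_measure_space: "outer_measure_space (Pow (pts X)) outer"
 unfolding outer_measure_space_def
proof (intro conjI)
 show "positive (Pow (pts X)) outer" by (simp add: positive_def outer_open lam_empty)
 show "increasing (Pow (pts X)) outer" by (auto simp: increasing_def intro: outer_mono)
 show "countably_subadditive (Pow (pts X)) outer"
  unfolding countably_subadditive_def
 proof (intro allI impI)
  fix A :: "nat \<Rightarrow> 'a set" assume A: "range A <= Pow (pts X)"
  show "outer (\<Union>n. A n) <= (\<Sum>n. outer (A n))"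
  proof (rule ennreal_le_epsilon)
   fix e :: real assume e: "0 < e"
   have "\<exists>U. openin X U\<and>A n <= U\<and>lam U <= outer (A n) + ennreal (e * (1/2) ^ Suc n)" for n
    by (rule outer_approx[of "A n" "e * (1/2) ^ Suc n"]) (use A e in auto)
   then obtain U where U: "!!n. openin X (U n)" "!!n. A n <= U n" "!!n. lam (U n) <= outer (A n) + ennreal (e * (1/2) ^ Suc n)"
    by metis
   have "outer (\<Union>n. A n) <= lam (\<Union>n. U n)" by (rule outer_le) (use U in auto)
   also have "\<dots> <= (\<Sum>n. lam (U n))" by (rule lam_UN[OF U(1)])
   also have "\<dots> <= (\<Sum>n. outer (A n) + ennreal (e * (1/2) ^ Suc n))" by (intro suminf_le U) auto
   also have "\<dots> = (\<Sum>n. outer (A n)) + (\<Sum>n. ennreal (e * (1/2) ^ Suc n))" by (rule suminf_add[symmetric]) auto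
   also have "(\<Sum>n. ennreal (e * (1/2) ^ Suc n)) = ennreal e"
   proof (rule suminf_ennreal_eq)
    show "(%n. e * (1/2) ^ Suc n) sums e" using sums_mult[OF power_half_series, of e] by simp
   qed (use e in auto)
   finally show "outer (\<Union>n. A n) <= (\<Sum>n. outer (A n)) + ennreal e" .
  qed
 qed
qed

text \<open>The nontrivial half of Caratheodory's condition for open sets. A function below
  \<open>V \<inter> U\<close> is cut down to live on a compact \<open>C\<close> inside
  \<open>U\<close>; a function below \<open>V - C\<close> can be added to it without exceeding 1, so
  both count towards \<open>lam V\<close>.\<close>

lemma open_measurable:
 assumes U: "openin X U" and A: "A <= pts X"
 shows "outer (U\<inter>A) + outer ((pts X - U)\<inter>A) <= outer A"
 unfolding outer_def[of A]
proof (rule INF_greatest, clarify)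
 fix V assume V: "openin X V" "A <= V"
 have "lam (V\<inter>U) + outer (V - U) <= lam V"
 proof -
  have "ennreal (\<Lambda> f) + outer (V - U) <= lam V" if f: "f\<in>adm (V\<inter>U)" for f
  proof (rule ennreal_le_epsilon)
   fix e :: real assume e: "0 < e"
   define eps where "eps = e / (\<Lambda> (%_. 1) + 1)"
   have eps: "0 < eps" "eps * \<Lambda> (%_. 1) <= e" using e total_nonneg by (auto simp: eps_def field_simps)
   have cf: "cont f" using f by (simp add: adm_def)
   let ?f = "%x. max (f x - eps) 0"
   define C where "C = {x\<in>pts X. eps <= f x}"
   have C: "closedin X C" unfolding C_def by (rule closedin_superlevel[OF cf])
   have fa: "?f\<in>adm (V\<inter>U)" by (rule adm_cut[OF f eps(1)])
   have CU: "C <= U" using f eps by (force simp: C_def adm_def)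
   have "ennreal (\<Lambda> ?f) + ennreal (\<Lambda> g) <= lam V" if g: "g\<in>adm (V - C)" for g
   proof -
    have cg: "cont g" using g by (simp add: adm_def)
    have "(%x. ?f x + g x)\<in>adm V"
    proof -
     have "?f x + g x <= 1" if "x\<in>pts X" for x
      using fa g that by (cases "x\<in>C") (auto simp: adm_def C_def)
     then show ?thesis using fa g cont_cut[OF cf] by (auto simp: adm_def intro!: continuous_map_add)
    qed
    then have "ennreal (\<Lambda> (%x. ?f x + g x)) <= lam V" by (rule lam_upper)
    moreover have "\<Lambda> (%x. ?f x + g x) = \<Lambda> ?f + \<Lambda> g" by (rule L_add[OF cont_cut[OF cf] cg])
    moreover have "0 <= \<Lambda> ?f" "0 <= \<Lambda> g" using L_pos[OF cont_cut[OF cf]] L_pos[OF cg] g by (auto simp: adm_def)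
    ultimately show ?thesis by simp
   qed
   then have "(SUP g\<in>adm (V - C). ennreal (\<Lambda> ?f) + ennreal (\<Lambda> g)) <= lam V" by (rule SUP_least)
   then have *: "ennreal (\<Lambda> ?f) + lam (V - C) <= lam V"
    unfolding lam_def[of "V - C"] using ennreal_SUP_add_right[of "adm (V - C)"] zero_adm by (metis empty_iff)
   have "outer (V - U) <= lam (V - C)" by (rule outer_le) (use V C CU in auto)
   have "\<Lambda> f <= \<Lambda> ?f + e" using L_cut[OF cf, of eps] eps by linarith
   then have "ennreal (\<Lambda> f) <= ennreal (\<Lambda> ?f) + ennreal e"
    by (rule order_trans[OF ennreal_leI ennreal_plus_le])
   then have "ennreal (\<Lambda> f) + outer (V - U) <= (ennreal (\<Lambda> ?f) + ennreal e) + lam (V - C)"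
    using \<open>outer (V - U) <= lam (V - C)\<close> by (rule add_mono)
   also have "\<dots> = (ennreal (\<Lambda> ?f) + lam (V - C)) + ennreal e" by (simp add: ac_simps)
   also have "\<dots> <= lam V + ennreal e" using * by (rule add_right_mono)
   finally show "ennreal (\<Lambda> f) + outer (V - U) <= lam V + ennreal e" .
  qed
  then have "(SUP f\<in>adm (V\<inter>U). ennreal (\<Lambda> f) + outer (V - U)) <= lam V" by (rule SUP_least)
  then show ?thesis
   unfolding lam_def[of "V\<inter>U"] using ennreal_SUP_add_left[of "adm (V\<inter>U)"] zero_adm by (metis empty_iff)
 qed
 moreover have "outer (U\<inter>A) <= lam (V\<inter>U)" by (rule outer_le) (use U V in auto)
 moreover have "outer ((pts X - U)\<inter>A) <= outer (V - U)" by (rule outer_mono) (use V in auto)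
 ultimately show "outer (U\<inter>A) + outer ((pts X - U)\<inter>A) <= lam V"
  by (meson add_mono order_trans)
qed

definition M :: "'a measure" where
 "M = measure_of (pts X) (bor X) outer"

lemma measure_space_outer: "measure_space (pts X) (bor X) outer"
proof -
 interpret P: sigma_algebra "pts X" "Pow (pts X)" by (rule sigma_algebra_Pow)
 let ?L = "lambda_system (pts X) (Pow (pts X)) outer"
 have ms: "measure_space (pts X) ?L outer" by (rule P.caratheodory_lemma[OF outer_measure_space])
 have "{U. openin X U} <= ?L"
 proof clarify
  fix U assume U: "openin X U"
  have "outer (U\<inter>A) + outer ((pts X - U)\<inter>A) = outer A" if A: "A <= pts X" for A
  proof (rule antisym[OF open_measurable[OF U A]])
   have "subadditive (Pow (pts X)) outer"
    using P.countably_subadditive_subadditive outer_measure_space unfolding outer_measure_space_def by blast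
   then have "outer ((U\<inter>A)\<union>((pts X - U)\<inter>A)) <= outer (U\<inter>A) + outer ((pts X - U)\<inter>A)"
    using A by (intro subadditiveD) auto
   moreover have "(U\<inter>A)\<union>((pts X - U)\<inter>A) = A" using A by auto
   ultimately show "outer A <= outer (U\<inter>A) + outer ((pts X - U)\<inter>A)" by simp
  qed
  then show "U\<in>?L" using openin_subset[OF U] by (auto simp: lambda_system_def)
 qed
 then have "bor X <= ?L"
  unfolding borel_sets_def using ms by (intro sigma_algebra.sigma_sets_subset) (auto simp: measure_space_def)
 then show ?thesis by (rule measure_down[OF ms sigma_algebra_borel_sets])
qed

lemma sets_M [simp]: "sets M = bor X" and space_M [simp]: "space M = pts X"
 using sigma_algebra.sets_measure_of_eq[OF sigma_algebra_borel_sets] sigma_algebra.space_measure_of_eq[OF sigma_algebra_borel_sets]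
 by (simp_all add: M_def)

lemma emeasure_M: "A\<in>bor X ==> emeasure M A = outer A"
 using measure_space_outer emeasure_measure_of_sigma[of "pts X" "bor X" outer A]
 by (simp add: M_def measure_space_def)

lemma finite_measure_M: "finite_measure M"
 by (rule finite_measureI) (use outer_finite[of "pts X"] in \<open>simp add: emeasure_M\<close>)

lemma measure_M_open: "openin X U ==> f\<in>adm U ==> \<Lambda> f <= measure M U"
 using lam_upper[of f U] finite_measure.emeasure_eq_measure[OF finite_measure_M, of U]
 by (simp add: emeasure_M[OF open_bor] outer_open)

lemma measure_M_top: "measure M (pts X) = \<Lambda> (%_. 1)"
 by (simp add: measure_def emeasure_M outer_open lam_top total_nonneg)

text \<open>Outer regularity, built into \<open>outer\<close>, is applied to the complement of
  \<open>A\<close>; in a compact space the complement of the approximating open set is the required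
  compact subset.\<close>

lemma M_Radon: "of_measure X M\<in>Mb_pos X"
proof (rule Mb_pos_of_measureI[OF Hausdorff_space finite_measure_M sets_M])
 fix A eps assume A: "A\<in>bor X" "(0::real) < eps"
 interpret finite_measure M by (rule finite_measure_M)
 let ?B = "pts X - A"
 have B: "?B\<in>bor X" by (rule bor_Diff[OF bor_top A(1)])
 obtain U where U: "openin X U" "?B <= U" "lam U <= outer ?B + ennreal (eps / 2)"
  by (rule outer_approx[of ?B "eps/2"]) (use A in auto)
 have UB: "U\<in>bor X" by (rule open_bor[OF U(1)])
 have "ennreal (measure M U) <= ennreal (measure M ?B + eps / 2)"
  using U(3) A(2) by (simp add: outer_open[OF U(1), symmetric] emeasure_M[symmetric, OF UB] emeasure_M[symmetric, OF B] emeasure_eq_measure)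
 then have "measure M U <= measure M ?B + eps / 2" using A(2) by (subst (asm) ennreal_le_iff) auto
 moreover have "measure M (U - ?B) = measure M U - measure M ?B"
  by (rule finite_measure_Diff) (use UB B U(2) in auto)
 moreover have "A - (pts X - U) = U - ?B" using openin_subset[OF U(1)] bor_sub[OF A(1)] by auto
 ultimately have "measure M (A - (pts X - U)) < eps" using A(2) by simp
 moreover have "compactin X (pts X - U)" using U(1) closed_compact by blast
 ultimately show "\<exists>C. compactin X C\<and>C <= A\<and>measure M (A - C) < eps" using U(2) by (intro exI[of _ "pts X - U"]) auto
qed

section \<open>Comparison of the functional with the integral\<close>

lemma clip_sum:
 fixes t d :: real
 assumes "0 <= t" "0 <= d"
 shows "(\<Sum>i<m. min (max (t - real i * d) 0) d) = min t (real m * d)"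
proof (induction m)
 case (Suc m)
 then show ?case using assms by (simp add: distrib_right min_def max_def)
qed (use assms in simp)

lemma step_sum:
 fixes t d :: real
 assumes "0 <= t" "0 <= d"
 shows "(\<Sum>i<m. d * of_bool (real i * d < t)) <= min (t + d) (real m * d)"
proof (induction m)
 case (Suc m)
 then show ?case using assms by (auto simp: distrib_right min_def split: if_splits)
qed (use assms in simp)

text \<open>\<open>f\<close> is cut into horizontal slices of height \<open>d\<close>. The slice
  above level \<open>i * d\<close> is at most \<open>d\<close> on the open set where
  \<open>f\<close> exceeds that level and 0 elsewhere, so its functional is at most \<open>d\<close>
  times the measure of that set. The resulting step function exceeds \<open>f\<close> by at most
  \<open>d\<close>.\<close>

lemma L_le_integral:
 assumes f: "cont f" "!!x. x\<in>pts X ==> 0 <= f x\<and>f x <= 1"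
 shows "\<Lambda> f <= (LINT x|M. f x)"
proof (rule le_by_eps[of _ _ "measure M (pts X)"])
 interpret finite_measure M by (rule finite_measure_M)
 fix e :: real assume e: "0 < e" "e < 1"
 obtain n where n: "0 < n" "1 / real n < e" using e(1) by (metis nat_approx_posE zero_less_Suc)
 define d where "d = 1 / real n"
 have d: "0 < d" "real n * d = 1" using n by (auto simp: d_def)
 define g where "g i x = min (max (f x - real i * d) 0) d" for i x
 define U where "U i = {x\<in>pts X. f x\<in>{real i * d<..}}" for i
 have U: "openin X (U i)" for i unfolding U_def by (rule openin_continuous_map_preimage[OF f(1)]) simp
 have cg: "cont (g i)" for i unfolding g_def by (intro continuous_map_real_min cont_cut f) auto
 have "\<Lambda> (g i) <= d * measure M (U i)" for i
 proof -
  have "cont (%x. (1 / d) * g i x)" by (intro continuous_intros cg)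
  moreover have "0 <= (1 / d) * g i x" "(1 / d) * g i x <= 1" for x
   using d(1) by (auto simp: g_def field_simps)
  moreover have "(1 / d) * g i x = 0" if "x\<in>pts X - U i" for x
   using d(1) that by (auto simp: g_def U_def)
  ultimately have "(%x. (1 / d) * g i x)\<in>adm (U i)" unfolding adm_def by blast
  then have "\<Lambda> (%x. (1 / d) * g i x) <= measure M (U i)" by (rule measure_M_open[OF U])
  then show ?thesis using d(1) by (simp only: L_scale[OF cg]) (simp add: field_simps)
 qed
 note gi = this
 have "\<Lambda> f = \<Lambda> (%x. \<Sum>i<n. g i x)"
 proof (rule antisym; rule L_mono)
  have "f x = (\<Sum>i<n. g i x)" if "x\<in>pts X" for x
   using clip_sum[of "f x" d n] f(2)[OF that] d by (simp add: g_def)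
  then show "f x <= (\<Sum>i<n. g i x)" "(\<Sum>i<n. g i x) <= f x" if "x\<in>pts X" for x using that by auto
 qed (use f cg in \<open>auto intro!: continuous_map_sum\<close>)
 also have "\<dots> = (\<Sum>i<n. \<Lambda> (g i))" by (rule L_sum[OF cg])
 also have "\<dots> <= (\<Sum>i<n. d * measure M (U i))" by (intro sum_mono gi)
 also have "\<dots> = (LINT x|M. (\<Sum>i<n. d * indicator (U i) x))"
  using open_bor[OF U] by (subst Bochner_Integration.integral_sum) (auto simp: emeasure_eq_measure Int_absorb2[OF openin_subset[OF U]])
 also have "\<dots> <= (LINT x|M. f x + d)"
 proof (rule integral_mono)
  show "integrable M (%x. \<Sum>i<n. d * indicator (U i) x)"
   using open_bor[OF U]
   by (intro Bochner_Integration.integrable_sum integrable_mult_right integrable_real_indicator) (auto simp: emeasure_eq_measure)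
  have "integrable M f"
   by (rule integrable_const_bound[of _ 1]) (use f cont_measurable[OF f(1)] in \<open>auto simp: measurable_cong_sets[OF sets_M[folded sets_borel_space] refl]\<close>)
  then show "integrable M (%x. f x + d)" by simp
  fix x assume "x\<in>space M"
  then have x: "x\<in>pts X" by simp
  have "(\<Sum>i<n. d * indicator (U i) x) = (\<Sum>i<n. d * of_bool (real i * d < f x))"
   using x by (intro sum.cong) (auto simp: U_def indicator_def)
  also have "\<dots> <= f x + d" using step_sum[of "f x" d n] f(2)[OF x] d(1) by simp
  finally show "(\<Sum>i<n. d * indicator (U i) x) <= f x + d" .
 qed
 also have "\<dots> = (LINT x|M. f x) + d * measure M (pts X)"
 proof -
  have "integrable M f"
   by (rule integrable_const_bound[of _ 1]) (use f cont_measurable[OF f(1)] in \<open>auto simp: measurable_cong_sets[OF sets_M[folded sets_borel_space] refl]\<close>)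
  then show ?thesis by simp
 qed
 also have "\<dots> <= (LINT x|M. f x) + e * measure M (pts X)"
  using n(2) by (intro add_left_mono mult_right_mono) (auto simp: d_def)
 finally show "\<Lambda> f <= (LINT x|M. f x) + e * measure M (pts X)" .
qed simp

lemma integrable_cont: assumes "cont f" shows "integrable M f"
proof -
 have "integrable M (cplx f)" by (rule integrable_bmf[OF finite_measure_M sets_M bmf_of_real[OF assms]])
 then show ?thesis using integrable_Re by fastforce
qed

text \<open>The one-sided estimate is applied to \<open>f\<close> and to \<open>1 - f\<close>, whose
  values add up to the total mass on both sides.\<close>

lemma L_eq_integral_unit:
 assumes f: "cont f" "!!x. x\<in>pts X ==> 0 <= f x\<and>f x <= 1"
 shows "\<Lambda> f = (LINT x|M. f x)"
proof -
 interpret finite_measure M by (rule finite_measure_M)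
 have c: "cont (%x. 1 + (-1) * f x)" using f(1) by (intro continuous_intros) auto
 have "\<Lambda> (%x. 1 + (-1) * f x) <= (LINT x|M. 1 + (-1) * f x)"
  by (rule L_le_integral[OF c]) (use f in auto)
 moreover have "\<Lambda> (%x. 1 + (-1) * f x) = \<Lambda> (%_. 1) + (-1) * \<Lambda> f"
  using f(1) by (subst L_add) (auto intro!: continuous_intros simp: L_scale[OF f(1), of "-1", simplified])
 moreover have "(LINT x|M. 1 + (-1) * f x) = measure M (pts X) - (LINT x|M. f x)"
  using integrable_cont[OF f(1)] by simp
 ultimately show ?thesis using L_le_integral[OF f] measure_M_top by linarith
qed

theorem Riesz_representation:
 "\<exists>u\<in>Mb_pos X. \<forall>f. cont f --> cint X (cplx f) u = complex_of_real (\<Lambda> f)"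
proof (intro bexI[OF _ M_Radon] allI impI)
 interpret finite_measure M by (rule finite_measure_M)
 fix f assume f: "cont f"
 obtain c where c: "0 <= c" "!!x. x\<in>pts X ==> cmod (complex_of_real (f x)) <= c"
  by (rule continuous_bound[OF cont_of_real[OF f]]) (rule that)
 define d where "d = c + 1"
 have d: "0 < d" "!!x. x\<in>pts X ==> \<bar>f x\<bar> <= d" using c by (force simp: d_def)+
 define g where "g x = 1/2 + (1 / (2 * d)) * f x" for x
 have cg: "cont g" unfolding g_def using f by (intro continuous_intros) auto
 have fg: "f = (%x. - d + 2 * d * g x)" using d(1) by (auto simp: g_def field_simps)
 have "\<Lambda> g = (LINT x|M. g x)"
 proof (rule L_eq_integral_unit[OF cg])
  fix x assume "x\<in>pts X"
  then show "0 <= g x\<and>g x <= 1" using d(2)[of x] d(1) by (auto simp: g_def field_simps abs_le_iff)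
 qed
 moreover have "\<Lambda> f = - d * \<Lambda> (%_. 1) + 2 * d * \<Lambda> g"
  by (subst fg, subst L_add) (use cg in \<open>auto intro!: continuous_intros simp: L_const[of "-d"] L_scale[OF cg, of "2*d"]\<close>)
 moreover have "(LINT x|M. f x) = - d * measure M (pts X) + 2 * d * (LINT x|M. g x)"
  by (subst fg) (use integrable_cont[OF cg] in simp)
 ultimately have "\<Lambda> f = (LINT x|M. f x)" using measure_M_top by simp
 then show "cint X (cplx f) (of_measure X M) = complex_of_real (\<Lambda> f)"
  by (simp add: cint_of_measure[OF finite_measure_M sets_M bmf_of_real[OF f]])
qed

end

context compact_Hausdorff

begin

lemma Riesz_complex:
 assumes add: "!!f g. cmap X f ==> cmap X g ==> L (%x. f x + g x) = L f + L g"
  and scale: "!!f c. cmap X f ==> L (%x. c * f x) = c * L f"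
  and pos: "!!g. rmap X g ==> (!!x. x\<in>pts X ==> 0 <= g x) ==> L (cplx g)\<in>\<real>\<^sub>\<ge>\<^sub>0"
 shows "\<exists>u\<in>Mb_pos X. \<forall>f. cmap X f --> cint X f u = (L f :: complex)"
proof -
 interpret R: riesz_functional X "%g. Re (L (cplx g))"
 proof
  fix f g :: "'a \<Rightarrow> real" and c assume f: "rmap X f"
  show "Re (L (%x. complex_of_real (f x + g x))) = Re (L (cplx f)) + Re (L (cplx g))"
   if "rmap X g" using add[OF cont_of_real[OF f] cont_of_real[OF that]] by simp
  show "Re (L (%x. complex_of_real (c * f x))) = c * Re (L (cplx f))"
   using scale[OF cont_of_real[OF f], of "complex_of_real c"] by simp
  show "0 <= Re (L (cplx f))" if "!!x. x\<in>pts X ==> 0 <= f x"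
   using pos[OF f that] by (simp add: complex_nonneg_Reals_iff)
 qed
 obtain u where mu: "u\<in>Mb_pos X"
  and rep: "!!f. rmap X f ==> cint X (cplx f) u = complex_of_real (Re (L (cplx f)))"
  using R.Riesz_representation by blast
 have "cint X f u = L f" if f: "cmap X f" for f
 proof -
  note cmu = Mb_cm[OF pos_Mb[OF mu]]
  \<comment> \<open>Positivity makes \<open>L\<close> real on real functions: both
    \<open>g + c\<close>, for a large constant \<open>c\<close>, and \<open>c\<close> itself are
    nonnegative.\<close>
  have real: "L (cplx g) = complex_of_real (Re (L (cplx g)))"
   if g: "rmap X g" for g
  proof -
   obtain c where c: "0 <= c" "!!x. x\<in>pts X ==> cmod (complex_of_real (g x)) <= c"
    by (rule continuous_bound[OF cont_of_real[OF g]]) (rule that)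
   have "L (%x. complex_of_real (g x + c))\<in>\<real>\<^sub>\<ge>\<^sub>0" "L (%x. complex_of_real c)\<in>\<real>\<^sub>\<ge>\<^sub>0"
   proof -
    have "0 <= g x + c" if "x\<in>pts X" for x using c(2)[OF that] by (simp add: abs_le_iff)
    then show "L (%x. complex_of_real (g x + c))\<in>\<real>\<^sub>\<ge>\<^sub>0" by (intro pos continuous_map_add g) auto
    show "L (%x. complex_of_real c)\<in>\<real>\<^sub>\<ge>\<^sub>0" using c(1) by (intro pos) auto
   qed
   moreover have "L (%x. complex_of_real (g x + c)) = L (cplx g) + L (%x. complex_of_real c)"
    using add[OF cont_of_real[OF g], of "%x. complex_of_real c"] by simp
   ultimately show ?thesis by (simp add: complex_nonneg_Reals_iff complex_eq_iff)
  qed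
  have cR: "rmap X (%x. Re (f x))" "rmap X (%x. Im (f x))"
   using continuous_map_compose[OF f, of euclideanreal Re] continuous_map_compose[OF f, of euclideanreal Im]
   by (simp_all add: o_def continuous_on_Re continuous_on_Im continuous_on_id)
  note c = cont_of_real[OF cR(1)] cont_of_real[OF cR(2)]
  have ci: "cmap X (%x. \<i> * complex_of_real (Im (f x)))"
   using continuous_map_compose[OF c(2), of euclidean "%z. \<i> * z"] by (simp add: o_def continuous_on_mult_left continuous_on_id)
  have "f = (%x. complex_of_real (Re (f x)) + \<i> * complex_of_real (Im (f x)))" by (auto simp: complex_eq_iff)
  moreover have "cint X (%x. complex_of_real (Re (f x)) + \<i> * complex_of_real (Im (f x))) u =
    L (%x. complex_of_real (Re (f x)) + \<i> * complex_of_real (Im (f x)))"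
   by (simp add: cint_add[OF cmu cont_bmf[OF c(1)] cont_bmf[OF ci]] add[OF c(1) ci]
    cint_scale[OF cmu cont_bmf[OF c(2)]] scale[OF c(2)] rep[OF cR(1)] rep[OF cR(2)] real[OF cR(1), symmetric] real[OF cR(2), symmetric])
  ultimately show ?thesis by simp
 qed
 then show ?thesis using mu by blast
qed

end

section \<open>Trigonometric systems\<close>

lemma continuous_map_Re: "cmap X f ==> rmap X (%x. Re (f x))"
 by (rule continuous_map_compose[of X euclidean f euclidean Re, unfolded o_def]) (simp_all add: continuous_on_Re continuous_on_id)

lemma continuous_map_Im: "cmap X f ==> rmap X (%x. Im (f x))"
 by (rule continuous_map_compose[of X euclidean f euclidean Im, unfolded o_def]) (simp_all add: continuous_on_Im continuous_on_id)

lemma cont_cmult: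
 fixes f :: "'a \<Rightarrow> complex"
 shows "cmap X f ==> cmap X g ==> cmap X (%x. f x * g x)"
 by (simp add: continuous_map_atin tendsto_mult)

text \<open>A copy of the product space of complex functions; the library instance of functions as a
 \<^class>\<open>t2_space\<close> is restricted to countable domains.\<close>

datatype 'd point_family = Family (coord: "'d \<Rightarrow> complex")

instantiation point_family :: (type) t2_space

begin

definition open_point_family :: "'a point_family set \<Rightarrow> bool" where
 "open_point_family U \<longleftrightarrow> open (Family -` U)"

instance
proof
 show "open (UNIV :: 'a point_family set)" by (simp add: open_point_family_def)
 show "open (S\<inter>T)" if "open S" "open T" for S T :: "'a point_family set"
  using that by (simp add: open_point_family_def vimage_Int open_Int)
 show "open (\<Union>K)" if "\<forall>S\<in>K. open S" for K :: "'a point_family set set"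
  using that by (auto simp: open_point_family_def vimage_Union)
 fix f g :: "'a point_family" assume "f ~= g"
 then have "coord f ~= coord g" using point_family.expand by blast
 then obtain d where "coord f d ~= coord g d" by blast
 then obtain U V where UV: "open U" "open V" "coord f d\<in>U" "coord g d\<in>V" "U\<inter>V = {}" using hausdorff by meson
 have "open ((%h :: 'a \<Rightarrow> complex. h d) -` U)" "open ((%h :: 'a \<Rightarrow> complex. h d) -` V)"
  using UV by (auto intro!: open_vimage continuous_on_product_coordinates)
 moreover have "Family -` {h. coord h d\<in>W} = (%h :: 'a \<Rightarrow> complex. h d) -` W" for W by auto
 ultimately have "open {h. coord h d\<in>U}" "open {h. coord h d\<in>V}" by (simp_all add: open_point_family_def)
 then show "\<exists>U V. open U\<and>open V\<and>f\<in>U\<and>g\<in>V\<and>U\<inter>V = {}"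
  using UV by (intro exI[of _ "{h. coord h d\<in>U}"] exI[of _ "{h. coord h d\<in>V}"]) auto
qed

end

lemma continuous_on_coord: "continuous_on S (%s. coord s d)"
proof -
 have "open ((%s. coord s d) -` B)" if "open B" for B
 proof -
  have "Family -` ((%s. coord s d) -` B) = (%h. h d) -` B" by auto
  moreover have "open ((%h :: 'a \<Rightarrow> complex. h d) -` B)"
   using that by (auto intro!: open_vimage continuous_on_product_coordinates)
  ultimately show ?thesis by (simp add: open_point_family_def)
 qed
 then have "continuous_on UNIV (%s. coord s d)" by (simp add: continuous_on_open_vimage)
 then show ?thesis by (rule continuous_on_subset) auto
qed

lemma continuous_map_Family: "cmap euclidean Family"
 by (simp add: continuous_on_open_vimage open_point_family_def)

lemma Hausdorff_space_euclidean_t2: "Hausdorff_space (euclidean :: 'a::t2_space topology)"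
 unfolding Hausdorff_space_def disjnt_def by (metis hausdorff open_openin)

lemma convergent_if_nearly_constant:
 fixes g :: "'i \<Rightarrow> complex"
 assumes G: "G ~= bot" and *: "!!eps. 0 < eps ==> \<exists>z. eventually (%i. cmod (g i - z) < eps) G"
 shows "\<exists>l. (g \<longlongrightarrow> l) G"
proof -
 have "cauchy_filter (filtermap g G)"
  unfolding cauchy_filter_metric_filtermap
 proof (intro allI impI)
  fix e :: real assume "0 < e"
  then obtain z where z: "eventually (%i. cmod (g i - z) < e / 2) G" using *[of "e / 2"] by auto
  show "\<exists>P. eventually P G\<and>(\<forall>x y. P x\<and>P y --> dist (g x) (g y) < e)"
   by (intro exI[of _ "%i. cmod (g i - z) < e / 2"] conjI z) (auto simp: dist_norm[symmetric] intro: dist_triangle_half_l)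
 qed
 moreover have "filtermap g G ~= bot" using G by (simp add: filtermap_bot_iff)
 ultimately obtain l where "filtermap g G <= nhds l"
  using complete_UNIV[where 'a=complex, unfolded complete_uniform] by auto
 then show ?thesis by (auto simp: filterlim_def)
qed

text \<open>The functions \<open>e d\<close> play the role of trigonometric monomials, with products
  only required to be finite combinations of them. The instances are the evaluations on the two
  duals and the functions \<open>E\<close> on their union.\<close>

locale trig_system = compact_Hausdorff X for X :: "'a topology" +
 fixes D :: "'d set" and e :: "'d \<Rightarrow> 'a \<Rightarrow> complex"
 assumes e_cont: "d\<in>D ==> cmap X (e d)"
  and e_one: "\<exists>d\<in>D. \<forall>x\<in>pts X. e d x = 1"
  and e_cnj: "d\<in>D ==> \<exists>d'\<in>D. \<forall>x\<in>pts X. e d' x = cnj (e d x)"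
  and e_mult: "d\<in>D ==> d'\<in>D ==>
   \<exists>F a. finite F\<and>F <= D\<and>(\<forall>x\<in>pts X. e d x * e d' x = (\<Sum>k\<in>F. a k * e k x))"
  and e_sep: "x\<in>pts X ==> y\<in>pts X ==> x ~= y ==> \<exists>d\<in>D. e d x ~= e d y"

begin

section \<open>The algebra of trigonometric polynomials\<close>

definition trig :: "('a \<Rightarrow> complex) \<Rightarrow> bool" where
 "trig f \<longleftrightarrow> (\<exists>F a. finite F\<and>F <= D\<and>(\<forall>x\<in>pts X. f x = (\<Sum>k\<in>F. a k * e k x)))"

lemma trig_e: "d\<in>D ==> trig (e d)"
 unfolding trig_def by (intro exI[of _ "{d}"] exI[of _ "%_. 1"]) auto

lemma trig_cong: "trig f ==> (!!x. x\<in>pts X ==> f x = g x) ==> trig g"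
 unfolding trig_def by auto

lemma trig_add: assumes "trig f" "trig g" shows "trig (%x. f x + g x)"
proof -
 obtain F a G b where F: "finite F" "F <= D" "!!x. x\<in>pts X ==> f x = (\<Sum>k\<in>F. a k * e k x)"
  and G: "finite G" "G <= D" "!!x. x\<in>pts X ==> g x = (\<Sum>k\<in>G. b k * e k x)"
  using assms unfolding trig_def by metis
 have "f x + g x = (\<Sum>k\<in>F\<union>G. (of_bool (k\<in>F) * a k + of_bool (k\<in>G) * b k) * e k x)" if "x\<in>pts X" for x
 proof -
  have "(\<Sum>k\<in>F. a k * e k x) = (\<Sum>k\<in>F\<union>G. of_bool (k\<in>F) * a k * e k x)"
   by (rule sum.mono_neutral_cong_left) (use F G in auto)
  moreover have "(\<Sum>k\<in>G. b k * e k x) = (\<Sum>k\<in>F\<union>G. of_bool (k\<in>G) * b k * e k x)"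
   by (rule sum.mono_neutral_cong_left) (use F G in auto)
  ultimately show ?thesis using F(3)[OF that] G(3)[OF that] by (simp add: distrib_right sum.distrib)
 qed
 then show ?thesis unfolding trig_def using F(1,2) G(1,2)
  by (intro exI[of _ "F\<union>G"] exI[of _ "%k. of_bool (k\<in>F) * a k + of_bool (k\<in>G) * b k"]) simp
qed

lemma trig_scale: assumes "trig f" shows "trig (%x. c * f x)"
proof -
 obtain F a where F: "finite F" "F <= D" "!!x. x\<in>pts X ==> f x = (\<Sum>k\<in>F. a k * e k x)"
  using assms unfolding trig_def by metis
 then show ?thesis unfolding trig_def
  by (intro exI[of _ F] exI[of _ "%k. c * a k"]) (simp add: sum_distrib_left mult.assoc)
qed

lemma trig_const: "trig (%_. c)"
proof -
 obtain d where d: "d\<in>D" "!!x. x\<in>pts X ==> e d x = 1" using e_one by blast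
 show ?thesis by (rule trig_cong[OF trig_scale[OF trig_e[OF d(1)], of c]]) (simp add: d)
qed

lemma trig_sum: "(!!i. i\<in>I ==> trig (f i)) ==> trig (%x. \<Sum>i\<in>I. f i x)"
 by (induction I rule: infinite_finite_induct) (auto intro: trig_const trig_add)

lemma trig_mult: assumes "trig f" "trig g" shows "trig (%x. f x * g x)"
proof -
 obtain F a G b where F: "finite F" "F <= D" "!!x. x\<in>pts X ==> f x = (\<Sum>k\<in>F. a k * e k x)"
  and G: "finite G" "G <= D" "!!x. x\<in>pts X ==> g x = (\<Sum>k\<in>G. b k * e k x)"
  using assms unfolding trig_def by metis
 have "trig (%x. \<Sum>k\<in>F. \<Sum>l\<in>G. (a k * b l) * (e k x * e l x))"
 proof (intro trig_sum trig_scale)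
  fix k l assume "k\<in>F" "l\<in>G"
  then show "trig (%x. e k x * e l x)" using e_mult[of k l] F G unfolding trig_def by blast
 qed
 then show ?thesis by (rule trig_cong) (simp add: F(3) G(3) sum_product ac_simps)
qed

lemma trig_cnj: assumes "trig f" shows "trig (%x. cnj (f x))"
proof -
 obtain F a where F: "finite F" "F <= D" "!!x. x\<in>pts X ==> f x = (\<Sum>k\<in>F. a k * e k x)"
  using assms unfolding trig_def by metis
 have "trig (%x. \<Sum>k\<in>F. cnj (a k) * cnj (e k x))"
 proof (intro trig_sum trig_scale)
  fix k assume "k\<in>F"
  then obtain d where "d\<in>D" "!!x. x\<in>pts X ==> e d x = cnj (e k x)" using e_cnj[of k] F by blast
  then show "trig (%x. cnj (e k x))" using trig_cong[OF trig_e[of d]] by simp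
 qed
 then show ?thesis by (rule trig_cong) (simp add: F(3))
qed

lemma trig_Re: "trig f ==> trig (%x. complex_of_real (Re (f x)))"
 by (rule trig_cong[OF trig_scale[OF trig_add[OF _ trig_cnj], of f f "1/2"]]) (auto simp: complex_eq_iff)

lemma trig_Im: "trig f ==> trig (%x. complex_of_real (Im (f x)))"
 by (rule trig_cong[OF trig_Re[OF trig_scale[of f "- \<i>"]]]) auto

lemma trig_continuous: assumes "trig f" shows "cmap X f"
proof -
 obtain F a where F: "finite F" "F <= D" "!!x. x\<in>pts X ==> f x = (\<Sum>k\<in>F. a k * e k x)"
  using assms unfolding trig_def by metis
 have "cmap X (%x. \<Sum>k\<in>F. a k * e k x)"
  using F e_cont by (intro continuous_map_sum cont_cmult) auto
 then show ?thesis by (rule continuous_map_eq) (simp add: F(3))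
qed

text \<open>The approximation theorem for rings of real functions on a compact subset of a
  topological type is applied after transport by \<open>E\<close>, which lists all values
  \<open>e d x\<close>. By compactness \<open>E\<close> is a homeomorphism onto its image, and real
  and imaginary parts of the coordinates separate points.\<close>

lemma Stone_Weierstrass_real:
 assumes f: "rmap X f" and eps: "0 < eps"
 obtains g where "trig (cplx g)" "!!x. x\<in>pts X ==> \<bar>f x - g x\<bar> < eps"
proof -
 define E0 where "E0 x = (%d. if d\<in>D then e d x else 0)" for x
 define E where "E x = Family (E0 x)" for x
 define S where "S = E ` pts X"
 have "continuous_map X (product_topology (%_. euclidean) UNIV) E0"
  unfolding continuous_map_componentwise_UNIV
 proof
  fix d show "cmap X (%x. E0 x d)"
   by (cases "d\<in>D") (simp_all add: E0_def e_cont)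
 qed
 then have "cmap X E0" by (simp add: euclidean_product_topology)
 then have E: "cmap X E"
  using continuous_map_compose[OF _ continuous_map_Family] unfolding E_def o_def by blast
 have inj: "inj_on E (pts X)"
 proof (rule inj_onI, rule ccontr)
  fix x y assume xy: "x\<in>pts X" "y\<in>pts X" "E x = E y" "x ~= y"
  then obtain d where "d\<in>D" "e d x ~= e d y" using e_sep by blast
  moreover have "E0 x d = E0 y d" using xy(3) by (simp add: E_def)
  ultimately show False by (simp add: E0_def)
 qed
 have S: "compact S"
  using image_compactin[of X "pts X" euclidean E] E compact_space by (simp add: S_def compact_space_def)
 have "homeomorphic_map X (top_of_set S) E"
 proof (rule continuous_imp_homeomorphic_map)
  show "Hausdorff_space (top_of_set S)" by (rule Hausdorff_space_subtopology[OF Hausdorff_space_euclidean_t2])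
 qed (use compact_space E inj in \<open>auto simp: S_def continuous_map_in_subtopology\<close>)
 then obtain k where "homeomorphic_maps X (top_of_set S) E k" using homeomorphic_map_maps by blast
 then have k: "continuous_map (top_of_set S) X k" "!!x. x\<in>pts X ==> k (E x) = x" by (auto simp: homeomorphic_maps_def)
 have fk: "continuous_on S (%s. f (k s))"
  using continuous_map_compose[OF k(1) f] by (simp add: o_def)
 define R where "R = {r :: 'd point_family \<Rightarrow> real. continuous_on S r\<and>trig (%x. complex_of_real (r (E x)))}"
 interpret R: function_ring_on R S
 proof
  show "compact S" by (rule S)
  show "f\<in>R ==> continuous_on S f" for f by (simp add: R_def)
  show "f\<in>R ==> g\<in>R ==> (%x. f x + g x)\<in>R" for f g
   by (auto simp: R_def intro!: continuous_intros trig_add)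
  show "f\<in>R ==> g\<in>R ==> (%x. f x * g x)\<in>R" for f g
   by (auto simp: R_def intro!: continuous_intros trig_mult)
  show "(%_. c)\<in>R" for c by (simp add: R_def trig_const)
  fix s t assume st: "s\<in>S" "t\<in>S" "s ~= t"
  then have "coord s ~= coord t" using point_family.expand by blast
  then obtain d where d: "coord s d ~= coord t d" by blast
  have dD: "d\<in>D" using st d by (auto simp: S_def E_def E0_def)
  have "trig (%x. coord (E x) d)" using trig_e[OF dD] by (simp add: E_def E0_def dD)
  then have "(%s. Re (coord s d))\<in>R" "(%s. Im (coord s d))\<in>R"
   using trig_Re[of "%x. coord (E x) d"] trig_Im[of "%x. coord (E x) d"]
   by (auto simp: R_def intro: continuous_on_Re continuous_on_Im continuous_on_coord)
  moreover have "Re (coord s d) ~= Re (coord t d)\<or>Im (coord s d) ~= Im (coord t d)" using d by (simp add: complex_eq_iff)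
  ultimately show "\<exists>f\<in>R. f s ~= f t" by (metis (no_types, lifting))
 qed
 obtain r where r: "r\<in>R" "\<forall>s\<in>S. \<bar>f (k s) - r s\<bar> < eps" using R.Stone_Weierstrass_basic[OF fk eps] by blast
 show thesis
 proof (rule that)
  show "trig (%x. complex_of_real (r (E x)))" using r by (simp add: R_def)
  show "\<bar>f x - r (E x)\<bar> < eps" if "x\<in>pts X" for x using r(2) k(2)[OF that] that by (auto simp: S_def)
 qed
qed

lemma Stone_Weierstrass:
 assumes f: "cmap X f" and eps: "0 < eps"
 obtains p where "trig p" "!!x. x\<in>pts X ==> cmod (f x - p x) < eps"
proof -
 have e2: "0 < eps / 2" using eps by simp
 obtain g where g: "trig (cplx g)" "!!x. x\<in>pts X ==> \<bar>Re (f x) - g x\<bar> < eps / 2"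
  by (rule Stone_Weierstrass_real[OF continuous_map_Re[OF f] e2]) (rule that)
 obtain h where h: "trig (cplx h)" "!!x. x\<in>pts X ==> \<bar>Im (f x) - h x\<bar> < eps / 2"
  by (rule Stone_Weierstrass_real[OF continuous_map_Im[OF f] e2]) (rule that)
 show thesis
 proof (rule that)
  show "trig (%x. complex_of_real (g x) + \<i> * complex_of_real (h x))" by (intro trig_add trig_scale g h)
  fix x assume x: "x\<in>pts X"
  show "cmod (f x - (complex_of_real (g x) + \<i> * complex_of_real (h x))) < eps"
   using g(2)[OF x] h(2)[OF x] cmod_le[of "f x - (complex_of_real (g x) + \<i> * complex_of_real (h x))"] by simp
 qed
qed

lemma bmf_e: "d\<in>D ==> e d\<in>bmf X"
 by (rule cont_bmf[OF e_cont])

lemma bmf_trig: "trig p ==> p\<in>bmf X"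
 by (rule cont_bmf[OF trig_continuous])

lemma cint_trig:
 assumes "cmeas X u" "finite F" "F <= D" "!!x. x\<in>pts X ==> p x = (\<Sum>k\<in>F. a k * e k x)"
 shows "cint X p u = (\<Sum>k\<in>F. a k * cint X (e k) u)"
proof -
 have b: "(%x. a k * e k x)\<in>bmf X" if "k\<in>F" for k using that assms(3) by (intro bmf_mult bmf_const bmf_e) auto
 have "cint X p u = cint X (%x. \<Sum>k\<in>F. a k * e k x) u" by (rule cint_cong[OF assms(4)])
 also have "\<dots> = (\<Sum>k\<in>F. cint X (%x. a k * e k x) u)" by (rule cint_sum[OF assms(1) b])
 also have "\<dots> = (\<Sum>k\<in>F. a k * cint X (e k) u)"
  using assms(3) by (intro sum.cong refl cint_scale[OF assms(1)] bmf_e) auto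
 finally show ?thesis .
qed

lemma cint_approx:
 assumes "cmeas X u" "f\<in>bmf X" "p\<in>bmf X" "0 <= eps" "!!x. x\<in>pts X ==> cmod (f x - p x) <= eps"
 shows "cmod (cint X f u - cint X p u) <= eps * tv X u (pts X)"
 using cint_norm[OF assms(1) bmf_diff[OF assms(2,3)] assms(4)] assms(5) by (simp add: cint_diff[OF assms(1-3)])

theorem transform_unique:
 assumes "u\<in>Mb X" "w\<in>Mb X" "!!d. d\<in>D ==> cint X (e d) u = cint X (e d) w"
 shows "u = w"
proof (rule Mb_eqI[OF assms(1,2)])
 fix f :: "'a \<Rightarrow> complex" assume f: "cmap X f"
 note cm = Mb_cm[OF assms(1)] Mb_cm[OF assms(2)]
 have "cmod (cint X f u - cint X f w) <= 0"
 proof (rule le_by_eps)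
  fix eps :: real assume eps: "0 < eps"
  obtain p where p: "trig p" "!!x. x\<in>pts X ==> cmod (f x - p x) < eps" by (rule Stone_Weierstrass[OF f eps]) (rule that)
  obtain F a where F: "finite F" "F <= D" "!!x. x\<in>pts X ==> p x = (\<Sum>k\<in>F. a k * e k x)"
   using p(1) unfolding trig_def by metis
  have "cint X p u = cint X p w"
   using F(2) assms(3) by (simp add: cint_trig[OF cm(1) F] cint_trig[OF cm(2) F] subset_iff)
  moreover have "cmod (cint X f u - cint X p u) <= eps * tv X u (pts X)"
   by (rule cint_approx[OF cm(1) cont_bmf[OF f] bmf_trig[OF p(1)]]) (use eps p(2) in \<open>auto intro: less_imp_le\<close>)
  moreover have "cmod (cint X f w - cint X p w) <= eps * tv X w (pts X)"
   by (rule cint_approx[OF cm(2) cont_bmf[OF f] bmf_trig[OF p(1)]]) (use eps p(2) in \<open>auto intro: less_imp_le\<close>)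
  ultimately show "cmod (cint X f u - cint X f w) <= 0 + eps * (tv X u (pts X) + tv X w (pts X))"
   using norm_triangle_ineq4[of "cint X f u - cint X p u" "cint X f w - cint X p w"]
   by (simp add: distrib_left)
 qed simp
 then show "cint X f u = cint X f w" by simp
qed

text \<open>Weak compactness stated through transforms. Along the filter of pairs (finite subset of
  \<open>D\<close>, precision) the transforms converge, hence so do the integrals of trigonometric
  polynomials and, all masses being 1, those of all continuous functions. The limit functional is
  represented by the Riesz theorem.\<close>

theorem limit_measure:
 assumes approx: "!!F eps. finite F ==> F <= D ==> 0 < eps ==>
  \<exists>u\<in>M_prob X. \<forall>d\<in>F. cmod (cint X (e d) u - j d) < eps"
 shows "\<exists>u\<in>M_prob X. \<forall>d\<in>D. cint X (e d) u = j d"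
proof -
 \<comment> \<open>Infinite index sets carry no condition, which makes the choice total; the filter
   \<open>G\<close> ignores them.\<close>
 have "\<exists>u. u\<in>M_prob X\<and>(\<forall>d\<in>fst i\<inter>D. finite (fst i) --> cmod (cint X (e d) u - j d) < 1 / real (Suc (snd i)))"
  for i :: "'d set\<times>nat"
 proof (cases "finite (fst i)")
  case True
  then have "\<exists>u\<in>M_prob X. \<forall>d\<in>fst i\<inter>D. cmod (cint X (e d) u - j d) < 1 / real (Suc (snd i))"
   by (intro approx) auto
  then show ?thesis by blast
 next
  case False
  then show ?thesis using approx[of "{}" 1] by auto
 qed
 then obtain m where m: "!!i :: 'd set\<times>nat. m i\<in>M_prob X\<and>(\<forall>d\<in>fst i\<inter>D. finite (fst i) --> cmod (cint X (e d) (m i) - j d) < 1 / real (Suc (snd i)))"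
  by metis
 note mp = m[THEN conjunct1]
 note cm = Mb_cm[OF prob_Mb[OF mp]] and pm = Mb_posD[OF prob_pos[OF mp]]
 define G where "G = finite_subsets_at_top D \<times>\<^sub>F sequentially"
 have G: "G ~= bot" by (simp add: G_def prod_filter_eq_bot)
 have te: "((%i. cint X (e d) (m i)) \<longlongrightarrow> j d) G" if d: "d\<in>D" for d
 proof (rule tendstoI)
  fix eps :: real assume "0 < eps"
  then obtain N where N: "1 / real (Suc N) < eps" by (rule nat_approx_posE)
  have 1: "eventually (%F. finite F\<and>d\<in>F) (finite_subsets_at_top D)"
   using d by (auto simp: eventually_finite_subsets_at_top intro!: exI[of _ "{d}"])
  have "eventually (%i. (finite (fst i)\<and>d\<in>fst i)\<and>N <= snd i) G"
   unfolding G_def by (rule eventually_prodI[OF 1 eventually_ge_at_top])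
  then show "eventually (%i. dist (cint X (e d) (m i)) (j d) < eps) G"
  proof eventually_elim
   case (elim i)
   then have "cmod (cint X (e d) (m i) - j d) < 1 / real (Suc (snd i))" using m[of i] d by blast
   also have "\<dots> <= 1 / real (Suc N)" using elim by (auto intro!: frac_le)
   finally show ?case using N by (simp add: dist_norm)
  qed
 qed
 define L where "L f = Lim G (%i. cint X f (m i))" for f
 have L: "((%i. cint X f (m i)) \<longlongrightarrow> L f) G" if f: "cmap X f" for f
 proof -
  have "\<exists>l. ((%i. cint X f (m i)) \<longlongrightarrow> l) G"
  proof (rule convergent_if_nearly_constant[OF G])
   fix eps :: real assume eps: "0 < eps"
   then have "0 < eps / 2" by simp
   then obtain p where p: "trig p" "!!x. x\<in>pts X ==> cmod (f x - p x) < eps / 2" by (rule Stone_Weierstrass[OF f]) (rule that)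
   obtain F a where F: "finite F" "F <= D" "!!x. x\<in>pts X ==> p x = (\<Sum>k\<in>F. a k * e k x)"
    using p(1) unfolding trig_def by metis
   define z where "z = (\<Sum>k\<in>F. a k * j k)"
   have "((%i. \<Sum>k\<in>F. a k * cint X (e k) (m i)) \<longlongrightarrow> z) G"
    unfolding z_def using F(2) by (intro tendsto_sum tendsto_mult tendsto_const te) auto
   then have "eventually (%i. dist (\<Sum>k\<in>F. a k * cint X (e k) (m i)) z < eps / 2) G"
    using eps by (intro tendstoD) auto
   then have "eventually (%i. cmod (cint X f (m i) - z) < eps) G"
   proof eventually_elim
    case (elim i)
    have "cmod (cint X f (m i) - cint X p (m i)) <= eps / 2 * tv X (m i) (pts X)"
     by (rule cint_approx[OF cm cont_bmf[OF f] bmf_trig[OF p(1)]]) (use eps p(2) in \<open>auto intro: less_imp_le\<close>)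
    also have "tv X (m i) (pts X) = 1" using tv_positive[OF pm bor_top] prob_top[OF mp] by simp
    finally show ?case using elim norm_triangle_ineq[of "cint X f (m i) - cint X p (m i)" "cint X p (m i) - z"]
     by (simp add: cint_trig[OF cm F] dist_norm)
   qed
   then show "\<exists>z. eventually (%i. cmod (cint X f (m i) - z) < eps) G" by blast
  qed
  then show ?thesis unfolding L_def using tendsto_Lim[OF G] by auto
 qed
 have L_eq: "L f = l" if "cmap X f" "((%i. cint X f (m i)) \<longlongrightarrow> l) G" for f l
  using tendsto_unique[OF G L[OF that(1)] that(2)] .
 have L_lin: "L (%x. f x + g x) = L f + L g" if "cmap X f" "cmap X g" for f g
  using that by (intro L_eq) (auto simp: cint_add[OF cm cont_bmf cont_bmf] intro!: continuous_map_add tendsto_add L)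
 have L_sc: "L (%x. c * f x) = c * L f" if "cmap X f" for f c
  using that by (intro L_eq) (auto simp: cint_scale[OF cm cont_bmf] intro!: cont_cmult tendsto_mult L)
 have L_pos: "L (cplx g)\<in>\<real>\<^sub>\<ge>\<^sub>0"
  if g: "rmap X g" "!!x. x\<in>pts X ==> 0 <= g x" for g
  by (rule Lim_in_closed_set[OF closed_nonneg_Reals_complex always_eventually[OF allI[OF cint_nonneg[OF pm bmf_of_real[OF g(1)] g(2)]]] G L[OF cont_of_real[OF g(1)]]])
 obtain u where mu: "u\<in>Mb_pos X" and rep: "!!f. cmap X f ==> cint X f u = L f"
  using Riesz_complex[of L, OF L_lin L_sc L_pos] by blast
 note cmu = Mb_cm[OF pos_Mb[OF mu]]
 have "u (pts X) = L (%_. 1)" using rep[of "%_. 1"] cint_const[OF cmu, of 1] by simp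
 also have "\<dots> = 1" by (rule L_eq) (simp_all add: cint_const[OF cm] prob_top[OF mp])
 finally have "u\<in>M_prob X" using mu by (simp add: M_prob_def)
 moreover have "cint X (e d) u = j d" if "d\<in>D" for d
  using rep[OF e_cont[OF that]] L_eq[OF e_cont[OF that] te[OF that]] by simp
 ultimately show ?thesis by blast
qed

end

section \<open>Convolutions determined by their transforms\<close>

text \<open>Local uniform limits are continuous. The local form is needed on spaces of measures,
  where the approximation error grows with the mass.\<close>

lemma cont_local_approx:
 fixes \<Phi> :: "'a \<Rightarrow> complex"
 assumes *: "!!z eps. z\<in>pts T ==> 0 < eps ==>
  \<exists>W \<Psi>. openin T W\<and>z\<in>W\<and>cmap T \<Psi>\<and>(\<forall>w\<in>W. cmod (\<Phi> w - \<Psi> w) <= eps)"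
 shows "cmap T \<Phi>"
 unfolding continuous_map_def
proof (intro conjI allI impI)
 fix U :: "complex set" assume "openin euclidean U"
 then have U: "open U" by (simp only: open_openin)
 show "openin T {x\<in>pts T. \<Phi> x\<in>U}"
 proof (subst openin_subopen, clarify)
  fix z assume z: "z\<in>pts T" "\<Phi> z\<in>U"
  obtain d where d: "0 < d" "!!w. dist w (\<Phi> z) < d ==> w\<in>U" using U z(2) unfolding open_dist by metis
  obtain W \<Psi> where W: "openin T W" "z\<in>W" "cmap T \<Psi>" "!!w. w\<in>W ==> cmod (\<Phi> w - \<Psi> w) <= d / 4"
   using *[OF z(1), of "d/4"] d(1) by auto
  define V where "V = W\<inter>{w\<in>pts T. \<Psi> w\<in>ball (\<Psi> z) (d / 4)}"
  have "openin T {w\<in>pts T. \<Psi> w\<in>ball (\<Psi> z) (d / 4)}"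
   by (rule openin_continuous_map_preimage[OF W(3)]) (simp add: open_openin[symmetric])
  then have "openin T V" unfolding V_def using W(1) by (rule openin_Int[rotated])
  moreover have "z\<in>V" using W(2) z(1) d(1) by (simp add: V_def)
  moreover have "\<Phi> w\<in>U" if "w\<in>V" for w
  proof (rule d(2))
   have w: "w\<in>W" "dist (\<Psi> z) (\<Psi> w) < d / 4" using that by (auto simp: V_def)
   have "dist (\<Phi> w) (\<Phi> z) <= dist (\<Phi> w) (\<Psi> w) + dist (\<Psi> w) (\<Psi> z) + dist (\<Psi> z) (\<Phi> z)"
    by (metis add.assoc add_left_mono dist_triangle order_trans)
   then show "dist (\<Phi> w) (\<Phi> z) < d" using W(4)[OF w(1)] W(4)[OF W(2)] w(2) d(1)
    by (simp add: dist_norm norm_minus_commute)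
  qed
  ultimately show "\<exists>V. openin T V\<and>z\<in>V\<and>V <= {x\<in>pts T. \<Phi> x\<in>U}"
   using openin_subset by (intro exI[of _ V]) blast
 qed
qed simp

lemma continuous_map_weak_topologyI:
 assumes "!!z. z\<in>pts T ==> F z\<in>Mb_pos X"
  and "!!f. f\<in>bounded_continuous X ==> cmap T (%z. cint X f (F z))"
 shows "continuous_map T (weak_topology X) F"
 unfolding weak_topology_def continuous_on_generated_topo_iff
proof (intro conjI allI impI)
 fix S assume "S\<in>{{u\<in>Mb_pos X. cint X f u\<in>U} | f U. f\<in>bounded_continuous X\<and>open U}"
 then obtain f U where S: "S = {u\<in>Mb_pos X. cint X f u\<in>U}" "f\<in>bounded_continuous X" "open U" by blast
 have "openin T {z\<in>pts T. cint X f (F z)\<in>U}"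
  by (rule openin_continuous_map_preimage[OF assms(2)[OF S(2)]]) (use S(3) in \<open>simp only: open_openin\<close>)
 moreover have "F -` S\<inter>pts T = {z\<in>pts T. cint X f (F z)\<in>U}" using assms(1) by (auto simp: S(1))
 ultimately show "openin T (F -` S\<inter>pts T)" by simp
next
 show "F ` pts T <= \<Union>{{u\<in>Mb_pos X. cint X f u\<in>U} | f U. f\<in>bounded_continuous X\<and>open U}"
  using assms(1) topspace_weak_topology[of X, unfolded weak_topology_def topology_generated_by_topspace] by blast
qed

lemma cint_cnj:
 assumes "pos_measure X u" "f\<in>bmf X"
 shows "cint X (%x. cnj (f x)) u = cnj (cint X f u)"
proof -
 obtain c where c: "!!x. x\<in>pts X ==> cmod (f x) <= c" by (rule bmf_bound[OF assms(2)]) (rule that)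
 have "(%x. cnj (f x))\<in>bmf X"
 proof (rule bmfI)
  show "(%x. cnj (f x))\<in>borel_measurable (borel_space X)"
   using assms(2) by (intro borel_measurable_continuous_on[of cnj]) (auto simp: bmf_def continuous_on_cnj continuous_on_id)
 qed (use c in simp)
 then show ?thesis using assms by (simp add: cint_pmeas integral_cnj)
qed

text \<open>Each generating set combines a meeting condition with an inclusion, and the two are
  separated here. Nonempty values are required because every generating set demands that some open
  set be met.\<close>

lemma continuous_map_MichaelI:
 assumes "!!z. z\<in>pts Z ==> compactin X (F z)\<and>F z ~= {}"
  and hit: "!!U. openin X U ==> openin Z {z\<in>pts Z. F z\<inter>U ~= {}}"
  and sub: "!!V. openin X V ==> openin Z {z\<in>pts Z. F z <= V}"
 shows "continuous_map Z (Michael_topology X) F"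
 unfolding Michael_topology_def continuous_on_generated_topo_iff
proof (intro conjI allI impI)
 fix S assume "S\<in>{{C. compactin X C\<and>C\<inter>U ~= {}\<and>C <= V} | U V. openin X U\<and>openin X V}"
 then obtain U V where S: "S = {C. compactin X C\<and>C\<inter>U ~= {}\<and>C <= V}" "openin X U" "openin X V" by blast
 have "F -` S\<inter>pts Z = {z\<in>pts Z. F z\<inter>U ~= {}}\<inter>{z\<in>pts Z. F z <= V}"
  using assms(1) by (auto simp: S(1))
 then show "openin Z (F -` S\<inter>pts Z)" using hit[OF S(2)] sub[OF S(3)] by auto
next
 show "F ` pts Z <= \<Union>{{C. compactin X C\<and>C\<inter>U ~= {}\<and>C <= V} | U V. openin X U\<and>openin X V}"
 proof clarify
  fix z assume "z\<in>pts Z"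
  then have "F z\<in>{C. compactin X C\<and>C\<inter>pts X ~= {}\<and>C <= pts X}"
   using assms(1) compactin_subset_topspace by blast
  then show "F z\<in>\<Union>{{C. compactin X C\<and>C\<inter>U ~= {}\<and>C <= V} | U V. openin X U\<and>openin X V}"
   by (intro UnionI) auto
 qed
qed

lemma continuous_map_MichaelD:
 assumes "continuous_map Z (Michael_topology X) F"
 shows "z\<in>pts Z ==> compactin X (F z)\<and>F z ~= {}"
  and "openin X U ==> openin Z {z\<in>pts Z. F z\<inter>U ~= {}}"
  and "openin X V ==> openin Z {z\<in>pts Z. F z <= V}"
proof -
 let ?B = "{{C. compactin X C\<and>C\<inter>U ~= {}\<and>C <= V} | U V. openin X U\<and>openin X V}"
 note * = assms[unfolded Michael_topology_def continuous_on_generated_topo_iff]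
 have c: "openin Z (F -` S\<inter>pts Z)" if "S\<in>?B" for S by (rule *[THEN conjunct1, rule_format, OF that])
 have i: "F ` pts Z <= \<Union>?B" by (rule *[THEN conjunct2])
 show 1: "compactin X (F z)\<and>F z ~= {}" if "z\<in>pts Z" for z using i that by auto
 have sub: "F z <= pts X" if "z\<in>pts Z" for z by (rule compactin_subset_topspace[OF 1[OF that, THEN conjunct1]])
 show "openin Z {z\<in>pts Z. F z\<inter>U ~= {}}" if "openin X U"
 proof -
  have "openin Z (F -` {C. compactin X C\<and>C\<inter>U ~= {}\<and>C <= pts X}\<inter>pts Z)" using that by (intro c) blast
  moreover have "F -` {C. compactin X C\<and>C\<inter>U ~= {}\<and>C <= pts X}\<inter>pts Z = {z\<in>pts Z. F z\<inter>U ~= {}}"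
   using 1 sub by auto
  ultimately show ?thesis by simp
 qed
 show "openin Z {z\<in>pts Z. F z <= V}" if "openin X V"
 proof -
  have "openin Z (F -` {C. compactin X C\<and>C\<inter>pts X ~= {}\<and>C <= V}\<inter>pts Z)" using that by (intro c) blast
  moreover have "F -` {C. compactin X C\<and>C\<inter>pts X ~= {}\<and>C <= V}\<inter>pts Z = {z\<in>pts Z. F z <= V}"
  proof -
   have "compactin X (F z)\<and>F z\<inter>pts X ~= {}" if "z\<in>pts Z" for z
    using 1[OF that] sub[OF that] by (simp add: Int_absorb2)
   then show ?thesis by auto
  qed
  ultimately show ?thesis by simp
 qed
qed

text \<open>The convolution is known only by its effect on transforms and by preserving Radon
  measures and positivity; \<open>transform_unique\<close> turns this into all algebraic laws. The
  instances are the two duals and their union.\<close>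

locale trig_conv = trig_system X D e for X :: "'a topology" and D :: "'d set" and e +
 fixes conv :: "'a cmeasure \<Rightarrow> 'a cmeasure \<Rightarrow> 'a cmeasure"
 assumes conv_Mb: "\<mu>\<in>Mb X ==> \<nu>\<in>Mb X ==> conv \<mu> \<nu>\<in>Mb X"
  and conv_tr: "d\<in>D ==> \<mu>\<in>Mb X ==> \<nu>\<in>Mb X ==>
   cint X (e d) (conv \<mu> \<nu>) = cint X (e d) \<mu> * cint X (e d) \<nu>"
  and conv_Mb_pos: "\<mu>\<in>Mb_pos X ==> \<nu>\<in>Mb_pos X ==> conv \<mu> \<nu>\<in>Mb_pos X"

begin

lemma cint_e_add: "d\<in>D ==> u\<in>Mb X ==> w\<in>Mb X ==> cint X (e d) (%A. u A + w A) = cint X (e d) u + cint X (e d) w"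
 by (intro cint_madd Mb_cm bmf_e)

lemma cint_e_scale: "d\<in>D ==> u\<in>Mb X ==> cint X (e d) (%A. a * u A) = a * cint X (e d) u"
 by (intro cint_mscale Mb_cm bmf_e)

lemma cint_e_dirac: "d\<in>D ==> x\<in>pts X ==> cint X (e d) (dirac X x) = e d x"
 by (intro cint_dirac bmf_e)

lemma conv_total: "u\<in>Mb X ==> w\<in>Mb X ==> conv u w (pts X) = u (pts X) * w (pts X)"
proof -
 assume m: "u\<in>Mb X" "w\<in>Mb X"
 obtain d where d: "d\<in>D" "!!x. x\<in>pts X ==> e d x = 1" using e_one by blast
 have "cint X (e d) r = r (pts X)" if "r\<in>Mb X" for r
  using cint_cong[of X "e d" "%_. 1"] cint_const[OF Mb_cm[OF that], of 1] d(2) by simp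
 then show ?thesis using conv_tr[OF d(1) m] m conv_Mb by simp
qed

lemma conv_prob: "u\<in>M_prob X ==> w\<in>M_prob X ==> conv u w\<in>M_prob X"
 using conv_total[OF prob_Mb prob_Mb] conv_Mb_pos by (simp add: M_prob_def)

lemma conv_commute: "u\<in>Mb X ==> w\<in>Mb X ==> conv u w = conv w u"
 by (rule transform_unique) (auto simp: conv_Mb conv_tr)

lemma conv_assoc: "u\<in>Mb X ==> w\<in>Mb X ==> r\<in>Mb X ==> conv (conv u w) r = conv u (conv w r)"
 by (rule transform_unique) (auto simp: conv_Mb conv_tr)

lemma conv_add_left: "u\<in>Mb X ==> u'\<in>Mb X ==> w\<in>Mb X ==> conv (%A. u A + u' A) w = (%A. conv u w A + conv u' w A)"
 by (rule transform_unique) (auto simp: conv_Mb conv_tr Mb_add cint_e_add algebra_simps)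

lemma conv_scale_left: "u\<in>Mb X ==> w\<in>Mb X ==> conv (%A. a * u A) w = (%A. a * conv u w A)"
 by (rule transform_unique) (auto simp: conv_Mb conv_tr Mb_scale cint_e_scale)

lemma conv_add_right: "u\<in>Mb X ==> w\<in>Mb X ==> w'\<in>Mb X ==> conv u (%A. w A + w' A) = (%A. conv u w A + conv u w' A)"
 by (rule transform_unique) (auto simp: conv_Mb conv_tr Mb_add cint_e_add algebra_simps)

lemma conv_scale_right: "u\<in>Mb X ==> w\<in>Mb X ==> conv u (%A. a * w A) = (%A. a * conv u w A)"
 by (rule transform_unique) (auto simp: conv_Mb conv_tr Mb_scale cint_e_scale)

lemma tv_Mb_pos: "u\<in>Mb_pos X ==> tv X u (pts X) = Re (u (pts X))"
 by (rule tv_positive[OF Mb_posD bor_top])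

lemma Mb_pos_cmod: "u\<in>Mb_pos X ==> cmod (u A) = Re (u A)"
 using pos_measureD(2,3)[OF Mb_posD, of u X A] by (simp add: cmod_def)

text \<open>For trigonometric polynomials the integral against a convolution is a polynomial in
  transforms of the factors, hence continuous. For general \<open>f\<close> the error is
  proportional to the mass of the convolution, which is bounded locally.\<close>

lemma conv_weakly_continuous:
 "continuous_map (prod_topology (weak_topology X) (weak_topology X)) (weak_topology X) (%(u, r). conv u r)"
proof (rule continuous_map_weak_topologyI)
 let ?T = "prod_topology (weak_topology X) (weak_topology X)"
 show "(%(u, r). conv u r) z\<in>Mb_pos X" if "z\<in>pts ?T" for z
  using that conv_Mb_pos by auto
 fix f assume "f\<in>bounded_continuous X"
 then have f: "cmap X f" by (simp add: bounded_continuous_def)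
 have c1: "cmap ?T (%z. cint X g (fst z))" if "cmap X g" for g
  using continuous_map_compose[OF continuous_map_fst continuous_map_cint[OF compact_bc[OF compact_space that]]]
  by (simp add: o_def)
 have c2: "cmap ?T (%z. cint X g (snd z))" if "cmap X g" for g
  using continuous_map_compose[OF continuous_map_snd continuous_map_cint[OF compact_bc[OF compact_space that]]]
  by (simp add: o_def)
 show "cmap ?T (%z. cint X f ((%(u, r). conv u r) z))"
 proof (rule cont_local_approx)
  fix z and eps :: real assume z: "z\<in>pts ?T" and eps: "0 < eps"
  \<comment> \<open>The summand 1 leaves room for an open neighbourhood of \<open>z\<close> on which
    the product of the masses stays below \<open>c\<close>.\<close>
  define c where "c = cmod (fst z (pts X) * snd z (pts X)) + 1"
  have c: "0 < c" by (simp add: c_def add_nonneg_pos)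
  then have ec: "0 < eps / c" using eps by simp
  obtain p where p: "trig p" "!!x. x\<in>pts X ==> cmod (f x - p x) < eps / c" by (rule Stone_Weierstrass[OF f ec]) (rule that)
  obtain F a where F: "finite F" "F <= D" "!!x. x\<in>pts X ==> p x = (\<Sum>k\<in>F. a k * e k x)"
   using p(1) unfolding trig_def by metis
  define \<Psi> where "\<Psi> w = (\<Sum>k\<in>F. a k * (cint X (e k) (fst w) * cint X (e k) (snd w)))" for w
  define W where "W = {w\<in>pts ?T. cint X (%_. 1) (fst w) * cint X (%_. 1) (snd w)\<in>ball 0 c}"
  have "openin ?T W" unfolding W_def
   by (rule openin_continuous_map_preimage[of _ euclidean]) (auto intro!: cont_cmult c1 c2 simp: open_openin[symmetric])
  moreover have one: "cint X (%_. 1) (fst w) * cint X (%_. 1) (snd w) = fst w (pts X) * snd w (pts X)"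
   if "w\<in>pts ?T" for w
   using that by (auto simp: cint_const pos_measureD(1)[OF Mb_posD])
  moreover have "z\<in>W" using z one[OF z] by (auto simp: W_def c_def)
  moreover have "cmap ?T \<Psi>"
   unfolding \<Psi>_def using F(1,2) by (intro continuous_map_sum cont_cmult c1 c2 e_cont) auto
  moreover have "cmod (cint X f ((%(u, r). conv u r) w) - \<Psi> w) <= eps" if w: "w\<in>W" for w
  proof -
   obtain u r where mn: "w = (u, r)" "u\<in>Mb_pos X" "r\<in>Mb_pos X" using w by (auto simp: W_def)
   note cm = conv_Mb_pos[OF mn(2,3)]
   have "\<Psi> w = cint X p (conv u r)"
    unfolding \<Psi>_def
    using F(2) mn by (simp add: cint_trig[OF Mb_cm[OF pos_Mb[OF cm]] F] subset_iff conv_tr pos_Mb)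
   then have "cmod (cint X f (conv u r) - \<Psi> w) <= eps / c * tv X (conv u r) (pts X)"
    using cint_approx[OF Mb_cm[OF pos_Mb[OF cm]] cont_bmf[OF f] bmf_trig[OF p(1)], of "eps / c"] p(2) ec
    by (auto intro: less_imp_le)
   also have "tv X (conv u r) (pts X) = cmod (conv u r (pts X))"
    by (simp add: tv_Mb_pos[OF cm] Mb_pos_cmod[OF cm])
   also have "\<dots> = cmod (cint X (%_. 1) (fst w) * cint X (%_. 1) (snd w))"
    using one[of w] w mn by (simp add: W_def conv_total pos_Mb)
   finally have "cmod (cint X f (conv u r) - \<Psi> w) <= eps / c * cmod (cint X (%_. 1) (fst w) * cint X (%_. 1) (snd w))" .
   also have "\<dots> <= eps / c * c" using w ec by (intro mult_left_mono) (auto simp: W_def)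
   finally show ?thesis using c mn(1) by simp
  qed
  ultimately show "\<exists>W \<Psi>. openin ?T W\<and>z\<in>W\<and>cmap ?T \<Psi> \<and>
    (\<forall>w\<in>W. cmod (cint X f ((%(u, r). conv u r) w) - \<Psi> w) <= eps)" by blast
 qed
qed

text \<open>A substitute for Fubini's theorem. For trigonometric polynomials both claims are the
  product formula for transforms, and general \<open>f\<close> are uniform limits of these.\<close>

lemma conv_kernel:
 assumes f: "cmap X f" and mu: "u\<in>Mb_pos X"
 shows "cmap X (%y. cint X f (conv u (dirac X y)))"
  and "r\<in>Mb X ==> cint X f (conv u r) = cint X (%y. cint X f (conv u (dirac X y))) r"
proof -
 let ?m = "Re (u (pts X))"
 let ?K = "%y. cint X f (conv u (dirac X y))"
 have m: "0 <= ?m" using pos_measureD(2)[OF Mb_posD[OF mu]] .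
 have "\<exists>P. cmap X P\<and>(\<forall>y\<in>pts X. cmod (?K y - P y) <= eps * ?m) \<and>
   (\<forall>r\<in>Mb X. cmod (cint X f (conv u r) - cint X P r) <= eps * tv X (conv u r) (pts X))" if eps: "0 < eps" for eps
 proof -
  obtain p where p: "trig p" "!!x. x\<in>pts X ==> cmod (f x - p x) < eps" by (rule Stone_Weierstrass[OF f eps]) (rule that)
  obtain F a where F: "finite F" "F <= D" "!!x. x\<in>pts X ==> p x = (\<Sum>k\<in>F. a k * e k x)"
   using p(1) unfolding trig_def by metis
  define P where "P y = (\<Sum>k\<in>F. (a k * cint X (e k) u) * e k y)" for y
  have ap: "cmod (cint X f (conv u r) - cint X P r) <= eps * tv X (conv u r) (pts X)" if nu: "r\<in>Mb X" for r
  proof -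
   note cm = Mb_cm[OF conv_Mb[OF pos_Mb[OF mu] nu]]
   have "cint X p (conv u r) = cint X P r"
    using F(2) by (simp add: cint_trig[OF cm F] cint_trig[OF Mb_cm[OF nu] F(1,2) P_def]
     subset_iff conv_tr[OF _ pos_Mb[OF mu] nu] mult.assoc)
   then show ?thesis
    using cint_approx[OF cm cont_bmf[OF f] bmf_trig[OF p(1)], of eps] p(2) eps by (auto intro: less_imp_le)
  qed
  have "cmap X P"
   unfolding P_def using F(1,2) by (intro continuous_map_sum cont_cmult e_cont) auto
  moreover have "cmod (?K y - P y) <= eps * ?m" if y: "y\<in>pts X" for y
  proof -
   note d = prob_dirac[OF y]
   have "cint X P (dirac X y) = P y" by (rule cint_dirac[OF y cont_bmf]) fact
   moreover have "tv X (conv u (dirac X y)) (pts X) = ?m"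
    using tv_Mb_pos[OF conv_Mb_pos[OF mu prob_pos[OF d]]] conv_total[OF pos_Mb[OF mu] prob_Mb[OF d]] prob_top[OF d] by simp
   ultimately show ?thesis using ap[OF prob_Mb[OF d]] by simp
  qed
  ultimately show ?thesis using ap by blast
 qed
 note * = this
 show cK: "cmap X ?K"
 proof (rule cont_local_approx)
  fix z and eps :: real assume z: "z\<in>pts X" and eps: "0 < eps"
  have "0 < eps / (?m + 1)" using m eps by simp
  then obtain P where P: "cmap X P" "!!y. y\<in>pts X ==> cmod (?K y - P y) <= eps / (?m + 1) * ?m" using * by meson
  have "eps / (?m + 1) * ?m <= eps" using m eps by (simp add: field_simps)
  then show "\<exists>W \<Psi>. openin X W\<and>z\<in>W\<and>cmap X \<Psi>\<and>(\<forall>w\<in>W. cmod (?K w - \<Psi> w) <= eps)"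
   using P z by (intro exI[of _ "pts X"] exI[of _ P]) (auto intro: order_trans)
 qed
 show "cint X f (conv u r) = cint X ?K r" if nu: "r\<in>Mb X"
 proof -
  have "cmod (cint X f (conv u r) - cint X ?K r) <= 0"
  proof (rule le_by_eps)
   fix eps :: real assume eps: "0 < eps"
   obtain P where P: "cmap X P" "!!y. y\<in>pts X ==> cmod (?K y - P y) <= eps * ?m"
    "!!r. r\<in>Mb X ==> cmod (cint X f (conv u r) - cint X P r) <= eps * tv X (conv u r) (pts X)" using *[OF eps] by meson
   have "cmod (cint X ?K r - cint X P r) <= eps * ?m * tv X r (pts X)"
    using cint_approx[OF Mb_cm[OF nu] cont_bmf[OF cK] cont_bmf[OF P(1)]] P(2) eps m by simp
   then show "cmod (cint X f (conv u r) - cint X ?K r) <= 0 + eps * (tv X (conv u r) (pts X) + ?m * tv X r (pts X))"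
    using P(3)[OF nu] norm_triangle_ineq4[of "cint X f (conv u r) - cint X P r" "cint X ?K r - cint X P r"]
    by (simp add: algebra_simps)
  qed (use m in simp)
  then show ?thesis by simp
 qed
qed

text \<open>A nonnegative \<open>g\<close> with \<open>g z > 0\<close> has, integrated against
  \<open>u\<close> convolved with a point mass, a continuous nonnegative function of that point
  which is positive at \<open>y\<close>; its integral against \<open>w\<close> is therefore
  positive.\<close>

lemma supp_conv:
 assumes mu: "u\<in>Mb_pos X" and nu: "w\<in>Mb_pos X" and y: "y\<in>supp X w" and z: "z\<in>supp X (conv u (dirac X y))"
 shows "z\<in>supp X (conv u w)"
proof (rule suppI[OF conv_Mb[OF pos_Mb[OF mu] pos_Mb[OF nu]]])
 show "z\<in>pts X" using z by (simp add: supp_def)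
 fix g assume g: "rmap X g" "!!x. x\<in>pts X ==> 0 <= g x" "0 < g z"
 let ?G = "%y. cint X (cplx g) (conv u (dirac X y))"
 have yX: "y\<in>pts X" using y by (simp add: supp_def)
 note k = conv_kernel[OF cont_of_real[OF g(1)] mu]
 have Gpos: "?G y\<in>\<real>\<^sub>\<ge>\<^sub>0" if "y\<in>pts X" for y
  by (rule cint_nonneg[OF Mb_posD[OF conv_Mb_pos[OF mu prob_pos[OF prob_dirac[OF that]]]] bmf_of_real[OF g(1)] g(2)])
 then have G: "?G y = complex_of_real (Re (?G y))" if "y\<in>pts X" for y
  using that by (simp add: complex_nonneg_Reals_iff complex_eq_iff)
 have "0 < Re (?G y)"
  by (rule supp_integral_pos[OF conv_Mb_pos[OF mu prob_pos[OF prob_dirac[OF yX]]] z g])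
 then have "0 < Re (cint X (%y. complex_of_real (Re (?G y))) w)"
  using Gpos by (intro supp_integral_pos[OF nu y continuous_map_Re[OF k(1)]]) (auto simp: complex_nonneg_Reals_iff)
 also have "cint X (%y. complex_of_real (Re (?G y))) w = cint X ?G w" by (rule cint_cong) (rule G[symmetric])
 also have "\<dots> = cint X (cplx g) (conv u w)" by (rule k(2)[OF pos_Mb[OF nu], symmetric])
 finally show "cint X (cplx g) (conv u w) ~= 0" by auto
qed

text \<open>Algebra, positivity and weak continuity come with the transforms; the norm inequality,
  the unit, the involution and the behaviour of supports remain as hypotheses.\<close>

theorem comm_hypergroupI:
 fixes K :: "'a hypergroup_data"
 assumes K: "htop K = X" "hconv K = conv"
  and norm: "!!r w. r\<in>Mb X ==> w\<in>Mb X ==> tv X (conv r w) (pts X) <= tv X r (pts X) * tv X w (pts X)"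
  and u: "hunit K\<in>pts X" "!!d. d\<in>D ==> e d (hunit K) = 1"
  and inv: "continuous_map X X (hinv K)" "!!x. x\<in>pts X ==> hinv K (hinv K x) = x"
   "!!d x. d\<in>D ==> x\<in>pts X ==> e d (hinv K x) = cnj (e d x)"
  and us: "!!x y. x\<in>pts X ==> y\<in>pts X ==> hunit K\<in>supp X (conv (dirac X x) (dirac X y)) \<longleftrightarrow> x = hinv K y"
  and sc: "continuous_map (prod_topology X X) (Michael_topology X) (%(x, y). supp X (conv (dirac X x) (dirac X y)))"
 shows "comm_hypergroup K"
proof (unfold_locales, unfold K Mb_norm_def pconv_def measure_inv_def)
 show "locally_compact_space X" by (rule compact_imp_locally_compact_space[OF compact_space])
 show "Hausdorff_space X" by (rule Hausdorff_space)
 show "continuous_map (prod_topology (weak_topology X) (weak_topology X)) (weak_topology X) (%(r, w). conv r w)"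
  by (rule conv_weakly_continuous)
 show "homeomorphic_maps X X (hinv K) (hinv K)" using inv by (simp add: homeomorphic_maps_def)
 show "continuous_map (prod_topology X X) (Michael_topology X) (%(x, y). supp X (conv (dirac X x) (dirac X y)))" by (rule sc)
next
 fix x y assume x: "x\<in>pts X" and y: "y\<in>pts X"
 note dx = prob_dirac[OF x] and dy = prob_dirac[OF y]
 show "conv (dirac X x) (dirac X y)\<in>M_prob X" by (rule conv_prob[OF dx dy])
 show "compactin X (supp X (conv (dirac X x) (dirac X y)))" by (rule compactin_supp)
 show "(hunit K\<in>supp X (conv (dirac X x) (dirac X y))) = (x = hinv K y)" by (rule us[OF x y])
 have ix: "hinv K x\<in>pts X" and iy: "hinv K y\<in>pts X" using inv(1) x y by (auto simp: continuous_map_def)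
 note dix = prob_dirac[OF ix] and diy = prob_dirac[OF iy]
 note cyx = conv_prob[OF dy dx]
 show "conv (dirac X (hinv K x)) (dirac X (hinv K y)) = push X X (hinv K) (conv (dirac X y) (dirac X x))"
 proof (rule transform_unique[OF conv_Mb[OF prob_Mb[OF dix] prob_Mb[OF diy]] Mb_push[OF prob_Mb[OF cyx] inv(1)]])
  fix d assume d: "d\<in>D"
  have "cint X (e d) (push X X (hinv K) (conv (dirac X y) (dirac X x))) = cint X (%x. e d (hinv K x)) (conv (dirac X y) (dirac X x))"
   by (rule cint_push[OF Mb_cm[OF prob_Mb[OF cyx]] inv(1) bmf_e[OF d]])
  also have "\<dots> = cint X (%x. cnj (e d x)) (conv (dirac X y) (dirac X x))" by (rule cint_cong) (rule inv(3)[OF d])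
  also have "\<dots> = cnj (cint X (e d) (conv (dirac X y) (dirac X x)))"
   by (rule cint_cnj[OF Mb_posD[OF prob_pos[OF cyx]] bmf_e[OF d]])
  also have "\<dots> = cnj (e d y) * cnj (e d x)"
   by (simp add: conv_tr[OF d prob_Mb[OF dy] prob_Mb[OF dx]] cint_e_dirac[OF d] x y)
  finally show "cint X (e d) (conv (dirac X (hinv K x)) (dirac X (hinv K y))) = cint X (e d) (push X X (hinv K) (conv (dirac X y) (dirac X x)))"
   by (simp add: conv_tr[OF d prob_Mb[OF dix] prob_Mb[OF diy]] cint_e_dirac[OF d] ix iy inv(3)[OF d] x y)
 qed
next
 fix x assume x: "x\<in>pts X"
 note dx = prob_Mb[OF prob_dirac[OF x]] and du = prob_Mb[OF prob_dirac[OF u(1)]]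
 show "conv (dirac X (hunit K)) (dirac X x) = dirac X x" "conv (dirac X x) (dirac X (hunit K)) = dirac X x"
  by (rule transform_unique; simp add: conv_Mb conv_tr dx du cint_e_dirac x u)+
qed (use norm u in \<open>auto simp: conv_Mb conv_add_left conv_add_right conv_scale_left conv_scale_right conv_assoc intro: conv_commute\<close>)

end

lemma cint_dominated:
 assumes mu: "cmeas X u" and f: "!!n::nat. f n\<in>bmf X" "g\<in>bmf X"
  and b: "!!n x. x\<in>pts X ==> cmod (f n x) <= c" and lim: "!!x. x\<in>pts X ==> (%n. f n x) \<longlonglongrightarrow> g x"
 shows "(%n. cint X (f n) u) \<longlonglongrightarrow> cint X g u"
proof -
 have *: "(%n. LINT x|M. f n x) \<longlonglongrightarrow> (LINT x|M. g x)" if M: "finite_measure M" "sets M = bor X" for M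
 proof (rule integral_dominated_convergence)
  interpret finite_measure M by fact
  have sp: "space M = pts X" using sets_eq_imp_space_eq[of M "borel_space X"] M(2) by simp
  show "integrable M (%x. c)" by simp
  show "g\<in>borel_measurable M" "!!n. f n\<in>borel_measurable M"
   using integrable_bmf[OF M] f by (auto intro: borel_measurable_integrable)
  show "AE x in M. (%n. f n x) \<longlonglongrightarrow> g x" by (rule AE_I2) (simp add: lim sp)
  show "!!n. AE x in M. cmod (f n x) <= c" by (rule AE_I2) (simp add: b sp)
 qed
 note p = cm_parts[OF mu]
 show ?thesis unfolding cintegral_def
  by (intro tendsto_add tendsto_diff tendsto_mult tendsto_const *[OF p(1)] *[OF p(2)] *[OF p(3)] *[OF p(4)]) auto
qed

section \<open>Measures on discrete spaces\<close>

lemma bor_discrete [simp]: "bor (disc S) = Pow S"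
proof
 show "bor (disc S) <= Pow S" using bor_sub[of _ "disc S"] by auto
qed (auto intro: open_bor)

lemma bmf_discreteI: "(!!x. x\<in>S ==> cmod (f x) <= c) ==> f\<in>bmf (disc S)"
proof (rule bmfI)
 show "f\<in>borel_measurable (borel_space (disc S))"
  by (rule measurableI) (unfold sets_borel_space space_borel_space bor_discrete, auto)
qed auto

lemma bmf_discreteI': "finite S ==> f\<in>bmf (disc S)"
 by (rule bmf_discreteI[of _ _ "\<Sum>x\<in>S. cmod (f x)"]) (auto intro!: member_le_sum)

lemma bmf_discrete_bc: "bounded_continuous (disc S) = bmf (disc S)"
 using bc_bmf[of "disc S"] by (auto simp: bounded_continuous_def bmf_def)

lemma cm_finite:
 assumes "cmeas (disc S) u" "finite A" "A <= S"
 shows "u A = (\<Sum>x\<in>A. u {x})"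
 using cm_finite_UN[OF assms(1,2), of "%x. {x}"] assms(3) by (auto simp: disjoint_family_on_def)

lemma Mb_discreteE:
 assumes "u\<in>Mb (disc S)" "A <= S" "0 < eps"
 obtains C where "finite C" "C <= A" "tv (disc S) u (A - C) < eps"
proof -
 obtain C where "compactin (disc S) C" "C <= A" "tv (disc S) u (A - C) < eps"
  by (rule MbE[OF assms(1) _ assms(3), of A]) (use assms(2) in auto)
 then show thesis using that[of C] by (simp add: compactin_discrete_topology)
qed

text \<open>Over an uncountable set the singletons determine a measure only through regularity: up
  to small variation every set may be replaced by a finite subset.\<close>

lemma Mb_discrete_eqI:
 assumes "u\<in>Mb (disc S)" "w\<in>Mb (disc S)" "!!x. x\<in>S ==> u {x} = w {x}"
 shows "u = w"
proof
 let ?X = "disc S"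
 define r where "r = (%A. u A + (-1) * w A)"
 have r: "r\<in>Mb ?X" unfolding r_def by (intro Mb_add Mb_scale assms)
 note cm = Mb_cm[OF r]
 fix A
 have "r A = 0"
 proof (cases "A <= S")
  case True
  have "cmod (r A) <= 0"
  proof (rule field_le_epsilon)
   fix eps :: real assume eps: "0 < eps"
   obtain C where C: "finite C" "C <= A" "tv ?X r (A - C) < eps" by (rule Mb_discreteE[OF r True eps])
   have "r C = 0" using cm_finite[OF cm C(1)] C(2) True assms(3) by (simp add: r_def subset_iff)
   then have "r A = r (A - C)" using cm_Diff[OF cm, of A C] C(2) True by simp
   moreover have "cmod (r (A - C)) <= tv ?X r (A - C)" by (rule norm_le_tv[OF cm]) (use True in auto)
   ultimately show "cmod (r A) <= 0 + eps" using C(3) by simp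
  qed
  then show ?thesis by simp
 qed (simp add: cm_outside[OF cm])
 then show "u A = w A" by (simp add: r_def)
qed

lemma supp_discrete:
 assumes "cmeas (disc S) u"
 shows "supp (disc S) u = {x\<in>S. u {x} ~= 0}"
proof -
 let ?X = "disc S"
 have 0: "total_variation ?X u A = 0 \<longleftrightarrow> tv ?X u A = 0" for A by (metis assms enn2real_0 ennreal_0 tv_finite)
 have "tv ?X u {x} = 0" if "u {x} = 0" for x
 proof -
  have "tv ?X u {x} <= 0"
  proof (rule tv_le)
   fix P assume "\<Union>P <= {x}"
   then have "B = {}\<or>B = {x}" if "B\<in>P" for B using that by blast
   then show "(\<Sum>B\<in>P. cmod (u B)) <= 0" using that cm_empty[OF assms] by (intro sum_nonpos) auto
  qed
  then show ?thesis using tv_nonneg[of ?X u "{x}"] by linarith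
 qed
 moreover have "tv ?X u U ~= 0" if "x\<in>U" "U <= S" "u {x} ~= 0" for x U
 proof -
  have "0 < cmod (u {x})" using that(3) by simp
  also have "\<dots> <= tv ?X u {x}" by (rule norm_le_tv[OF assms]) (use that in auto)
  also have "\<dots> <= tv ?X u U" by (rule tv_mono[OF assms]) (use that in auto)
  finally show ?thesis by simp
 qed
 ultimately show ?thesis unfolding supp_def 0 by auto
qed

lemma finite_supp_eq:
 assumes "u\<in>Mb (disc S)" "finite T" "T <= S" "!!x. x\<in>S ==> x\<notin>T ==> u {x} = 0"
 shows "u = (%A. \<Sum>x\<in>T. u {x} * dirac (disc S) x A)"
proof (rule Mb_discrete_eqI[OF assms(1)])
 show "(%A. \<Sum>x\<in>T. u {x} * dirac (disc S) x A)\<in>Mb (disc S)"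
  using assms(3) by (intro Mb_sum Mb_scale Mb_dirac) auto
 fix y assume y: "y\<in>S"
 have "(\<Sum>x\<in>T. u {x} * dirac (disc S) x {y}) = (\<Sum>x\<in>T. if x = y then u {y} else 0)"
  using y by (intro sum.cong) (auto simp: dirac_def)
 then show "u {y} = (\<Sum>x\<in>T. u {x} * dirac (disc S) x {y})" using assms(2,4) y by auto
qed

lemma cint_finite_supp:
 assumes "u\<in>Mb (disc S)" "finite T" "T <= S" "!!x. x\<in>S ==> x\<notin>T ==> u {x} = 0" "f\<in>bmf (disc S)"
 shows "cint (disc S) f u = (\<Sum>x\<in>T. u {x} * f x)"
proof -
 let ?X = "disc S"
 have "cint ?X f u = cint ?X f (%A. \<Sum>x\<in>T. u {x} * dirac ?X x A)"
  using finite_supp_eq[OF assms(1-4)] by simp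
 also have "\<dots> = (\<Sum>x\<in>T. cint ?X f (%A. u {x} * dirac ?X x A))"
  by (intro cint_msum cm_scale cm_dirac assms)
 also have "\<dots> = (\<Sum>x\<in>T. u {x} * f x)"
  using assms(3) by (intro sum.cong) (auto simp: cint_mscale[OF cm_dirac assms(5)] cint_dirac[OF _ assms(5)])
 finally show ?thesis .
qed

text \<open>A finite combination of point masses, on which \<open>L\<close> vanishes, is subtracted.
  What remains is \<open>u\<close> restricted to the complement of a large finite set, and its
  variation is small.\<close>

lemma linear_discrete_zero:
 assumes mu: "u\<in>Mb (disc S)"
  and add: "!!u w. u\<in>Mb (disc S) ==> w\<in>Mb (disc S) ==> L (%A. u A + w A) = L u + L w"
  and scale: "!!u a. u\<in>Mb (disc S) ==> L (%A. a * u A) = a * L u"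
  and bound: "!!u. u\<in>Mb (disc S) ==> cmod (L u) <= k * tv (disc S) u S"
  and dirac: "!!x. x\<in>S ==> L (dirac (disc S) x) = 0"
 shows "L u = (0::complex)"
proof -
 let ?X = "disc S"
 note cm = Mb_cm[OF mu]
 have "cmod (L u) <= 0"
 proof (rule le_by_eps[of _ _ "\<bar>k\<bar>"])
  fix eps :: real assume eps: "0 < eps"
  obtain F where F: "finite F" "F <= S" "tv ?X u (S - F) < eps" by (rule Mb_discreteE[OF mu order_refl eps])
  define uF where "uF = (%A. \<Sum>x\<in>F. u {x} * dirac ?X x A)"
  have 1: "(%A. \<Sum>x\<in>F. u {x} * dirac ?X x A)\<in>Mb ?X\<and>L (%A. \<Sum>x\<in>F. u {x} * dirac ?X x A) = 0"
   using F(1,2)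
  proof (induction F)
   case empty
   have "L (%A. 0) = 0" using scale[OF Mb_zero, of 0] by simp
   then show ?case by (simp add: Mb_zero)
  next
   case (insert x F)
   then have "dirac ?X x\<in>Mb ?X" by (intro Mb_dirac) auto
   then show ?case using insert add[of "%A. u {x} * dirac ?X x A" "%A. \<Sum>x\<in>F. u {x} * dirac ?X x A"] dirac[of x] scale[of "dirac ?X x" "u {x}"]
    by (simp add: Mb_scale Mb_add)
  qed
  define w where "w = (%A. u A + (-1) * uF A)"
  have nu: "w\<in>Mb ?X" unfolding w_def using 1 by (intro Mb_add Mb_scale mu) (simp add: uF_def)
  have "L w = L u + (-1) * L uF"
   unfolding w_def using 1 add[OF mu Mb_scale[of uF ?X "-1"]] scale[of uF "-1"] by (simp add: uF_def)
  then have "L u = L w" using 1 by (simp add: uF_def)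
  have w: "w B = u (B - F)" if B: "B <= S" for B
  proof -
   have "uF B = (\<Sum>x\<in>F. if x\<in>B then u {x} else 0)" unfolding uF_def using B by (intro sum.cong) (auto simp: dirac_def)
   also have "\<dots> = (\<Sum>x\<in>B\<inter>F. u {x})" using F(1) by (simp add: sum.If_cases Int_commute)
   also have "\<dots> = u (B\<inter>F)" using F B by (intro cm_finite[OF cm, symmetric]) auto
   finally show ?thesis using cm_Diff[OF cm, of B "B\<inter>F"] B by (simp add: w_def Diff_Int le_infI1)
  qed
  have "tv ?X w S <= tv ?X u (S - F)"
  proof (rule tv_le)
   fix P assume P: "finite P" "disjoint P" "P <= bor ?X" "\<Union>P <= S"
   have "(\<Sum>B\<in>P. cmod (w B)) = (\<Sum>B\<in>P. cmod (u (B - F)))" using P w by (intro sum.cong) auto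
   also have "\<dots> <= tv ?X u (S - F)"
    using P by (intro tv_upper[OF cm]) (auto simp: disjoint_family_on_def disjoint_def)
   finally show "(\<Sum>B\<in>P. cmod (w B)) <= tv ?X u (S - F)" .
  qed
  have "k * tv ?X w S <= \<bar>k\<bar> * tv ?X w S" by (intro mult_right_mono) auto
  also have "\<dots> <= \<bar>k\<bar> * eps" using F(3) \<open>tv ?X w S <= tv ?X u (S - F)\<close> by (intro mult_left_mono) auto
  finally have "k * tv ?X w S <= \<bar>k\<bar> * eps" .
  then show "cmod (L u) <= 0 + eps * \<bar>k\<bar>" using bound[OF nu] \<open>L u = L w\<close> by (simp add: mult.commute)
 qed simp
 then show ?thesis by simp
qed

lemma linear_discrete_eq:
 assumes mu: "u\<in>Mb (disc S)"
  and add: "!!u w. u\<in>Mb (disc S) ==> w\<in>Mb (disc S) ==> L (%A. u A + w A) = L u + L w"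
   "!!u w. u\<in>Mb (disc S) ==> w\<in>Mb (disc S) ==> L' (%A. u A + w A) = L' u + L' w"
  and scale: "!!u a. u\<in>Mb (disc S) ==> L (%A. a * u A) = a * L u"
   "!!u a. u\<in>Mb (disc S) ==> L' (%A. a * u A) = a * L' u"
  and bound: "!!u. u\<in>Mb (disc S) ==> cmod (L u) <= k * tv (disc S) u S"
   "!!u. u\<in>Mb (disc S) ==> cmod (L' u) <= k' * tv (disc S) u S"
  and dirac: "!!x. x\<in>S ==> L (dirac (disc S) x) = L' (dirac (disc S) x)"
 shows "L u = (L' u :: complex)"
proof -
 have "L u - L' u = 0"
 proof (rule linear_discrete_zero[OF mu, of "%u. L u - L' u" "k + k'"])
  fix u assume m: "u\<in>Mb (disc S)"
  show "cmod (L u - L' u) <= (k + k') * tv (disc S) u S"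
   using bound[OF m] norm_triangle_ineq4[of "L u" "L' u"] by (simp add: distrib_right)
 qed (simp_all add: add scale dirac algebra_simps)
 then show ?thesis by simp
qed

section \<open>Discrete hypergroups\<close>

locale discrete_kernel =
 fixes S :: "'a set" and c :: "'a \<Rightarrow> 'a \<Rightarrow> 'a cmeasure"
 assumes c_prob: "x\<in>S ==> y\<in>S ==> c x y\<in>M_prob (disc S)"
  and c_supp: "x\<in>S ==> y\<in>S ==> finite (supp (disc S) (c x y))"

begin

abbreviation X :: "'a topology" where "X \<equiv> disc S"

abbreviation conv :: "'a cmeasure \<Rightarrow> 'a cmeasure \<Rightarrow> 'a cmeasure" where "conv \<equiv> bilinear_ext X c"

lemma c_cm: "x\<in>S ==> y\<in>S ==> cmeas X (c x y)"
 by (rule Mb_cm[OF prob_Mb[OF c_prob]])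

lemma c_tv: "x\<in>S ==> y\<in>S ==> tv X (c x y) S = 1"
 using tv_positive[OF Mb_posD[OF prob_pos[OF c_prob]], of x y S] prob_top[OF c_prob, of x y] by simp

text \<open>Everything about the convolution is reduced to iterated integrals of bounded functions of two variables.\<close>

definition it :: "('a \<Rightarrow> 'a \<Rightarrow> complex) \<Rightarrow> 'a cmeasure \<Rightarrow> 'a cmeasure \<Rightarrow> complex" where
 "it f u w = cint X (%x. cint X (f x) w) u"

definition bd :: "('a \<Rightarrow> 'a \<Rightarrow> complex) \<Rightarrow> real \<Rightarrow> bool" where
 "bd f k \<longleftrightarrow> 0 <= k\<and>(\<forall>x\<in>S. \<forall>y\<in>S. cmod (f x y) <= k)"

lemma bd_bmf: "bd f k ==> x\<in>S ==> f x\<in>bmf X"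
 by (rule bmf_discreteI) (auto simp: bd_def)

lemma bd_inner:
 assumes "bd f k" "cmeas X w" "x\<in>S"
 shows "cmod (cint X (f x) w) <= k * tv X w S"
 using cint_norm[OF assms(2) bd_bmf[OF assms(1,3)], of k] assms by (simp add: bd_def)

lemma bd_inner_bmf: "bd f k ==> cmeas X w ==> (%x. cint X (f x) w)\<in>bmf X"
 by (rule bmf_discreteI[OF bd_inner])

lemma it_norm:
 assumes "bd f k" "cmeas X u" "cmeas X w"
 shows "cmod (it f u w) <= k * tv X w S * tv X u S"
 using cint_norm[OF assms(2) bd_inner_bmf[OF assms(1,3)], of "k * tv X w S"] bd_inner[OF assms(1,3)] assms(1)
 by (simp add: it_def bd_def)

text \<open>Points with \<open>x\<close> in \<open>F\<close> contribute only through the tail of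
  \<open>w\<close> outside \<open>G\<close>, the remaining ones only through the tail of
  \<open>u\<close> outside \<open>F\<close>.\<close>

lemma it_tail:
 assumes b: "bd f k" and cm: "cmeas X u" "cmeas X w"
  and FG: "F <= S" "G <= S" and f0: "!!x y. x\<in>F ==> y\<in>G ==> f x y = 0"
 shows "cmod (it f u w) <= k * (tv X u S * tv X w (S - G) + tv X u (S - F) * tv X w S)"
proof -
 have k: "0 <= k" using b by (simp add: bd_def)
 let ?g = "%x. cint X (f x) w"
 have inF: "cmod (?g x) <= k * tv X w (S - G)" if "x\<in>F" for x
  by (rule cint_norm_on[OF cm(2) bd_bmf[OF b]]) (use b that FG f0 k in \<open>auto simp: bd_def\<close>)
 have gb: "?g\<in>bmf X" by (rule bd_inner_bmf[OF b cm(2)])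
 have i1: "(%x. ?g x * of_bool (x\<in>F))\<in>bmf X" "(%x. ?g x * of_bool (x\<in>S - F))\<in>bmf X"
  by (rule bmf_mult[OF gb bmf_indicator], use FG in simp, rule bmf_mult[OF gb bmf_indicator], simp)
 have "it f u w = cint X (%x. ?g x * of_bool (x\<in>F) + ?g x * of_bool (x\<in>S - F)) u"
  unfolding it_def by (rule cint_cong) auto
 also have "\<dots> = cint X (%x. ?g x * of_bool (x\<in>F)) u + cint X (%x. ?g x * of_bool (x\<in>S - F)) u"
  by (rule cint_add[OF cm(1) i1])
 finally have it: "cmod (it f u w) <= cmod (cint X (%x. ?g x * of_bool (x\<in>F)) u) + cmod (cint X (%x. ?g x * of_bool (x\<in>S - F)) u)"
  by (simp add: norm_triangle_ineq)
 have "cmod (cint X (%x. ?g x * of_bool (x\<in>F)) u) <= k * tv X w (S - G) * tv X u (pts X)"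
  by (rule cint_norm[OF cm(1) i1(1)]) (use inF k in \<open>auto simp: norm_mult\<close>)
 moreover have "cmod (cint X (%x. ?g x * of_bool (x\<in>S - F)) u) <= k * tv X w S * tv X u (S - F)"
  by (rule cint_norm_on[OF cm(1) i1(2)]) (use bd_inner[OF b cm(2)] k in \<open>auto simp: norm_mult\<close>)
 ultimately show ?thesis using it by (simp add: algebra_simps)
qed

lemma it_cong: "(!!x y. x\<in>S ==> y\<in>S ==> f x y = g x y) ==> it f u w = it g u w"
 unfolding it_def by (intro cint_cong) (simp add: cint_cong)

lemma it_add:
 assumes "bd f k" "bd g l" "cmeas X u" "cmeas X w"
 shows "it (%x y. f x y + g x y) u w = it f u w + it g u w"
proof -
 have "it (%x y. f x y + g x y) u w = cint X (%x. cint X (f x) w + cint X (g x) w) u"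
  unfolding it_def by (rule cint_cong) (simp add: cint_add[OF assms(4) bd_bmf[OF assms(1)] bd_bmf[OF assms(2)]])
 then show ?thesis by (simp add: cint_add[OF assms(3)] bd_inner_bmf[OF assms(1,4)] bd_inner_bmf[OF assms(2,4)] it_def)
qed

lemma it_scale:
 assumes "bd f k" "cmeas X u" "cmeas X w"
 shows "it (%x y. a * f x y) u w = a * it f u w"
proof -
 have "it (%x y. a * f x y) u w = cint X (%x. a * cint X (f x) w) u"
  unfolding it_def by (rule cint_cong) (simp add: cint_scale[OF assms(3) bd_bmf[OF assms(1)]])
 then show ?thesis by (simp add: cint_scale[OF assms(2)] bd_inner_bmf[OF assms(1,3)] it_def)
qed

lemma bd_sum:
 "(!!i. i\<in>I ==> bd (f i) (k i)) ==> bd (%x y. \<Sum>i\<in>I. f i x y) (\<Sum>i\<in>I. k i)"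
 unfolding bd_def by (auto intro!: sum_nonneg sum_norm_le)

lemma bd_scale: "bd f k ==> bd (%x y. a * f x y) (cmod a * k)"
 unfolding bd_def by (auto simp: norm_mult intro: mult_left_mono)

lemma it_sum:
 assumes "cmeas X u" "cmeas X w" "!!i. i\<in>I ==> bd (f i) (k i)"
 shows "it (%x y. \<Sum>i\<in>I. f i x y) u w = (\<Sum>i\<in>I. it (f i) u w)"
 using assms(3)
proof (induction I rule: infinite_finite_induct)
 case (insert i I)
 then show ?case using it_add[of "f i" "k i" "%x y. \<Sum>i\<in>I. f i x y" "\<Sum>i\<in>I. k i" u w] bd_sum[of I f k] assms by simp
qed (simp_all add: it_def)

lemma bd_c: "A <= S ==> bd (%x y. c x y A) 1"
 unfolding bd_def
proof (intro conjI ballI)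
 fix x y assume A: "A <= S" and xy: "x\<in>S" "y\<in>S"
 have "cmod (c x y A) <= tv X (c x y) A" by (rule norm_le_tv[OF c_cm[OF xy]]) (use A in auto)
 also have "\<dots> <= tv X (c x y) S" by (rule tv_mono[OF c_cm[OF xy] A])
 finally show "cmod (c x y A) <= 1" by (simp add: c_tv[OF xy])
qed simp

lemma conv_apply: "A <= S ==> conv u w A = it (%x y. c x y A) u w"
 by (simp add: bilinear_ext_def it_def)

text \<open>Countable additivity by dominated convergence in the inner and then in the outer
  integral; all partial sums are kernel values of finite unions and hence bounded by 1.\<close>

lemma conv_cm:
 assumes "cmeas X u" "cmeas X w"
 shows "cmeas X (conv u w)"
 unfolding complex_measure_def
proof (intro conjI allI impI)
 fix F :: "nat \<Rightarrow> 'a set" assume F: "range F <= bor X" "disjoint_family F"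
 then have FS: "F n <= S" "(\<Union>n. F n) <= S" for n by auto
 have b: "bd (%x y. \<Sum>i<n. c x y (F i)) 1" for n
 proof -
  have "(\<Sum>i<n. c x y (F i)) = c x y (\<Union>i<n. F i)" if "x\<in>S" "y\<in>S" for x y
   using F FS by (subst cm_finite_UN[OF c_cm[OF that]]) (auto simp: disjoint_family_on_def)
  moreover have "bd (%x y. c x y (\<Union>i<n. F i)) 1" by (rule bd_c) (use FS in auto)
  ultimately show ?thesis by (simp add: bd_def)
 qed
 have "(\<Sum>i<n. conv u w (F i)) = it (%x y. \<Sum>i<n. c x y (F i)) u w" for n
  using it_sum[OF assms, of "{..<n}" "%i x y. c x y (F i)" "%_. 1"] bd_c FS by (simp add: conv_apply)
 moreover have "(%n. it (%x y. \<Sum>i<n. c x y (F i)) u w) \<longlonglongrightarrow> it (%x y. c x y (\<Union>n. F n)) u w"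
  unfolding it_def
 proof (rule cint_dominated[OF assms(1), where c = "1 * tv X w S"])
  show "(%x. cint X (%y. \<Sum>i<n. c x y (F i)) w)\<in>bmf X" for n by (rule bd_inner_bmf[OF b assms(2)])
  show "(%x. cint X (%y. c x y (\<Union>n. F n)) w)\<in>bmf X" by (rule bd_inner_bmf[OF bd_c assms(2)]) (rule FS)
  show "cmod (cint X (%y. \<Sum>i<n. c x y (F i)) w) <= 1 * tv X w S" if "x\<in>pts X" for n x
   using bd_inner[OF b assms(2)] that by simp
  fix x assume "x\<in>pts X"
  then have x: "x\<in>S" by simp
  show "(%n. cint X (%y. \<Sum>i<n. c x y (F i)) w) \<longlonglongrightarrow> cint X (%y. c x y (\<Union>n. F n)) w"
  proof (rule cint_dominated[OF assms(2), where c = 1])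
   show "(%y. \<Sum>i<n. c x y (F i))\<in>bmf X" for n by (rule bd_bmf[OF b x])
   show "(%y. c x y (\<Union>n. F n))\<in>bmf X" by (rule bd_bmf[OF bd_c x]) (rule FS)
   show "cmod (\<Sum>i<n. c x y (F i)) <= 1" if "y\<in>pts X" for n y using b[of n] x that by (simp add: bd_def)
   show "(%n. \<Sum>i<n. c x y (F i)) \<longlonglongrightarrow> c x y (\<Union>n. F n)" if "y\<in>pts X" for y
    using cm_sums[OF c_cm[OF x, of y] _ F(2)] F(1) that unfolding sums_def by auto
  qed
 qed
 ultimately show "(%n. conv u w (F n)) sums conv u w (\<Union>n. F n)"
  using FS by (simp add: sums_def conv_apply)
qed (auto simp: bilinear_ext_def)

text \<open>Unimodular factors turn a sum of moduli of the convolution into a single iterated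
  integral; the integrand is bounded by the total variation of the kernel, which is 1.\<close>

lemma conv_sum_repr:
 assumes cm: "cmeas X u" "cmeas X w" and P: "finite P" "disjoint P" "P <= Pow S"
 obtains f where "bd f 1" "(\<Sum>B\<in>P. cmod (conv u w B)) <= cmod (it f u w)"
  "!!x y. (!!B. B\<in>P ==> c x y B = 0) ==> f x y = 0"
proof -
 define h where "h B = (if conv u w B = 0 then 0 else complex_of_real (cmod (conv u w B)) / conv u w B)" for B
 have h: "cmod (h B) <= 1" "h B * conv u w B = complex_of_real (cmod (conv u w B))" for B
  by (auto simp: h_def norm_divide)
 define f where "f x y = (\<Sum>B\<in>P. h B * c x y B)" for x y
 have bf: "bd (%x y. h B * c x y B) (cmod (h B) * 1)" if "B\<in>P" for B using that P by (intro bd_scale bd_c) auto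
 have b: "bd f 1" unfolding bd_def
 proof (intro conjI ballI)
  fix x y assume xy: "x\<in>S" "y\<in>S"
  have "cmod (f x y) <= (\<Sum>B\<in>P. cmod (c x y B))" unfolding f_def
   by (rule sum_norm_le) (use h(1) in \<open>auto simp: norm_mult intro: mult_left_le_one_le\<close>)
  also have "\<dots> <= tv X (c x y) S" by (rule tv_upper_set[OF c_cm[OF xy]]) (use P in auto)
  finally show "cmod (f x y) <= 1" by (simp add: c_tv[OF xy])
 qed simp
 have "complex_of_real (\<Sum>B\<in>P. cmod (conv u w B)) = (\<Sum>B\<in>P. h B * conv u w B)" by (simp add: h(2))
 also have "\<dots> = (\<Sum>B\<in>P. it (%x y. h B * c x y B) u w)"
  using P by (intro sum.cong) (auto simp: conv_apply it_scale[OF bd_c cm])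
 also have "\<dots> = it f u w" unfolding f_def by (rule it_sum[OF cm bf, symmetric])
 finally have "\<bar>\<Sum>B\<in>P. cmod (conv u w B)\<bar> = cmod (it f u w)" by (metis norm_of_real)
 then show thesis by (intro that[OF b]) (auto simp: f_def)
qed

lemma conv_tv:
 assumes "cmeas X u" "cmeas X w"
 shows "tv X (conv u w) S <= tv X u S * tv X w S"
proof (rule tv_le)
 fix P assume P: "finite P" "disjoint P" "P <= bor X" "\<Union>P <= S"
 obtain f where "bd f 1" "(\<Sum>B\<in>P. cmod (conv u w B)) <= cmod (it f u w)"
  by (rule conv_sum_repr[OF assms P(1,2)]) (use P(3) in auto)
 then show "(\<Sum>B\<in>P. cmod (conv u w B)) <= tv X u S * tv X w S"
  using it_norm[OF _ assms, of f 1] by (simp add: mult.commute)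
qed

lemma it_measure_add_left: "bd f k ==> cmeas X u ==> cmeas X u' ==> cmeas X w ==>
  it f (%A. u A + u' A) w = it f u w + it f u' w"
 unfolding it_def by (rule cint_madd[OF _ _ bd_inner_bmf])

lemma it_measure_scale_left: "bd f k ==> cmeas X u ==> cmeas X w ==>
  it f (%A. a * u A) w = a * it f u w"
 unfolding it_def by (rule cint_mscale[OF _ bd_inner_bmf])

lemma it_measure_add_right:
 assumes "bd f k" "cmeas X u" "cmeas X w" "cmeas X w'"
 shows "it f u (%A. w A + w' A) = it f u w + it f u w'"
proof -
 have "it f u (%A. w A + w' A) = cint X (%x. cint X (f x) w + cint X (f x) w') u"
  unfolding it_def by (rule cint_cong) (simp add: cint_madd[OF assms(3,4) bd_bmf[OF assms(1)]])
 then show ?thesis by (simp add: it_def cint_add[OF assms(2) bd_inner_bmf[OF assms(1,3)] bd_inner_bmf[OF assms(1,4)]])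
qed

lemma it_measure_scale_right:
 assumes "bd f k" "cmeas X u" "cmeas X w"
 shows "it f u (%A. a * w A) = a * it f u w"
proof -
 have "it f u (%A. a * w A) = cint X (%x. a * cint X (f x) w) u"
  unfolding it_def by (rule cint_cong) (simp add: cint_mscale[OF assms(3) bd_bmf[OF assms(1)]])
 then show ?thesis by (simp add: it_def cint_scale[OF assms(2) bd_inner_bmf[OF assms(1,3)]])
qed

lemma conv_eqI: "(!!A. A <= S ==> conv u w A = r A) ==> (!!A. \<not> A <= S ==> r A = 0) ==> conv u w = r"
 by (rule ext) (metis bilinear_ext_def bor_discrete PowD)

lemma conv_outside: "\<not> A <= S ==> conv u w A = 0"
 by (simp add: bilinear_ext_def)

lemma conv_add_left: "cmeas X u ==> cmeas X u' ==> cmeas X w ==>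
  conv (%A. u A + u' A) w = (%A. conv u w A + conv u' w A)"
 by (rule conv_eqI) (simp_all add: conv_apply it_measure_add_left[OF bd_c] conv_outside)

lemma conv_scale_left: "cmeas X u ==> cmeas X w ==>
  conv (%A. a * u A) w = (%A. a * conv u w A)"
 by (rule conv_eqI) (simp_all add: conv_apply it_measure_scale_left[OF bd_c] conv_outside)

lemma conv_add_right: "cmeas X u ==> cmeas X w ==> cmeas X w' ==>
  conv u (%A. w A + w' A) = (%A. conv u w A + conv u w' A)"
 by (rule conv_eqI) (simp_all add: conv_apply it_measure_add_right[OF bd_c] conv_outside)

lemma conv_scale_right: "cmeas X u ==> cmeas X w ==>
  conv u (%A. a * w A) = (%A. a * conv u w A)"
 by (rule conv_eqI) (simp_all add: conv_apply it_measure_scale_right[OF bd_c] conv_outside)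

lemma it_dirac: "bd f k ==> x\<in>S ==> cmeas X w ==> it f (dirac X x) w = cint X (f x) w"
 unfolding it_def by (rule cint_dirac[OF _ bd_inner_bmf]) auto

lemma it_dirac_dirac: "bd f k ==> x\<in>S ==> y\<in>S ==> it f (dirac X x) (dirac X y) = f x y"
 by (simp add: it_dirac cm_dirac cint_dirac bd_bmf)

lemma conv_dirac: "x\<in>S ==> y\<in>S ==> conv (dirac X x) (dirac X y) = c x y"
 by (rule conv_eqI) (simp_all add: conv_apply it_dirac_dirac[OF bd_c] cm_outside[OF c_cm])

lemma conv_Mb:
 assumes "u\<in>Mb X" "w\<in>Mb X"
 shows "conv u w\<in>Mb X"
proof (rule MbI)
 note cm = Mb_cm[OF assms(1)] Mb_cm[OF assms(2)]
 note cc = conv_cm[OF cm]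
 show "cmeas X (conv u w)" by (rule cc)
 fix A eps assume "A\<in>bor X" and eps: "(0::real) < eps"
 then have A: "A <= S" by simp
 define k where "k = tv X u S + tv X w S + 1"
 have k: "0 < k" "tv X u S <= k" "tv X w S <= k" by (auto simp: k_def add_nonneg_pos)
 \<comment> \<open>Two tail terms of at most \<open>k * d\<close> each give \<open>eps / 2\<close>,
   strictly below \<open>eps\<close>.\<close>
 define d where "d = eps / (4 * k)"
 have d: "0 < d" using eps k by (simp add: d_def)
 obtain F where F: "finite F" "F <= S" "tv X u (S - F) < d" by (rule Mb_discreteE[OF assms(1) order_refl d])
 obtain G where G: "finite G" "G <= S" "tv X w (S - G) < d" by (rule Mb_discreteE[OF assms(2) order_refl d])
 \<comment> \<open>Products of points of \<open>F\<close> and \<open>G\<close> live on the finite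
   set \<open>T\<close>, so a set that avoids \<open>T\<close> receives mass only from the tails of
   \<open>u\<close> and \<open>w\<close>.\<close>
 define T where "T = (\<Union>x\<in>F. \<Union>y\<in>G. supp X (c x y))"
 have T: "finite T" "T <= S" using F G c_supp by (auto simp: T_def supp_def)
 have c0: "c x y B = 0" if "x\<in>F" "y\<in>G" "B <= S - T" for x y B
 proof -
  have xy: "x\<in>S" "y\<in>S" using that F G by auto
  let ?s = "supp X (c x y)"
  have "c x y {z} = 0" if "z\<in>S" "z\<notin>?s" for z using that by (simp add: supp_discrete[OF c_cm[OF xy]])
  then have "c x y = (%A. \<Sum>z\<in>?s. c x y {z} * dirac X z A)"
   using c_supp[OF xy] by (intro finite_supp_eq prob_Mb c_prob xy) (auto simp: supp_def)
  then have "c x y B = (\<Sum>z\<in>?s. c x y {z} * dirac X z B)" by (rule fun_cong)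
  also have "\<dots> = 0" using that by (intro sum.neutral) (auto simp: dirac_def T_def)
  finally show ?thesis .
 qed
 have "tv X (conv u w) (A - A\<inter>T) <= k * d + d * k"
 proof (rule tv_le)
  fix P assume P: "finite P" "disjoint P" "P <= bor X" "\<Union>P <= A - A\<inter>T"
  obtain f where b: "bd f 1" and le: "(\<Sum>B\<in>P. cmod (conv u w B)) <= cmod (it f u w)"
   and f: "!!x y. (!!B. B\<in>P ==> c x y B = 0) ==> f x y = 0"
   by (rule conv_sum_repr[OF cm P(1,2)]) (use P(3) in auto)
  have "f x y = 0" if "x\<in>F" "y\<in>G" for x y
   using P A that by (intro f c0) auto
  then have "cmod (it f u w) <= 1 * (tv X u S * tv X w (S - G) + tv X u (S - F) * tv X w S)"
   by (intro it_tail[OF b cm F(2) G(2)])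
  also have "\<dots> <= k * d + d * k"
   unfolding mult_1_left using F(3) G(3) k d by (intro add_mono mult_mono) auto
  finally show "(\<Sum>B\<in>P. cmod (conv u w B)) <= k * d + d * k" using le by simp
 qed
 also have "\<dots> < eps" using eps k by (simp add: d_def)
 finally show "\<exists>C. compactin X C\<and>C <= A\<and>tv X (conv u w) (A - C) < eps"
  using T by (intro exI[of _ "A\<inter>T"]) (auto simp: compactin_discrete_topology)
qed

end

section \<open>Bounded bilinear functionals of two measures\<close>

definition bilin :: "'a set \<Rightarrow> ('a cmeasure \<Rightarrow> 'a cmeasure \<Rightarrow> complex) \<Rightarrow> bool" where
 "bilin S \<Phi> \<longleftrightarrow> (let M = Mb (disc S); n = (%u. tv (disc S) u S) in
  (\<forall>u\<in>M. \<forall>u'\<in>M. \<forall>w\<in>M. \<Phi> (%A. u A + u' A) w = \<Phi> u w + \<Phi> u' w\<and>\<Phi> w (%A. u A + u' A) = \<Phi> w u + \<Phi> w u') \<and>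
  (\<forall>u\<in>M. \<forall>w\<in>M. \<forall>a. \<Phi> (%A. a * u A) w = a * \<Phi> u w\<and>\<Phi> u (%A. a * w A) = a * \<Phi> u w) \<and>
  (\<exists>k. \<forall>u\<in>M. \<forall>w\<in>M. cmod (\<Phi> u w) <= k * (n u * n w)))"

text \<open>Bounded linear functionals on a discrete space are determined by point masses; this is
  applied to the second argument with a point mass in the first, and then to the first
  argument.\<close>

lemma bilin_eq:
 assumes b: "bilin S \<Phi>" "bilin S \<Psi>" and m: "u\<in>Mb (disc S)" "w\<in>Mb (disc S)"
  and eq: "!!x y. x\<in>S ==> y\<in>S ==> \<Phi> (dirac (disc S) x) (dirac (disc S) y)
   = \<Psi> (dirac (disc S) x) (dirac (disc S) y)"
 shows "\<Phi> u w = \<Psi> u w"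
proof -
 let ?X = "disc S"
 have "\<exists>k. \<forall>u\<in>Mb ?X. \<forall>w\<in>Mb ?X. cmod (\<Phi> u w) <= k * (tv ?X u S * tv ?X w S)" if "bilin S \<Phi>" for \<Phi>
  using that unfolding bilin_def Let_def by (elim conjE)
 note ex = this
 obtain k where "\<forall>u\<in>Mb ?X. \<forall>w\<in>Mb ?X. cmod (\<Phi> u w) <= k * (tv ?X u S * tv ?X w S)" using ex[OF b(1)] by (elim exE)
 note k = this[rule_format]
 obtain l where "\<forall>u\<in>Mb ?X. \<forall>w\<in>Mb ?X. cmod (\<Psi> u w) <= l * (tv ?X u S * tv ?X w S)" using ex[OF b(2)] by (elim exE)
 note l = this[rule_format]
 have 1: "\<Phi> (dirac ?X x) w = \<Psi> (dirac ?X x) w" if x: "x\<in>S" for x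
 proof -
  have d: "dirac ?X x\<in>Mb ?X" using x by (simp add: Mb_dirac)
  show ?thesis
   by (rule linear_discrete_eq[OF m(2), of "\<Phi> (dirac ?X x)" "\<Psi> (dirac ?X x)" "k * tv ?X (dirac ?X x) S" "l * tv ?X (dirac ?X x) S"])
    (use b d k[OF d] l[OF d] eq[OF x] in \<open>simp_all add: bilin_def Let_def mult.assoc\<close>)
 qed
 show ?thesis
  by (rule linear_discrete_eq[OF m(1), of "%u. \<Phi> u w" "%u. \<Psi> u w" "k * tv ?X w S" "l * tv ?X w S"])
   (use b k[OF _ m(2)] l[OF _ m(2)] 1 m(2) in \<open>simp_all add: bilin_def Let_def mult_ac\<close>)
qed

lemma bilin_swap: assumes "bilin S \<Phi>" shows "bilin S (%u w. \<Phi> w u)"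
proof -
 let ?X = "disc S"
 obtain k where k: "\<forall>u\<in>Mb ?X. \<forall>w\<in>Mb ?X. cmod (\<Phi> u w) <= k * (tv ?X u S * tv ?X w S)"
  using assms unfolding bilin_def Let_def by (elim conjE exE)
 have "cmod (\<Phi> w u) <= k * (tv ?X u S * tv ?X w S)" if "u\<in>Mb ?X" "w\<in>Mb ?X" for u w
  using k[rule_format, OF that(2,1)] by (simp only: mult.commute)
 then show ?thesis using assms unfolding bilin_def Let_def by blast
qed

context discrete_kernel

begin

lemma bilinI:
 assumes L: "!!u w. u\<in>Mb X ==> w\<in>Mb X ==> L (%A. u A + w A) = L u + L w"
  "!!u a. u\<in>Mb X ==> L (%A. a * u A) = a * L u"
  "!!u. u\<in>Mb X ==> cmod (L u) <= k * tv X u S" "0 <= k"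
 shows "bilin S (%u w. L (conv u w))"
proof -
 have "cmod (L (conv u w)) <= k * (tv X u S * tv X w S)" if m: "u\<in>Mb X" "w\<in>Mb X" for u w
  using order_trans[OF L(3)[OF conv_Mb[OF m]] mult_left_mono[OF conv_tv[OF m[THEN Mb_cm]] L(4)]] .
 then show ?thesis unfolding bilin_def Let_def
  by (auto simp: conv_add_left conv_add_right conv_scale_left conv_scale_right Mb_cm conv_Mb L(1,2))
qed

lemma bilin_conv_apply: "A <= S ==> bilin S (%u w. conv u w A)"
proof (rule bilinI[of "%u. u A" 1])
 fix u assume A: "A <= S" and m: "u\<in>Mb X"
 have "cmod (u A) <= tv X u A" using A by (intro norm_le_tv Mb_cm m) simp
 also have "\<dots> <= tv X u S" by (rule tv_mono[OF Mb_cm[OF m] A])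
 finally show "cmod (u A) <= 1 * tv X u S" by simp
qed auto

lemma bilin_it: "bd f k ==> bilin S (it f)"
 unfolding bilin_def Let_def
 by (auto simp: it_measure_add_left it_measure_add_right it_measure_scale_left it_measure_scale_right Mb_cm
   intro!: exI[of _ k] order_trans[OF it_norm[of f k]])

lemma conv_mono_eq:
 assumes "bilin S \<Phi>" "u\<in>Mb X" "w\<in>Mb X" "A <= S" "!!x y. x\<in>S ==> y\<in>S ==> \<Phi> (dirac X x) (dirac X y) = c x y A"
 shows "conv u w A = \<Phi> u w"
 by (rule bilin_eq[OF bilin_conv_apply[OF assms(4)] assms(1-3)]) (simp add: assms(5) conv_dirac)

lemma conv_commute_if:
 assumes "!!x y. x\<in>S ==> y\<in>S ==> c x y = c y x" "u\<in>Mb X" "w\<in>Mb X"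
 shows "conv u w = conv w u"
proof (rule conv_eqI)
 fix A assume A: "A <= S"
 have "bilin S (%u w. conv w u A)"
  by (rule bilin_swap[OF bilin_conv_apply[OF A]])
 then show "conv u w A = conv w u A"
  by (rule conv_mono_eq[OF _ assms(2,3) A]) (simp add: conv_dirac assms(1)[of _ _])
qed (simp add: conv_outside)

text \<open>Both triple products are bounded and linear in each variable. \<open>bilin_eq\<close>
  reduces the first two variables to point masses, \<open>linear_discrete_eq\<close> the
  third.\<close>

lemma conv_assoc_if:
 assumes as: "!!x y z. x\<in>S ==> y\<in>S ==> z\<in>S ==> conv (c x y) (dirac X z) = conv (dirac X x) (c y z)"
  and m: "u\<in>Mb X" "w\<in>Mb X" "r\<in>Mb X"
 shows "conv (conv u w) r = conv u (conv w r)"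
proof (rule conv_eqI)
 fix A assume A: "A <= S"
 note B = bilin_conv_apply[OF A, unfolded bilin_def Let_def]
 have bound: "cmod (conv u w A) <= tv X u S * tv X w S" if "u\<in>Mb X" "w\<in>Mb X" for u w
 proof -
  note cc = conv_cm[OF that[THEN Mb_cm]]
  have "cmod (conv u w A) <= tv X (conv u w) A" using A by (intro norm_le_tv[OF cc]) simp
  also have "\<dots> <= tv X (conv u w) S" by (rule tv_mono[OF cc A])
  also have "\<dots> <= tv X u S * tv X w S" by (rule conv_tv[OF that[THEN Mb_cm]])
  finally show ?thesis .
 qed
 have b1: "cmod (conv (conv u w) r A) <= tv X u S * tv X w S * tv X r S" if "u\<in>Mb X" "w\<in>Mb X" "r\<in>Mb X" for u w r
  using bound[OF conv_Mb[OF that(1,2)] that(3)] mult_right_mono[OF conv_tv[OF that(1,2)[THEN Mb_cm]], of "tv X r S"]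
  by simp
 have b2: "cmod (conv u (conv w r) A) <= tv X u S * (tv X w S * tv X r S)" if "u\<in>Mb X" "w\<in>Mb X" "r\<in>Mb X" for u w r
  using bound[OF that(1) conv_Mb[OF that(2,3)]] mult_left_mono[OF conv_tv[OF that(2,3)[THEN Mb_cm]], of "tv X u S"]
  by simp
 note lin = Mb_cm conv_Mb conv_cm conv_add_left conv_add_right conv_scale_left conv_scale_right
 show "conv (conv u w) r A = conv u (conv w r) A"
 proof (rule bilin_eq[OF _ _ m(1,2)])
  show "bilin S (%u w. conv (conv u w) r A)" "bilin S (%u w. conv u (conv w r) A)"
   using b1[OF _ _ m(3)] b2[OF _ _ m(3)] m(3) unfolding bilin_def Let_def
   by (auto simp: lin mult_ac intro!: exI[of _ "tv X r S"])
  fix x y assume xy: "x\<in>S" "y\<in>S"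
  have d: "dirac X x\<in>Mb X" "dirac X y\<in>Mb X" using xy by (auto intro: Mb_dirac)
  show "conv (conv (dirac X x) (dirac X y)) r A = conv (dirac X x) (conv (dirac X y) r) A"
  proof (rule linear_discrete_eq[OF m(3)])
   show "cmod (conv (conv (dirac X x) (dirac X y)) r A) <= (tv X (dirac X x) S * tv X (dirac X y) S) * tv X r S"
    "cmod (conv (dirac X x) (conv (dirac X y) r) A) <= (tv X (dirac X x) S * tv X (dirac X y) S) * tv X r S"
    if "r\<in>Mb X" for r using b1[OF d that] b2[OF d that] by (simp_all add: mult.assoc)
   fix z assume "z\<in>S"
   then show "conv (conv (dirac X x) (dirac X y)) (dirac X z) A = conv (dirac X x) (conv (dirac X y) (dirac X z)) A"
    using as[OF xy] by (simp add: conv_dirac xy)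
  qed (simp_all add: lin d)
 qed
qed (simp add: conv_outside)

lemma cint_conv:
 assumes f: "!!x. x\<in>S ==> cmod (f x) <= k" "0 <= k" and m: "u\<in>Mb X" "w\<in>Mb X"
 shows "cint X f (conv u w) = it (%x y. cint X f (c x y)) u w"
  and "bd (%x y. cint X f (c x y)) k"
proof -
 have fb: "f\<in>bmf X" by (rule bmf_discreteI[OF f(1)])
 have "cmod (cint X f (c x y)) <= k" if "x\<in>S" "y\<in>S" for x y
  using cint_norm[OF c_cm[OF that] fb f(2)] f(1) c_tv[OF that] by simp
 then show bd: "bd (%x y. cint X f (c x y)) k" using f(2) by (simp add: bd_def)
 have b: "bilin S (%u w. cint X f (conv u w))"
 proof (rule bilinI[of "cint X f" k])
  show "cmod (cint X f u) <= k * tv X u S" if "u\<in>Mb X" for u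
   using cint_norm[OF Mb_cm[OF that] fb f(2)] f(1) by simp
 qed (auto simp: cint_madd cint_mscale Mb_cm fb f)
 show "cint X f (conv u w) = it (%x y. cint X f (c x y)) u w"
  by (rule bilin_eq[OF b bilin_it[OF bd] m]) (simp add: conv_dirac it_dirac_dirac[OF bd])
qed

lemma conv_Mb_pos:
 assumes "u\<in>Mb_pos X" "w\<in>Mb_pos X" shows "conv u w\<in>Mb_pos X"
proof (rule Mb_posI[OF conv_Mb[OF assms[THEN pos_Mb]]], unfold pos_measure_def, intro conjI allI)
 note pm = assms[THEN Mb_posD]
 note cm = pos_measureD(1)[OF pm(1)] pos_measureD(1)[OF pm(2)]
 show "cmeas X (conv u w)" by (rule conv_cm[OF cm])
 fix A show "conv u w A\<in>\<real>\<^sub>\<ge>\<^sub>0"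
 proof (cases "A <= S")
  case A: True
  have re: "c x y A = complex_of_real (Re (c x y A))" "0 <= Re (c x y A)" if "x\<in>S" "y\<in>S" for x y
   using pos_measureD(2,4)[OF Mb_posD[OF prob_pos[OF c_prob[OF that]]], of A] by auto
  let ?r = "%x y. complex_of_real (Re (c x y A))"
  have b: "bd ?r 1" using bd_c[OF A] re unfolding bd_def by (metis (no_types, lifting))
  have in1: "cint X (?r x) w\<in>\<real>\<^sub>\<ge>\<^sub>0" if "x\<in>S" for x
   by (rule cint_nonneg[OF pm(2) bd_bmf[OF b that]]) (use re that in auto)
  then have in2: "cint X (?r x) w = complex_of_real (Re (cint X (?r x) w))" "0 <= Re (cint X (?r x) w)" if "x\<in>S" for x
   using that by (auto simp: complex_nonneg_Reals_iff complex_eq_iff)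
  have "conv u w A = it ?r u w" unfolding conv_apply[OF A] by (rule it_cong) (rule re)
  also have "\<dots> = cint X (%x. complex_of_real (Re (cint X (?r x) w))) u"
   unfolding it_def by (rule cint_cong) (rule in2, simp)
  also have "\<dots>\<in>\<real>\<^sub>\<ge>\<^sub>0"
  proof (rule cint_nonneg[OF pm(1)])
   show "(%x. complex_of_real (Re (cint X (?r x) w)))\<in>bmf X"
    using bmf_cong[of X "%x. complex_of_real (Re (cint X (?r x) w))" "%x. cint X (?r x) w"] in2 bd_inner_bmf[OF b cm(2)] by simp
  qed (use in2 in simp)
  finally show ?thesis .
 qed (simp add: conv_outside)
qed

text \<open>The space need not be compact, so tightness is the issue. The mass outside a finite set
  is the integral of a bounded continuous function, hence stays small near the given pair; on a
  finite square the integral is a polynomial in the point masses.\<close>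

lemma conv_weakly_continuous:
 "continuous_map (prod_topology (weak_topology X) (weak_topology X)) (weak_topology X) (%(u, r). conv u r)"
proof (rule continuous_map_weak_topologyI)
 let ?T = "prod_topology (weak_topology X) (weak_topology X)"
 show "(%(u, r). conv u r) z\<in>Mb_pos X" if "z\<in>pts ?T" for z
  using that conv_Mb_pos by auto
 fix f assume "f\<in>bounded_continuous X"
 then have fb: "f\<in>bmf X" by (simp add: bmf_discrete_bc)
 obtain k where k: "0 <= k" "!!x. x\<in>S ==> cmod (f x) <= k" by (rule bmf_bound[OF fb]) (simp add: that)
 let ?f = "%x y. cint X f (c x y)"
 have ci: "continuous_map (weak_topology X) euclidean (cint X g)" if "g\<in>bmf X" for g
  using that by (intro continuous_map_cint) (simp add: bmf_discrete_bc)
 have c1: "cmap ?T (%z. cint X g (fst z))" if "g\<in>bmf X" for g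
  using continuous_map_compose[OF continuous_map_fst ci[OF that]] by (simp add: o_def)
 have c2: "cmap ?T (%z. cint X g (snd z))" if "g\<in>bmf X" for g
  using continuous_map_compose[OF continuous_map_snd ci[OF that]] by (simp add: o_def)
 have ind: "(%x. of_bool (x\<in>A))\<in>bmf X" for A :: "'a set" by (rule bmf_discreteI[of _ _ 1]) auto
 have indc: "cint X (%x. of_bool (x\<in>A)) u = u A" if "u\<in>Mb_pos X" "A <= S" for u A
  using that by (intro cint_indicator Mb_cm pos_Mb) auto
 have tvp: "tv X u A = cmod (u A)" if "u\<in>Mb_pos X" "A <= S" for u A
  using tv_positive[OF Mb_posD[OF that(1)], of A] pos_measureD(2,3)[OF Mb_posD[OF that(1)], of A] that(2)
  by (simp add: cmod_def)
 show "cmap ?T (%z. cint X f ((%(u, r). conv u r) z))"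
 proof (rule cont_local_approx)
  fix z and eps :: real assume z: "z\<in>pts ?T" and eps: "0 < eps"
  obtain u0 r0 where mn: "z = (u0, r0)" "u0\<in>Mb_pos X" "r0\<in>Mb_pos X" using z by auto
  define q where "q = cmod (u0 S) + cmod (r0 S) + 1"
  have q: "0 < q" "cmod (u0 S) < q" "cmod (r0 S) < q" by (auto simp: q_def add_nonneg_pos intro: add_pos_nonneg add_nonneg_pos)
  define d where "d = eps / (2 * (k + 1) * q)"
  have d: "0 < d" using eps k q by (simp add: d_def)
  obtain F1 where F1: "finite F1" "F1 <= S" "tv X u0 (S - F1) < d" by (rule Mb_discreteE[OF pos_Mb[OF mn(2)] order_refl d])
  obtain F2 where F2: "finite F2" "F2 <= S" "tv X r0 (S - F2) < d" by (rule Mb_discreteE[OF pos_Mb[OF mn(3)] order_refl d])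
  define F where "F = F1\<union>F2"
  have F: "finite F" "F <= S" "tv X u0 (S - F) < d" "tv X r0 (S - F) < d"
  proof -
   have "tv X u0 (S - F) <= tv X u0 (S - F1)" "tv X r0 (S - F) <= tv X r0 (S - F2)"
    by (auto intro!: tv_mono Mb_cm pos_Mb mn simp: F_def)
   then show "finite F" "F <= S" "tv X u0 (S - F) < d" "tv X r0 (S - F) < d" using F1 F2 by (auto simp: F_def)
  qed
  define I where "I A u = cint X (%x. of_bool (x\<in>A)) u" for A u
  \<comment> \<open>The neighbourhood keeps both tails outside \<open>F\<close> below
    \<open>d\<close> and both total masses below \<open>q\<close>.\<close>
  define W where "W = {w\<in>pts ?T. I (S - F) (fst w)\<in>ball 0 d}\<inter>{w\<in>pts ?T. I (S - F) (snd w)\<in>ball 0 d}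
   \<inter>{w\<in>pts ?T. I S (fst w)\<in>ball 0 q}\<inter>{w\<in>pts ?T. I S (snd w)\<in>ball 0 q}"
  define \<Psi> where "\<Psi> w = (\<Sum>a\<in>F. \<Sum>b\<in>F. ?f a b * (I {a} (fst w) * I {b} (snd w)))" for w
  have "openin ?T W" unfolding W_def I_def
   by (intro openin_Int openin_continuous_map_preimage[of _ euclidean] c1 c2 ind) (auto simp: open_openin[symmetric])
  moreover have "z\<in>W" using z mn F q tvp[OF mn(2), of "S - F"] tvp[OF mn(3), of "S - F"]
   by (simp add: W_def I_def indc[OF mn(2)] indc[OF mn(3)] del: Diff_iff)
  moreover have "cmap ?T \<Psi>"
   unfolding \<Psi>_def I_def using F(1) by (intro continuous_map_sum cont_cmult c1 c2 ind) auto
  moreover have "cmod (cint X f ((%(u, r). conv u r) w) - \<Psi> w) <= eps" if w: "w\<in>W" for w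
  proof -
   obtain u r where mn: "w = (u, r)" "u\<in>Mb_pos X" "r\<in>Mb_pos X" using w by (auto simp: W_def)
   note mb = mn(2,3)[THEN pos_Mb] and cm = mn(2,3)[THEN pos_Mb, THEN Mb_cm]
   have b: "bd ?f k" by (rule cint_conv(2)[OF k(2,1) mb])
   let ?g = "%x y. \<Sum>a\<in>F. \<Sum>b\<in>F. ?f a b * (of_bool (x = a) * of_bool (y = b))"
   have g: "?g x y = (if x\<in>F\<and>y\<in>F then ?f x y else 0)" for x y
   proof -
    have "?g x y = (\<Sum>a\<in>F. if a = x then (\<Sum>b\<in>F. if b = y then ?f x y else 0) else 0)"
     by (intro sum.cong refl) (auto intro!: sum.cong)
    then show ?thesis using F(1) by auto
   qed
   have i1: "bd (%x y. of_bool (x = a) * of_bool (y = b)) 1" for a b :: 'a by (simp add: bd_def)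
   have it1: "it (%x y. of_bool (x = a) * of_bool (y = b)) u r = I {a} u * I {b} r" for a b
    unfolding it_def I_def by (simp add: cint_scale[OF cm(2) ind[of "{b}", simplified]] mult.commute[of _ "cint X _ r"] cint_scale[OF cm(1) ind[of "{a}", simplified]])
   have bg: "bd ?g (\<Sum>a\<in>F. \<Sum>b\<in>F. cmod (?f a b) * 1)" by (intro bd_sum bd_scale i1)
   have b1: "bd (%x y. ?f a b * (of_bool (x = a) * of_bool (y = b))) (cmod (?f a b) * 1)" for a b by (rule bd_scale[OF i1])
   have b2: "bd (%x y. \<Sum>b\<in>F. ?f a b * (of_bool (x = a) * of_bool (y = b))) (\<Sum>b\<in>F. cmod (?f a b) * 1)" for a
    by (rule bd_sum[OF b1])
   have "it ?g u r = (\<Sum>a\<in>F. \<Sum>b\<in>F. it (%x y. ?f a b * (of_bool (x = a) * of_bool (y = b))) u r)"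
    by (simp only: it_sum[OF cm b2] it_sum[OF cm b1])
   then have "it ?g u r = \<Psi> w" by (simp add: it_scale[OF i1 cm] it1 \<Psi>_def mn(1))
   moreover have "it (%x y. ?f x y + (-1) * ?g x y) u r = it ?f u r + (-1) * it ?g u r"
    using it_add[OF b bd_scale[OF bg, of "-1"] cm] it_scale[OF bg cm, of "-1"] by simp
   ultimately have "cint X f (conv u r) - \<Psi> w = it (%x y. ?f x y + (-1) * ?g x y) u r"
    using cint_conv(1)[OF k(2,1) mb] by simp
   moreover have "cmod (it (%x y. ?f x y + (-1) * ?g x y) u r) <= k * (tv X u S * tv X r (S - F) + tv X u (S - F) * tv X r S)"
    by (rule it_tail[OF _ cm F(2,2)]) (use b k(1) in \<open>simp_all only: g, auto simp: bd_def\<close>)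
   moreover have "tv X u S * tv X r (S - F) + tv X u (S - F) * tv X r S <= q * d + d * q"
    using w q(1) d by (intro add_mono mult_mono) (auto simp: tvp[OF mn(2)] tvp[OF mn(3)] W_def I_def indc[OF mn(2)] indc[OF mn(3)] mn(1) simp del: Diff_iff intro: less_imp_le)
   ultimately have "cmod (cint X f (conv u r) - \<Psi> w) <= k * (q * d + d * q)"
    using k(1) by (smt (verit) mult_left_mono)
   also have "\<dots> <= (k + 1) * (q * d + d * q)" using q d by (intro mult_right_mono) auto
   also have "\<dots> = (2 * (k + 1) * q) * d" by (simp add: algebra_simps)
   also have "\<dots> = eps" using k(1) q(1) by (simp add: d_def)
   finally show ?thesis by (simp add: mn(1))
  qed
  ultimately show "\<exists>W \<Psi>. openin ?T W\<and>z\<in>W\<and>cmap ?T \<Psi> \<and>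
    (\<forall>w\<in>W. cmod (cint X f ((%(u, r). conv u r) w) - \<Psi> w) <= eps)" by blast
 qed
qed

theorem comm_hypergroupI:
 fixes K :: "'a hypergroup_data"
 assumes K: "htop K = X" "hconv K = conv"
  and as: "!!x y z. x\<in>S ==> y\<in>S ==> z\<in>S ==> conv (c x y) (dirac X z) = conv (dirac X x) (c y z)"
  and co: "!!x y. x\<in>S ==> y\<in>S ==> c x y = c y x"
  and u: "hunit K\<in>S" "!!x. x\<in>S ==> c (hunit K) x = dirac X x"
  and inv: "!!x. x\<in>S ==> hinv K x\<in>S" "!!x. x\<in>S ==> hinv K (hinv K x) = x"
   "!!x y z. x\<in>S ==> y\<in>S ==> z\<in>S ==> c (hinv K x) (hinv K y) {hinv K z} = c y x {z}"
  and us: "!!x y. x\<in>S ==> y\<in>S ==> c x y {hunit K} ~= 0 \<longleftrightarrow> x = hinv K y"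
 shows "comm_hypergroup K"
proof (unfold_locales, unfold K Mb_norm_def pconv_def measure_inv_def topspace_discrete_topology)
 have hm: "continuous_map X X (hinv K)" using inv(1) by (auto simp: Pi_iff)
 show "locally_compact_space X" by (rule locally_compact_space_discrete_topology)
 show "Hausdorff_space X" by (rule Hausdorff_space_discrete_topology)
 show "continuous_map (prod_topology (weak_topology X) (weak_topology X)) (weak_topology X) (%(r, s). conv r s)"
  by (rule conv_weakly_continuous)
 show "homeomorphic_maps X X (hinv K) (hinv K)" using hm inv by (simp add: homeomorphic_maps_def)
 have ne: "supp X (c x y) ~= {}" if "x\<in>S" "y\<in>S" for x y
 proof
  assume "supp X (c x y) = {}"
  then have "c x y = (%A. 0)"
   using that by (intro Mb_discrete_eqI[OF prob_Mb[OF c_prob[OF that]] Mb_zero]) (auto simp: supp_discrete[OF c_cm[OF that]])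
  then show False using prob_top[OF c_prob[OF that]] by simp
 qed
 show "continuous_map (prod_topology X X) (Michael_topology X) (%(x, y). supp X (conv (dirac X x) (dirac X y)))"
  unfolding prod_topology_discrete_topology[symmetric]
  by (rule continuous_map_MichaelI)
   (auto simp: conv_dirac compactin_discrete_topology c_supp ne, auto simp: supp_def)
next
 fix x y assume xy: "x\<in>S" "y\<in>S"
 show "conv (dirac X x) (dirac X y)\<in>M_prob X" using xy by (simp add: conv_dirac c_prob)
 show "compactin X (supp X (conv (dirac X x) (dirac X y)))"
  using c_supp[OF xy] by (auto simp: conv_dirac xy compactin_discrete_topology) (auto simp: supp_def)
 show "(hunit K\<in>supp X (conv (dirac X x) (dirac X y))) = (x = hinv K y)"
  using us[OF xy] u(1) by (simp add: conv_dirac xy supp_discrete[OF c_cm[OF xy]])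
 have hm: "continuous_map X X (hinv K)" using inv(1) by (auto simp: Pi_iff)
 have "c (hinv K x) (hinv K y) = push X X (hinv K) (c y x)"
 proof (rule Mb_discrete_eqI[OF prob_Mb[OF c_prob] Mb_push[OF prob_Mb[OF c_prob] hm]])
  fix w assume w: "w\<in>S"
  have "hinv K -` {w}\<inter>S = {hinv K w}" using inv(1,2) w by auto
  then show "c (hinv K x) (hinv K y) {w} = push X X (hinv K) (c y x) {w}"
   using inv(3)[OF xy inv(1)[OF w]] inv(2)[OF w] w by (simp add: push_apply)
 qed (use xy inv in auto)
 then show "conv (dirac X (hinv K x)) (dirac X (hinv K y)) = push X X (hinv K) (conv (dirac X y) (dirac X x))"
  using xy inv by (simp add: conv_dirac)
next
 show "conv (dirac X x) (dirac X (hunit K)) = dirac X x" if "x\<in>S" for x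
  by (metis conv_dirac[OF that u(1)] co[OF u(1) that] u(2)[OF that])
qed (use u conv_tv in \<open>auto simp: conv_Mb conv_add_left conv_add_right conv_scale_left conv_scale_right conv_dirac Mb_cm
  intro: conv_assoc_if[OF as] conv_commute_if[OF co]\<close>)

end

section \<open>Characters and the dual of a discrete hypergroup\<close>

lemma topspace_compact_convergence [simp]: "pts (compact_convergence_topology X C) = C"
proof -
 have "openin (compact_convergence_topology X C) C"
  unfolding openin_compact_convergence_topology by (auto intro!: exI[of _ "{}"] exI[of _ 1])
 then have "C <= pts (compact_convergence_topology X C)" by (rule openin_subset)
 moreover have "pts (compact_convergence_topology X C) <= C"
  using openin_topspace[of "compact_convergence_topology X C"] unfolding openin_compact_convergence_topology by (rule conjunct1)
 ultimately show ?thesis by (rule antisym[rotated])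
qed

lemma continuous_map_evaluation:
 assumes "x\<in>pts X"
 shows "continuous_map (compact_convergence_topology X C) euclidean (%f. f x)"
 unfolding continuous_map_def
proof (intro conjI allI impI)
 fix U :: "complex set" assume "openin euclidean U"
 then have U: "open U" by (simp only: open_openin)
 show "openin (compact_convergence_topology X C) {f\<in>pts (compact_convergence_topology X C). f x\<in>U}"
  unfolding openin_compact_convergence_topology topspace_compact_convergence
 proof (intro conjI ballI)
  fix f assume f: "f\<in>{f\<in>C. f x\<in>U}"
  then obtain eps where eps: "0 < eps" "!!z. dist z (f x) < eps ==> z\<in>U" using U unfolding open_dist by blast
  then show "\<exists>D eps. compactin X D\<and>0 < eps\<and>{g\<in>C. \<forall>x\<in>D. dist (f x) (g x) < eps} <= {f\<in>C. f x\<in>U}"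
   using assms by (intro exI[of _ "{x}"] exI[of _ eps]) (auto simp: dist_commute)
 qed auto
qed simp

lemma Mb_functional_sum:
 assumes add: "!!u w. u\<in>Mb X ==> w\<in>Mb X ==> L (%A. u A + w A) = L u + L w"
  and scale: "!!u a. u\<in>Mb X ==> L (%A. a * u A) = a * L u"
  and P: "finite P" "!!i. i\<in>P ==> u i\<in>Mb X"
 shows "L (%A. \<Sum>i\<in>P. a i * u i A) = (\<Sum>i\<in>P. a i * (L (u i) :: complex))"
 using P
proof (induction P)
 case empty
 then show ?case using scale[OF Mb_zero, of 0] by simp
next
 case (insert i P)
 then show ?case
  using add[OF Mb_scale[of "u i" X "a i"] Mb_sum[of P "%i A. a i * u i A" X]] scale[of "u i" "a i"] by (simp add: Mb_scale)
qed

lemma supp_dirac: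
 assumes "Hausdorff_space X" "x\<in>pts X" shows "supp X (dirac X x) = {x}"
proof -
 have 0: "total_variation X (dirac X x) A = 0 \<longleftrightarrow> tv X (dirac X x) A = 0" for A
  by (metis cm_dirac enn2real_0 ennreal_0 tv_finite)
 have t: "tv X (dirac X x) U = of_bool (x\<in>U)" if "openin X U" for U
  using tv_positive[OF positive_measure_dirac open_bor[OF that], of x] open_bor[OF that] by (auto simp: dirac_def)
 have "\<exists>U. openin X U\<and>y\<in>U\<and>x\<notin>U" if "y\<in>pts X" "y ~= x" for y
  using assms that unfolding Hausdorff_space_def disjnt_def by (metis disjoint_iff)
 then show ?thesis unfolding supp_def 0 using t assms(2) by auto
qed

context hypergroup

begin

lemma character_unit: assumes "y\<in>characters K" shows "y (hunit K) = 1"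
proof -
 have b: "y\<in>bmf (htop K)" using assms bc_bmf by (auto simp: characters_def)
 obtain x where x: "x\<in>carrier_of K" "y x ~= 0" using assms by (auto simp: characters_def)
 have "y x * y (hunit K) = cint (htop K) y (pconv K x (hunit K))"
  using assms x(1) unit_carrier by (simp add: characters_def)
 also have "\<dots> = y x" by (simp add: unit_right[OF x(1)] cint_dirac[OF x(1) b])
 finally show ?thesis using x(2) by simp
qed

text \<open>With \<open>s\<close> the supremum of the modulus, multiplicativity on
  \<open>pconv K x x\<close> gives that the square of the modulus at \<open>x\<close> is at most
  \<open>s\<close>. Hence \<open>s\<close> is at most its square root, and so at most 1.\<close>

lemma character_norm: assumes c: "y\<in>characters K" and x: "x\<in>carrier_of K" shows "cmod (y x) <= 1"
proof -
 have b: "y\<in>bmf (htop K)" using c bc_bmf by (auto simp: characters_def)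
 define s where "s = (SUP x\<in>carrier_of K. cmod (y x))"
 obtain q where q: "!!x. x\<in>carrier_of K ==> cmod (y x) <= q" by (rule bmf_bound[OF b]) (rule that)
 then have bd: "bdd_above ((%x. cmod (y x)) ` carrier_of K)" by (auto simp: bdd_above_def)
 have le: "cmod (y x) <= s" if "x\<in>carrier_of K" for x unfolding s_def by (rule cSUP_upper[OF that bd])
 have s0: "0 <= s" using le[OF x] norm_ge_zero[of "y x"] by linarith
 have "cmod (y x) <= sqrt s" if x: "x\<in>carrier_of K" for x
 proof -
  note p = pconv_prob[OF x x]
  have "cmod (y x * y x) = cmod (cint (htop K) y (pconv K x x))" using c x by (simp add: characters_def)
  also have "\<dots> <= s * tv (htop K) (pconv K x x) (carrier_of K)"
   by (rule cint_norm[OF Mb_cm[OF prob_Mb[OF p]] b s0 le])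
  also have "tv (htop K) (pconv K x x) (carrier_of K) = 1"
   using tv_positive[OF Mb_posD[OF prob_pos[OF p]] bor_top] prob_top[OF p] by simp
  finally show ?thesis by (intro real_le_rsqrt) (simp add: norm_mult power2_eq_square)
 qed
 then have "s <= sqrt s" unfolding s_def using x by (intro cSUP_least) auto
 then have "s * s <= s" using power_mono[of s "sqrt s" 2] s0 by (simp add: power2_eq_square)
 then have "s <= 1" using mult_strict_left_mono[of 1 s s] by (cases "1 < s") auto
 then show ?thesis using le[OF x] by linarith
qed

end

locale discrete_comm_hypergroup = comm_hypergroup H for H :: "'a hypergroup_data" +
 assumes discrete: "discrete_hypergroup H"

begin

abbreviation S :: "'a set" where "S \<equiv> carrier_of H"

definition P :: "'a \<Rightarrow> 'a \<Rightarrow> 'a \<Rightarrow> complex" where "P x y z = pconv H x y {z}"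

definition N :: "'a \<Rightarrow> 'a \<Rightarrow> 'a set" where "N x y = supp (htop H) (pconv H x y)"

lemma htop_eq: "htop H = disc S"
 using discrete by (simp add: discrete_hypergroup_def)

lemma pconv_Mb: "x\<in>S ==> y\<in>S ==> pconv H x y\<in>Mb (disc S)"
 using prob_Mb[OF pconv_prob] htop_eq by metis

lemma compactin_iff: "compactin (htop H) C \<longleftrightarrow> C <= S\<and>finite C"
 by (metis compactin_discrete_topology htop_eq)

lemma N_finite: "x\<in>S ==> y\<in>S ==> finite (N x y)" and N_subset: "x\<in>S ==> y\<in>S ==> N x y <= S"
 using compact_supp[of x y, unfolded N_def[symmetric]] by (auto simp: compactin_iff)

lemma bmf_iff: "f\<in>bmf (htop H) \<longleftrightarrow> f\<in>bmf (disc S)"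
 using htop_eq by metis

lemma N_eq: "x\<in>S ==> y\<in>S ==> N x y = {z\<in>S. P x y z ~= 0}"
 using supp_discrete[OF Mb_cm[OF pconv_Mb]] unfolding htop_eq[symmetric] N_def P_def .

lemma P_nonneg: "x\<in>S ==> y\<in>S ==> P x y z\<in>\<real>\<^sub>\<ge>\<^sub>0"
 using Mb_posD[OF prob_pos[OF pconv_prob]] by (auto simp: P_def pos_measure_def)

lemma cint_pconv: "x\<in>S ==> y\<in>S ==> f\<in>bmf (htop H) ==> cint (htop H) f (pconv H x y) = (\<Sum>z\<in>N x y. P x y z * f z)"
proof -
 assume xy: "x\<in>S" "y\<in>S" and f: "f\<in>bmf (htop H)"
 have "cint (disc S) f (pconv H x y) = (\<Sum>z\<in>N x y. pconv H x y {z} * f z)"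
  by (rule cint_finite_supp[OF pconv_Mb[OF xy] N_finite[OF xy] N_subset[OF xy]]) (use f bmf_iff N_eq[OF xy] P_def in auto)
 then show ?thesis unfolding P_def using htop_eq by metis
qed

lemma inv_closed: "x\<in>S ==> hinv H x\<in>S" and inv_inv: "x\<in>S ==> hinv H (hinv H x) = x"
 using inv_homeomorphism by (auto simp: homeomorphic_maps_def continuous_map_def)

lemma P_unit: "x\<in>S ==> y\<in>S ==> P x y (hunit H) ~= 0 \<longleftrightarrow> x = hinv H y"
 using unit_in_supp_iff[of x y] unit_carrier N_eq[of x y] by (auto simp: N_def)

lemma P_inv: assumes "x\<in>S" "y\<in>S" "z\<in>S" shows "P (hinv H x) (hinv H y) (hinv H z) = P y x z"
proof -
 have "hinv H -` {hinv H z}\<inter>S = {z}" using assms inv_inv by auto metis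
 moreover have "{hinv H z}\<in>bor (htop H)" using bor_discrete[of S] htop_eq inv_closed[OF assms(3)] by (metis PowI empty_subsetI insert_subset)
 ultimately show ?thesis
  unfolding P_def inv_pconv[OF assms(1,2)] measure_inv_def by (simp add: push_apply)
qed

text \<open>With the bound 1 built in and the value 1 at the unit in place of being nonzero,
  characters are the points of a product of discs satisfying equations that involve finitely many
  coordinates each.\<close>

lemma char_iff: "j\<in>characters H \<longleftrightarrow> j\<in>(\<Pi>\<^sub>E x\<in>S. cball 0 1)\<and>j (hunit H) = 1 \<and>
  (\<forall>x\<in>S. \<forall>y\<in>S. (\<Sum>z\<in>N x y. P x y z * j z) = j x * j y)\<and>(\<forall>x\<in>S. j (hinv H x) = cnj (j x))"
proof
 assume c: "j\<in>characters H"
 then have "j\<in>bmf (htop H)" "j\<in>extensional S" using bc_bmf by (auto simp: characters_def)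
 then show "j\<in>(\<Pi>\<^sub>E x\<in>S. cball 0 1)\<and>j (hunit H) = 1 \<and>
  (\<forall>x\<in>S. \<forall>y\<in>S. (\<Sum>z\<in>N x y. P x y z * j z) = j x * j y)\<and>(\<forall>x\<in>S. j (hinv H x) = cnj (j x))"
  using c character_unit[OF c] character_norm[OF c] by (auto simp: characters_def PiE_def cint_pconv)
next
 assume c: "j\<in>(\<Pi>\<^sub>E x\<in>S. cball 0 1)\<and>j (hunit H) = 1 \<and>
  (\<forall>x\<in>S. \<forall>y\<in>S. (\<Sum>z\<in>N x y. P x y z * j z) = j x * j y)\<and>(\<forall>x\<in>S. j (hinv H x) = cnj (j x))"
 then have n: "!!x. x\<in>S ==> cmod (j x) <= 1" by (auto simp: PiE_iff)
 have b: "j\<in>bmf (htop H)" unfolding bmf_iff by (rule bmf_discreteI[OF n])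
 moreover have "j\<in>bounded_continuous (htop H)"
  using b bmf_discrete_bc[of S] htop_eq by metis
 ultimately show "j\<in>characters H"
  using c unit_carrier unfolding characters_def by (auto simp: cint_pconv PiE_def intro!: bexI[of _ "hunit H"])
qed

lemma htop_dual: "htop (dual H) = compact_convergence_topology (htop H) (characters H)"
 by (simp add: dual_def dual_with_def)

lemma topspace_dual [simp]: "pts (htop (dual H)) = characters H"
 by (simp add: htop_dual)

text \<open>The characters form a closed subset of a product of closed discs. Compact subsets of a
  discrete space are finite, so the pointwise topology already controls compact convergence and its
  compactness carries over.\<close>

lemma compact_space_dual: "compact_space (htop (dual H))"
proof -
 let ?Q = "product_topology (%_. euclidean :: complex topology) S"
 have c: "cmap ?Q (%j. j x)" if "x\<in>S" for x
  using continuous_map_product_projection[of x S "%_. euclidean"] that by simp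
 have ccl: "closedin ?Q {j\<in>pts ?Q. f j = g j}" if "cmap ?Q f" "cmap ?Q g"
  for f g :: "_ \<Rightarrow> complex" by (rule closedin_continuous_maps_eq[OF Hausdorff_space_euclidean that])
 have cc: "cmap ?Q (%j. cnj (j x))" if "x\<in>S" for x
  using continuous_map_compose[OF c[OF that], of euclidean cnj] by (simp add: o_def continuous_on_cnj continuous_on_id)
 have cs: "cmap ?Q (%j. \<Sum>z\<in>N x y. P x y z * j z)" if "x\<in>S" "y\<in>S" for x y
  using N_finite[OF that] N_subset[OF that] by (intro continuous_map_sum cont_cmult c) auto
 let ?\<F> = "{{j\<in>pts ?Q. j (hunit H) = 1}}\<union>(%(x, y). {j\<in>pts ?Q. (\<Sum>z\<in>N x y. P x y z * j z) = j x * j y}) ` (S\<times>S)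
  \<union>(%x. {j\<in>pts ?Q. j (hinv H x) = cnj (j x)}) ` S"
 have F1: "closedin ?Q {j\<in>pts ?Q. j (hunit H) = 1}" by (rule ccl[OF c[OF unit_carrier]]) simp
 have F2: "closedin ?Q {j\<in>pts ?Q. (\<Sum>z\<in>N x y. P x y z * j z) = j x * j y}" if "x\<in>S" "y\<in>S" for x y
  by (rule ccl[OF cs[OF that] cont_cmult[OF c c]]) (rule that)+
 have F3: "closedin ?Q {j\<in>pts ?Q. j (hinv H x) = cnj (j x)}" if "x\<in>S" for x
  by (rule ccl[OF c[OF inv_closed[OF that]] cc[OF that]])
 have "closedin ?Q A" if "A\<in>?\<F>" for A
  using that by (elim UnE imageE insertE emptyE SigmaE) (simp_all only: prod.case F1 F2 F3)
 then have "closedin ?Q (\<Inter>?\<F>)" by (intro closedin_Inter) (simp, assumption)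
 moreover have "compactin ?Q (\<Pi>\<^sub>E x\<in>S. cball 0 1)" by (simp add: compactin_PiE)
 ultimately have "compactin ?Q (\<Inter>?\<F>\<inter>(\<Pi>\<^sub>E x\<in>S. cball 0 1))" by (rule closed_Int_compactin)
 moreover have "\<Inter>?\<F>\<inter>(\<Pi>\<^sub>E x\<in>S. cball 0 1) = characters H"
 proof (intro set_eqI iffI)
  fix j assume a: "j\<in>\<Inter>?\<F>\<inter>(\<Pi>\<^sub>E x\<in>S. cball 0 1)"
  have "j (hunit H) = 1" using a by blast
  moreover have "(\<Sum>z\<in>N x y. P x y z * j z) = j x * j y" if "x\<in>S" "y\<in>S" for x y using a that by blast
  moreover have "j (hinv H x) = cnj (j x)" if "x\<in>S" for x using a that by blast
  ultimately show "j\<in>characters H" using a by (simp add: char_iff)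
 next
  fix j assume a: "j\<in>characters H"
  then have "j\<in>(\<Pi>\<^sub>E x\<in>S. cball 0 1)" "j\<in>pts ?Q" by (auto simp: char_iff PiE_iff)
  then show "j\<in>\<Inter>?\<F>\<inter>(\<Pi>\<^sub>E x\<in>S. cball 0 1)" using a unfolding char_iff by blast
 qed
 ultimately have 1: "compactin ?Q (characters H)" by simp
 have "continuous_map (subtopology ?Q (characters H)) (htop (dual H)) id"
  unfolding continuous_map_def
 proof (intro conjI allI impI)
  have ct: "characters H <= pts ?Q" using compactin_subset_topspace[OF 1] .
  then show "id\<in>pts (subtopology ?Q (characters H)) \<rightarrow> pts (htop (dual H))" by auto
  fix W assume W: "openin (htop (dual H)) W"
  then have WS: "W <= characters H" using openin_subset by fastforce
  have "openin (subtopology ?Q (characters H)) W"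
  proof (subst openin_subopen, intro ballI)
   fix f assume f: "f\<in>W"
   obtain C eps where C: "compactin (htop H) C" "0 < eps" "{g\<in>characters H. \<forall>x\<in>C. dist (f x) (g x) < eps} <= W"
    using W f unfolding htop_dual openin_compact_convergence_topology by blast
   have fC: "finite C" "C <= S" using C(1) by (auto simp: compactin_iff)
   let ?V = "pts ?Q\<inter>(\<Inter>x\<in>C. {g\<in>pts ?Q. g x\<in>ball (f x) eps})"
   have "openin ?Q ?V"
   proof (cases "C = {}")
    case False
    have "openin ?Q (\<Inter>x\<in>C. {g\<in>pts ?Q. g x\<in>ball (f x) eps})"
    proof (rule openin_INT2[OF fC(1) False])
     fix x assume "x\<in>C"
     then show "openin ?Q {g\<in>pts ?Q. g x\<in>ball (f x) eps}"
      using fC by (intro openin_continuous_map_preimage[OF c]) (auto simp: open_openin[symmetric])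
    qed
    then show ?thesis by (rule openin_Int[OF openin_topspace])
   qed (use openin_topspace[of ?Q] in simp)
   then have "openin (subtopology ?Q (characters H)) (?V\<inter>characters H)" by (rule openin_subtopology_Int)
   moreover have "f\<in>?V\<inter>characters H" using f WS ct C(2) by auto
   moreover have "?V\<inter>characters H <= W" using C(3) by auto
   ultimately show "\<exists>T. openin (subtopology ?Q (characters H)) T\<and>f\<in>T\<and>T <= W" by blast
  qed
  moreover have "{x\<in>pts (subtopology ?Q (characters H)). id x\<in>W} = W" using WS ct by auto
  ultimately show "openin (subtopology ?Q (characters H)) {x\<in>pts (subtopology ?Q (characters H)). id x\<in>W}" by simp
 qed
 moreover have "compactin (subtopology ?Q (characters H)) (characters H)" using 1 by (simp add: compactin_subtopology)
 ultimately have "compactin (htop (dual H)) (id ` characters H)" by (rule image_compactin[rotated])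
 then show ?thesis by (simp add: compact_space_def)
qed

end

section \<open>The dual of a discrete strong hypergroup\<close>

locale discrete_strong = discrete_comm_hypergroup H for H :: "'a hypergroup_data" +
 assumes strong: "strong H"

begin

abbreviation X :: "('a \<Rightarrow> complex) topology" where "X \<equiv> htop (dual H)"

abbreviation conv where "conv \<equiv> hconv (dual H)"

lemma ex_dual_convolution: obtains c where "dual H = dual_with H c" "dual_convolution H c"
proof -
 have "\<exists>c. dual_convolution H c" using strong by (simp only: strong_def)
 then have "dual_convolution H (SOME c. dual_convolution H c)" by (rule someI_ex)
 then show thesis by (rule that[OF dual_def])
qed

sublocale D: hypergroup "dual H"
 by (rule ex_dual_convolution) (simp only: dual_convolution_def)

lemma dual_product:
 "y\<in>characters H ==> y'\<in>characters H ==> x\<in>S ==> y x * y' x = cint X (%s. s x) (pconv (dual H) y y')"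
 by (rule ex_dual_convolution) (simp add: dual_convolution_def)

lemma hunit_dual: "hunit (dual H) = (\<lambda>x\<in>S. 1)" and hinv_dual: "hinv (dual H) = (%y. \<lambda>x\<in>S. cnj (y x))"
 by (simp_all add: dual_def dual_with_def)

sublocale trig_system X S "%h \<chi>. \<chi> h"
proof
 show "compact_space X" by (rule compact_space_dual)
 show "Hausdorff_space X" by (rule D.Hausdorff)
 show "cmap X (%\<chi>. \<chi> h)" if "h\<in>S" for h
  unfolding htop_dual by (rule continuous_map_evaluation[OF that])
 show "\<exists>d\<in>S. \<forall>x\<in>pts X. x d = 1" using unit_carrier by (auto simp: char_iff)
 show "\<exists>d'\<in>S. \<forall>x\<in>pts X. x d' = cnj (x d)" if "d\<in>S" for d
  by (rule bexI[of _ "hinv H d"]) (use that inv_closed[OF that] in \<open>auto simp: char_iff\<close>)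
 show "\<exists>F a. finite F\<and>F <= S\<and>(\<forall>x\<in>pts X. x d * x d' = (\<Sum>k\<in>F. a k * x k))" if "d\<in>S" "d'\<in>S" for d d'
  using that N_finite[OF that] N_subset[OF that] by (intro exI[of _ "N d d'"] exI[of _ "P d d'"]) (auto simp: char_iff)
 show "\<exists>d\<in>S. x d ~= y d" if "x\<in>pts X" "y\<in>pts X" "x ~= y" for x y
  using that extensionalityI[of x S y] by (auto simp: characters_def)
qed

lemma conv_pos: "u\<in>Mb_pos X ==> w\<in>Mb_pos X ==> conv u w\<in>Mb_pos X"
 using continuous_map_image_subset_topspace[OF D.conv_weakly_continuous] by auto

text \<open>The product formula for points extends to all measures, since combinations of point measures are
 weakly dense and the convolution is weakly continuous.\<close>

lemma tr_conv_pos: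
 assumes h: "h\<in>S" and mn: "u\<in>Mb_pos X" "w\<in>Mb_pos X"
 shows "cint X (%y. y h) (conv u w) = cint X (%y. y h) u * cint X (%y. y h) w"
proof (rule ccontr)
 let ?T = "prod_topology (weak_topology X) (weak_topology X)"
 let ?t = "cint X (%y. y h)"
 \<comment> \<open>The defect \<Phi> of the product formula is weakly continuous. If it were nonzero
   at one pair, it would be nonzero on a product of open sets, and these contain combinations of
   point masses, where the formula holds by bilinearity.\<close>
 define \<Phi> where "\<Phi> z = ?t ((%(u, w). conv u w) z) - ?t (fst z) * ?t (snd z)" for z
 assume "?t (conv u w) ~= ?t u * ?t w"
 then have nz: "\<Phi> (u, w) ~= 0" by (simp add: \<Phi>_def)
 note ct = continuous_map_cint[OF compact_bc[OF compact_space e_cont[OF h]]]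
 have "cmap ?T \<Phi>"
  unfolding \<Phi>_def using continuous_map_compose[OF D.conv_weakly_continuous ct]
   continuous_map_compose[OF continuous_map_fst ct] continuous_map_compose[OF continuous_map_snd ct]
  by (intro continuous_map_diff cont_cmult) (auto simp: o_def)
 then have "openin ?T {z\<in>pts ?T. \<Phi> z\<in>- {0}}"
  by (rule openin_continuous_map_preimage) (rule open_openin[THEN iffD1, OF open_Compl[OF closed_singleton]])
 moreover have "(u, w)\<in>{z\<in>pts ?T. \<Phi> z\<in>- {0}}" using nz mn by simp
 ultimately have "\<exists>U V. openin (weak_topology X) U\<and>openin (weak_topology X) V\<and>u\<in>U\<and>w\<in>V\<and>U\<times>V <= {z\<in>pts ?T. \<Phi> z\<in>- {0}}"
  by (rule iffD1[OF openin_prod_topology_alt, rule_format])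
 then obtain U V where UV: "openin (weak_topology X) U" "openin (weak_topology X) V" "u\<in>U" "w\<in>V"
  "U\<times>V <= {z\<in>pts ?T. \<Phi> z\<in>- {0}}" by (elim exE conjE)
 obtain I :: "('a \<Rightarrow> complex) set set" and s a where I: "finite I" "!!i. i\<in>I ==> s i\<in>pts X"
  "!!i. i\<in>I ==> a i\<in>\<real>\<^sub>\<ge>\<^sub>0" "(%A. \<Sum>i\<in>I. a i * dirac X (s i) A)\<in>U"
  by (rule dirac_combination_dense[OF UV(1,3)]) (rule that)
 obtain J :: "('a \<Rightarrow> complex) set set" and r b where J: "finite J" "!!i. i\<in>J ==> r i\<in>pts X"
  "!!i. i\<in>J ==> b i\<in>\<real>\<^sub>\<ge>\<^sub>0" "(%A. \<Sum>i\<in>J. b i * dirac X (r i) A)\<in>V"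
  by (rule dirac_combination_dense[OF UV(2,4)]) (rule that)
 let ?u = "%A. \<Sum>i\<in>I. a i * dirac X (s i) A" and ?w = "%A. \<Sum>i\<in>J. b i * dirac X (r i) A"
 have dI: "!!i. i\<in>I ==> dirac X (s i)\<in>Mb X" and dJ: "!!i. i\<in>J ==> dirac X (r i)\<in>Mb X" using Mb_dirac[OF I(2)] Mb_dirac[OF J(2)] by blast+
 have m: "?u\<in>Mb X" "?w\<in>Mb X" using dI dJ by (auto intro!: Mb_sum Mb_scale)
 have cadd: "?t (%A. u A + w A) = ?t u + ?t w" if "u\<in>Mb X" "w\<in>Mb X" for u w
  using that by (intro cint_madd Mb_cm bmf_e h)
 have csc: "?t (%A. a * u A) = a * ?t u" if "u\<in>Mb X" for u a
  using that by (intro cint_mscale Mb_cm bmf_e h)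
 have tp: "?t (conv (dirac X y) (dirac X y')) = y h * y' h" if "y\<in>pts X" "y'\<in>pts X" for y y'
  using dual_product[of y y' h] that h by (simp add: pconv_def)
 have 1: "?t (conv (dirac X y) ?w) = (\<Sum>j\<in>J. b j * (y h * r j h))" if x: "y\<in>pts X" for y
  using Mb_functional_sum[of X "%w. ?t (conv (dirac X y) w)", OF _ _ J(1) dJ, of "%i. i" b] J(2) x
  by (simp add: D.conv_add_right D.conv_scale_right Mb_dirac cadd csc D.conv_closed tp)
 have "?t (conv ?u ?w) = (\<Sum>i\<in>I. a i * ?t (conv (dirac X (s i)) ?w))"
  by (rule Mb_functional_sum[of X "%u. ?t (conv u ?w)", OF _ _ I(1) dI])
   (use m in \<open>simp_all add: D.conv_add_left D.conv_scale_left cadd csc D.conv_closed\<close>)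
 also have "\<dots> = (\<Sum>i\<in>I. a i * (\<Sum>j\<in>J. b j * (s i h * r j h)))"
  by (intro sum.cong refl arg_cong2[of _ _ _ _ "(*)"] 1 I(2))
 also have "\<dots> = (\<Sum>i\<in>I. a i * s i h) * (\<Sum>j\<in>J. b j * r j h)"
  unfolding sum_product by (intro sum.cong refl) (simp only: sum_distrib_left mult_ac)
 also have "(\<Sum>i\<in>I. a i * s i h) = (\<Sum>i\<in>I. a i * ?t (dirac X (s i)))"
  by (intro sum.cong refl arg_cong2[of _ _ _ _ "(*)"] cint_dirac[symmetric] I(2) bmf_e h)
 also have "\<dots> = ?t ?u" by (rule Mb_functional_sum[of X ?t, OF cadd csc I(1) dI, symmetric])
 also have "(\<Sum>j\<in>J. b j * r j h) = (\<Sum>j\<in>J. b j * ?t (dirac X (r j)))"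
  by (intro sum.cong refl arg_cong2[of _ _ _ _ "(*)"] cint_dirac[symmetric] J(2) bmf_e h)
 also have "\<dots> = ?t ?w" by (rule Mb_functional_sum[of X ?t, OF cadd csc J(1) dJ, symmetric])
 finally have "\<Phi> (?u, ?w) = 0" by (simp only: \<Phi>_def prod.case fst_conv snd_conv diff_self)
 then show False using UV(5) I(4) J(4) by auto
qed

sublocale trig_conv X S "%h \<chi>. \<chi> h" conv
proof
 show "conv \<mu> \<nu>\<in>Mb X" if "\<mu>\<in>Mb X" "\<nu>\<in>Mb X" for \<mu> \<nu> by (rule D.conv_closed[OF that])
 show "conv \<mu> \<nu>\<in>Mb_pos X" if "\<mu>\<in>Mb_pos X" "\<nu>\<in>Mb_pos X" for \<mu> \<nu> by (rule conv_pos[OF that])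
 fix h \<mu> \<nu> assume h: "h\<in>S" and mn: "\<mu>\<in>Mb X" "\<nu>\<in>Mb X"
 let ?t = "cint X (%\<chi>. \<chi> h)"
 have cadd: "?t (%A. \<mu> A + \<nu> A) = ?t \<mu> + ?t \<nu>" if "\<mu>\<in>Mb X" "\<nu>\<in>Mb X" for \<mu> \<nu>
  using that by (intro cint_madd Mb_cm bmf_e h)
 have csc: "?t (%A. a * \<mu> A) = a * ?t \<mu>" if "\<mu>\<in>Mb X" for \<mu> a
  using that by (intro cint_mscale Mb_cm bmf_e h)
 show "?t (conv \<mu> \<nu>) = ?t \<mu> * ?t \<nu>"
 proof (rule Mb_pos_induct[OF Hausdorff_space mn(1), of "%\<mu>. ?t (conv \<mu> \<nu>) = ?t \<mu> * ?t \<nu>"])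
  fix \<mu> assume m: "\<mu>\<in>Mb_pos X"
  note m' = pos_Mb[OF m]
  show "?t (conv \<mu> \<nu>) = ?t \<mu> * ?t \<nu>"
   by (rule Mb_pos_induct[OF Hausdorff_space mn(2), of "%\<nu>. ?t (conv \<mu> \<nu>) = ?t \<mu> * ?t \<nu>"])
    (simp_all add: tr_conv_pos[OF h m] D.conv_add_right D.conv_scale_right m' cadd csc D.conv_closed distrib_left)
 qed (simp_all add: D.conv_add_left D.conv_scale_left mn(2) cadd csc D.conv_closed distrib_right)
qed

lemma point_prob: "x\<in>characters H ==> dirac X x\<in>M_prob X"
 by (rule prob_dirac) simp

text \<open>For \<open>y\<close> in the support, the unit belongs to the support of the product of
  the inverse of \<open>y\<close> with \<open>y\<close>, hence to that of the translate of \<omega>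
  by the inverse, which is \<omega> itself.\<close>

lemma unit_mem_supp:
 assumes "\<omega>\<in>M_prob X" "supp X \<omega> <= G" "!!y. y\<in>G ==> conv (dirac X (hinv (dual H) y)) \<omega> = \<omega>"
 shows "hunit (dual H)\<in>supp X \<omega>"
proof -
 obtain y where x: "y\<in>supp X \<omega>" using supp_nonempty[OF assms(1)] by blast
 then have xX: "y\<in>pts X" by (simp add: supp_def)
 then have iX: "hinv (dual H) y\<in>pts X" using D.inv_homeomorphism by (auto simp: homeomorphic_maps_def continuous_map_def)
 have "hunit (dual H)\<in>supp X (conv (dirac X (hinv (dual H) y)) (dirac X y))"
  using D.unit_in_supp_iff[OF iX xX] by (simp add: pconv_def)
 then have "hunit (dual H)\<in>supp X (conv (dirac X (hinv (dual H) y)) \<omega>)"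
  by (intro supp_conv[OF _ _ x] prob_pos prob_dirac iX assms(1))
 then show ?thesis using assms(2,3) x by auto
qed

lemma translate_mem_supp:
 assumes "\<omega>\<in>M_prob X" "hunit (dual H)\<in>supp X \<omega>" "x\<in>characters H"
 shows "x\<in>supp X (conv (dirac X x) \<omega>)"
proof (rule supp_conv[OF _ _ assms(2)])
 show "x\<in>supp X (conv (dirac X x) (dirac X (hunit (dual H))))"
  using D.unit_right[of x] assms(3) supp_dirac[OF Hausdorff_space, of x] by (simp add: pconv_def)
qed (auto intro: prob_pos point_prob assms)

lemma tr_dirac: "h\<in>S ==> x\<in>characters H ==> cint X (%x. x h) (dirac X x) = x h"
 by (rule cint_e_dirac) auto

lemma hinv_dual_mem: "x\<in>characters H ==> hinv (dual H) x\<in>characters H"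
 using D.inv_homeomorphism by (auto simp: homeomorphic_maps_def continuous_map_def)

lemma hunit_dual_mem: "hunit (dual H)\<in>characters H"
 using D.unit_carrier by simp

end

section \<open>Restriction of characters to a subhypergroup\<close>

context compact_Hausdorff

begin

text \<open>Obtaining the measure with density \<open>f\<close> from \<open>Riesz_complex\<close>
  makes it Radon by construction.\<close>

lemma density_exists:
 assumes mu: "u\<in>Mb_pos X" and f: "rmap X f" "!!x. x\<in>pts X ==> 0 <= f x"
 shows "\<exists>r\<in>Mb_pos X. \<forall>g. cmap X g --> cint X g r = cint X (%x. g x * complex_of_real (f x)) u"
proof (rule Riesz_complex)
 note cm = pos_measureD(1)[OF Mb_posD[OF mu]]
 have c: "(%x. g x * complex_of_real (f x))\<in>bmf X" if "cmap X g" for g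
  by (intro cont_bmf cont_cmult that cont_of_real f)
 show "cint X (%x. (g x + h x) * complex_of_real (f x)) u = cint X (%x. g x * complex_of_real (f x)) u + cint X (%x. h x * complex_of_real (f x)) u"
  if "cmap X g" "cmap X h" for g h
  using cint_add[OF cm c[OF that(1)] c[OF that(2)]] by (simp add: distrib_right)
 show "cint X (%x. a * g x * complex_of_real (f x)) u = a * cint X (%x. g x * complex_of_real (f x)) u"
  if "cmap X g" for g a
  using cint_scale[OF cm c[OF that], of a] by (simp add: mult.assoc)
 fix g assume g: "rmap X g" "!!x. x\<in>pts X ==> 0 <= g x"
 have "(%x. complex_of_real (g x * f x))\<in>bmf X" by (intro bmf_of_real continuous_map_real_mult g f)
 then have "cint X (%x. complex_of_real (g x * f x)) u\<in>\<real>\<^sub>\<ge>\<^sub>0"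
  by (rule cint_nonneg[OF Mb_posD[OF mu]]) (use f g in simp)
 then show "cint X (%x. complex_of_real (g x) * complex_of_real (f x)) u\<in>\<real>\<^sub>\<ge>\<^sub>0" by simp
qed

end

lemma cint_norm_le:
 assumes mu: "pos_measure X u" and g: "g\<in>bmf X" and r: "(cplx r)\<in>bmf X"
  and le: "!!x. x\<in>pts X ==> cmod (g x) <= r x"
 shows "cmod (cint X g u) <= Re (cint X (cplx r) u)"
proof -
 note fm = finite_measure_pmeas[OF pos_measureD(1)[OF mu]]
 have "integrable (pmeas X u) (%x. Re (complex_of_real (r x)))" by (intro integrable_Re integrable_bmf[OF fm sets_pmeas r])
 then have ir: "integrable (pmeas X u) r" by simp
 have "cmod (LINT x|pmeas X u. g x) <= (LINT x|pmeas X u. cmod (g x))" by (rule integral_norm_bound)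
 also have "\<dots> <= (LINT x|pmeas X u. r x)"
  by (rule integral_mono[OF integrable_norm[OF integrable_bmf[OF fm sets_pmeas g]] ir]) (use le in simp)
 finally show ?thesis by (simp add: cint_pmeas[OF mu g] cint_pmeas[OF mu r])
qed

lemma cint_cong_on:
 assumes mu: "pos_measure X u" and E: "E\<in>bor X" "u (pts X - E) = 0"
  and f: "f\<in>bmf X" "g\<in>bmf X" and eq: "!!x. x\<in>E ==> f x = g x"
 shows "cint X f u = cint X g u"
proof -
 note cm = pos_measureD(1)[OF mu]
 have B: "pts X - E\<in>bor X" by (intro bor_Diff E bor_top)
 obtain c where c: "0 <= c" "!!x. x\<in>pts X ==> cmod (f x - g x) <= c" by (rule bmf_bound[OF bmf_diff[OF f]]) (rule that)
 have "cmod (cint X (%x. f x - g x) u) <= c * tv X u (pts X - E)"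
  by (rule cint_norm_on[OF cm bmf_diff[OF f] B]) (use c eq in auto)
 also have "\<dots> = 0" using tv_positive[OF mu B] E(2) by simp
 finally show ?thesis by (simp add: cint_diff[OF cm f])
qed

locale dual_pair =
 fixes H :: "'a hypergroup_data" and H\<^sub>0 :: "'a set"
 assumes pontryagin: "pontryagin H" and discrete_H: "discrete_hypergroup H"
  and sub: "subhypergroup H H\<^sub>0" and strong_sub: "strong (subhypergroup_of H H\<^sub>0)"

begin

abbreviation L :: "'a hypergroup_data" where "L \<equiv> subhypergroup_of H H\<^sub>0"

sublocale A: discrete_strong H
 using pontryagin discrete_H by (auto simp: discrete_strong_def discrete_strong_axioms_def discrete_comm_hypergroup_def
   discrete_comm_hypergroup_axioms_def pontryagin_def strong_def)

lemma sub_subset: "H\<^sub>0 <= A.S"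
 using sub closedin_subset by (auto simp: subhypergroup_def)

lemma htop_L: "htop L = disc H\<^sub>0"
proof -
 have "htop L = subtopology (htop H) H\<^sub>0" by (simp add: subhypergroup_of_def Let_def)
 also have "\<dots> = subtopology (disc A.S) H\<^sub>0" using A.htop_eq by metis
 finally show ?thesis using sub_subset by (simp add: subtopology_discrete_topology Int_absorb1)
qed

lemma carrier_L [simp]: "carrier_of L = H\<^sub>0"
 by (simp add: htop_L)

lemma hunit_L: "hunit L = hunit H" and hinv_L: "hinv L = hinv H"
 by (simp_all add: subhypergroup_of_def Let_def)

sublocale B: discrete_strong L
 using strong_sub htop_L by (auto simp: discrete_strong_def discrete_strong_axioms_def discrete_comm_hypergroup_def
   discrete_comm_hypergroup_axioms_def strong_def discrete_hypergroup_def)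

lemma unit_L: "hunit H\<in>H\<^sub>0" using B.unit_carrier by (simp add: hunit_L)

lemma inv_L: "h\<in>H\<^sub>0 ==> hinv H h\<in>H\<^sub>0" using sub by (simp add: subhypergroup_def)

lemma P_L: assumes "x\<in>H\<^sub>0" "y\<in>H\<^sub>0" "z\<in>H\<^sub>0" shows "B.P x y z = A.P x y z"
proof -
 have pd: "push (htop L) (htop H) (%x. x) (dirac (htop L) x) = dirac (htop H) x" if "x\<in>H\<^sub>0" for x
 proof
  fix A show "push (htop L) (htop H) (%x. x) (dirac (htop L) x) A = dirac (htop H) x A"
   using that by (auto simp: push_def dirac_def htop_L)
 qed
 have "hconv L u w {z} = hconv H (push (htop L) (htop H) (%x. x) u) (push (htop L) (htop H) (%x. x) w) {z}" for u w
 proof -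
  have "htop L = subtopology (htop H) H\<^sub>0" by (simp add: subhypergroup_of_def Let_def)
  moreover have "{z}\<in>bor (htop L)" using assms by (simp add: htop_L)
  ultimately show ?thesis by (simp add: subhypergroup_of_def Let_def)
 qed
 then show ?thesis using assms by (simp add: A.P_def B.P_def pconv_def pd)
qed

lemma N_sub: "x\<in>H\<^sub>0 ==> y\<in>H\<^sub>0 ==> A.N x y <= H\<^sub>0"
 using sub by (simp add: subhypergroup_def A.N_def)

lemma N_L: "x\<in>H\<^sub>0 ==> y\<in>H\<^sub>0 ==> B.N x y = A.N x y"
 using N_sub[of x y] A.N_eq[OF subsetD[OF sub_subset] subsetD[OF sub_subset], of x y] B.N_eq[of x y] P_L[of x y] sub_subset by auto

abbreviation p :: "('a \<Rightarrow> complex) \<Rightarrow> 'a \<Rightarrow> complex" where "p x \<equiv> restrict x H\<^sub>0"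

lemma p_char: assumes "j\<in>characters H" shows "p j\<in>characters L"
proof -
 have "p j\<in>(\<Pi>\<^sub>E x\<in>H\<^sub>0. cball 0 1)" using assms sub_subset by (auto simp: A.char_iff PiE_iff)
 moreover have "(\<Sum>z\<in>A.N x y. B.P x y z * p j z) = j x * j y" if "x\<in>H\<^sub>0" "y\<in>H\<^sub>0" for x y
 proof -
  have "(\<Sum>z\<in>A.N x y. B.P x y z * p j z) = (\<Sum>z\<in>A.N x y. A.P x y z * j z)"
   using N_sub[OF that] P_L[OF that] by (intro sum.cong) auto
  also have "\<dots> = j x * j y" using assms subsetD[OF sub_subset] that by (simp add: A.char_iff)
  finally show ?thesis .
 qed
 ultimately show ?thesis
  using assms sub_subset unit_L inv_L unfolding B.char_iff A.char_iff by (auto simp: hunit_L hinv_L N_L)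
qed

lemma cont_p: "continuous_map A.X B.X p"
 unfolding continuous_map_def
proof (intro conjI allI impI)
 show "p\<in>pts A.X \<rightarrow> pts B.X" using p_char by auto
 fix W assume W: "openin B.X W"
 show "openin A.X {y\<in>pts A.X. p y\<in>W}"
  unfolding A.htop_dual openin_compact_convergence_topology topspace_compact_convergence
 proof (intro conjI ballI)
  fix y assume x: "y\<in>{y\<in>characters H. p y\<in>W}"
  obtain C eps where C: "compactin (htop L) C" "0 < eps" "{g\<in>characters L. \<forall>x\<in>C. dist (p y x) (g x) < eps} <= W"
   using W x unfolding B.htop_dual openin_compact_convergence_topology by blast
  have C': "compactin (htop H) C" "C <= H\<^sub>0" using C(1) sub_subset by (auto simp: A.compactin_iff B.compactin_iff)
  have "{g\<in>characters H. \<forall>x\<in>C. dist (y x) (g x) < eps} <= {y\<in>characters H. p y\<in>W}"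
  proof
   fix g assume g: "g\<in>{g\<in>characters H. \<forall>x\<in>C. dist (y x) (g x) < eps}"
   then have "p g\<in>{g\<in>characters L. \<forall>x\<in>C. dist (p y x) (g x) < eps}" using p_char C'(2) by auto
   then show "g\<in>{y\<in>characters H. p y\<in>W}" using C(3) g by blast
  qed
  then show "\<exists>C eps. compactin (htop H) C\<and>0 < eps\<and>{g\<in>characters H. \<forall>x\<in>C. dist (y x) (g x) < eps} <= {y\<in>characters H. p y\<in>W}"
   using C'(1) C(2) by blast
 qed auto
qed

section \<open>Haar measure of the dual and measures near a fibre\<close>

abbreviation tA :: "'a \<Rightarrow> ('a \<Rightarrow> complex) cmeasure \<Rightarrow> complex" where "tA h u \<equiv> cint A.X (%x. x h) u"

abbreviation tB :: "'a \<Rightarrow> ('a \<Rightarrow> complex) cmeasure \<Rightarrow> complex" where "tB h u \<equiv> cint B.X (%x. x h) u"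

lemma tA_norm: assumes "u\<in>M_prob A.X" "h\<in>A.S" shows "cmod (tA h u) <= 1"
proof -
 have "cmod (tA h u) <= 1 * tv A.X u (pts A.X)"
  by (rule cint_norm[OF Mb_cm[OF prob_Mb[OF assms(1)]] A.bmf_e[OF assms(2)]])
   (use A.character_norm assms(2) in auto)
 then show ?thesis using A.tv_Mb_pos[OF prob_pos[OF assms(1)]] prob_top[OF assms(1)] by simp
qed

lemma tA_unit: assumes "u\<in>M_prob A.X" shows "tA (hunit H) u = 1"
proof -
 have "tA (hunit H) u = cint A.X (%_. 1) u" by (rule cint_cong) (auto simp: A.character_unit)
 then show ?thesis using prob_top[OF assms] cint_const[OF Mb_cm[OF prob_Mb[OF assms]], of 1] by simp
qed

text \<open>If all characters agreed at two points, their evaluations would coincide, against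
  injectivity of the map into the bidual.\<close>

lemma points_separated: assumes "h\<in>A.S" "h'\<in>A.S" "h ~= h'" shows "\<exists>y\<in>characters H. y h ~= y h'"
proof (rule ccontr)
 assume "\<not> ?thesis"
 then have "(\<lambda>y\<in>characters H. y h) = (\<lambda>y\<in>characters H. y h')" by (auto simp: fun_eq_iff)
 moreover have "inj_on (%x. \<lambda>y\<in>characters H. y x) A.S"
  using pontryagin by (auto simp: pontryagin_def hypergroup_iso_def dest: homeomorphic_imp_injective_map)
 ultimately show False using assms by (auto dest: inj_onD)
qed

text \<open>Strict convexity of the disc: the midpoint of two distinct points lies in the
  interior.\<close>

lemma half_norm: assumes "cmod z <= 1" "z ~= 1" shows "cmod ((1 + z) / 2) < 1"
proof -
 have "(Re z)\<^sup>2 + (Im z)\<^sup>2 <= 1" using assms(1) power_mono[of "cmod z" 1 2] by (simp add: cmod_power2)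
 moreover have "Re z ~= 1\<or>Im z ~= 0" using assms(2) by (auto simp: complex_eq_iff)
 ultimately have "Re z < 1" by (smt (verit) power2_less_0 abs_Re_le_cmod assms(1) one_power2 zero_eq_power2 zero_le_power2)
 then have "(1 + Re z)\<^sup>2 + (Im z)\<^sup>2 < 4"
  using \<open>(Re z)\<^sup>2 + (Im z)\<^sup>2 <= 1\<close> by (simp add: power2_eq_square algebra_simps)
 then have "(cmod (1 + z))\<^sup>2 < 2\<^sup>2" by (simp add: cmod_power2)
 then have "cmod (1 + z) < 2" by (rule power2_less_imp_less) simp
 then show ?thesis by (simp add: norm_divide)
qed

text \<open>The mean of the unit and a character \<open>y\<close> with \<open>y k \<noteq> 1\<close>
  has transform \<open>(1 + y h) / 2\<close>, of modulus at most 1 everywhere and below 1 at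
  \<open>k\<close>. Its convolution powers make the transform at \<open>k\<close> small without
  enlarging those already treated.\<close>

lemma approx_Haar:
 assumes "finite F" "F <= A.S - {hunit H}" "0 < eps"
 shows "\<exists>u\<in>M_prob A.X. \<forall>h\<in>F. cmod (tA h u) < eps"
 using assms(1,2)
proof (induction F)
 case empty
 then show ?case using A.point_prob[OF A.hunit_dual_mem] by auto
next
 case (insert k F)
 then obtain u where mu: "u\<in>M_prob A.X" "!!h. h\<in>F ==> cmod (tA h u) < eps" by auto
 have k: "k\<in>A.S" "k ~= hunit H" using insert by auto
 obtain y where x: "y\<in>characters H" "y k ~= 1" using points_separated[OF k(1) A.unit_carrier k(2)] A.character_unit by metis
 note d = A.point_prob[OF A.hunit_dual_mem] A.point_prob[OF x(1)]
 define j where "j = (%A. 1/2 * dirac A.X (hunit (dual H)) A + 1/2 * dirac A.X y A)"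
 have "complex_of_real (1/2)\<in>\<real>\<^sub>\<ge>\<^sub>0" by (simp only: nonneg_Reals_of_real_iff)
 then have "1/2\<in>(\<real>\<^sub>\<ge>\<^sub>0 :: complex set)" by simp
 then have phi: "j\<in>M_prob A.X"
  using prob_top[OF d(1)] prob_top[OF d(2)] Mb_pos_add[OF Mb_pos_scale Mb_pos_scale, OF prob_pos[OF d(1)] \<open>1/2\<in>(\<real>\<^sub>\<ge>\<^sub>0 :: complex set)\<close> prob_pos[OF d(2)] \<open>1/2\<in>(\<real>\<^sub>\<ge>\<^sub>0 :: complex set)\<close>]
  by (simp add: M_prob_def j_def)
 have tphi: "tA h j = (1 + y h) / 2" if "h\<in>A.S" for h
  unfolding j_def
  by (simp only: A.cint_e_add[OF that Mb_scale[OF prob_Mb[OF d(1)]] Mb_scale[OF prob_Mb[OF d(2)]]]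
    A.cint_e_scale[OF that prob_Mb[OF d(1)]] A.cint_e_scale[OF that prob_Mb[OF d(2)]] A.tr_dirac[OF that A.hunit_dual_mem] A.tr_dirac[OF that x(1)])
   (simp add: A.hunit_dual that add_divide_distrib)
 define w where "w n = ((A.conv j) ^^ n) u" for n
 have nu: "w n\<in>M_prob A.X" for n by (induction n) (simp_all add: w_def mu A.conv_prob phi)
 have tnu: "tA h (w n) = ((1 + y h) / 2) ^ n * tA h u" if "h\<in>A.S" for h n
  by (induction n) (use that in \<open>simp_all add: w_def A.conv_tr[OF that] prob_Mb[OF phi] prob_Mb[OF nu, unfolded w_def] tphi[OF that]\<close>)
 have lt: "cmod ((1 + y k) / 2) < 1" by (rule half_norm[OF A.character_norm[OF x(1) k(1)] x(2)])
 obtain n where n: "cmod ((1 + y k) / 2) ^ n < eps" using real_arch_pow_inv[OF assms(3) lt] by blast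
 have "cmod (tA h (w n)) < eps" if "h\<in>insert k F" for h
 proof -
  have h: "h\<in>A.S" using that insert.prems by auto
  have "cmod (tA h (w n)) = cmod ((1 + y h) / 2) ^ n * cmod (tA h u)" by (simp add: tnu[OF h] norm_mult norm_power)
  moreover have "cmod ((1 + y h) / 2) ^ n <= 1"
   using tA_norm[OF phi h] by (intro power_le_one) (simp_all add: tphi[OF h])
  ultimately show ?thesis
   using that n mu(2)[of h] tA_norm[OF mu(1) h] mult_right_le_one_le[of "cmod ((1 + y k) / 2) ^ n" "cmod (tA h u)"]
    mult_left_le_one_le[of "cmod (tA h u)" "cmod ((1 + y h) / 2) ^ n"] by (cases "h = k") auto
 qed
 then show ?case using nu by blast
qed

lemma ex_Haar: "\<exists>\<omega>\<in>M_prob A.X. \<forall>h\<in>A.S. tA h \<omega> = of_bool (h = hunit H)"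
proof (rule A.limit_measure)
 fix F and eps :: real assume F: "finite F" "F <= A.S" "0 < eps"
 obtain u where mu: "u\<in>M_prob A.X" "\<forall>h\<in>F - {hunit H}. cmod (tA h u) < eps"
  using approx_Haar[of "F - {hunit H}" eps] F by auto
 then show "\<exists>u\<in>M_prob A.X. \<forall>d\<in>F. cmod (tA d u - of_bool (d = hunit H)) < eps"
  using F(3) tA_unit[OF mu(1)] by (intro bexI[OF _ mu(1)]) auto
qed

definition \<omega> where "\<omega> = (SOME \<omega>. \<omega>\<in>M_prob A.X\<and>(\<forall>h\<in>A.S. tA h \<omega> = of_bool (h = hunit H)))"

lemma omega: "\<omega>\<in>M_prob A.X" "h\<in>A.S ==> tA h \<omega> = of_bool (h = hunit H)"
 using someI_ex[OF ex_Haar[unfolded Bex_def]] by (auto simp: \<omega>_def)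

lemma tB_push: "u\<in>Mb A.X ==> h\<in>H\<^sub>0 ==> tB h (push A.X B.X p u) = tA h u"
 by (subst cint_push[OF Mb_cm cont_p]) (auto intro: B.bmf_e)

text \<open>The image of \<omega> has the transform of a Haar measure, so it is invariant under all
  translations. Its support therefore contains the unit, and with it every translate of the
  unit.\<close>

lemma full_support: "supp B.X (push A.X B.X p \<omega>) = characters L"
proof -
 let ?\<omega> = "push A.X B.X p \<omega>"
 have w: "?\<omega>\<in>M_prob B.X" by (rule prob_push[OF omega(1) cont_p])
 have t: "tB h ?\<omega> = of_bool (h = hunit H)" if "h\<in>H\<^sub>0" for h
  using tB_push[OF prob_Mb[OF omega(1)] that] omega(2)[of h] that sub_subset by auto
 have inv: "B.conv (dirac B.X x) ?\<omega> = ?\<omega>" if "x\<in>characters L" for x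
  using that by (intro B.transform_unique) (auto simp: B.conv_tr B.conv_Mb prob_Mb[OF w] prob_Mb[OF B.point_prob] B.tr_dirac t
   B.character_unit[unfolded hunit_L])
 have "hunit (dual L)\<in>supp B.X ?\<omega>"
  by (rule B.unit_mem_supp[OF w, of "characters L"]) (auto simp: supp_def intro!: inv B.hinv_dual_mem)
 then show ?thesis using B.translate_mem_supp[OF w] inv by (force simp: supp_def)
qed

lemma P_cross: assumes "h\<in>A.S - H\<^sub>0" "k\<in>H\<^sub>0" shows "A.P h k (hunit H) = 0"
 using A.P_unit[of h k] assms inv_L sub_subset by auto

text \<open>For \<open>k\<close> in \<open>H\<^sub>0\<close> the unit has no mass in the product of
  \<open>h\<close> and \<open>k\<close>, since otherwise \<open>h\<close> would be the inverse of
  \<open>k\<close> and lie in \<open>H\<^sub>0\<close>. So the integral vanishes for polynomials in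
  restrictions, and they approximate \<open>f\<close> uniformly.\<close>

lemma omega_orthogonal:
 assumes h: "h\<in>A.S - H\<^sub>0" and f: "cmap B.X f"
 shows "cint A.X (%y. y h * f (p y)) \<omega> = 0"
proof -
 have hS: "h\<in>A.S" using h by blast
 note cm = Mb_cm[OF prob_Mb[OF omega(1)]]
 have c: "(%y. y h * f (p y))\<in>bmf A.X" if "cmap B.X f" for f
  using continuous_map_compose[OF cont_p that] by (intro A.cont_bmf cont_cmult A.e_cont hS) (simp add: o_def)
 have "cmod (cint A.X (%y. y h * f (p y)) \<omega>) <= 0"
 proof (rule field_le_epsilon)
  fix eps :: real assume eps: "0 < eps"
  obtain g where g: "B.trig g" "!!x. x\<in>pts B.X ==> cmod (f x - g x) < eps" by (rule B.Stone_Weierstrass[OF f eps]) (rule that)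
  obtain F a where F: "finite F" "F <= carrier_of L" "!!x. x\<in>pts B.X ==> g x = (\<Sum>k\<in>F. a k * x k)"
   using g(1) unfolding B.trig_def by blast
  have F0: "F <= H\<^sub>0" using F(2) by simp
  have "cint A.X (%y. y h * g (p y)) \<omega> = cint A.X (%y. \<Sum>k\<in>F. a k * (\<Sum>z\<in>A.N h k. A.P h k z * y z)) \<omega>"
  proof (rule cint_cong)
   fix y assume x: "y\<in>pts A.X"
   then have "g (p y) = (\<Sum>k\<in>F. a k * y k)" using F(3)[of "p y"] p_char F0 by (auto intro!: sum.cong)
   moreover have "(\<Sum>z\<in>A.N h k. A.P h k z * y z) = y h * y k" if "k\<in>F" for k
    using x hS that F0 sub_subset by (auto simp: A.char_iff)
   ultimately show "y h * g (p y) = (\<Sum>k\<in>F. a k * (\<Sum>z\<in>A.N h k. A.P h k z * y z))"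
    by (simp add: sum_distrib_left mult_ac)
  qed
  also have "\<dots> = (\<Sum>k\<in>F. a k * (\<Sum>z\<in>A.N h k. A.P h k z * tA z \<omega>))"
  proof -
   have N: "A.N h k <= A.S" if "k\<in>F" for k using that A.N_subset[OF hS, of k] F0 sub_subset by auto
   have b: "(%y. A.P h k z * y z)\<in>bmf A.X" if "k\<in>F" "z\<in>A.N h k" for k z
    using N that by (intro bmf_mult bmf_const A.bmf_e) auto
   show ?thesis
    by (subst cint_sum[OF cm], rule bmf_mult[OF bmf_const bmf_sum[OF b]], assumption, assumption)
     (use N b in \<open>auto intro!: sum.cong simp: cint_scale[OF cm] cint_sum[OF cm] bmf_sum A.bmf_e subset_iff\<close>)
  qed
  also have "\<dots> = 0"
  proof (intro sum.neutral ballI)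
   fix k assume k: "k\<in>F"
   have "A.P h k z * tA z \<omega> = 0" if "z\<in>A.N h k" for z
   proof -
    have "k\<in>H\<^sub>0" "k\<in>A.S" using k F0 sub_subset by auto
    then have "z\<in>A.S" "z = hunit H ==> A.P h k z = 0" using that A.N_subset[OF hS, of k] P_cross[OF h, of k] by auto
    then show ?thesis using omega(2)[of z] by (cases "z = hunit H") auto
   qed
   then show "a k * (\<Sum>z\<in>A.N h k. A.P h k z * tA z \<omega>) = 0" by (subst sum.neutral) auto
  qed
  finally have 0: "cint A.X (%y. y h * g (p y)) \<omega> = 0" .
  have "cmod (cint A.X (%y. y h * f (p y)) \<omega> - cint A.X (%y. y h * g (p y)) \<omega>) <= eps * tv A.X \<omega> (pts A.X)"
  proof (rule A.cint_approx[OF cm c[OF f] c[OF B.trig_continuous[OF g(1)]]])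
   fix y assume x: "y\<in>pts A.X"
   have "cmod (y h * f (p y) - y h * g (p y)) = cmod (y h) * cmod (f (p y) - g (p y))"
    by (simp add: norm_mult[symmetric] right_diff_distrib)
   also have "\<dots> <= 1 * eps"
    using A.character_norm[of y h] g(2)[of "p y"] p_char[of y] x hS by (intro mult_mono) (auto intro: less_imp_le)
   finally show "cmod (y h * f (p y) - y h * g (p y)) <= eps" by simp
  qed (use eps in simp)
  then show "cmod (cint A.X (%y. y h * f (p y)) \<omega>) <= 0 + eps"
   using A.tv_Mb_pos[OF prob_pos[OF omega(1)]] prob_top[OF omega(1)] by (simp add: 0)
 qed
 then show ?thesis by simp
qed

text \<open>The Haar measure of the dual, multiplied by functions concentrating near the fibre over \<open>\<tau>\<close>,
 converges to the invariant measure on that fibre.\<close>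

lemma ex_fibre_measure:
 assumes tau: "t\<in>characters L"
 shows "\<exists>u\<in>M_prob A.X. \<forall>h\<in>A.S. tA h u = (if h\<in>H\<^sub>0 then t h else 0)"
proof (rule A.limit_measure)
 fix F and eps :: real assume F: "finite F" "F <= A.S" "0 < eps"
 let ?w = "push A.X B.X p \<omega>"
 note pw = Mb_posD[OF prob_pos[OF omega(1)]]
 note cm = pos_measureD(1)[OF pw]
 define U where "U = pts B.X\<inter>(\<Inter>h\<in>F\<inter>H\<^sub>0. {s\<in>pts B.X. s h\<in>ball (t h) (eps / 2)})"
 have U: "openin B.X U"
 proof (cases "F\<inter>H\<^sub>0 = {}")
  case False
  have "openin B.X (\<Inter>h\<in>F\<inter>H\<^sub>0. {s\<in>pts B.X. s h\<in>ball (t h) (eps / 2)})"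
   by (rule openin_INT2[OF _ False], use F(1) in simp, rule openin_continuous_map_preimage[OF B.e_cont])
    (auto simp: open_openin[symmetric])
  then show ?thesis unfolding U_def by (rule openin_Int[OF openin_topspace])
 next
  case True then show ?thesis unfolding U_def True using openin_topspace[of B.X] by simp
 qed
 have tU: "t\<in>U" using tau F(3) by (simp add: U_def)
 obtain f where f: "rmap B.X f" "!!x. x\<in>pts B.X ==> 0 <= f x\<and>f x <= 1"
  "!!y. y\<in>pts B.X ==> y\<notin>U ==> f y = 0" "f t = 1" by (rule B.bump[OF U tU]) (rule that)
 let ?f = "%z. f (p z)"
 have fp: "rmap A.X ?f" using continuous_map_compose[OF cont_p f(1)] by (simp add: o_def)
 have pX: "p z\<in>pts B.X" if "z\<in>pts A.X" for z using p_char that by simp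
 define m where "m = Re (cint A.X (cplx ?f) \<omega>)"
 \<comment> \<open>\<open>f\<close> is positive at \<open>t\<close>, which belongs to the full
   support of the image of \<omega>; this permits normalising the density.\<close>
 have m: "0 < m"
 proof -
  have "0 < Re (cint B.X (cplx f) ?w)"
   by (rule B.supp_integral_pos[OF pos_push[OF prob_pos[OF omega(1)] cont_p], of t]) (use full_support tau f in auto)
  then show ?thesis by (simp add: m_def cint_push[OF cm cont_p B.bmf_of_real[OF f(1)]])
 qed
 have mi: "cint A.X (cplx ?f) \<omega> = complex_of_real m"
  using cint_nonneg[OF pw A.bmf_of_real[OF fp]] f(2) pX by (simp add: m_def complex_nonneg_Reals_iff complex_eq_iff)
 obtain r where rho: "r\<in>Mb_pos A.X"
  "!!g. cmap A.X g ==> cint A.X g r = cint A.X (%z. g z * complex_of_real (?f z)) \<omega>"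
  using A.density_exists[OF prob_pos[OF omega(1)] fp] f(2) pX by meson
 define u where "u = (%A. complex_of_real (1 / m) * r A)"
 have im: "complex_of_real (1 / m)\<in>\<real>\<^sub>\<ge>\<^sub>0" using m by (simp only: nonneg_Reals_of_real_iff) simp
 have "r (pts A.X) = complex_of_real m"
  using rho(2)[of "%_. 1"] cint_const[OF Mb_cm[OF pos_Mb[OF rho(1)]], of 1] by (simp add: mi)
 then have mu: "u\<in>M_prob A.X" using m Mb_pos_scale[OF rho(1) im] by (simp add: M_prob_def u_def)
 have "cmod (tA h u - (if h\<in>H\<^sub>0 then t h else 0)) < eps" if h: "h\<in>F" for h
 proof -
  have hS: "h\<in>A.S" using h F by blast
  have tmu: "tA h u = complex_of_real (1 / m) * cint A.X (%z. z h * complex_of_real (?f z)) \<omega>"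
   unfolding u_def by (simp only: A.cint_e_scale[OF hS pos_Mb[OF rho(1)]] rho(2)[OF A.e_cont[OF hS]])
  show ?thesis
  proof (cases "h\<in>H\<^sub>0")
   case False
   \<comment> \<open>The density factors through restriction, so orthogonality makes the transform
     exactly 0 outside \<open>H\<^sub>0\<close>.\<close>
   then show ?thesis using omega_orthogonal[OF _ B.cont_of_real[OF f(1)], of h] hS F(3) by (simp add: tmu)
  next
   case True
   have b: "(%z. z h * complex_of_real (?f z))\<in>bmf A.X" "(%z. t h * complex_of_real (?f z))\<in>bmf A.X"
    by (intro bmf_mult A.bmf_e hS A.bmf_of_real fp bmf_const)+
   have "tA h u - t h = complex_of_real (1 / m) * cint A.X (%z. z h * complex_of_real (?f z) - t h * complex_of_real (?f z)) \<omega>"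
    using m by (simp add: tmu cint_diff[OF cm b] cint_scale[OF cm A.bmf_of_real[OF fp]] mi right_diff_distrib)
   also have "cmod \<dots> <= (1 / m) * Re (cint A.X (%z. complex_of_real (eps / 2 * ?f z)) \<omega>)"
    unfolding norm_mult
   proof (rule mult_mono)
    show "cmod (cint A.X (%z. z h * complex_of_real (?f z) - t h * complex_of_real (?f z)) \<omega>)
      <= Re (cint A.X (%z. complex_of_real (eps / 2 * ?f z)) \<omega>)"
    proof (rule cint_norm_le[OF pw bmf_diff[OF b]])
     show "(%x. complex_of_real (eps / 2 * ?f x))\<in>bmf A.X" by (intro A.bmf_of_real continuous_map_real_mult_left fp)
     fix z assume x: "z\<in>pts A.X"
     have "cmod (z h * complex_of_real (?f z) - t h * complex_of_real (?f z)) = cmod (z h - t h) * ?f z"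
      using f(2)[OF pX[OF x]] by (simp add: left_diff_distrib[symmetric] norm_mult)
     also have "\<dots> <= eps / 2 * ?f z"
     proof (cases "p z\<in>U")
      case pU: True
      then have "cmod (z h - t h) <= eps / 2" using True h by (auto simp: U_def dist_norm norm_minus_commute less_imp_le)
      then show ?thesis using f(2)[OF pX[OF x]] by (intro mult_right_mono) auto
     qed (use f(3)[OF pX[OF x]] in simp)
     finally show "cmod (z h * complex_of_real (?f z) - t h * complex_of_real (?f z)) <= eps / 2 * ?f z" .
    qed
   qed (use m in \<open>auto simp: norm_divide\<close>)
   also have "\<dots> = eps / 2"
    using m by (simp only: of_real_mult[of "eps / 2"] cint_scale[OF cm A.bmf_of_real[OF fp]] mi) simp
   finally show ?thesis using F(3) True by simp
  qed
 qed
 then show "\<exists>u\<in>M_prob A.X. \<forall>h\<in>F. cmod (tA h u - (if h\<in>H\<^sub>0 then t h else 0)) < eps" using mu by blast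
qed

end

section \<open>Weakly continuous kernels\<close>

lemma cint_mono_Re:
 assumes mu: "pos_measure X u" and f: "(cplx f)\<in>bmf X" "(cplx g)\<in>bmf X"
  and le: "!!x. x\<in>pts X ==> f x <= g x"
 shows "Re (cint X (cplx f) u) <= Re (cint X (cplx g) u)"
proof -
 have "cint X (%x. complex_of_real (g x - f x)) u\<in>\<real>\<^sub>\<ge>\<^sub>0"
  using bmf_diff[OF f(2,1)] le by (intro cint_nonneg[OF mu]) simp_all
 then show ?thesis by (simp add: cint_diff[OF pos_measureD(1)[OF mu] f(2,1)] complex_nonneg_Reals_iff)
qed

lemma complex_of_real_of_bool: "complex_of_real (of_bool b) = of_bool b"
 by (cases b) auto

lemma bmf_of_bool: "A\<in>bor X ==> (%x. complex_of_real (of_bool (x\<in>A)))\<in>bmf X"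
 by (simp only: bmf_indicator complex_of_real_of_bool)

lemma cint_of_bool: "cmeas X u ==> A\<in>bor X ==> cint X (%x. complex_of_real (of_bool (x\<in>A))) u = u A"
 by (simp only: cint_indicator complex_of_real_of_bool)

context compact_Hausdorff

begin

definition under :: "'a set \<Rightarrow> ('a \<Rightarrow> real) \<Rightarrow> bool" where
 "under U f \<longleftrightarrow> rmap X f\<and>(\<forall>x\<in>pts X. 0 <= f x\<and>f x <= of_bool (x\<in>U))"

lemma under_bmf: "under U f ==> (cplx f)\<in>bmf X"
 by (simp add: under_def bmf_of_real)

lemma under_le:
 assumes "pos_measure X u" "openin X U" "under U f"
 shows "Re (cint X (cplx f) u) <= Re (u U)"
 using cint_mono_Re[OF assms(1) under_bmf[OF assms(3)] bmf_of_bool[OF open_bor[OF assms(2)]]] assms(3)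
 by (simp only: cint_of_bool[OF pos_measureD(1)[OF assms(1)] open_bor[OF assms(2)]] under_def)

text \<open>Inner regularity supplies a compact subset of almost full measure, and a Urysohn
  function lies between its indicator and that of \<open>U\<close>.\<close>

lemma under_approx:
 assumes mu: "a\<in>Mb_pos X" and U: "openin X U" and c: "c < Re (a U)"
 shows "\<exists>f. under U f\<and>c < Re (cint X (cplx f) a)"
proof -
 note pm = Mb_posD[OF mu]
 note cm = pos_measureD(1)[OF pm]
 obtain C where C: "compactin X C" "C <= U" "tv X a (U - C) < Re (a U) - c"
  by (rule MbE[OF pos_Mb[OF mu] open_bor[OF U], of "Re (a U) - c"]) (use c in simp, rule that)
 have cC: "closedin X C" using C(1) closed_compact by simp
 obtain f where f: "rmap X f" "!!x. x\<in>pts X ==> 0 <= f x\<and>f x <= 1"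
  "!!x. x\<in>pts X - U ==> f x = 0" "!!x. x\<in>C ==> f x = 1"
  by (rule Urysohn[OF closedin_diff[OF closedin_topspace U] cC]) (use C(2) in blast, rule that)
 have u: "under U f" unfolding under_def using f by (auto simp: of_bool_def)
 have B: "C\<in>bor X" "U\<in>bor X" using closed_bor[OF cC] open_bor[OF U] .
 have "Re (a (U - C)) = Re (a U) - Re (a C)" using cm_Diff[OF cm B(2,1) C(2)] by simp
 then have "c < Re (a C)" using C(3) tv_positive[OF pm bor_Diff[OF B(2,1)]] by simp
 also have "Re (a C) <= Re (cint X (cplx f) a)"
  using cint_mono_Re[OF pm bmf_of_bool[OF B(1)] bmf_of_real[OF f(1)]] f(2,4)
  by (simp only: cint_of_bool[OF cm B(1)]) (simp add: of_bool_def)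
 finally show ?thesis using u by blast
qed

lemma under_finite:
 assumes "finite \<Phi>" "!!f. f\<in>\<Phi> ==> under U f"
 shows "\<exists>g. under U g\<and>(\<forall>f\<in>\<Phi>. \<forall>x. f x <= g x)"
 using assms
proof (induction \<Phi>)
 case empty
 then show ?case by (intro exI[of _ "%_. 0"]) (auto simp: under_def)
next
 case (insert f \<Phi>)
 then obtain g where g: "under U g" "\<forall>f\<in>\<Phi>. \<forall>x. f x <= g x" by auto
 have "under U (%x. max (f x) (g x))"
  using g(1) insert.prems[of f] unfolding under_def by (auto intro!: continuous_map_real_max simp: le_max_iff_disj)
 then show ?case using g(2) by (intro exI[of _ "%x. max (f x) (g x)"]) (auto simp: le_max_iff_disj)
qed

end

text \<open>Weak continuity of the kernel says nothing directly about the values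
  \<open>m y A\<close>. The locale provides their measurability in \<open>y\<close> and identifies
  their integrals with the measure that represents the integrated functionals. It is instantiated
  with the invariant measures on the fibres of restriction.\<close>

locale continuous_kernel = X: compact_Hausdorff X + Y: compact_Hausdorff Y
 for X :: "'a topology" and Y :: "'b topology" +
 fixes m :: "'b \<Rightarrow> 'a cmeasure"
 assumes m_prob: "y\<in>pts Y ==> m y\<in>M_prob X"
  and m_cont: "cmap X f ==> cmap Y (%y. cint X f (m y))"

begin

abbreviation J :: "('a \<Rightarrow> real) \<Rightarrow> 'b \<Rightarrow> complex" where "J f y \<equiv> cint X (cplx f) (m y)"

lemma m_pos: "y\<in>pts Y ==> pos_measure X (m y)"
 using m_prob Mb_posD prob_pos by blast

lemma m_cm: "y\<in>pts Y ==> cmeas X (m y)"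
 using m_pos pos_measureD(1) by blast

lemma m_le_1: "y\<in>pts Y ==> A\<in>bor X ==> Re (m y A) <= 1"
 using positive_measure_mono[OF m_pos _ bor_top bor_sub] prob_top[OF m_prob] by fastforce

lemma m_cmod: "y\<in>pts Y ==> cmod (m y A) = Re (m y A)"
 using pos_measureD(2,4)[OF m_pos] by (metis norm_of_real abs_of_nonneg)

lemma m_cont_real: "rmap X f ==> rmap Y (%y. Re (J f y))"
 by (intro continuous_map_Re m_cont X.cont_of_real)

lemma m_real: "y\<in>pts Y ==> m y A = complex_of_real (Re (m y A))"
 using pos_measureD(4)[OF m_pos] .

lemma m_real_bmf: "(%y. m y A)\<in>bmf Y ==> (%y. complex_of_real (Re (m y A)))\<in>bmf Y"
 by (rule bmf_cong[THEN iffD1, rotated], assumption) (rule m_real)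

text \<open>Lower semicontinuity: \<open>m y U\<close> is a supremum of integrals of continuous
  functions below \<open>U\<close>, each continuous in \<open>y\<close>, so the superlevel sets are
  open.\<close>

lemma m_open_bmf: assumes U: "openin X U" shows "(%y. m y U)\<in>bmf Y"
proof -
 have "{y\<in>pts Y. c < Re (m y U)}\<in>bor Y" for c
 proof (rule open_bor, subst openin_subopen, intro ballI)
  fix y assume y: "y\<in>{y\<in>pts Y. c < Re (m y U)}"
  then obtain f where f: "X.under U f" "c < Re (J f y)"
   using X.under_approx[OF prob_pos[OF m_prob] U] by blast
  let ?W = "{y\<in>pts Y. Re (J f y)\<in>{c<..}}"
  have "openin Y ?W" using f(1)
   by (intro openin_continuous_map_preimage[OF m_cont_real]) (auto simp: X.under_def open_openin[symmetric])
  moreover have "?W <= {y\<in>pts Y. c < Re (m y U)}"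
   using X.under_le[OF m_pos U f(1)] by (auto intro: less_le_trans)
  ultimately show "\<exists>T. openin Y T\<and>y\<in>T\<and>T <= {y\<in>pts Y. c < Re (m y U)}" using y f(2) by (intro exI[of _ ?W]) auto
 qed
 then have "(%y. Re (m y U))\<in>borel_measurable (borel_space Y)"
  by (intro borel_measurable_iff_greater[THEN iffD2]) simp
 then have "(%y. complex_of_real (Re (m y U)))\<in>borel_measurable (borel_space Y)" by measurable
 then have "(%y. complex_of_real (Re (m y U)))\<in>bmf Y"
  using m_le_1[OF _ open_bor[OF U]] pos_measureD(2)[OF m_pos] by (intro bmfI[of _ _ 1]) (auto simp: abs_le_iff intro: order_trans[of _ 0])
 then show ?thesis by (subst bmf_cong[OF m_real]) auto
qed

text \<open>Smoothness of Radon measures: for open \<open>U\<close> the integral of the supremum of the functions \<open>y \<mapsto> \<integral> f dm\<^sub>y\<close>,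
 \<open>f\<close> under \<open>U\<close>, is the supremum of their integrals.  The supremum is nearly constant on each of finitely many Borel sets,
 and finitely many \<open>f\<close> suffice on compact subsets of these.\<close>

lemma smooth:
 assumes U: "openin X U" and nu: "w\<in>Mb_pos Y" and d: "0 < d"
 shows "\<exists>f. X.under U f \<and>
  Re (cint Y (%y. m y U) w) <= Re (cint Y (J f) w) + d * (3 * Re (w (pts Y)) + 1)"
proof -
 note pn = Mb_posD[OF nu]
 note cn = pos_measureD(1)[OF pn]
 define F where "F y = Re (m y U)" for y
 define G where "G f y = Re (J f y)" for f y
 have Gc: "rmap Y (G f)" if "X.under U f" for f
  unfolding G_def using that by (intro m_cont_real) (simp add: X.under_def)
 obtain P s where P: "step_approx Y (%y. m y U) d P (%B. B) (%B. m (s B) U)" "!!B. B\<in>P ==> s B\<in>B"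
  by (rule step_approx_exists[of "{%y. m y U}" Y d]) (use m_open_bmf[OF U] d in auto)
 have Ps: "finite P" "P <= bor Y" "\<Union>P = pts Y" using P(1) by (auto simp: step_approx_def)
 have near: "\<bar>F y - F (s B)\<bar> <= d" if "B\<in>P" "y\<in>B" for B y
  using that P(1) abs_Re_le_cmod[of "m y U - m (s B) U"] by (fastforce simp: step_approx_def F_def)
 \<comment> \<open>On \<open>B\<close> the function \<open>F\<close> varies by at most
   \<open>d\<close> from its representative value, and the open sets \<open>W f\<close> allow a
   deficit of \<open>2 * d\<close> below that value; together this gives
   \<open>3 * d\<close>.\<close>
 have piece: "\<exists>\<Phi>. finite \<Phi>\<and>(\<forall>f\<in>\<Phi>. X.under U f)\<and>(\<forall>y\<in>C. \<exists>f\<in>\<Phi>. F y <= G f y + 3 * d)"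
  if B: "B\<in>P" and C: "compactin Y C" "C <= B" for B C
 proof -
  define W where "W f = {y\<in>pts Y. G f y\<in>{F (s B) - 2 * d<..}}" for f
  have oW: "openin Y (W f)" if "X.under U f" for f
   unfolding W_def by (rule openin_continuous_map_preimage[OF Gc[OF that]]) (auto simp: open_openin[symmetric])
  have "C <= \<Union>(W ` Collect (X.under U))"
  proof
   fix y assume y: "y\<in>C"
   then have yY: "y\<in>pts Y" using compactin_subset_topspace[OF C(1)] by blast
   have "F (s B) - 2 * d < F y" using near[OF B, of y] y C(2) d by auto
   then obtain f where "X.under U f" "F (s B) - 2 * d < G f y"
    using X.under_approx[OF prob_pos[OF m_prob[OF yY]] U] by (auto simp: F_def G_def)
   then show "y\<in>\<Union>(W ` Collect (X.under U))" using yY by (auto simp: W_def)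
  qed
  moreover have "\<forall>T\<in>W ` Collect (X.under U). openin Y T" using oW by auto
  ultimately obtain \<V> where V: "finite \<V>" "\<V> <= W ` Collect (X.under U)" "C <= \<Union>\<V>"
   using C(1) unfolding compactin_def by meson
  obtain \<Phi> where Phi: "finite \<Phi>" "\<Phi> <= Collect (X.under U)" "\<V> = W ` \<Phi>" using finite_subset_image[OF V(1,2)] by blast
  have "\<exists>f\<in>\<Phi>. F y <= G f y + 3 * d" if y: "y\<in>C" for y
  proof -
   obtain f where "f\<in>\<Phi>" "F (s B) - 2 * d < G f y" using y V(3) Phi(3) by (auto simp: W_def)
   then show ?thesis using near[OF B, of y] y C(2) by (intro bexI[of _ f]) auto
  qed
  then show ?thesis using Phi by (intro exI[of _ \<Phi>]) auto
 qed
 have "\<exists>\<Phi> E. finite \<Phi>\<and>(\<forall>f\<in>\<Phi>. X.under U f)\<and>E\<in>bor Y\<and>tv Y w (\<Union>Q - E) < eps\<and>(\<forall>y\<in>E. \<exists>f\<in>\<Phi>. F y <= G f y + 3 * d)"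
  if "finite Q" "Q <= P" "0 < eps" for Q eps
  using that
 proof (induction Q arbitrary: eps)
  case empty
  then show ?case
   using tv_positive[OF pn bor_empty] cm_empty[OF cn] by (intro exI[of _ "{}"]) auto
 next
  case (insert B Q)
  have B: "B\<in>P" "B\<in>bor Y" "\<Union>Q\<in>bor Y"
   using insert.prems insert.hyps(1) Ps(2) bor_finite_UN[of Q "%B. B" Y, simplified, OF _ subsetD[of Q]] by blast+
  obtain \<Phi> E where E: "finite \<Phi>" "\<forall>f\<in>\<Phi>. X.under U f" "E\<in>bor Y" "tv Y w (\<Union>Q - E) < eps / 2" "\<forall>y\<in>E. \<exists>f\<in>\<Phi>. F y <= G f y + 3 * d"
   using insert.IH[of "eps / 2"] insert.prems by auto
  obtain C where C: "compactin Y C" "C <= B" "tv Y w (B - C) < eps / 2"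
   by (rule MbE[OF pos_Mb[OF nu] B(2), of "eps / 2"]) (use insert.prems in simp, rule that)
  obtain \<Phi>' where Phi: "finite \<Phi>'" "\<forall>f\<in>\<Phi>'. X.under U f" "\<forall>y\<in>C. \<exists>f\<in>\<Phi>'. F y <= G f y + 3 * d"
   using piece[OF B(1) C(1,2)] by blast
  have Cb: "C\<in>bor Y" using C(1) Y.closed_compact closed_bor by blast
  have "tv Y w (\<Union>(insert B Q) - (E\<union>C)) <= tv Y w ((\<Union>Q - E)\<union>(B - C))" by (rule tv_mono[OF cn]) auto
  also have "\<dots> <= tv Y w (\<Union>Q - E) + tv Y w (B - C)" by (intro tv_Un[OF cn] bor_Diff B E Cb)
  finally have "tv Y w (\<Union>(insert B Q) - (E\<union>C)) < eps" using E(4) C(3) by simp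
  then show ?case
   using E Phi bor_Un[OF E(3) Cb] by (intro exI[of _ "\<Phi>\<union>\<Phi>'"] exI[of _ "E\<union>C"]) (simp add: ball_Un bex_Un)
 qed
 from this[OF Ps(1) subset_refl d] obtain \<Phi> E where E: "finite \<Phi>" "!!f. f\<in>\<Phi> ==> X.under U f" "E\<in>bor Y"
  "tv Y w (pts Y - E) < d" "!!y. y\<in>E ==> \<exists>f\<in>\<Phi>. F y <= G f y + 3 * d" unfolding Ps(3) by blast
 obtain f where f: "X.under U f" "!!g x. g\<in>\<Phi> ==> g x <= f x" using X.under_finite[OF E(1,2)] by blast
 let ?E = "pts Y - E"
 have Eb: "?E\<in>bor Y" by (intro bor_Diff bor_top E)
 have bF: "(cplx F)\<in>bmf Y" unfolding F_def by (rule m_real_bmf[OF m_open_bmf[OF U]])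
 have bG: "(%y. complex_of_real (G f y))\<in>bmf Y" by (rule Y.bmf_of_real[OF Gc[OF f(1)]])
 have b1: "(%y. complex_of_real (G f y + 3 * d))\<in>bmf Y" "(%y. complex_of_real (of_bool (y\<in>?E)))\<in>bmf Y"
  using bmf_add[OF bG bmf_const[of "complex_of_real (3 * d)"]] bmf_of_bool[OF Eb] by (simp_all only: of_real_add)
 have G0: "0 <= G f y" if "y\<in>pts Y" for y
  using cint_nonneg[OF m_pos[OF that] X.under_bmf[OF f(1)]] f(1) by (simp add: G_def X.under_def complex_nonneg_Reals_iff)
 \<comment> \<open>On the exceptional set outside \<open>E\<close>, of measure below
   \<open>d\<close>, the bound \<open>F \<le> 1\<close> is used.\<close>
 have "Re (cint Y (cplx F) w) <= Re (cint Y (%y. complex_of_real (G f y + 3 * d + of_bool (y\<in>?E))) w)"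
 proof (rule cint_mono_Re[OF pn bF])
  show "(%y. complex_of_real (G f y + 3 * d + of_bool (y\<in>?E)))\<in>bmf Y" using bmf_add[OF b1] by (simp only: of_real_add)
  fix y assume y: "y\<in>pts Y"
  show "F y <= G f y + 3 * d + of_bool (y\<in>?E)"
  proof (cases "y\<in>E")
   case True
   then obtain g where g: "g\<in>\<Phi>" "F y <= G g y + 3 * d" using E(5) by blast
   moreover have "G g y <= G f y" unfolding G_def
    by (rule cint_mono_Re[OF m_pos[OF y] X.under_bmf[OF E(2)[OF g(1)]] X.under_bmf[OF f(1)] f(2)[OF g(1)]])
   ultimately show ?thesis using True by simp
  next
   case False
   then show ?thesis using m_le_1[OF y open_bor[OF U]] G0[OF y] y d by (simp add: F_def)
  qed
 qed
 also have "cint Y (%y. complex_of_real (G f y + 3 * d + of_bool (y\<in>?E))) w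
   = cint Y (%y. complex_of_real (G f y)) w + complex_of_real (3 * d) * w (pts Y) + w ?E"
  by (simp only: of_real_add cint_add[OF cn b1[unfolded of_real_add]] cint_add[OF cn bG bmf_const] cint_const[OF cn] cint_of_bool[OF cn Eb])
 also have "cint Y (%y. complex_of_real (G f y)) w = cint Y (J f) w"
  using cint_nonneg[OF m_pos X.under_bmf[OF f(1)]] f(1)
  by (intro cint_cong) (auto simp: G_def X.under_def complex_nonneg_Reals_iff complex_eq_iff)
 also have "cint Y (cplx F) w = cint Y (%y. m y U) w"
  by (intro cint_cong) (simp add: F_def m_real[symmetric])
 finally have *: "Re (cint Y (%y. m y U) w) <= Re (cint Y (J f) w)
   + 3 * d * Re (w (pts Y)) + Re (w ?E)" by simp
 have "Re (w ?E) < d" using E(4) tv_positive[OF pn Eb] by simp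
 then show ?thesis using * f(1) by (intro exI[of _ f]) (simp add: algebra_simps)
qed

lemma bmf_m_cint: "cmap X f ==> (%y. cint X f (m y))\<in>bmf Y"
 by (intro Y.cont_bmf m_cont)

lemma ex_mixture:
 assumes nu: "w\<in>Mb_pos Y"
 shows "\<exists>r\<in>Mb_pos X. \<forall>f. cmap X f --> cint X f r = cint Y (%y. cint X f (m y)) w"
proof (rule X.Riesz_complex)
 note pn = Mb_posD[OF nu]
 note cn = pos_measureD(1)[OF pn]
 show "cint Y (%y. cint X (%x. f x + g x) (m y)) w = cint Y (%y. cint X f (m y)) w + cint Y (%y. cint X g (m y)) w"
  if "cmap X f" "cmap X g" for f g
  using that by (subst cint_add[OF cn bmf_m_cint bmf_m_cint, symmetric]) (auto intro!: cint_cong cint_add m_cm X.cont_bmf)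
 show "cint Y (%y. cint X (%x. c * f x) (m y)) w = c * cint Y (%y. cint X f (m y)) w"
  if "cmap X f" for f c
  using that by (subst cint_scale[OF cn bmf_m_cint, symmetric]) (auto intro!: cint_cong cint_scale m_cm X.cont_bmf)
 fix g assume g: "rmap X g" "!!x. x\<in>pts X ==> 0 <= g x"
 have n: "cint X (cplx g) (m y)\<in>\<real>\<^sub>\<ge>\<^sub>0" if "y\<in>pts Y" for y
  by (rule cint_nonneg[OF m_pos[OF that] X.bmf_of_real[OF g(1)] g(2)])
 have "cint Y (%y. complex_of_real (Re (cint X (cplx g) (m y)))) w\<in>\<real>\<^sub>\<ge>\<^sub>0"
  using n by (intro cint_nonneg[OF pn] Y.bmf_of_real m_cont_real g) (auto simp: complex_nonneg_Reals_iff)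
 then show "cint Y (%y. cint X (cplx g) (m y)) w\<in>\<real>\<^sub>\<ge>\<^sub>0"
  by (subst cint_cong[of Y _ "%y. complex_of_real (Re (cint X (cplx g) (m y)))"])
   (use n in \<open>auto simp: complex_nonneg_Reals_iff complex_eq_iff\<close>)
qed

text \<open>Set-wise integration matches the form of \<open>induced\<close>, at the price that
  countable additivity and regularity have to be proved.\<close>

definition mix :: "'b cmeasure \<Rightarrow> 'a cmeasure" where
 "mix w = (%A. if A\<in>bor X then cint Y (%y. m y A) w else 0)"

text \<open>Measurability of \<open>m y A\<close> in \<open>y\<close> and agreement of its integral
  with the representing measure are carried together through a Dynkin argument that starts from the
  open sets.\<close>

lemma m_bmf_mixture:
 assumes A: "A\<in>bor X"
 shows "(%y. m y A)\<in>bmf Y\<and>(\<forall>w\<in>Mb_pos Y. \<forall>r\<in>Mb_pos X.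
  (\<forall>f. cmap X f --> cint X f r = cint Y (%y. cint X f (m y)) w) --> cint Y (%y. m y A) w = r A)"
  (is "_\<and>(\<forall>w\<in>_. \<forall>r\<in>_. ?R w r --> _)")
proof (rule sigma_sets_induct_disjoint[of "{U. openin X U}" "pts X" A])
 show "Int_stable {U. openin X U}" by (auto simp: Int_stable_def)
 show "{U. openin X U} <= Pow (pts X)" by (rule opens_subset_Pow)
 show "A\<in>sigma_sets (pts X) {U. openin X U}" using A by (simp add: borel_sets_def)
next
 fix U assume "U\<in>{U. openin X U}"
 then have U: "openin X U" by simp
 have "cint Y (%y. m y U) w = r U" if nu: "w\<in>Mb_pos Y" and rho: "r\<in>Mb_pos X" and R: "?R w r" for w r
 proof -
  note pn = Mb_posD[OF nu] and pr = Mb_posD[OF rho]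
  have R': "cint X (cplx f) r = cint Y (J f) w" if "X.under U f" for f
   using R X.cont_of_real[of f] that by (simp add: X.under_def)
  have real: "complex_of_real (Re (cint Y (%y. m y U) w)) = cint Y (%y. m y U) w"
  proof -
   have e: "cint Y (%y. m y U) w = cint Y (%y. complex_of_real (Re (m y U))) w" by (intro cint_cong m_real)
   have "cint Y (%y. complex_of_real (Re (m y U))) w\<in>\<real>\<^sub>\<ge>\<^sub>0"
    by (rule cint_nonneg[OF pn]) (use m_real_bmf[OF m_open_bmf[OF U]] pos_measureD(2)[OF m_pos] in auto)
   then show ?thesis unfolding e by (auto simp: complex_nonneg_Reals_iff complex_eq_iff)
  qed
  \<comment> \<open>This direction interchanges a possibly uncountable supremum with the integral
    and rests on \<open>smooth\<close>; the opposite one follows from regularity of \<open>r\<close>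
    and monotonicity.\<close>
  have "Re (cint Y (%y. m y U) w) <= Re (r U)"
  proof (rule le_by_eps)
   fix eps :: real assume eps: "0 < eps"
   obtain f where f: "X.under U f" "Re (cint Y (%y. m y U) w) <= Re (cint X (cplx f) r) + eps * (3 * Re (w (pts Y)) + 1)"
    using smooth[OF U nu eps] R' by auto
   then show "Re (cint Y (%y. m y U) w) <= Re (r U) + eps * (3 * Re (w (pts Y)) + 1)"
    using X.under_le[OF pr U f(1)] by simp
  qed (use pos_measureD(2)[OF pn] in simp)
  moreover have "Re (r U) <= Re (cint Y (%y. m y U) w)"
  proof (rule ccontr)
   assume "\<not> ?thesis"
   then obtain f where f: "X.under U f" "Re (cint Y (%y. m y U) w) < Re (cint X (cplx f) r)"
    using X.under_approx[OF rho U] by (meson not_le)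
   have n: "J f y\<in>\<real>\<^sub>\<ge>\<^sub>0" if "y\<in>pts Y" for y
    using f(1) by (intro cint_nonneg[OF m_pos[OF that] X.under_bmf[OF f(1)]]) (simp add: X.under_def)
   have "Re (cint Y (%y. complex_of_real (Re (J f y))) w) <= Re (cint Y (%y. complex_of_real (Re (m y U))) w)"
   proof (rule cint_mono_Re[OF pn])
    show "(%y. complex_of_real (Re (J f y)))\<in>bmf Y"
     using f(1) by (intro Y.bmf_of_real m_cont_real) (simp add: X.under_def)
    show "(%y. complex_of_real (Re (m y U)))\<in>bmf Y" by (rule m_real_bmf[OF m_open_bmf[OF U]])
    show "Re (J f y) <= Re (m y U)" if "y\<in>pts Y" for y
     by (rule X.under_le[OF m_pos[OF that] U f(1)])
   qed
   moreover have "cint Y (%y. complex_of_real (Re (J f y))) w = cint X (cplx f) r"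
    unfolding R'[OF f(1)] using n by (intro cint_cong) (auto simp: complex_nonneg_Reals_iff complex_eq_iff)
   moreover have "cint Y (%y. complex_of_real (Re (m y U))) w = cint Y (%y. m y U) w" by (intro cint_cong m_real[symmetric])
   ultimately show False using f(2) by simp
  qed
  ultimately have "Re (cint Y (%y. m y U) w) = Re (r U)" by simp
  then have "complex_of_real (Re (cint Y (%y. m y U) w)) = complex_of_real (Re (r U))" by simp
  then show ?thesis by (simp only: real pos_measureD(4)[OF pr, symmetric])
 qed
 then show "(%y. m y U)\<in>bmf Y\<and>(\<forall>w\<in>Mb_pos Y. \<forall>r\<in>Mb_pos X. ?R w r --> cint Y (%y. m y U) w = r U)"
  using m_open_bmf[OF U] by blast
next
 have 0: "cint Y (%y. m y {}) w = 0" for w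
  using cint_cong[of Y "%y. m y {}" "%_. 0" w] cm_empty[OF m_cm] by simp
 have "(%y. m y {})\<in>bmf Y" using bmf_cong[of Y "%y. m y {}" "%_. 0"] cm_empty[OF m_cm] by simp
 then show "(%y. m y {})\<in>bmf Y\<and>(\<forall>w\<in>Mb_pos Y. \<forall>r\<in>Mb_pos X. ?R w r --> cint Y (%y. m y {}) w = r {})"
  using cm_empty[OF Mb_cm[OF pos_Mb]] unfolding 0 by metis
next
 fix A assume "A\<in>sigma_sets (pts X) {U. openin X U}"
  and IH: "(%y. m y A)\<in>bmf Y\<and>(\<forall>w\<in>Mb_pos Y. \<forall>r\<in>Mb_pos X. ?R w r --> cint Y (%y. m y A) w = r A)"
 then have A: "A\<in>bor X" by (simp add: borel_sets_def)
 have eq: "m y (pts X - A) = 1 - m y A" if "y\<in>pts Y" for y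
  using cm_Diff[OF m_cm[OF that] bor_top A bor_sub[OF A]] prob_top[OF m_prob[OF that]] by simp
 have "(%y. m y (pts X - A))\<in>bmf Y"
  using bmf_diff[OF bmf_const[of 1] conjunct1[OF IH]] by (subst bmf_cong[OF eq])
 moreover have "cint Y (%y. m y (pts X - A)) w = r (pts X - A)"
  if nu: "w\<in>Mb_pos Y" and rho: "r\<in>Mb_pos X" and R: "?R w r" for w r
 proof -
  note cn = Mb_cm[OF pos_Mb[OF nu]] and cr = Mb_cm[OF pos_Mb[OF rho]]
  have "r (pts X) = cint Y (%y. cint X (%_. 1) (m y)) w" using R cint_const[OF cr, of 1] by simp
  also have "\<dots> = cint Y (%_. 1) w" by (rule cint_cong) (simp add: cint_const[OF m_cm] prob_top[OF m_prob])
  finally have "r (pts X) = cint Y (%_. 1) w" .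
  moreover have "cint Y (%y. m y (pts X - A)) w = cint Y (%y. 1 - m y A) w" by (rule cint_cong[OF eq])
  ultimately show ?thesis
   using IH nu rho R cint_diff[OF cn bmf_const[of 1] conjunct1[OF IH]] cm_Diff[OF cr bor_top A bor_sub[OF A]] by simp
 qed
 ultimately show "(%y. m y (pts X - A))\<in>bmf Y \<and>
   (\<forall>w\<in>Mb_pos Y. \<forall>r\<in>Mb_pos X. ?R w r --> cint Y (%y. m y (pts X - A)) w = r (pts X - A))" by blast
next
 fix A :: "nat \<Rightarrow> 'a set"
 assume dj: "disjoint_family A" and "range A <= sigma_sets (pts X) {U. openin X U}"
  and IH: "!!i. (%y. m y (A i))\<in>bmf Y\<and>(\<forall>w\<in>Mb_pos Y. \<forall>r\<in>Mb_pos X. ?R w r --> cint Y (%y. m y (A i)) w = r (A i))"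
 then have A: "A i\<in>bor X" for i by (auto simp: borel_sets_def)
 define g where "g n y = (\<Sum>i<n. m y (A i))" for n y
 have gb: "g n\<in>bmf Y" for n unfolding g_def using IH by (intro bmf_sum) blast
 have lim: "(%n. g n y) \<longlonglongrightarrow> m y (\<Union>i. A i)" if "y\<in>pts Y" for y
  using cm_sums[OF m_cm[OF that] A dj] by (simp add: sums_def g_def)
 have g1: "cmod (g n y) <= 1" if "y\<in>pts Y" for n y
 proof -
  have "g n y = m y (\<Union>i\<in>{..<n}. A i)"
   unfolding g_def using dj A by (intro cm_finite_UN[OF m_cm[OF that], symmetric]) (auto simp: disjoint_family_on_def)
  then show ?thesis using m_le_1[OF that bor_finite_UN[of "{..<n}" A]] A m_cmod[OF that] by simp
 qed
 have UA: "(\<Union>i. A i)\<in>bor X" by (rule bor_UN[OF A])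
 have bU: "(%y. m y (\<Union>i. A i))\<in>bmf Y"
 proof (rule bmfI)
  show "(%y. m y (\<Union>i. A i))\<in>borel_measurable (borel_space Y)"
   by (rule borel_measurable_LIMSEQ_metric[of g]) (use gb lim in \<open>auto simp: bmf_def\<close>)
  show "cmod (m y (\<Union>i. A i)) <= 1" if "y\<in>pts Y" for y using m_le_1[OF that UA] m_cmod[OF that] by simp
 qed
 moreover have "cint Y (%y. m y (\<Union>i. A i)) w = r (\<Union>i. A i)"
  if nu: "w\<in>Mb_pos Y" and rho: "r\<in>Mb_pos X" and R: "?R w r" for w r
 proof -
  note cn = Mb_cm[OF pos_Mb[OF nu]] and cr = Mb_cm[OF pos_Mb[OF rho]]
  have "cint Y (g n) w = (\<Sum>i<n. r (A i))" for n
  proof -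
   have "cint Y (g n) w = (\<Sum>i<n. cint Y (%y. m y (A i)) w)"
    unfolding g_def by (rule cint_sum[OF cn]) (use IH in blast)
   then show ?thesis using IH nu rho R by auto
  qed
  then have "(%n. \<Sum>i<n. r (A i)) \<longlonglongrightarrow> cint Y (%y. m y (\<Union>i. A i)) w"
   using cint_dominated[OF cn gb bU g1 lim] by simp
  moreover have "(%n. \<Sum>i<n. r (A i)) \<longlonglongrightarrow> r (\<Union>i. A i)" using cm_sums[OF cr A dj] by (simp add: sums_def)
  ultimately show ?thesis by (rule LIMSEQ_unique)
 qed
 ultimately show "(%y. m y (\<Union>i. A i))\<in>bmf Y\<and>(\<forall>w\<in>Mb_pos Y. \<forall>r\<in>Mb_pos X. ?R w r --> cint Y (%y. m y (\<Union>i. A i)) w = r (\<Union>i. A i))"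
  by blast
qed

lemma m_bmf: "A\<in>bor X ==> (%y. m y A)\<in>bmf Y"
 using m_bmf_mixture by blast

lemma mix_pos:
 assumes nu: "w\<in>Mb_pos Y"
 shows "mix w\<in>Mb_pos X" "cmap X f ==> cint X f (mix w) = cint Y (%y. cint X f (m y)) w"
proof -
 obtain r where rho: "r\<in>Mb_pos X" "\<forall>f. cmap X f --> cint X f r = cint Y (%y. cint X f (m y)) w"
  using ex_mixture[OF nu] by blast
 have "mix w A = r A" for A
  using conjunct2[OF m_bmf_mixture[of A]] nu rho cm_outside[OF Mb_cm[OF pos_Mb[OF rho(1)]], of A]
  by (simp add: mix_def)
 then have "mix w = r" by blast
 then show "mix w\<in>Mb_pos X" "cmap X f ==> cint X f (mix w) = cint Y (%y. cint X f (m y)) w"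
  using rho by auto
qed

lemma mix_add: "cmeas Y u ==> cmeas Y w ==> mix (%A. u A + w A) = (%A. mix u A + mix w A)"
 by (auto simp: mix_def fun_eq_iff cint_madd m_bmf)

lemma mix_scale: "cmeas Y u ==> mix (%A. a * u A) = (%A. a * mix u A)"
 by (auto simp: mix_def fun_eq_iff cint_mscale m_bmf)

lemma mix_Mb_cint:
 assumes nu: "w\<in>Mb Y"
 shows "mix w\<in>Mb X\<and>(\<forall>f. cmap X f --> cint X f (mix w) = cint Y (%y. cint X f (m y)) w)"
proof (rule Mb_pos_induct[OF Y.Hausdorff_space nu])
 show "mix w\<in>Mb X\<and>(\<forall>f. cmap X f --> cint X f (mix w) = cint Y (%y. cint X f (m y)) w)"
  if "w\<in>Mb_pos Y" for w using mix_pos[OF that] pos_Mb by blast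
qed (simp_all add: mix_add mix_scale Mb_cm Mb_add Mb_scale cint_madd cint_mscale X.cont_bmf bmf_m_cint)

lemma mix_Mb: "w\<in>Mb Y ==> mix w\<in>Mb X"
 and cint_mix: "w\<in>Mb Y ==> cmap X f ==> cint X f (mix w) = cint Y (%y. cint X f (m y)) w"
 using mix_Mb_cint by blast+

text \<open>Factors of modulus at most 1 turn the sum of moduli over a partition into one integral
  against \<open>w\<close>, whose integrand is bounded by the mass 1 of \<open>m y\<close>.\<close>

lemma tv_mix: assumes nu: "w\<in>Mb Y" shows "tv X (mix w) (pts X) <= tv Y w (pts Y)"
proof (rule tv_le)
 note cn = Mb_cm[OF nu]
 fix P assume P: "finite P" "disjoint P" "P <= bor X" "\<Union>P <= pts X"
 define u where "u B = (if mix w B = 0 then 0 else cnj (mix w B) / cmod (mix w B))" for B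
 have u: "u B * mix w B = cmod (mix w B)" "cmod (u B) <= 1" for B
  using complex_norm_square[of "mix w B"] by (auto simp: u_def norm_divide mult.commute power2_eq_square field_simps)
 have bB: "(%y. u B * m y B)\<in>bmf Y" if "B\<in>P" for B using that P(3) by (intro bmf_mult bmf_const m_bmf) auto
 have "complex_of_real (\<Sum>B\<in>P. cmod (mix w B)) = (\<Sum>B\<in>P. u B * cint Y (%y. m y B) w)"
  unfolding of_real_sum
 proof (rule sum.cong[OF refl])
  fix B assume "B\<in>P"
  then have "mix w B = cint Y (%y. m y B) w" using P(3) by (auto simp: mix_def)
  then show "complex_of_real (cmod (mix w B)) = u B * cint Y (%y. m y B) w" using u(1)[of B] by simp
 qed
 also have "\<dots> = cint Y (%y. \<Sum>B\<in>P. u B * m y B) w"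
  using P(3) m_bmf by (subst cint_sum[OF cn bB]) (auto intro!: sum.cong cint_scale[OF cn, symmetric])
 finally have "(\<Sum>B\<in>P. cmod (mix w B)) = cmod (cint Y (%y. \<Sum>B\<in>P. u B * m y B) w)"
  using norm_of_real[of "\<Sum>B\<in>P. cmod (mix w B)", where 'a=complex] by (simp only: abs_of_nonneg[OF sum_nonneg[OF norm_ge_zero]])
 also have "\<dots> <= 1 * tv Y w (pts Y)"
 proof (rule cint_norm[OF cn bmf_sum[OF bB]])
  fix y assume y: "y\<in>pts Y"
  have "cmod (\<Sum>B\<in>P. u B * m y B) <= (\<Sum>B\<in>P. cmod (m y B))"
   by (rule order_trans[OF norm_sum sum_mono]) (use u(2) in \<open>simp add: norm_mult mult_left_le_one_le\<close>)
  also have "\<dots> <= tv X (m y) (pts X)" by (rule tv_upper_set[OF m_cm[OF y] P])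
  also have "\<dots> = 1" using tv_positive[OF m_pos[OF y] bor_top] prob_top[OF m_prob[OF y]] by simp
  finally show "cmod (\<Sum>B\<in>P. u B * m y B) <= 1" .
 qed auto
 finally show "(\<Sum>B\<in>P. cmod (mix w B)) <= tv Y w (pts Y)" by simp
qed

end

section \<open>Invariant measures on the fibres of restriction\<close>

context dual_pair

begin

text \<open>The choice is harmless, as the transform determines the measure. It turns out to be the
  invariant probability measure on the extensions of \<open>t\<close>.\<close>

definition mu :: "('a \<Rightarrow> complex) \<Rightarrow> ('a \<Rightarrow> complex) cmeasure" where
 "mu t = (SOME u. u\<in>M_prob A.X\<and>(\<forall>h\<in>A.S. tA h u = (if h\<in>H\<^sub>0 then t h else 0)))"

lemma mu_prob: "t\<in>characters L ==> mu t\<in>M_prob A.X"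
 and mu_tr: "t\<in>characters L ==> h\<in>A.S ==> tA h (mu t) = (if h\<in>H\<^sub>0 then t h else 0)"
 using someI_ex[OF ex_fibre_measure[unfolded Bex_def]] unfolding mu_def by blast+

lemma mu_Mb: "t\<in>characters L ==> mu t\<in>Mb A.X"
 using mu_prob prob_Mb by blast

lemma mu_eqI: "u\<in>Mb A.X ==> t\<in>characters L ==> (!!h. h\<in>A.S ==> tA h u = (if h\<in>H\<^sub>0 then t h else 0)) ==> u = mu t"
 by (rule A.transform_unique) (simp_all add: mu_Mb mu_tr)

text \<open>The image under restriction has the transform of a point mass; this is what concentrates
  \<open>mu t\<close> on the fibre over \<open>t\<close>.\<close>

lemma push_mu: assumes "t\<in>characters L" shows "push A.X B.X p (mu t) = dirac B.X t"
proof (rule B.transform_unique)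
 show "push A.X B.X p (mu t)\<in>Mb B.X" by (rule Mb_push[OF mu_Mb[OF assms] cont_p])
 show "dirac B.X t\<in>Mb B.X" by (rule prob_Mb[OF B.point_prob[OF assms]])
 fix h assume "h\<in>carrier_of L"
 then have "h\<in>H\<^sub>0" "h\<in>A.S" "h\<in>carrier_of L" using sub_subset by auto
 then show "tB h (push A.X B.X p (mu t)) = tB h (dirac B.X t)"
  using tB_push[OF mu_Mb[OF assms]] mu_tr[OF assms] B.tr_dirac[OF _ assms] by simp
qed

lemma extensions_eq: "extensions H H\<^sub>0 t = {x\<in>pts A.X. p x = t}"
 by (simp add: extensions_def)

lemma closedin_extensions: "t\<in>characters L ==> closedin A.X (extensions H H\<^sub>0 t)"
 using closedin_continuous_map_preimage[OF cont_p closedin_Hausdorff_singleton[OF B.Hausdorff_space]] by (simp add: extensions_eq)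

lemma mu_null: assumes "t\<in>characters L" shows "mu t (pts A.X - extensions H H\<^sub>0 t) = 0"
proof -
 have B: "pts B.X - {t}\<in>bor B.X"
  by (intro bor_Diff bor_top closed_bor closedin_Hausdorff_singleton[OF B.Hausdorff_space]) (simp add: assms)
 have "pts A.X - extensions H H\<^sub>0 t = p -` (pts B.X - {t})\<inter>pts A.X"
  using p_char by (auto simp: extensions_def)
 then have "mu t (pts A.X - extensions H H\<^sub>0 t) = push A.X B.X p (mu t) (pts B.X - {t})" by (simp only: push_apply[OF B])
 then show ?thesis by (simp add: push_mu[OF assms] dirac_def)
qed

lemma mu_cint_cong:
 assumes "t\<in>characters L" "f\<in>bmf A.X" "g\<in>bmf A.X" "!!x. x\<in>extensions H H\<^sub>0 t ==> f x = g x"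
 shows "cint A.X f (mu t) = cint A.X g (mu t)"
 by (rule cint_cong_on[OF Mb_posD[OF prob_pos[OF mu_prob]] closed_bor[OF closedin_extensions] mu_null]) (use assms in auto)

text \<open>A probability measure concentrated on the set of extensions forces that set to be
  nonempty.\<close>

lemma ex_extension: assumes "t\<in>characters L" obtains x where "x\<in>characters H" "p x = t"
proof -
 have "extensions H H\<^sub>0 t ~= {}" using mu_null[OF assms] prob_top[OF mu_prob[OF assms]] by auto
 then show thesis using that by (auto simp: extensions_def)
qed

abbreviation one :: "'a \<Rightarrow> complex" where "one \<equiv> \<lambda>h\<in>H\<^sub>0. 1"

lemma one_mem: "one\<in>characters L"
 using B.hunit_dual_mem by (simp add: B.hunit_dual)

lemma annihilator_eq: "annihilator H H\<^sub>0 = extensions H H\<^sub>0 one"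
 by (auto simp: annihilator_def extensions_def fun_eq_iff restrict_def)

lemma conv_mu_one: assumes "x\<in>characters H" shows "A.conv (dirac A.X x) (mu one) = mu (p x)"
 using assms p_char one_mem mu_Mb prob_Mb[OF A.point_prob]
 by (intro mu_eqI) (auto simp: A.conv_Mb A.conv_tr A.tr_dirac mu_tr)

lemma mu_invariant: assumes "t\<in>characters L" "s\<in>annihilator H H\<^sub>0" shows "A.conv (dirac A.X s) (mu t) = mu t"
 using assms mu_Mb[OF assms(1)] prob_Mb[OF A.point_prob[of s]]
 by (intro mu_eqI) (auto simp: A.conv_Mb A.conv_tr A.tr_dirac mu_tr annihilator_def)

text \<open>\<open>mu one\<close> lives on the annihilator. If all its elements were 1 at
  \<open>h\<close>, the transform at \<open>h\<close> would be 1, but it is 0.\<close>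

lemma annihilator_separates: assumes "h\<in>A.S - H\<^sub>0" shows "\<exists>s\<in>annihilator H H\<^sub>0. s h ~= 1"
proof (rule ccontr)
 assume "\<not> ?thesis"
 then have "tA h (mu one) = cint A.X (%_. 1) (mu one)"
  using assms by (intro mu_cint_cong[OF one_mem]) (auto simp: annihilator_eq A.bmf_e)
 then show False
  using mu_tr[OF one_mem, of h] assms cint_const[OF Mb_cm[OF mu_Mb[OF one_mem]], of 1] prob_top[OF mu_prob[OF one_mem]] by simp
qed

text \<open>Uniqueness through transforms: on \<open>H\<^sub>0\<close> the integrand is 1 on the
  annihilator, and elsewhere invariance under an element with value other than 1 at \<open>h\<close>
  forces the transform to vanish.\<close>

lemma normalized_Haar_annihilator: "normalized_Haar (dual H) (annihilator H H\<^sub>0) = mu one"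
 unfolding normalized_Haar_def
proof (rule the_equality)
 show "mu one\<in>M_prob A.X\<and>mu one (carrier_of (dual H) - annihilator H H\<^sub>0) = 0\<and>(\<forall>x\<in>annihilator H H\<^sub>0. A.conv (point (dual H) x) (mu one) = mu one)"
  using mu_prob[OF one_mem] mu_null[OF one_mem] mu_invariant[OF one_mem] by (auto simp: annihilator_eq)
 fix \<omega> assume w: "\<omega>\<in>M_prob A.X\<and>\<omega> (carrier_of (dual H) - annihilator H H\<^sub>0) = 0\<and>(\<forall>x\<in>annihilator H H\<^sub>0. A.conv (point (dual H) x) \<omega> = \<omega>)"
 then have pm: "pos_measure A.X \<omega>" and m: "\<omega>\<in>Mb A.X" using Mb_posD prob_pos prob_Mb by blast+
 show "\<omega> = mu one"
 proof (rule mu_eqI[OF m one_mem])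
  fix h assume h: "h\<in>A.S"
  show "tA h \<omega> = (if h\<in>H\<^sub>0 then one h else 0)"
  proof (cases "h\<in>H\<^sub>0")
   case True
   have "tA h \<omega> = cint A.X (%_. 1) \<omega>"
    using w True by (intro cint_cong_on[OF pm closed_bor[OF closedin_extensions[OF one_mem]]])
     (auto simp: annihilator_eq[symmetric] A.bmf_e h annihilator_def)
   then show ?thesis using True prob_top[OF conjunct1[OF w]] cint_const[OF Mb_cm[OF m], of 1] by simp
  next
   case False
   then obtain t where s: "t\<in>annihilator H H\<^sub>0" "t h ~= 1" using annihilator_separates h by blast
   have "t\<in>characters H" using s by (simp add: annihilator_def)
   then have "tA h \<omega> = t h * tA h \<omega>"
    using A.conv_tr[OF h prob_Mb[OF A.point_prob] m, of t] A.tr_dirac[OF h, of t] w s by simp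
   then show ?thesis using s False by simp
  qed
 qed
qed

text \<open>By \<open>conv_mu_one\<close> the translate of the Haar measure of the annihilator by
  any extension of \<open>t\<close> is \<open>mu t\<close>, whichever extension is taken.\<close>

lemma induced_point_eq: assumes "t\<in>characters L" shows "induced_point H H\<^sub>0 t = mu t"
 unfolding induced_point_def normalized_Haar_annihilator
proof (rule the_equality)
 obtain y where x: "y\<in>characters H" "p y = t" using ex_extension[OF assms] .
 then show "mu t\<in>M_prob A.X\<and>mu t (carrier_of (dual H) - extensions H H\<^sub>0 t) = 0 \<and>
  (\<forall>s\<in>annihilator H H\<^sub>0. A.conv (point (dual H) s) (mu t) = mu t) \<and>
  (\<exists>y\<in>extensions H H\<^sub>0 t. mu t = A.conv (point (dual H) y) (mu one))"
  using mu_prob[OF assms] mu_null[OF assms] mu_invariant[OF assms] conv_mu_one[OF x(1)] by (auto simp: extensions_def)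
qed (auto simp: extensions_def conv_mu_one)

text \<open>Every extension translates \<open>mu one\<close> into \<open>mu t\<close>, and the unit
  belongs to the support of \<open>mu one\<close> by invariance; so every extension lies in the
  support.\<close>

lemma supp_mu: assumes "t\<in>characters L" shows "supp A.X (mu t) = extensions H H\<^sub>0 t"
proof
 have sub: "supp A.X (mu t) <= extensions H H\<^sub>0 t" if "t\<in>characters L" for t
  by (rule A.supp_subset_closed[OF prob_pos[OF mu_prob] closedin_extensions mu_null]) (rule that)+
 show "supp A.X (mu t) <= extensions H H\<^sub>0 t" by (rule sub[OF assms])
 have ia: "hinv (dual H) s\<in>annihilator H H\<^sub>0" if "s\<in>annihilator H H\<^sub>0" for s
  using that A.hinv_dual_mem[of s] sub_subset by (auto simp: annihilator_def A.hinv_dual subset_iff)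
 have u: "hunit (dual H)\<in>supp A.X (mu one)"
  by (rule A.unit_mem_supp[OF mu_prob[OF one_mem] sub[OF one_mem]]) (simp add: annihilator_eq[symmetric] ia mu_invariant[OF one_mem])
 show "extensions H H\<^sub>0 t <= supp A.X (mu t)"
 proof
  fix y assume "y\<in>extensions H H\<^sub>0 t"
  then have x: "y\<in>characters H" "p y = t" by (auto simp: extensions_def)
  show "y\<in>supp A.X (mu t)" using A.translate_mem_supp[OF mu_prob[OF one_mem] u x(1)] conv_mu_one[OF x(1)] x(2) by simp
 qed
qed

text \<open>For a trigonometric polynomial the integral is a finite combination of values
  \<open>s k\<close> with \<open>k\<close> in \<open>H\<^sub>0\<close>. All \<open>mu s\<close> have
  mass 1, so the approximation of \<open>f\<close> is uniform in \<open>s\<close>.\<close>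

lemma continuous_mu_cint:
 assumes f: "cmap A.X f"
 shows "cmap B.X (%s. cint A.X f (mu s))"
proof (rule cont_local_approx)
 fix s and eps :: real assume t: "s\<in>pts B.X" and eps: "0 < eps"
 obtain g where g: "A.trig g" "!!x. x\<in>pts A.X ==> cmod (f x - g x) < eps" by (rule A.Stone_Weierstrass[OF f eps]) (rule that)
 obtain F a where F: "finite F" "F <= A.S" "!!x. x\<in>pts A.X ==> g x = (\<Sum>k\<in>F. a k * x k)"
  using g(1) unfolding A.trig_def by blast
 have "cmap B.X (%s. \<Sum>k\<in>F. a k * (if k\<in>H\<^sub>0 then s k else 0))"
  using B.e_cont by (intro continuous_map_sum cont_cmult) (auto simp: F)
 moreover have "cmod (cint A.X f (mu w) - (\<Sum>k\<in>F. a k * (if k\<in>H\<^sub>0 then w k else 0))) <= eps" if w: "w\<in>characters L" for w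
 proof -
  note cm = Mb_cm[OF mu_Mb[OF w]]
  have "cint A.X g (mu w) = (\<Sum>k\<in>F. a k * tA k (mu w))" by (rule A.cint_trig[OF cm F])
  also have "\<dots> = (\<Sum>k\<in>F. a k * (if k\<in>H\<^sub>0 then w k else 0))"
   using F(2) mu_tr[OF w] by (intro sum.cong refl arg_cong2[of _ _ _ _ "(*)"]) auto
  finally have e: "cint A.X g (mu w) = (\<Sum>k\<in>F. a k * (if k\<in>H\<^sub>0 then w k else 0))" .
  have "cmod (cint A.X f (mu w) - cint A.X g (mu w)) <= eps * tv A.X (mu w) (pts A.X)"
   using g eps by (intro A.cint_approx[OF cm A.cont_bmf[OF f] A.bmf_trig]) (auto intro: less_imp_le)
  then show ?thesis using A.tv_Mb_pos[OF prob_pos[OF mu_prob[OF w]]] prob_top[OF mu_prob[OF w]] by (simp add: e)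
 qed
 ultimately show "\<exists>W \<Psi>. openin B.X W\<and>s\<in>W\<and>cmap B.X \<Psi>\<and>(\<forall>w\<in>W. cmod (cint A.X f (mu w) - \<Psi> w) <= eps)"
  using t openin_topspace[of B.X] by (intro exI[of _ "pts B.X"] exI[of _ "%s. \<Sum>k\<in>F. a k * (if k\<in>H\<^sub>0 then s k else 0)"]) auto
qed

sublocale M: continuous_kernel A.X B.X mu
 by unfold_locales (auto intro: mu_prob continuous_mu_cint)

text \<open>For a bump function inside \<open>U\<close>, the characters \<open>t\<close> with
  positive integral against \<open>mu t\<close> form an open set. Since \<open>mu t\<close> lives on
  the fibre over \<open>t\<close>, each of them has an extension in \<open>U\<close>.\<close>

lemma open_map_p: assumes U: "openin A.X U" shows "openin B.X (p ` U)"
proof (subst openin_subopen, intro ballI)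
 fix t assume "t\<in>p ` U"
 then obtain z where x: "z\<in>U" "t = p z" by blast
 have xH: "z\<in>characters H" using openin_subset[OF U] x(1) by auto
 obtain f where f: "rmap A.X f" "!!x. x\<in>pts A.X ==> 0 <= f x\<and>f x <= 1"
  "!!y. y\<in>pts A.X ==> y\<notin>U ==> f y = 0" "f z = 1" by (rule A.bump[OF U x(1)]) (rule that)
 let ?W = "{t\<in>pts B.X. Re (cint A.X (cplx f) (mu t))\<in>{0<..}}"
 have "openin B.X ?W"
  by (rule openin_continuous_map_preimage[OF M.m_cont_real[OF f(1)]]) (auto simp: open_openin[symmetric])
 moreover have "t\<in>?W"
  using A.supp_integral_pos[OF prob_pos[OF mu_prob], of t z f] p_char[OF xH] f x xH
  by (auto simp: supp_mu extensions_def)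
 moreover have "?W <= p ` U"
 proof
  fix \<sigma> assume s: "\<sigma>\<in>?W"
  then have sL: "\<sigma>\<in>characters L" by simp
  show "\<sigma>\<in>p ` U"
  proof (rule ccontr)
   assume "\<sigma>\<notin>p ` U"
   then have "cint A.X (cplx f) (mu \<sigma>) = cint A.X (%_. 0) (mu \<sigma>)"
    using f(3) by (intro mu_cint_cong[OF sL A.bmf_of_real[OF f(1)]]) (auto simp: extensions_def)
   then show False using s by simp
  qed
 qed
 ultimately show "\<exists>T. openin B.X T\<and>t\<in>T\<and>T <= p ` U" by blast
qed

section \<open>Induced measures\<close>

abbreviation ind :: "('a \<Rightarrow> complex) cmeasure \<Rightarrow> ('a \<Rightarrow> complex) cmeasure" where "ind \<equiv> induced H H\<^sub>0"

lemma ind_eq: "ind = M.mix"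
proof
 fix w show "ind w = M.mix w"
  using cint_cong[of B.X "%t. induced_point H H\<^sub>0 t A" "%t. mu t A" w for A] by (auto simp: induced_def M.mix_def fun_eq_iff induced_point_eq)
qed

lemma ind_tr: assumes "w\<in>Mb B.X" "h\<in>A.S" shows "tA h (ind w) = (if h\<in>H\<^sub>0 then tB h w else 0)"
proof -
 have "tA h (ind w) = cint B.X (%t. tA h (mu t)) w" unfolding ind_eq by (rule M.cint_mix[OF assms(1) A.e_cont[OF assms(2)]])
 also have "\<dots> = cint B.X (%t. if h\<in>H\<^sub>0 then t h else 0) w" by (rule cint_cong) (simp add: mu_tr assms)
 finally show ?thesis by simp
qed

text \<open>The image of the induced measure under restriction is \<open>w\<close>, so no mass lies
  off the preimage of its support. Conversely, positivity at a point of \<open>supp_mu\<close> and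
  continuity in \<open>t\<close> propagate through the integral against \<open>w\<close>.\<close>

lemma supp_ind: assumes nu: "w\<in>Mb_pos B.X" shows "supp A.X (ind w) = {y\<in>characters H. p y\<in>supp B.X w}"
proof
 note ri = M.mix_pos(1)[OF nu, folded ind_eq]
 let ?E = "{y\<in>pts A.X. p y\<in>supp B.X w}"
 have cl: "closedin A.X ?E" by (rule closedin_continuous_map_preimage[OF cont_p B.closedin_supp])
 have pp: "push A.X B.X p (ind w) = w"
 proof (rule B.transform_unique)
  show "push A.X B.X p (ind w)\<in>Mb B.X" by (rule Mb_push[OF pos_Mb[OF ri] cont_p])
  fix h assume "h\<in>carrier_of L"
  then have "h\<in>H\<^sub>0" "h\<in>A.S" using sub_subset by auto
  then show "tB h (push A.X B.X p (ind w)) = tB h w" using tB_push[OF pos_Mb[OF ri]] ind_tr[OF pos_Mb[OF nu]] by simp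
 qed (rule pos_Mb[OF nu])
 have Bs: "pts B.X - supp B.X w\<in>bor B.X" by (intro bor_Diff bor_top closed_bor B.closedin_supp)
 have "pts A.X - ?E = p -` (pts B.X - supp B.X w)\<inter>pts A.X" using p_char by auto
 then have "ind w (pts A.X - ?E) = w (pts B.X - supp B.X w)" using push_apply[OF Bs, of A.X p "ind w"] by (simp only: pp)
 also have "\<dots> = 0" by (rule B.null_if_disjoint_supp[OF pos_Mb[OF nu] Bs]) auto
 finally show "supp A.X (ind w) <= {y\<in>characters H. p y\<in>supp B.X w}" using A.supp_subset_closed[OF ri cl] by simp
 show "{y\<in>characters H. p y\<in>supp B.X w} <= supp A.X (ind w)"
 proof
  fix y assume "y\<in>{y\<in>characters H. p y\<in>supp B.X w}"
  then have x: "y\<in>characters H" "p y\<in>supp B.X w" by auto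
  show "y\<in>supp A.X (ind w)"
  proof (rule A.suppI[OF pos_Mb[OF ri]])
   fix g assume g: "rmap A.X g" "!!x. x\<in>pts A.X ==> 0 <= g x" "0 < g y"
   let ?G = "%t. Re (cint A.X (cplx g) (mu t))"
   have n: "cint A.X (cplx g) (mu t)\<in>\<real>\<^sub>\<ge>\<^sub>0" if "t\<in>pts B.X" for t
    by (rule cint_nonneg[OF M.m_pos[OF that] A.bmf_of_real[OF g(1)] g(2)])
   have "0 < Re (cint B.X (cplx ?G) w)"
   proof (rule B.supp_integral_pos[OF nu x(2) M.m_cont_real[OF g(1)]])
    show "0 <= ?G t" if "t\<in>pts B.X" for t using n[OF that] by (simp add: complex_nonneg_Reals_iff)
    show "0 < ?G (p y)"
     by (rule A.supp_integral_pos[OF prob_pos[OF mu_prob], of _ y]) (use x g p_char in \<open>auto simp: supp_mu extensions_def\<close>)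
   qed
   also have "cint B.X (cplx ?G) w = cint B.X (%t. cint A.X (cplx g) (mu t)) w"
    using n by (intro cint_cong) (auto simp: complex_nonneg_Reals_iff complex_eq_iff)
   also have "\<dots> = cint A.X (cplx g) (ind w)"
    unfolding ind_eq by (rule M.cint_mix[OF pos_Mb[OF nu] A.cont_of_real[OF g(1)], symmetric])
   finally show "cint A.X (cplx g) (ind w) ~= 0" by auto
  qed (use x in simp)
 qed
qed

end

section \<open>The hypergroup on the union of two duals\<close>

lemma (in compact_Hausdorff) supp_pos:
 assumes mu: "u\<in>Mb_pos X"
 shows "x\<in>supp X u \<longleftrightarrow> x\<in>pts X\<and>(\<forall>U. openin X U --> x\<in>U --> u U ~= 0)"
proof -
 note pm = Mb_posD[OF mu]
 have "total_variation X u U = 0 \<longleftrightarrow> u U = 0" if "openin X U" for U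
  using tv_zero_iff[OF pos_measureD(1)[OF pm], of U] tv_positive[OF pm open_bor[OF that]] pos_measureD(4)[OF pm, of U]
  by (metis of_real_0 zero_complex.simps(1))
 then show ?thesis by (auto simp: supp_def)
qed

context dual_pair

begin

section \<open>Topology and measures on the disjoint union\<close>

abbreviation C :: "tag \<Rightarrow> ('a \<Rightarrow> complex) topology" where "C \<equiv> union_component H H\<^sub>0"

abbreviation X :: "(tag\<times>('a \<Rightarrow> complex)) topology" where "X \<equiv> union_topology H H\<^sub>0"

abbreviation put' where "put' \<equiv> put H H\<^sub>0"

abbreviation part' where "part' \<equiv> part H H\<^sub>0"

lemma C_simps [simp]: "C Circ = A.X" "C Bullet = B.X"
 by (simp_all add: union_component_def)

lemma compact_C: "compact_Hausdorff (C s)"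
 by (cases s) (simp_all add: A.compact_Hausdorff_axioms B.compact_Hausdorff_axioms)

lemma topspace_X [simp]: "pts X = Sigma UNIV (pts \<circ> C)"
 by (simp add: union_topology_def)

lemma cont_Pair: "continuous_map (C s) X (Pair s)"
 unfolding union_topology_def by (rule continuous_map_component_injection) simp

lemma openin_X: "openin X U \<longleftrightarrow> U <= pts X\<and>(\<forall>s. openin (C s) {x. (s, x)\<in>U})"
 unfolding union_topology_def openin_sum_topology topspace_sum_topology by simp

lemma openin_Pair: "openin (C s) V ==> openin X (Pair s ` V)"
 using open_map_component_injection[of s UNIV C] unfolding union_topology_def open_map_def by blast

lemma continuous_map_X: assumes "!!s. continuous_map (C s) Y (%x. f (s, x))" shows "continuous_map X Y f"
 unfolding continuous_map_def openin_X
proof (intro conjI allI impI)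
 show "f\<in>pts X \<rightarrow> pts Y" using continuous_map_image_subset_topspace[OF assms] by (fastforce simp: image_subset_iff)
 fix U s assume U: "openin Y U"
 have "{x. (s, x)\<in>{z\<in>pts X. f z\<in>U}} = {x\<in>pts (C s). f (s, x)\<in>U}" by auto
 then show "openin (C s) {x. (s, x)\<in>{z\<in>pts X. f z\<in>U}}" using openin_continuous_map_preimage[OF assms U] by simp
qed auto

lemma compact_X: "compact_Hausdorff X"
proof
 have "compactin X (Pair s ` pts (C s))" for s
  using compact_Hausdorff.compact_space[OF compact_C] by (intro image_compactin[OF _ cont_Pair]) (simp add: compact_space_def)
 then have "compactin X (Pair Circ ` pts (C Circ)\<union>Pair Bullet ` pts (C Bullet))" by (rule compactin_Un) fact
 moreover have "pts X = Pair Circ ` pts (C Circ)\<union>Pair Bullet ` pts (C Bullet)"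
 proof (rule set_eqI)
  fix z show "z\<in>pts X \<longleftrightarrow> z\<in>Pair Circ ` pts (C Circ)\<union>Pair Bullet ` pts (C Bullet)" by (cases z; cases "fst z") auto
 qed
 ultimately show "compact_space X" unfolding compact_space_def by (simp only:)
 show "Hausdorff_space X"
  unfolding Hausdorff_space_def
 proof (intro allI impI)
  fix x y assume xy: "x\<in>pts X\<and>y\<in>pts X\<and>x ~= y"
  obtain s a t b where [simp]: "x = (s, a)" "y = (t, b)" by fastforce
  show "\<exists>U V. openin X U\<and>openin X V\<and>x\<in>U\<and>y\<in>V\<and>disjnt U V"
  proof (cases "s = t")
   case False
   then show ?thesis using xy openin_Pair[OF openin_topspace[of "C s"]] openin_Pair[OF openin_topspace[of "C t"]]
    by (intro exI[of _ "Pair s ` pts (C s)"] exI[of _ "Pair t ` pts (C t)"]) (auto simp: disjnt_def)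
  next
   case True
   then have "a\<in>pts (C s)" "b\<in>pts (C s)" "a ~= b" using xy by auto
   then obtain U V where "openin (C s) U" "openin (C s) V" "a\<in>U" "b\<in>V" "disjnt U V"
    using compact_Hausdorff.Hausdorff_space[OF compact_C[of s]] unfolding Hausdorff_space_def by meson
   then show ?thesis using True openin_Pair by (intro exI[of _ "Pair s ` U"] exI[of _ "Pair s ` V"]) (auto simp: disjnt_def)
  qed
 qed
qed

lemma borel_Pair: assumes "A\<in>bor (C s)" shows "Pair s ` A\<in>bor X"
 using assms unfolding borel_sets_def[of "C s"]
proof (induction rule: sigma_sets.induct)
 case (Basic a)
 then show ?case using openin_Pair open_bor by blast
next
 case (Compl a)
 have "Pair s ` (pts (C s) - a) = Pair s ` pts (C s) - Pair s ` a" by blast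
 then show ?case using bor_Diff[OF open_bor[OF openin_Pair[OF openin_topspace]] Compl.IH] by simp
next
 case (Union F)
 then show ?case by (simp only: image_UN bor_UN)
qed simp

lemma Pair_vimage: "A\<in>bor (C s) ==> Pair s -` Pair s ` A\<inter>pts (C s) = A"
 using bor_sub by fastforce

lemma put_Mb: "u\<in>Mb (C s) ==> put' s u\<in>Mb X"
 and put_pos: "u\<in>Mb_pos (C s) ==> put' s u\<in>Mb_pos X"
 unfolding put_def by (auto intro: Mb_push pos_push cont_Pair)

lemma part_put: "cmeas (C s) u ==> part' s (put' s u) = u"
 using borel_Pair Pair_vimage cm_outside by (auto simp: part_def put_def push_def fun_eq_iff)

lemma part_put_other: "cmeas (C s) u ==> s ~= t ==> part' t (put' s u) = (%A. 0)"
proof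
 fix A assume "cmeas (C s) u" "s ~= t"
 moreover from this have "Pair s -` Pair t ` A\<inter>pts (C s) = {}" by auto
 ultimately show "part' t (put' s u) A = 0"
  by (simp add: part_def put_def push_def cm_empty)
qed

lemma part_cm: assumes "cmeas X M" shows "cmeas (C s) (part' s M)"
 unfolding complex_measure_def
proof (intro conjI allI impI)
 fix F :: "nat \<Rightarrow> ('a \<Rightarrow> complex) set" assume F: "range F <= bor (C s)" "disjoint_family F"
 have "(%n. M (Pair s ` F n)) sums M (\<Union>n. Pair s ` F n)"
  by (intro cm_sums[OF assms] borel_Pair range_subsetD[OF F(1)]) (use F(2) in \<open>auto simp: disjoint_family_on_def\<close>)
 moreover have "(\<Union>n. F n)\<in>bor (C s)" using F by (intro bor_UN) auto
 ultimately show "(%n. part' s M (F n)) sums part' s M (\<Union>n. F n)" using F by (simp add: part_def image_UN range_subsetD)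
qed (simp add: part_def)

lemma part_Mb: assumes "M\<in>Mb X" shows "part' s M\<in>Mb (C s)"
proof (rule MbI[OF part_cm[OF Mb_cm[OF assms]]])
 note cm = Mb_cm[OF assms]
 fix A eps assume A: "A\<in>bor (C s)" and eps: "0 < (eps :: real)"
 obtain D where D: "compactin X D" "D <= Pair s ` A" "tv X M (Pair s ` A - D) < eps" by (rule MbE[OF assms borel_Pair[OF A] eps]) (rule that)
 let ?D = "{x\<in>pts (C s). (s, x)\<in>D}"
 have "closedin X D" using D(1) compact_Hausdorff.closed_compact[OF compact_X] by blast
 then have "closedin (C s) ?D" by (rule closedin_continuous_map_preimage[OF cont_Pair])
 then have c: "compactin (C s) ?D" using compact_Hausdorff.closed_compact[OF compact_C] by blast
 have "tv (C s) (part' s M) (A - ?D) <= tv X M (Pair s ` A - D)"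
 proof (rule tv_le)
  fix P assume P: "finite P" "disjoint P" "P <= bor (C s)" "\<Union>P <= A - ?D"
  have "(\<Sum>B\<in>P. cmod (M (Pair s ` B))) <= tv X M (Pair s ` A - D)"
  proof (rule tv_upper[OF cm P(1)])
   show "disjoint_family_on (%B. Pair s ` B) P" using P(2) by (fastforce simp: disjoint_family_on_def disjoint_def)
   show "Pair s ` B <= Pair s ` A - D" if "B\<in>P" for B using that P(3,4) bor_sub[OF A] by fastforce
  qed (use P borel_Pair in auto)
  then show "(\<Sum>B\<in>P. cmod (part' s M B)) <= tv X M (Pair s ` A - D)" using P(3) by (simp add: part_def subset_iff)
 qed
 then show "\<exists>E. compactin (C s) E\<and>E <= A\<and>tv (C s) (part' s M) (A - E) < eps" using c D by (intro exI[of _ ?D]) auto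
qed

lemma part_pos: "M\<in>Mb_pos X ==> part' s M\<in>Mb_pos (C s)"
 using part_Mb by (simp add: Mb_pos_def part_def)

text \<open>Disjoint families on the two components, once tagged, form one disjoint family on the
  union; the two suprema are then taken one after the other.\<close>

lemma tv_parts: assumes "M\<in>Mb X" shows "tv A.X (part' Circ M) (pts A.X) + tv B.X (part' Bullet M) (pts B.X) <= tv X M (pts X)"
proof -
 note cm = Mb_cm[OF assms]
 have *: "(\<Sum>B\<in>P. cmod (part' Circ M B)) + (\<Sum>B\<in>Q. cmod (part' Bullet M B)) <= tv X M (pts X)"
  if P: "finite P" "disjoint P" "P <= bor A.X" and Q: "finite Q" "disjoint Q" "Q <= bor B.X" for P Q
 proof -
  let ?R = "%s. case s of Circ \<Rightarrow> P | Bullet \<Rightarrow> Q"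
  have R: "finite (?R s)" "disjoint (?R s)" "?R s <= bor (C s)" for s using P Q by (cases s; simp)+
  have "Pair s ` B\<inter>Pair t ` D = {}" if "B\<in>?R s" "D\<in>?R t" "(s, B) ~= (t, D)" for s B t D
  proof (cases "s = t")
   case True
   then have "B\<inter>D = {}" using that by (intro disjointD[OF R(2)[of s]]) auto
   then show ?thesis by auto
  qed auto
  then have dj: "disjoint_family_on (%i. Pair (fst i) ` snd i) (Sigma {Circ, Bullet} ?R)"
   unfolding disjoint_family_on_def by (intro ballI impI) (simp only: split_paired_all mem_Sigma_iff fst_conv snd_conv, blast)
  have "(\<Sum>i\<in>Sigma {Circ, Bullet} ?R. cmod (M (Pair (fst i) ` snd i))) <= tv X M (pts X)"
  proof (rule tv_upper[OF cm _ dj])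
   fix i assume "i\<in>Sigma {Circ, Bullet} ?R"
   then obtain s B where i: "i = (s, B)" "B\<in>bor (C s)" using R(3) by blast
   show 1: "Pair (fst i) ` snd i\<in>bor X" using i borel_Pair by simp
   show "Pair (fst i) ` snd i <= pts X" using bor_sub[OF 1] .
  qed (use P Q in auto)
  moreover have "(\<Sum>i\<in>Sigma {Circ, Bullet} ?R. cmod (M (Pair (fst i) ` snd i)))
    = (\<Sum>B\<in>P. cmod (M (Pair Circ ` B))) + (\<Sum>B\<in>Q. cmod (M (Pair Bullet ` B)))"
   using P(1) Q(1) by (simp add: sum.Sigma[of "{Circ, Bullet}" ?R "%s B. cmod (M (Pair s ` B))", unfolded case_prod_beta, symmetric] split: tag.splits)
  moreover have "(\<Sum>B\<in>P. cmod (M (Pair Circ ` B))) = (\<Sum>B\<in>P. cmod (part' Circ M B))" "(\<Sum>B\<in>Q. cmod (M (Pair Bullet ` B))) = (\<Sum>B\<in>Q. cmod (part' Bullet M B))"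
   using P(3) Q(3) by (auto simp: part_def intro!: sum.cong)
  ultimately show ?thesis by simp
 qed
 have "tv A.X (part' Circ M) (pts A.X) <= tv X M (pts X) - (\<Sum>B\<in>Q. cmod (part' Bullet M B))"
  if "finite Q" "disjoint Q" "Q <= bor B.X" for Q
  by (rule tv_le) (use *[OF _ _ _ that] in \<open>simp add: le_diff_eq\<close>)
 then have "tv B.X (part' Bullet M) (pts B.X) <= tv X M (pts X) - tv A.X (part' Circ M) (pts A.X)"
  by (intro tv_le) (simp add: le_diff_eq add.commute)
 then show ?thesis by simp
qed

lemma put_parts: assumes "M\<in>Mb X" shows "M = (%A. put' Circ (part' Circ M) A + put' Bullet (part' Bullet M) A)"
proof
 fix A
 note cm = Mb_cm[OF assms]
 show "M A = put' Circ (part' Circ M) A + put' Bullet (part' Bullet M) A"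
 proof (cases "A\<in>bor X")
  case True
  have b: "Pair s -` A\<inter>pts (C s)\<in>bor (C s)" for s by (rule bor_vimage[OF cont_Pair True])
  have "A = Pair Circ ` (Pair Circ -` A\<inter>pts (C Circ))\<union>Pair Bullet ` (Pair Bullet -` A\<inter>pts (C Bullet))"
  proof (rule set_eqI)
   fix z show "z\<in>A \<longleftrightarrow> z\<in>Pair Circ ` (Pair Circ -` A\<inter>pts (C Circ))\<union>Pair Bullet ` (Pair Bullet -` A\<inter>pts (C Bullet))"
    using bor_sub[OF True] by (cases z; cases "fst z") auto
  qed
  then have "M A = M (Pair Circ ` (Pair Circ -` A\<inter>pts (C Circ))) + M (Pair Bullet ` (Pair Bullet -` A\<inter>pts (C Bullet)))"
   using cm_Un[OF cm borel_Pair[OF b[of Circ]] borel_Pair[OF b[of Bullet]]] by fastforce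
  then show ?thesis using b[of Circ] b[of Bullet] True by (simp add: put_def push_def part_def)
 qed (simp add: put_def push_def cm_outside[OF cm])
qed

lemma supp_X: assumes M: "M\<in>Mb_pos X" shows "(s, x)\<in>supp X M \<longleftrightarrow> x\<in>supp (C s) (part' s M)"
 unfolding compact_Hausdorff.supp_pos[OF compact_X M] compact_Hausdorff.supp_pos[OF compact_C part_pos[OF M]]
proof (intro conj_cong iffI allI impI)
 fix V assume *: "\<forall>U. openin X U --> (s, x)\<in>U --> M U ~= 0" and V: "openin (C s) V" "x\<in>V"
 then have "M (Pair s ` V) ~= 0" using openin_Pair[OF V(1)] by blast
 then show "part' s M V ~= 0" using open_bor[OF V(1)] by (simp add: part_def)
next
 fix U assume *: "\<forall>V. openin (C s) V --> x\<in>V --> part' s M V ~= 0" and U: "openin X U" "(s, x)\<in>U"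
 let ?V = "{x. (s, x)\<in>U}"
 note pm = Mb_posD[OF M]
 have V: "openin (C s) ?V" using U(1) openin_X by blast
 then have "M (Pair s ` ?V) ~= 0" using * U(2) open_bor[OF V] by (auto simp: part_def split: if_splits)
 moreover have "Re (M (Pair s ` ?V)) <= Re (M U)"
  by (rule positive_measure_mono[OF pm open_bor[OF openin_Pair[OF V]] open_bor[OF U(1)]]) auto
 moreover have "Re (M (Pair s ` ?V)) ~= 0" using calculation(1) pos_measureD(4)[OF pm, of "Pair s ` ?V"] by (metis of_real_0)
 ultimately show "M U ~= 0" using pos_measureD(2)[OF pm, of "Pair s ` ?V"] by auto
qed auto

lemma supp_put: assumes "u\<in>Mb_pos (C s)" shows "supp X (put' s u) = Pair s ` supp (C s) u"
proof -
 note cm = Mb_cm[OF pos_Mb[OF assms]]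
 have "supp (C t) (%A. 0) = {}" for t
  using compact_Hausdorff.supp_pos[OF compact_C Mb_pos_zero, of _ t] openin_topspace[of "C t"] by blast
 then have "(t, x)\<in>supp X (put' s u) \<longleftrightarrow> (t, x)\<in>Pair s ` supp (C s) u" for t x
  unfolding supp_X[OF put_pos[OF assms]] using part_put[OF cm] part_put_other[OF cm, of t] by (cases "s = t") auto
 then show ?thesis by (intro set_eqI) (simp only: split_paired_all)
qed

end

locale union_dual = dual_pair H H\<^sub>0 for H :: "'a hypergroup_data" and H\<^sub>0 +
 fixes q :: real
 assumes q: "0 < q" "q <= 1"

begin

abbreviation K :: "(tag\<times>('a \<Rightarrow> complex)) hypergroup_data" where "K \<equiv> dual_union_hypergroup H H\<^sub>0 q"

text \<open>The characters of \<open>K\<close> are the functions that are \<open>\<pi> \<mapsto> \<pi> h\<close> on the dual of \<open>H\<close> and \<open>\<tau> \<mapsto> c \<tau> h\<close> on the dual of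
 \<open>H\<^sub>0\<close>, where \<open>c\<close> is one of the solutions \<open>1\<close>, \<open>-q\<close> of \<open>c\<^sup>2 = q + (1 - q) c\<close> if \<open>h \<in> H\<^sub>0\<close>, and \<open>c = 0\<close> otherwise.\<close>

definition bs :: "'a \<Rightarrow> complex set" where "bs h = (if h\<in>H\<^sub>0 then {1, - complex_of_real q} else {0})"

definition Ix :: "('a\<times>complex) set" where "Ix = Sigma A.S bs"

fun E :: "'a\<times>complex \<Rightarrow> tag\<times>('a \<Rightarrow> complex) \<Rightarrow> complex" where
 "E (h, c) (Circ, x) = x h"
| "E (h, c) (Bullet, t) = c * t h"

text \<open>The coefficients of the product of two such functions; the second ones solve
 \<open>t = w\<^sub>1 - q w\<^sub>-\<^sub>q\<close>, \<open>1 = w\<^sub>1 + w\<^sub>-\<^sub>q\<close>.\<close>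

definition wt :: "complex \<Rightarrow> complex \<Rightarrow> complex" where
 "wt t b = (if b = 0 then 1 else if b = 1 then (of_real q + t) / (1 + of_real q) else (1 - t) / (1 + of_real q))"

definition NI :: "'a\<times>complex \<Rightarrow> 'a\<times>complex \<Rightarrow> ('a\<times>complex) set" where "NI i j = Sigma (A.N (fst i) (fst j)) bs"

definition T :: "'a\<times>complex \<Rightarrow> 'a\<times>complex \<Rightarrow> 'a\<times>complex \<Rightarrow> complex" where
 "T i j l = A.P (fst i) (fst j) (fst l) * wt (snd i * snd j) (snd l)"

lemma q_complex: "1 + complex_of_real q ~= 0" "- complex_of_real q ~= 1" "complex_of_real q ~= 0"
 using q by (auto simp: complex_eq_iff)

lemma sum_bs: "(\<Sum>b\<in>bs h. f b) = (if h\<in>H\<^sub>0 then f 1 + f (- complex_of_real q) else f 0)"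
 using q_complex(2) by (auto simp: bs_def)

lemma finite_bs [simp]: "finite (bs h)" by (simp add: bs_def)

text \<open>The first identity is what the product formula needs on the dual of \<open>H\<close>,
  where the index value is not seen; the second is what it needs on the dual of
  \<open>H\<^sub>0\<close>, where it appears as a factor.\<close>

lemma wt_sum: "(\<Sum>b\<in>bs h. wt t b) = 1" and wt_sum_mult: "(\<Sum>b\<in>bs h. wt t b * b) = (if h\<in>H\<^sub>0 then t else 0)"
 using q_complex unfolding sum_bs by (auto simp: wt_def divide_simps) (auto simp: algebra_simps)

lemma finite_NI: "i\<in>Ix ==> j\<in>Ix ==> finite (NI i j)"
 unfolding NI_def Ix_def by (intro finite_SigmaI A.N_finite) auto

lemma NI_sub: "i\<in>Ix ==> j\<in>Ix ==> NI i j <= Ix"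
 using A.N_subset[of "fst i" "fst j"] unfolding NI_def Ix_def by (intro Sigma_mono) auto

lemma sum_NI: assumes "h\<in>A.S" "k\<in>A.S"
 shows "(\<Sum>l\<in>NI (h, c) (k, d). T (h, c) (k, d) l * f l) = (\<Sum>y\<in>A.N h k. A.P h k y * (\<Sum>b\<in>bs y. wt (c * d) b * f (y, b)))"
 unfolding NI_def T_def using A.N_finite[OF assms] by (simp add: sum.Sigma sum_distrib_left mult.assoc case_prod_beta)

lemma Ix_zero: "(h, c)\<in>Ix ==> h\<notin>H\<^sub>0 ==> c = 0"
 by (simp add: Ix_def bs_def)

text \<open>On the second component, points of \<open>H\<^sub>0\<close> multiply within
  \<open>H\<^sub>0\<close>. If one of the two points lies outside, its value is 0 and both sides
  vanish.\<close>

lemma E_mult: assumes i: "i\<in>Ix" "j\<in>Ix" and z: "z\<in>pts X"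
 shows "E i z * E j z = (\<Sum>l\<in>NI i j. T i j l * E l z)"
proof -
 obtain h c k d where ij: "i = (h, c)" "j = (k, d)" by fastforce
 have hk: "h\<in>A.S" "k\<in>A.S" using i by (auto simp: ij Ix_def)
 obtain s \<chi> where [simp]: "z = (s, \<chi>)" by fastforce
 show ?thesis
 proof (cases s)
  case Circ
  then have "\<chi>\<in>characters H" using z by simp
  moreover have "(\<Sum>b\<in>bs y. wt (c * d) b * E (y, b) z) = \<chi> y" for y using Circ wt_sum[of "c * d" y] by (simp add: sum_distrib_right[symmetric])
  ultimately show ?thesis using hk Circ unfolding ij sum_NI[OF hk] by (simp add: A.char_iff)
 next
  case Bullet
  then have x: "\<chi>\<in>characters L" using z by simp
  have b: "(\<Sum>b\<in>bs y. wt (c * d) b * E (y, b) z) = (if y\<in>H\<^sub>0 then c * d else 0) * \<chi> y" for y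
   using Bullet wt_sum_mult[of "c * d" y] by (simp add: sum_distrib_right[symmetric] mult.assoc[symmetric])
  show ?thesis
  proof (cases "h\<in>H\<^sub>0\<and>k\<in>H\<^sub>0")
   case True
   have "(\<Sum>y\<in>A.N h k. A.P h k y * ((if y\<in>H\<^sub>0 then c * d else 0) * \<chi> y)) = c * d * (\<Sum>y\<in>B.N h k. B.P h k y * \<chi> y)"
    unfolding sum_distrib_left N_L[OF conjunct1[OF True] conjunct2[OF True]] using N_sub[of h k] P_L[of h k] True by (intro sum.cong) auto
   also have "\<dots> = c * d * (\<chi> h * \<chi> k)" using x True by (simp add: B.char_iff)
   finally show ?thesis unfolding ij sum_NI[OF hk] b using Bullet by simp
  next
   case False
   then have cd: "c * d = 0" using i Ix_zero by (auto simp: ij)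
   then show ?thesis unfolding ij sum_NI[OF hk] b unfolding cd if_cancel using Bullet cd by auto
  qed
 qed
qed

lemma one_Ix: "h\<in>H\<^sub>0 ==> (h, 1)\<in>Ix" and q_Ix: "h\<in>H\<^sub>0 ==> (h, - complex_of_real q)\<in>Ix"
 using sub_subset by (auto simp: Ix_def bs_def)

lemma ex_Ix: "h\<in>A.S ==> \<exists>c. (h, c)\<in>Ix"
 by (auto simp: Ix_def bs_def)

lemma Ix_inv: assumes "(h, c)\<in>Ix" shows "(hinv H h, c)\<in>Ix" "cnj c = c"
proof -
 have h: "h\<in>A.S" using assms by (simp add: Ix_def)
 have "hinv H h\<in>H\<^sub>0 \<longleftrightarrow> h\<in>H\<^sub>0" using inv_L[of h] inv_L[of "hinv H h"] A.inv_inv[OF h] by auto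
 then show "(hinv H h, c)\<in>Ix" "cnj c = c" using assms A.inv_closed[OF h] by (auto simp: Ix_def bs_def split: if_splits)
qed

lemma E_cnj: assumes i: "(h, c)\<in>Ix" and z: "z\<in>pts X" shows "E (hinv H h, c) z = cnj (E (h, c) z)"
proof -
 obtain s x where [simp]: "z = (s, x)" by fastforce
 have h: "h\<in>A.S" using i by (simp add: Ix_def)
 show ?thesis
 proof (cases s)
  case Circ then show ?thesis using z h by (auto simp: A.char_iff)
 next
  case Bullet
  then show ?thesis using z Ix_inv(2)[OF i] Ix_zero[OF i] by (cases "h\<in>H\<^sub>0") (auto simp: B.char_iff hinv_L)
 qed
qed

lemma E_continuous: assumes "i\<in>Ix" shows "cmap X (E i)"
proof (rule continuous_map_X)
 fix s
 obtain h c where i: "i = (h, c)" by fastforce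
 then have h: "h\<in>A.S" using assms by (simp add: Ix_def)
 show "continuous_map (C s) euclidean (%x. E i (s, x))"
 proof (cases s)
  case Circ then show ?thesis using A.e_cont[OF h] by (simp add: i)
 next
  case Bullet
  then show ?thesis using B.e_cont[of h] Ix_zero[of h c] assms by (cases "h\<in>H\<^sub>0") (auto simp: i intro!: cont_cmult)
 qed
qed

lemma E_unit: "x\<in>characters H ==> E (hunit H, c) (Circ, x) = 1" "t\<in>characters L ==> E (hunit H, c) (Bullet, t) = c"
 using A.character_unit[of x] B.character_unit[of t] by (simp_all add: hunit_L)

sublocale trig_system X Ix E
proof
 show "compact_space X" "Hausdorff_space X" using compact_X by (auto simp: compact_Hausdorff_def)
 show "\<exists>d\<in>Ix. \<forall>x\<in>pts X. E d x = 1"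
 proof (intro bexI[of _ "(hunit H, 1)"] ballI)
  fix x assume x: "x\<in>pts X"
  obtain s \<chi> where "x = (s, \<chi>)" by fastforce
  then show "E (hunit H, 1) x = 1" using x by (cases s) (auto simp: E_unit simp del: E.simps)
 qed (rule one_Ix[OF unit_L])
 show "\<exists>d'\<in>Ix. \<forall>x\<in>pts X. E d' x = cnj (E d x)" if "d\<in>Ix" for d
  using that E_cnj Ix_inv(1) by (cases d) blast
 show "\<exists>F a. finite F\<and>F <= Ix\<and>(\<forall>x\<in>pts X. E d x * E d' x = (\<Sum>k\<in>F. a k * E k x))" if "d\<in>Ix" "d'\<in>Ix" for d d'
  using E_mult[OF that] finite_NI[OF that] NI_sub[OF that] by (intro exI[of _ "NI d d'"] exI[of _ "T d d'"]) blast
 fix x y assume xy: "x\<in>pts X" "y\<in>pts X" "x ~= y"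
 obtain s \<chi> t \<psi> where [simp]: "x = (s, \<chi>)" "y = (t, \<psi>)" by fastforce
 show "\<exists>d\<in>Ix. E d x ~= E d y"
 proof (cases "s = t")
  case False
  \<comment> \<open>The components are separated by the index of the unit with value
    \<open>-q\<close>, which gives 1 on the first and \<open>-q \<noteq> 1\<close> on the
    second.\<close>
  have "E (hunit H, - complex_of_real q) x ~= E (hunit H, - complex_of_real q) y"
   using False xy q_complex(2) q_complex(2)[symmetric] by (cases s; cases t) (auto simp: E_unit simp del: E.simps)
  then show ?thesis using q_Ix[OF unit_L] by blast
 next
  case True
  then have d: "\<chi> ~= \<psi>" using xy by simp
  show ?thesis
  proof (cases s)
   case Circ
   then obtain h where "h\<in>A.S" "\<chi> h ~= \<psi> h" using A.e_sep[of \<chi> \<psi>] d xy True by auto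
   then show ?thesis using ex_Ix[of h] Circ True by force
  next
   case Bullet
   then obtain h where "h\<in>H\<^sub>0" "\<chi> h ~= \<psi> h" using B.e_sep[of \<chi> \<psi>] d xy True by auto
   then show ?thesis using one_Ix[of h] Bullet True by (intro bexI[of _ "(h, 1)"]) auto
  qed
 qed
qed (rule E_continuous)

section \<open>Transforms and convolution on the union\<close>

abbreviation tK :: "'a\<times>complex \<Rightarrow> (tag\<times>('a \<Rightarrow> complex)) cmeasure \<Rightarrow> complex" where "tK i u \<equiv> cint X (E i) u"

lemma tK_put:
 assumes i: "(h, c)\<in>Ix"
 shows "u\<in>Mb A.X ==> tK (h, c) (put' Circ u) = tA h u" "u\<in>Mb B.X ==> tK (h, c) (put' Bullet u) = c * tB h u"
proof -
 have p: "tK (h, c) (put' s u) = cint (C s) (%x. E (h, c) (s, x)) u" if "u\<in>Mb (C s)" for s u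
  unfolding put_def by (rule cint_push[OF Mb_cm[OF that] cont_Pair bmf_e[OF i]])
 show "u\<in>Mb A.X ==> tK (h, c) (put' Circ u) = tA h u" using p[of u Circ] by simp
 assume m: "u\<in>Mb B.X"
 show "tK (h, c) (put' Bullet u) = c * tB h u"
  using p[of u Bullet] m Ix_zero[OF i] cint_scale[OF Mb_cm[OF m] B.bmf_e[of h]] by (cases "h\<in>H\<^sub>0") auto
qed

lemma tK_add: "i\<in>Ix ==> u\<in>Mb X ==> w\<in>Mb X ==> tK i (%A. u A + w A) = tK i u + tK i w"
 and tK_scale: "i\<in>Ix ==> u\<in>Mb X ==> tK i (%A. a * u A) = a * tK i u"
 by (intro cint_madd cint_mscale Mb_cm bmf_e; assumption)+

lemma part_Mb': "M\<in>Mb X ==> part' Circ M\<in>Mb A.X" "M\<in>Mb X ==> part' Bullet M\<in>Mb B.X"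
 using part_Mb[of M Circ] part_Mb[of M Bullet] by simp_all

lemma put_Mb': "u\<in>Mb A.X ==> put' Circ u\<in>Mb X" "w\<in>Mb B.X ==> put' Bullet w\<in>Mb X"
 using put_Mb[of u Circ] put_Mb[of w Bullet] by simp_all

lemma tK_parts: "(h, c)\<in>Ix ==> M\<in>Mb X ==> tK (h, c) M = tA h (part' Circ M) + c * tB h (part' Bullet M)"
 by (subst put_parts, assumption) (simp only: tK_add tK_put part_Mb' put_Mb')

definition conv2 where "conv2 r = (%A. of_real q * put' Circ (ind r) A + of_real (1 - q) * put' Bullet r A)"

lemma ind_Mb: "r\<in>Mb B.X ==> ind r\<in>Mb A.X" and ind_pos: "r\<in>Mb_pos B.X ==> ind r\<in>Mb_pos A.X"
 unfolding ind_eq by (rule M.mix_Mb M.mix_pos(1); assumption)+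

lemma conv2_Mb: "r\<in>Mb B.X ==> conv2 r\<in>Mb X"
 unfolding conv2_def by (intro Mb_add Mb_scale put_Mb' ind_Mb)

lemma q_nonneg: "complex_of_real q\<in>\<real>\<^sub>\<ge>\<^sub>0" "complex_of_real (1 - q)\<in>\<real>\<^sub>\<ge>\<^sub>0"
 using q by (simp_all only: nonneg_Reals_of_real_iff)

lemma conv2_pos: "r\<in>Mb_pos B.X ==> conv2 r\<in>Mb_pos X"
 unfolding conv2_def using put_pos[of _ Circ] put_pos[of _ Bullet] by (intro Mb_pos_add Mb_pos_scale q_nonneg) (simp_all add: ind_pos)

text \<open>The quadratic equation for \<open>c\<close> enters here: induction keeps the transform
  on \<open>H\<^sub>0\<close> and kills it elsewhere, so the factor is
  \<open>q + (1 - q) * c = c\<^sup>2\<close> over \<open>H\<^sub>0\<close> and 0 outside.\<close>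

lemma tK_conv2: assumes i: "(h, c)\<in>Ix" and r: "w\<in>Mb B.X" shows "tK (h, c) (conv2 w) = c\<^sup>2 * tB h w"
proof -
 have "tK (h, c) (conv2 w) = of_real q * tA h (ind w) + of_real (1 - q) * (c * tB h w)"
  unfolding conv2_def by (simp only: tK_add[OF i] tK_scale[OF i] tK_put[OF i] put_Mb' Mb_scale ind_Mb r)
 moreover have "q + of_real (1 - q) * c = c\<^sup>2" if "h\<in>H\<^sub>0" using i that by (auto simp: Ix_def bs_def power2_eq_square algebra_simps)
 ultimately show ?thesis using Ix_zero[OF i] i ind_tr[OF r, of h]
  by (cases "h\<in>H\<^sub>0") (auto simp: Ix_def mult.assoc[symmetric] distrib_right[symmetric])
qed

lemma hconv_K: "hconv K M N = (%A. put' Circ (A.conv (part' Circ M) (part' Circ N)) A +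
  (put' Bullet (B.conv (push A.X B.X p (part' Circ M)) (part' Bullet N)) A +
  (put' Bullet (B.conv (part' Bullet M) (push A.X B.X p (part' Circ N))) A +
   conv2 (B.conv (part' Bullet M) (part' Bullet N)) A)))"
 by (rule ext) (simp add: dual_union_hypergroup_def conv2_def Let_def restr_def)

sublocale trig_conv X Ix E "hconv K"
proof
 fix M N
 show "hconv K M N\<in>Mb X" if "M\<in>Mb X" "N\<in>Mb X"
  unfolding hconv_K by (intro Mb_add put_Mb' conv2_Mb A.conv_Mb B.conv_Mb Mb_push[OF _ cont_p] part_Mb' that)
 show "hconv K M N\<in>Mb_pos X" if "M\<in>Mb_pos X" "N\<in>Mb_pos X"
 proof -
  have p: "part' Circ M\<in>Mb_pos A.X" "part' Bullet M\<in>Mb_pos B.X" "part' Circ N\<in>Mb_pos A.X" "part' Bullet N\<in>Mb_pos B.X"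
   using part_pos[OF that(1), of Circ] part_pos[OF that(1), of Bullet] part_pos[OF that(2), of Circ] part_pos[OF that(2), of Bullet] by simp_all
  show ?thesis unfolding hconv_K using put_pos[of _ Circ] put_pos[of _ Bullet]
   by (intro Mb_pos_add conv2_pos) (simp_all add: p A.conv_Mb_pos B.conv_Mb_pos pos_push[OF _ cont_p])
 qed
 fix i assume i': "i\<in>Ix" and m: "M\<in>Mb X" "N\<in>Mb X"
 obtain h c where i: "i = (h, c)" "(h, c)\<in>Ix" using i' by (cases i) auto
 have h: "h\<in>A.S" using i by (simp add: Ix_def)
 note pm = part_Mb'[OF m(1)] part_Mb'[OF m(2)] Mb_push[OF part_Mb'(1)[OF m(1)] cont_p] Mb_push[OF part_Mb'(1)[OF m(2)] cont_p]
 have "tK (h, c) (hconv K M N) = tA h (A.conv (part' Circ M) (part' Circ N)) +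
   (c * tB h (B.conv (push A.X B.X p (part' Circ M)) (part' Bullet N)) +
   (c * tB h (B.conv (part' Bullet M) (push A.X B.X p (part' Circ N))) + c\<^sup>2 * tB h (B.conv (part' Bullet M) (part' Bullet N))))"
  unfolding hconv_K
  by (simp only: tK_add[OF i(2)] tK_put[OF i(2)] tK_conv2[OF i(2)] put_Mb' conv2_Mb A.conv_Mb B.conv_Mb pm Mb_add)
 also have "\<dots> = (tA h (part' Circ M) + c * tB h (part' Bullet M)) * (tA h (part' Circ N) + c * tB h (part' Bullet N))"
 proof (cases "h\<in>H\<^sub>0")
  case True
  then have hL: "h\<in>carrier_of L" by simp
  show ?thesis
   by (simp only: A.conv_tr[OF h pm(1,3)] B.conv_tr[OF hL] pm tB_push[OF _ True]) (simp add: algebra_simps power2_eq_square)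
 qed (use Ix_zero[OF i(2)] in \<open>simp add: A.conv_tr[OF h pm(1,3)]\<close>)
 finally show "tK i (hconv K M N) = tK i M * tK i N" unfolding i(1) tK_parts[OF i(2) m(1)] tK_parts[OF i(2) m(2)] .
qed

text \<open>Restriction, induction and embedding into the union do not increase the variation, and
  \<open>q\<close> and \<open>1 - q\<close> add up to 1. The four products of component norms then
  form the product of the sums.\<close>

lemma conv_norm_K: assumes m: "M\<in>Mb X" "N\<in>Mb X" shows "tv X (hconv K M N) (pts X) <= tv X M (pts X) * tv X N (pts X)"
proof -
 note pm = part_Mb'[OF m(1)] part_Mb'[OF m(2)]
 note pp = pm(1)[THEN Mb_push[OF _ cont_p]] pm(3)[THEN Mb_push[OF _ cont_p]]
 let ?n = "%u. tv A.X u (pts A.X)" and ?m = "%u. tv B.X u (pts B.X)"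
 have put: "tv X (put' s u) (pts X) <= tv (C s) u (pts (C s))" if "u\<in>Mb (C s)" for s u
 proof -
  have "Pair s -` pts X\<inter>pts (C s) = pts (C s)" by auto
  then show ?thesis using tv_push[OF Mb_cm[OF that] cont_Pair, of "pts X"] by (simp add: put_def)
 qed
 have putC: "tv X (put' Circ u) (pts X) <= ?n u" if "u\<in>Mb A.X" for u using put[of u Circ] that by simp
 have putB: "tv X (put' Bullet u) (pts X) <= ?m u" if "u\<in>Mb B.X" for u using put[of u Bullet] that by simp
 have push: "?m (push A.X B.X p u) <= ?n u" if "u\<in>Mb A.X" for u
 proof -
  have "p -` pts B.X\<inter>pts A.X = pts A.X" using p_char by auto
  then show ?thesis using tv_push[OF Mb_cm[OF that] cont_p, of "pts B.X"] by simp
 qed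
 have c2: "tv X (conv2 r) (pts X) <= ?m r" if "r\<in>Mb B.X" for r
 proof -
  note pc = put_Mb'(1)[OF ind_Mb[OF that], THEN Mb_cm] put_Mb'(2)[OF that, THEN Mb_cm]
  have "tv X (conv2 r) (pts X) <= tv X (%A. of_real q * put' Circ (ind r) A) (pts X) + tv X (%A. of_real (1 - q) * put' Bullet r A) (pts X)"
   unfolding conv2_def by (intro tv_add cm_scale pc)
  also have "\<dots> <= cmod (of_real q) * tv X (put' Circ (ind r)) (pts X) + cmod (of_real (1 - q)) * tv X (put' Bullet r) (pts X)"
   by (intro add_mono tv_scale pc)
  also have "\<dots> <= cmod (of_real q) * ?m r + cmod (of_real (1 - q)) * ?m r"
   using putC[OF ind_Mb[OF that]] M.tv_mix[OF that, folded ind_eq] putB[OF that] by (intro add_mono mult_left_mono) auto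
  finally show ?thesis using q unfolding norm_of_real by (simp add: algebra_simps)
 qed
 have cA: "?n (A.conv u w) <= ?n u * ?n w" if "u\<in>Mb A.X" "w\<in>Mb A.X" for u w using A.D.conv_norm[OF that] by (simp add: Mb_norm_def)
 have cB: "?m (B.conv u w) <= ?m u * ?m w" if "u\<in>Mb B.X" "w\<in>Mb B.X" for u w using B.D.conv_norm[OF that] by (simp add: Mb_norm_def)
 let ?t1 = "A.conv (part' Circ M) (part' Circ N)" and ?t2 = "B.conv (push A.X B.X p (part' Circ M)) (part' Bullet N)"
  and ?t3 = "B.conv (part' Bullet M) (push A.X B.X p (part' Circ N))" and ?t4 = "B.conv (part' Bullet M) (part' Bullet N)"
 have t: "?t1\<in>Mb A.X" "?t2\<in>Mb B.X" "?t3\<in>Mb B.X" "?t4\<in>Mb B.X" by (intro A.conv_Mb B.conv_Mb pm pp)+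
 note cm = put_Mb'(1)[OF t(1)] put_Mb'(2)[OF t(2)] put_Mb'(2)[OF t(3)] conv2_Mb[OF t(4)]
 have "tv X (hconv K M N) (pts X) <= tv X (put' Circ ?t1) (pts X) + (tv X (put' Bullet ?t2) (pts X) +
   (tv X (put' Bullet ?t3) (pts X) + tv X (conv2 ?t4) (pts X)))"
  unfolding hconv_K by (intro order_trans[OF tv_add] add_left_mono order_refl cm_add cm[THEN Mb_cm])
 also have "\<dots> <= ?n ?t1 + (?m ?t2 + (?m ?t3 + ?m ?t4))" by (intro add_mono putC putB c2 t)
 also have "\<dots> <= ?n (part' Circ M) * ?n (part' Circ N) + (?n (part' Circ M) * ?m (part' Bullet N) + (?m (part' Bullet M) * ?n (part' Circ N) + ?m (part' Bullet M) * ?m (part' Bullet N)))"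
  by (intro add_mono cA pm order_trans[OF cB] pp mult_mono push order_refl tv_nonneg)
 also have "\<dots> = (?n (part' Circ M) + ?m (part' Bullet M)) * (?n (part' Circ N) + ?m (part' Bullet N))" by (simp add: algebra_simps)
 also have "\<dots> <= tv X M (pts X) * tv X N (pts X)" by (intro mult_mono tv_parts m add_nonneg_nonneg tv_nonneg)
 finally show ?thesis .
qed

section \<open>Supports of products on the union\<close>

lemma supp_conv2: assumes r: "w\<in>Mb_pos B.X"
 shows "supp X (conv2 w) = Pair Circ ` {y\<in>characters H. p y\<in>supp B.X w}\<union>(if q < 1 then Pair Bullet ` supp B.X w else {})"
proof -
 note ri = ind_pos[OF r]
 note cm = Mb_cm[OF pos_Mb[OF r]] Mb_cm[OF pos_Mb[OF ri]]
 have pc: "part' Circ (conv2 w) = (%A. of_real q * ind w A)" "part' Bullet (conv2 w) = (%A. of_real (1 - q) * w A)"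
 proof -
  have 1: "part' s (conv2 w) = (%A. of_real q * part' s (put' Circ (ind w)) A + of_real (1 - q) * part' s (put' Bullet w) A)" for s
   by (rule ext) (simp add: part_def conv2_def)
  show "part' Circ (conv2 w) = (%A. of_real q * ind w A)" "part' Bullet (conv2 w) = (%A. of_real (1 - q) * w A)"
   unfolding 1 using part_put[of Circ "ind w"] part_put[of Bullet w] part_put_other[of Circ "ind w" Bullet] part_put_other[of Bullet w Circ] cm by simp_all
 qed
 have "(Circ, x)\<in>supp X (conv2 w) \<longleftrightarrow> x\<in>supp A.X (ind w)" for x
  using A.supp_pos[OF Mb_pos_scale[OF ri q_nonneg(1)]] A.supp_pos[OF ri] q_complex(3) by (simp add: supp_X[OF conv2_pos[OF r]] pc)
 moreover have mem: "(s, x)\<in>Pair Circ ` A\<union>(if b then Pair Bullet ` B else {}) \<longleftrightarrow> (case s of Circ \<Rightarrow> x\<in>A | Bullet \<Rightarrow> b\<and>x\<in>B)"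
  for s and x :: "'a \<Rightarrow> complex" and A B b by (cases s) auto
 moreover have "(Bullet, x)\<in>supp X (conv2 w) \<longleftrightarrow> q < 1\<and>x\<in>supp B.X w" for x
  unfolding supp_X[OF conv2_pos[OF r]] pc C_simps B.supp_pos[OF Mb_pos_scale[OF r q_nonneg(2)]] B.supp_pos[OF r]
 proof (cases "q = 1")
  case False
  then have "complex_of_real (1 - q) ~= 0" "q < 1" using q by auto
  then show "(x\<in>pts B.X\<and>(\<forall>U. openin B.X U --> x\<in>U --> complex_of_real (1 - q) * w U ~= 0)) \<longleftrightarrow>
   q < 1\<and>x\<in>pts B.X\<and>(\<forall>U. openin B.X U --> x\<in>U --> w U ~= 0)" by simp
 qed (use openin_topspace[of B.X] in auto)
 ultimately have "(s, x)\<in>supp X (conv2 w) \<longleftrightarrow> (s, x)\<in>Pair Circ ` {y\<in>characters H. p y\<in>supp B.X w}\<union>(if q < 1 then Pair Bullet ` supp B.X w else {})" for s x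
  unfolding mem supp_ind[OF r, symmetric] by (cases s) simp_all
 then show ?thesis by (intro set_eqI) (simp only: split_paired_all)
qed

lemma conv_points:
 shows "z\<in>characters H ==> \<psi>\<in>characters H ==> hconv K (dirac X (Circ, z)) (dirac X (Circ, \<psi>)) = put' Circ (pconv (dual H) z \<psi>)"
  and "z\<in>characters H ==> t\<in>characters L ==> hconv K (dirac X (Circ, z)) (dirac X (Bullet, t)) = put' Bullet (pconv (dual L) (p z) t)"
  and "z\<in>characters H ==> t\<in>characters L ==> hconv K (dirac X (Bullet, t)) (dirac X (Circ, z)) = put' Bullet (pconv (dual L) t (p z))"
  and "s\<in>characters L ==> t\<in>characters L ==> hconv K (dirac X (Bullet, s)) (dirac X (Bullet, t)) = conv2 (pconv (dual L) s t)"
proof -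
 have *: "hconv K (dirac X x) (dirac X y) = R"
  if "x\<in>pts X" "y\<in>pts X" "R\<in>Mb X" "!!h c. (h, c)\<in>Ix ==> tK (h, c) R = E (h, c) x * E (h, c) y" for x y R
 proof (rule transform_unique)
  note d = Mb_dirac[OF that(1)] Mb_dirac[OF that(2)]
  show "hconv K (dirac X x) (dirac X y)\<in>Mb X" by (rule conv_Mb[OF d])
  fix i assume i: "i\<in>Ix"
  then show "tK i (hconv K (dirac X x) (dirac X y)) = tK i R"
   using that(4)[of "fst i" "snd i"] by (simp only: conv_tr[OF i d] cint_e_dirac[OF i that(1)] cint_e_dirac[OF i that(2)] prod.collapse)
 qed (rule that(3))
 have A: "pconv (dual H) z \<psi>\<in>Mb A.X" "!!h. h\<in>A.S ==> tA h (pconv (dual H) z \<psi>) = z h * \<psi> h"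
  if "z\<in>characters H" "\<psi>\<in>characters H" for z \<psi>
  using that A.D.pconv_prob[of z \<psi>] prob_Mb A.dual_product[OF that] by auto
 have B: "pconv (dual L) z \<psi>\<in>Mb B.X" "!!h. h\<in>H\<^sub>0 ==> tB h (pconv (dual L) z \<psi>) = z h * \<psi> h"
  if "z\<in>characters L" "\<psi>\<in>characters L" for z \<psi>
  using that B.D.pconv_prob[of z \<psi>] prob_Mb B.dual_product[OF that] by auto
 have I: "h\<in>A.S" "c = 0\<or>h\<in>H\<^sub>0" if "(h, c)\<in>Ix" for h c using that Ix_zero by (auto simp: Ix_def)
 show "hconv K (dirac X (Circ, z)) (dirac X (Circ, \<psi>)) = put' Circ (pconv (dual H) z \<psi>)" if "z\<in>characters H" "\<psi>\<in>characters H"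
  using that I by (intro *) (simp_all add: A put_Mb' tK_put)
 show "hconv K (dirac X (Circ, z)) (dirac X (Bullet, t)) = put' Bullet (pconv (dual L) (p z) t)" if "z\<in>characters H" "t\<in>characters L"
 proof (rule *)
  fix h c assume i: "(h, c)\<in>Ix"
  show "tK (h, c) (put' Bullet (pconv (dual L) (p z) t)) = E (h, c) (Circ, z) * E (h, c) (Bullet, t)" using I(2)[OF i] that B(2)[OF p_char, of z t h] B(2)[OF _ p_char, of t z h]
   by (auto simp: tK_put[OF i] B p_char)
 qed (use that in \<open>auto simp: B p_char put_Mb'\<close>)
 show "hconv K (dirac X (Bullet, t)) (dirac X (Circ, z)) = put' Bullet (pconv (dual L) t (p z))" if "z\<in>characters H" "t\<in>characters L"
 proof (rule *)
  fix h c assume i: "(h, c)\<in>Ix"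
  show "tK (h, c) (put' Bullet (pconv (dual L) t (p z))) = E (h, c) (Bullet, t) * E (h, c) (Circ, z)" using I(2)[OF i] that B(2)[OF p_char, of z t h] B(2)[OF _ p_char, of t z h]
   by (auto simp: tK_put[OF i] B p_char)
 qed (use that in \<open>auto simp: B p_char put_Mb'\<close>)
 show "hconv K (dirac X (Bullet, s)) (dirac X (Bullet, t)) = conv2 (pconv (dual L) s t)" if "s\<in>characters L" "t\<in>characters L"
 proof (rule *)
  fix h c assume i: "(h, c)\<in>Ix"
  show "tK (h, c) (conv2 (pconv (dual L) s t)) = E (h, c) (Bullet, s) * E (h, c) (Bullet, t)"
   using I(2)[OF i] that by (auto simp: tK_conv2[OF i] B power2_eq_square)
 qed (use that in \<open>auto simp: B conv2_Mb\<close>)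
qed

lemma openin_prod_X:
 assumes "!!s t. openin (prod_topology (C s) (C t)) {w\<in>pts (prod_topology (C s) (C t)). Q (s, fst w) (t, snd w)}"
 shows "openin (prod_topology X X) {z\<in>pts (prod_topology X X). Q (fst z) (snd z)}"
proof (subst openin_subopen, intro ballI)
 fix z assume z: "z\<in>{z\<in>pts (prod_topology X X). Q (fst z) (snd z)}"
 obtain s a t b where [simp]: "z = ((s, a), (t, b))" by (metis surj_pair)
 have "(a, b)\<in>{w\<in>pts (prod_topology (C s) (C t)). Q (s, fst w) (t, snd w)}" using z by simp
 then obtain U V where UV: "openin (C s) U" "openin (C t) V" "a\<in>U" "b\<in>V"
  "U\<times>V <= {w\<in>pts (prod_topology (C s) (C t)). Q (s, fst w) (t, snd w)}"
  using assms[of s t] unfolding openin_prod_topology_alt by meson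
 have "openin (prod_topology X X) (Pair s ` U\<times>Pair t ` V)" using UV openin_Pair by (simp add: openin_prod_Times_iff)
 moreover have "Pair s ` U\<times>Pair t ` V <= {z\<in>pts (prod_topology X X). Q (fst z) (snd z)}" using UV(5) by auto
 ultimately show "\<exists>T. openin (prod_topology X X) T\<and>z\<in>T\<and>T <= {z\<in>pts (prod_topology X X). Q (fst z) (snd z)}"
  using UV by (intro exI[of _ "Pair s ` U\<times>Pair t ` V"]) auto
qed

lemma supp_points:
 shows "x\<in>characters H ==> \<psi>\<in>characters H ==> supp X (hconv K (dirac X (Circ, x)) (dirac X (Circ, \<psi>))) = Pair Circ ` supp A.X (pconv (dual H) x \<psi>)"
  and "x\<in>characters H ==> t\<in>characters L ==> supp X (hconv K (dirac X (Circ, x)) (dirac X (Bullet, t))) = Pair Bullet ` supp B.X (pconv (dual L) (p x) t)"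
  and "x\<in>characters H ==> t\<in>characters L ==> supp X (hconv K (dirac X (Bullet, t)) (dirac X (Circ, x))) = Pair Bullet ` supp B.X (pconv (dual L) t (p x))"
  and "s\<in>characters L ==> t\<in>characters L ==> supp X (hconv K (dirac X (Bullet, s)) (dirac X (Bullet, t))) =
   Pair Circ ` {x\<in>characters H. p x\<in>supp B.X (pconv (dual L) s t)}\<union>(if q < 1 then Pair Bullet ` supp B.X (pconv (dual L) s t) else {})"
 using supp_put[of _ Circ] supp_put[of _ Bullet] supp_conv2 A.D.pconv_prob[THEN prob_pos] B.D.pconv_prob[THEN prob_pos] p_char
 by (simp_all add: conv_points)

text \<open>The critical case is a product of two points of the second component, whose support
  contains the full preimage under restriction of a support \<open>D\<close> in the dual of
  \<open>H\<^sub>0\<close>. Openness of restriction handles meeting conditions, compactness handles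
  inclusions.\<close>

lemma supp_continuous_K: "continuous_map (prod_topology X X) (Michael_topology X) (%(x, y). supp X (hconv K (dirac X x) (dirac X y)))"
proof (rule continuous_map_MichaelI)
 let ?F = "%x y. supp X (hconv K (dirac X x) (dirac X y))"
 let ?PA = "prod_topology A.X A.X" and ?PB = "prod_topology B.X B.X"
 show "compactin X ((%(x, y). ?F x y) z)\<and>(%(x, y). ?F x y) z ~= {}" if "z\<in>pts (prod_topology X X)" for z
  using that compactin_supp supp_nonempty[OF conv_prob[OF prob_dirac prob_dirac]] by auto
 note mA = continuous_map_MichaelD(2,3)[OF A.D.supp_continuous] and mB = continuous_map_MichaelD(2,3)[OF B.D.supp_continuous]
 have c1: "continuous_map (prod_topology A.X B.X) ?PB (%w. (p (fst w), snd w))"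
  and c2: "continuous_map (prod_topology B.X A.X) ?PB (%w. (fst w, p (snd w)))"
  using continuous_map_compose[OF continuous_map_fst cont_p] continuous_map_compose[OF continuous_map_snd cont_p]
  by (auto intro!: continuous_map_pairedI continuous_map_fst continuous_map_snd simp: o_def)
 text \<open>Both kinds of subbasic conditions reduce, on each pair of components, to one of the same kind on the supports in a dual.\<close>
 have open1: "openin (prod_topology X X) {z\<in>pts (prod_topology X X). R (?F (fst z) (snd z))}"
  if rA: "openin ?PA {w\<in>pts ?PA. RA ((%(x, y). supp A.X (pconv (dual H) x y)) w)}"
   and rB: "openin ?PB {w\<in>pts ?PB. RB ((%(x, y). supp B.X (pconv (dual L) x y)) w)}"
   and rC: "openin ?PB {w\<in>pts ?PB. RC ((%(x, y). supp B.X (pconv (dual L) x y)) w)}"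
   and A: "!!D. D <= characters H ==> R (Pair Circ ` D) \<longleftrightarrow> RA D" and B: "!!D. D <= characters L ==> R (Pair Bullet ` D) \<longleftrightarrow> RB D"
   and C: "!!D. D <= characters L ==> R (Pair Circ ` {j\<in>characters H. p j\<in>D}\<union>(if q < 1 then Pair Bullet ` D else {})) \<longleftrightarrow> RC D" for R RA RB RC
 proof (rule openin_prod_X)
  have sA: "supp A.X u <= characters H" and sB: "supp B.X r <= characters L" for u r by (auto simp: supp_def)
  note cong = arg_cong[of _ _ "openin T" for T, THEN iffD1]
  fix s t
  show "openin (prod_topology (C s) (C t)) {w\<in>pts (prod_topology (C s) (C t)). R (?F (s, fst w) (t, snd w))}"
  proof (cases s; cases t)
   assume st: "s = Circ" "t = Circ"
   show ?thesis unfolding st C_simps by (rule cong[OF _ rA]) (auto simp: supp_points A[OF sA])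
  next
   assume st: "s = Circ" "t = Bullet"
   show ?thesis unfolding st C_simps
    by (rule cong[OF _ openin_continuous_map_preimage[OF c1 rB]]) (auto simp: supp_points B[OF sB] p_char)
  next
   assume st: "s = Bullet" "t = Circ"
   show ?thesis unfolding st C_simps
    by (rule cong[OF _ openin_continuous_map_preimage[OF c2 rB]]) (auto simp: supp_points B[OF sB] p_char)
  next
   assume st: "s = Bullet" "t = Bullet"
   show ?thesis unfolding st C_simps by (rule cong[OF _ rC]) (auto simp: supp_points C[OF sB])
  qed
 qed
 have slice: "openin A.X {x. (Circ, x)\<in>U}" "openin B.X {x. (Bullet, x)\<in>U}" if "openin X U" for U
  using that openin_X[of U] C_simps by metis+
 show "openin (prod_topology X X) {z\<in>pts (prod_topology X X). (%(x, y). ?F x y) z\<inter>U ~= {}}" if U: "openin X U" for U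
 proof -
  \<comment> \<open>The preimage of \<open>D\<close> meets the first slice of \<open>U\<close>
    exactly if \<open>D\<close> meets its image under restriction; for \<open>q < 1\<close> the copy
    of \<open>D\<close> adds the second slice.\<close>
  let ?W = "p ` {x. (Circ, x)\<in>U}\<union>(if q < 1 then {x. (Bullet, x)\<in>U} else {})"
  have W: "openin B.X ?W" using open_map_p[OF slice(1)[OF U]] slice(2)[OF U] by auto
  have UA: "j\<in>characters H" if "(Circ, j)\<in>U" for j using openin_subset[OF slice(1)[OF U]] that by auto
  have "openin (prod_topology X X) {z\<in>pts (prod_topology X X). ?F (fst z) (snd z)\<inter>U ~= {}}"
   by (rule open1[OF mA(1)[OF slice(1)[OF U]] mB(1)[OF slice(2)[OF U]] mB(1)[OF W]])
    (use UA in \<open>(cases "q < 1"; (simp only: if_True if_False)?; blast)+\<close>)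
  then show ?thesis by (simp add: case_prod_beta)
 qed
 show "openin (prod_topology X X) {z\<in>pts (prod_topology X X). (%(x, y). ?F x y) z <= V}" if V: "openin X V" for V
 proof -
  have topspace_A: "pts A.X = characters H" "pts B.X = characters L" by simp_all
  let ?D = "pts A.X - {x. (Circ, x)\<in>V}"
  \<comment> \<open>The preimage of \<open>D\<close> lies in the first slice of \<open>V\<close>
    exactly if \<open>D\<close> avoids the image of the complement, which is compact and hence
    closed; for \<open>q < 1\<close> the copy of \<open>D\<close> must also lie in the second
    slice.\<close>
  let ?W = "(pts B.X - p ` ?D)\<inter>(if q < 1 then {x. (Bullet, x)\<in>V} else pts B.X)"
  have "compactin A.X ?D" using slice(1)[OF V] by (intro A.closed_compact[THEN iffD1] closedin_diff closedin_topspace)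
  then have "closedin B.X (p ` ?D)" using image_compactin[OF _ cont_p] B.closed_compact by blast
  then have W: "openin B.X ?W" using slice(2)[OF V] openin_topspace[of B.X] by (intro openin_Int openin_diff openin_topspace) auto
  have "openin (prod_topology X X) {z\<in>pts (prod_topology X X). ?F (fst z) (snd z) <= V}"
   by (rule open1[OF mA(2)[OF slice(1)[OF V]] mB(2)[OF slice(2)[OF V]] mB(2)[OF W]])
    (cases "q < 1"; (simp only: if_True if_False topspace_A)?; blast)+
  then show ?thesis by (simp add: case_prod_beta)
 qed
qed

lemma hinv_K: "hinv K (Circ, x) = (Circ, hinv (dual H) x)" "hinv K (Bullet, t) = (Bullet, hinv (dual L) t)"
 and hunit_K: "hunit K = (Circ, hunit (dual H))" and htop_K: "htop K = X"
 by (simp_all add: dual_union_hypergroup_def)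

lemma hinv_K_mem: "x\<in>pts X ==> hinv K x\<in>pts X"
 using A.hinv_dual_mem B.hinv_dual_mem by (cases x; cases "fst x") (auto simp: hinv_K)

lemma hinv_K_E: assumes i: "i\<in>Ix" and x: "x\<in>pts X" shows "E i (hinv K x) = cnj (E i x)"
proof -
 obtain h c where [simp]: "i = (h, c)" by fastforce
 obtain s y where [simp]: "x = (s, y)" by fastforce
 show ?thesis using x i Ix_inv(2)[of h c] Ix_zero[of h c]
  by (cases s; cases "h\<in>H\<^sub>0") (auto simp: hinv_K A.hinv_dual B.hinv_dual Ix_def)
qed

lemma hunit_K_E: "i\<in>Ix ==> E i (hunit K) = 1"
 by (cases i) (auto simp: hunit_K A.hunit_dual Ix_def)

lemma comm_hypergroup_K: "comm_hypergroup K"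
proof (rule comm_hypergroupI[OF htop_K refl conv_norm_K _ hunit_K_E _ _ hinv_K_E])
 show "hunit K\<in>pts X" using A.hunit_dual_mem by (simp add: hunit_K)
 show "continuous_map X X (hinv K)"
 proof (rule continuous_map_X)
  fix s
  have "continuous_map A.X X (Pair Circ \<circ> hinv (dual H))" "continuous_map B.X X (Pair Bullet \<circ> hinv (dual L))"
   using A.D.inv_homeomorphism B.D.inv_homeomorphism cont_Pair[of Circ] cont_Pair[of Bullet]
   by (auto simp: homeomorphic_maps_def intro: continuous_map_compose)
  then show "continuous_map (C s) X (%x. hinv K (s, x))" by (cases s) (simp_all add: hinv_K o_def)
 qed
 show "hinv K (hinv K x) = x" if "x\<in>pts X" for x
  using that A.D.inv_homeomorphism B.D.inv_homeomorphism by (cases x; cases "fst x") (auto simp: hinv_K homeomorphic_maps_def)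
 show "hunit K\<in>supp X (hconv K (dirac X x) (dirac X y)) \<longleftrightarrow> x = hinv K y" if xy: "x\<in>pts X" "y\<in>pts X" for x y
 proof -
  obtain s z t \<psi> where [simp]: "x = (s, z)" "y = (t, \<psi>)" by fastforce
  have p1: "p (hunit (dual H)) = hunit (dual L)" using sub_subset by (auto simp: A.hunit_dual B.hunit_dual fun_eq_iff)
  show ?thesis using xy A.D.unit_in_supp_iff[of z \<psi>] B.D.unit_in_supp_iff[of z \<psi>] A.hunit_dual_mem
   by (cases s; cases t) (auto simp: supp_points hunit_K hinv_K p1)
 qed
 show "continuous_map (prod_topology X X) (Michael_topology X) (%(x, y). supp X (hconv K (dirac X x) (dirac X y)))"
  by (rule supp_continuous_K)
qed

end

section \<open>The two-point hypergroup\<close>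

locale two_point_hypergroup =
 fixes q :: real
 assumes q01: "0 < q" "q <= 1"

begin

abbreviation D2 :: "two_point topology" where "D2 \<equiv> disc UNIV"

definition zk :: "two_point \<Rightarrow> two_point \<Rightarrow> two_point cmeasure" where
 "zk x y = (if x = Ell0 then dirac D2 y else if y = Ell0 then dirac D2 x
   else (%A. of_real q * dirac D2 Ell0 A + of_real (1 - q) * dirac D2 Ell1 A))"

text \<open>\<open>gm t\<close> is the measure of total mass 1 at which the nontrivial character \<open>(1, -q)\<close> takes the value \<open>t\<close>.\<close>

definition gm :: "complex \<Rightarrow> two_point cmeasure" where
 "gm t = (%A. (of_real q + t) / (1 + of_real q) * dirac D2 Ell0 A + (1 - t) / (1 + of_real q) * dirac D2 Ell1 A)"

definition v :: "two_point \<Rightarrow> complex" where "v x = (case x of Ell0 \<Rightarrow> 1 | Ell1 \<Rightarrow> - of_real q)"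

lemma v_simps [simp]: "v Ell0 = 1" "v Ell1 = - of_real q"
 by (simp_all add: v_def)

lemma one_q: "1 + complex_of_real q ~= 0" "complex_of_real q ~= 0" "complex_of_real q + 1 ~= 0" "- complex_of_real q ~= 1"
 using q01 by (auto simp: complex_eq_iff)

lemma gm_singleton: "gm t {Ell0} = (of_real q + t) / (1 + of_real q)" "gm t {Ell1} = (1 - t) / (1 + of_real q)" "gm t UNIV = 1"
proof -
 have "(of_real q + t) / (1 + of_real q) + (1 - t) / (1 + of_real q) = (of_real q + t + (1 - t)) / (1 + of_real q)"
  by (rule add_divide_distrib[symmetric])
 also have "\<dots> = 1" using one_q by (simp add: add.commute)
 finally show "gm t {Ell0} = (of_real q + t) / (1 + of_real q)" "gm t {Ell1} = (1 - t) / (1 + of_real q)" "gm t UNIV = 1"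
  by (simp_all add: gm_def dirac_def)
qed

lemma gm_inj: "gm s = gm t \<longleftrightarrow> s = t"
proof
 assume "gm s = gm t"
 then have "(of_real q + s) / (1 + of_real q) = (of_real q + t) / (1 + of_real q)" by (simp only: gm_singleton(1)[symmetric])
 then show "s = t" using one_q by simp
qed simp

lemma dirac_gm: "dirac D2 x = gm (v x)"
proof (cases x)
 case Ell0
 have "(of_real q + 1) / (1 + of_real q) = (1::complex)" using one_q by (simp add: add.commute)
 then show ?thesis by (simp only: gm_def Ell0 v_simps) simp
next
 case Ell1
 have "(1 - - of_real q) / (1 + of_real q) = (1::complex)" using one_q by simp
 then show ?thesis by (simp only: gm_def Ell1 v_simps) simp
qed

lemma gm_points: "gm 1 = dirac D2 Ell0" "gm (- of_real q) = dirac D2 Ell1"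
 by (simp_all add: dirac_gm)

lemma zk_gm: "zk x y = gm (v x * v y)"
proof -
 have "(of_real q + v Ell1 * v Ell1) / (1 + of_real q) = of_real q" "(1 - v Ell1 * v Ell1) / (1 + of_real q) = of_real (1 - q)"
  using one_q by (simp_all add: divide_simps) (simp_all add: algebra_simps)
 then have 11: "(%A. of_real q * dirac D2 Ell0 A + of_real (1 - q) * dirac D2 Ell1 A) = gm (v Ell1 * v Ell1)" unfolding gm_def by (simp only:)
 show ?thesis
 proof (cases "x = Ell0\<or>y = Ell0")
  case False
  then have "x = Ell1" "y = Ell1" by (cases x; cases y; simp)+
  then show ?thesis using 11 by (simp only: zk_def two_point.distinct if_False)
 qed (auto simp: zk_def dirac_gm)
qed

lemma gm_Mb: "gm t\<in>Mb D2"
 unfolding gm_def by (intro Mb_add Mb_scale Mb_dirac) auto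

lemma zk_prob: "zk x y\<in>M_prob D2"
proof -
 have "(%A. of_real q * dirac D2 Ell0 A + of_real (1 - q) * dirac D2 Ell1 A)\<in>Mb_pos D2"
  using q01 by (intro Mb_pos_add Mb_pos_scale prob_pos[OF prob_dirac]) (simp_all only: nonneg_Reals_of_real_iff topspace_discrete_topology UNIV_I)
 then have "(%A. of_real q * dirac D2 Ell0 A + of_real (1 - q) * dirac D2 Ell1 A)\<in>M_prob D2" by (simp add: M_prob_def dirac_def)
 then show ?thesis by (simp add: zk_def prob_dirac)
qed

sublocale Z: discrete_kernel UNIV zk
proof
 have "finite (A :: two_point set)" for A
  by (rule finite_subset[of _ "{Ell0, Ell1}"]) (auto intro: two_point.exhaust)
 then show "finite (supp D2 (zk x y))" for x y .
qed (rule zk_prob)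

text \<open>The parameter is a character value, so convolution has to multiply it; bilinearity
  reduces this to the four products of points.\<close>

lemma conv_gm: "Z.conv (gm s) (gm t) = gm (s * t)"
proof -
 note cd = cm_dirac[of D2] and cg = Mb_cm[OF gm_Mb]
 note cs = cm_scale[OF cd]
 have r: "Z.conv (dirac D2 x) (gm t) = (%A. (of_real q + t) / (1 + of_real q) * zk x Ell0 A + (1 - t) / (1 + of_real q) * zk x Ell1 A)" for x
  unfolding gm_def by (simp only: Z.conv_add_right[OF cd cs cs] Z.conv_scale_right[OF cd cd] Z.conv_dirac UNIV_I)
 have "Z.conv (gm s) (gm t) = (%A. (of_real q + s) / (1 + of_real q) * Z.conv (dirac D2 Ell0) (gm t) A + (1 - s) / (1 + of_real q) * Z.conv (dirac D2 Ell1) (gm t) A)"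
  unfolding gm_def[of s] by (simp only: Z.conv_add_left[OF cs cs cg] Z.conv_scale_left[OF cd cg])
 then have e: "Z.conv (gm s) (gm t) = (%A. (of_real q + s) / (1 + of_real q) * ((of_real q + t) / (1 + of_real q) * zk Ell0 Ell0 A + (1 - t) / (1 + of_real q) * zk Ell0 Ell1 A)
   + (1 - s) / (1 + of_real q) * ((of_real q + t) / (1 + of_real q) * zk Ell1 Ell0 A + (1 - t) / (1 + of_real q) * zk Ell1 Ell1 A))" by (simp only: r)
 show ?thesis unfolding e
 proof
  fix A
  have k: "zk Ell0 Ell0 A = dirac D2 Ell0 A" "zk Ell0 Ell1 A = dirac D2 Ell1 A" "zk Ell1 Ell0 A = dirac D2 Ell1 A"
   "zk Ell1 Ell1 A = of_real q * dirac D2 Ell0 A + of_real (1 - q) * dirac D2 Ell1 A" by (simp_all add: zk_def)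
  show "(of_real q + s) / (1 + of_real q) * ((of_real q + t) / (1 + of_real q) * zk Ell0 Ell0 A + (1 - t) / (1 + of_real q) * zk Ell0 Ell1 A)
   + (1 - s) / (1 + of_real q) * ((of_real q + t) / (1 + of_real q) * zk Ell1 Ell0 A + (1 - t) / (1 + of_real q) * zk Ell1 Ell1 A) = gm (s * t) A"
   unfolding k gm_def using one_q by (simp add: divide_simps) (simp add: algebra_simps)
 qed
qed

abbreviation G where "G \<equiv> Zq2 q"

lemma G_simps: "htop G = D2" "hconv G = Z.conv" "hunit G = Ell0" "hinv G = (%x. x)"
proof -
 have "zk = (%x y. if x = Ell0 then dirac D2 y else if y = Ell0 then dirac D2 x
   else (%A. of_real q * dirac D2 Ell0 A + of_real (1 - q) * dirac D2 Ell1 A))" by (intro ext) (simp add: zk_def)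
 then show "htop G = D2" "hconv G = Z.conv" "hunit G = Ell0" "hinv G = (%x. x)" by (simp_all add: Zq2_def Let_def)
qed

lemma comm_hypergroup_G: "comm_hypergroup G"
proof (rule Z.comm_hypergroupI[OF G_simps(1,2)])
 show "Z.conv (zk x y) (dirac D2 z) = Z.conv (dirac D2 x) (zk y z)" for x y z
  by (simp add: zk_gm dirac_gm conv_gm mult.assoc)
 show "zk x y {hunit G} ~= 0 \<longleftrightarrow> x = hinv G y" for x y
  using one_q by (cases x; cases y) (auto simp: G_simps zk_def dirac_def)
qed (auto simp: G_simps zk_gm dirac_gm mult.commute)

text \<open>On two points a measure is determined by its mass and its integral against the character
  \<open>(1, -q)\<close>; that integral is the parameter.\<close>

lemma prob_gm: assumes "\<omega>\<in>M_prob D2" shows "\<exists>t. \<omega> = gm t"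
proof -
 note cm = Mb_cm[OF prob_Mb[OF assms]]
 have "{Ell0}\<union>{Ell1} = UNIV" by (auto intro: two_point.exhaust)
 then have 1: "\<omega> {Ell0} + \<omega> {Ell1} = 1" using cm_Un[OF cm, of "{Ell0}" "{Ell1}"] prob_top[OF assms] by simp
 have "\<omega> {x} = gm (\<omega> {Ell0} - of_real q * \<omega> {Ell1}) {x}" for x
 proof -
  have e: "\<omega> {Ell1} = 1 - \<omega> {Ell0}" using 1 by (simp add: eq_diff_eq add.commute)
  have a: "of_real q + (w - of_real q * (1 - w)) = w * (1 + of_real q)" "1 - (w - of_real q * (1 - w)) = (1 - w) * (1 + of_real q)" for w :: complex
   by (simp_all add: algebra_simps)
  show ?thesis by (cases x) (simp_all only: gm_singleton e a nonzero_mult_div_cancel_right[OF one_q(1)])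
 qed
 then have "\<omega> = gm (\<omega> {Ell0} - of_real q * \<omega> {Ell1})" by (rule Mb_discrete_eqI[OF prob_Mb[OF assms] gm_Mb])
 then show ?thesis by blast
qed

lemma Haar_trivial: "normalized_Haar G {Ell0} = gm 1"
 unfolding normalized_Haar_def G_simps topspace_discrete_topology
proof (rule the_equality)
 have u: "UNIV - {Ell0} = {Ell1}" by (auto intro: two_point.exhaust)
 show "gm 1\<in>M_prob D2\<and>gm 1 (UNIV - {Ell0}) = 0\<and>(\<forall>x\<in>{Ell0}. Z.conv (dirac D2 x) (gm 1) = gm 1)"
  using prob_dirac[of Ell0 D2] by (auto simp: u gm_singleton dirac_gm conv_gm)
 show "\<omega> = gm 1" if "\<omega>\<in>M_prob D2\<and>\<omega> (UNIV - {Ell0}) = 0\<and>(\<forall>x\<in>{Ell0}. Z.conv (dirac D2 x) \<omega> = \<omega>)" for \<omega>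
  using that prob_gm[of \<omega>] one_q by (auto simp: u gm_singleton)
qed

text \<open>Convolution with \<open>Ell1\<close> multiplies the parameter by
  \<open>-q \<noteq> 1\<close>, so invariance leaves only the parameter 0.\<close>

lemma Haar_full: "normalized_Haar G {Ell0, Ell1} = gm 0"
 unfolding normalized_Haar_def G_simps topspace_discrete_topology
proof (rule the_equality)
 have u: "UNIV - {Ell0, Ell1} = {}" by (auto intro: two_point.exhaust)
 have "complex_of_real (q / (1 + q))\<in>\<real>\<^sub>\<ge>\<^sub>0" "complex_of_real (1 / (1 + q))\<in>\<real>\<^sub>\<ge>\<^sub>0" using q01 by (simp_all only: nonneg_Reals_of_real_iff) simp_all
 then have "(%A. complex_of_real (q / (1 + q)) * dirac D2 Ell0 A + complex_of_real (1 / (1 + q)) * dirac D2 Ell1 A)\<in>Mb_pos D2"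
  by (intro Mb_pos_add Mb_pos_scale prob_pos[OF prob_dirac]) simp_all
 then have "gm 0\<in>M_prob D2" using gm_singleton(3)[of 0] by (simp add: M_prob_def gm_def)
 then show "gm 0\<in>M_prob D2\<and>gm 0 (UNIV - {Ell0, Ell1}) = 0\<and>(\<forall>x\<in>{Ell0, Ell1}. Z.conv (dirac D2 x) (gm 0) = gm 0)"
  using cm_empty[OF Mb_cm[OF gm_Mb]] by (simp add: u dirac_gm conv_gm)
 fix \<omega> assume w: "\<omega>\<in>M_prob D2\<and>\<omega> (UNIV - {Ell0, Ell1}) = 0\<and>(\<forall>x\<in>{Ell0, Ell1}. Z.conv (dirac D2 x) \<omega> = \<omega>)"
 then obtain t where t: "\<omega> = gm t" using prob_gm by blast
 then show "\<omega> = gm 0" using w one_q by (auto simp: dirac_gm conv_gm gm_inj)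
qed

end

section \<open>Duality for the union\<close>

context union_dual

begin

sublocale Q: two_point_hypergroup q
 by unfold_locales (rule q)+

sublocale Kh: comm_hypergroup K
 by (rule comm_hypergroup_K)

section \<open>Independence and isolation of the characters\<close>

lemma omega_product: assumes "h\<in>A.S" "k\<in>A.S" shows "cint A.X (%x. x h * x k) \<omega> = A.P h k (hunit H)"
proof -
 have "cint A.X (%x. x h * x k) \<omega> = (\<Sum>y\<in>A.N h k. A.P h k y * tA y \<omega>)"
  using assms A.N_finite[OF assms] A.N_subset[OF assms]
  by (intro A.cint_trig[OF Mb_cm[OF prob_Mb[OF omega(1)]]]) (auto simp: A.char_iff)
 also have "\<dots> = (\<Sum>y\<in>A.N h k. if y = hunit H then A.P h k (hunit H) else 0)"
  using A.N_subset[OF assms] omega(2) by (intro sum.cong) auto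
 also have "\<dots> = A.P h k (hunit H)" using A.N_finite[OF assms] A.N_eq[OF assms] A.unit_carrier by auto
 finally show ?thesis .
qed

text \<open>The relation is multiplied by evaluation at the inverse of \<open>k\<close> and
  integrated against \<omega>; by orthogonality only the term of \<open>k\<close> survives, with a
  nonzero factor.\<close>

lemma A_indep:
 assumes Z: "finite Z" "Z <= A.S" and 0: "!!x. x\<in>characters H ==> (\<Sum>z\<in>Z. s z * x z) = 0" and k: "k\<in>Z"
 shows "s k = 0"
proof -
 note cm = Mb_cm[OF prob_Mb[OF omega(1)]]
 have kS: "k\<in>A.S" "hinv H k\<in>A.S" using k Z A.inv_closed by auto
 have b: "(%x. x z * x (hinv H k))\<in>bmf A.X" if "z\<in>Z" for z using that Z kS by (intro bmf_mult A.bmf_e) auto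
 have "0 = cint A.X (%x. \<Sum>z\<in>Z. s z * (x z * x (hinv H k))) \<omega>"
  using 0 by (subst cint_cong[of _ _ "%_. 0"]) (simp_all add: mult.assoc[symmetric] sum_distrib_right[symmetric])
 also have "\<dots> = (\<Sum>z\<in>Z. s z * A.P z (hinv H k) (hunit H))"
  using b Z kS by (subst cint_sum[OF cm]) (auto intro!: sum.cong bmf_mult[OF bmf_const] simp: cint_scale[OF cm] omega_product)
 also have "\<dots> = (\<Sum>z\<in>Z. if z = k then s k * A.P k (hinv H k) (hunit H) else 0)"
  using A.P_unit[OF _ kS(2)] A.inv_inv[OF kS(1)] Z by (intro sum.cong refl) (auto simp: subset_iff)
 also have "\<dots> = s k * A.P k (hinv H k) (hunit H)" using k Z by simp
 finally show ?thesis using A.P_unit[OF kS] A.inv_inv[OF kS(1)] by simp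
qed

text \<open>On the dual of \<open>H\<close> the relation gives, for each \<open>z\<close>, that the
  coefficients sum to 0; on the dual of \<open>H\<^sub>0\<close>, pulled back along restriction, it
  gives the same for the sum weighted by \<open>b\<close>. With the values 1 and \<open>-q\<close>
  this system has determinant \<open>-(1 + q)\<close>.\<close>

lemma E_indep:
 assumes F: "finite F" "F <= Ix" and 0: "!!x. x\<in>pts X ==> (\<Sum>l\<in>F. a l * E l x) = 0" and l: "l\<in>F"
 shows "a l = 0"
proof -
 define Z where "Z = fst ` F"
 define a' where "a' z b = (if (z, b)\<in>F then a (z, b) else 0)" for z b
 have Z: "finite Z" "Z <= A.S" using F by (auto simp: Z_def Ix_def)
 have FZ: "F <= Sigma Z bs" using F(2) by (force simp: Z_def Ix_def)
 have s: "(\<Sum>z\<in>Z. \<Sum>b\<in>bs z. a' z b * E (z, b) x) = 0" if "x\<in>pts X" for x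
 proof -
  have "(\<Sum>z\<in>Z. \<Sum>b\<in>bs z. a' z b * E (z, b) x) = (\<Sum>l\<in>Sigma Z bs. if l\<in>F then a l * E l x else 0)"
   using Z(1) by (subst sum.Sigma) (auto simp: a'_def intro!: sum.cong)
  also have "\<dots> = (\<Sum>l\<in>F. a l * E l x)" using FZ Z(1) by (simp add: sum.If_cases Int_absorb1 Collect_mem_eq)
  finally show ?thesis using 0[OF that] by simp
 qed
 have 1: "(\<Sum>b\<in>bs z. a' z b) = 0" if "z\<in>Z" for z
  by (rule A_indep[OF Z _ that]) (use s[of "(Circ, _)"] in \<open>simp add: sum_distrib_right\<close>)
 have 2: "(\<Sum>b\<in>bs z. a' z b * b) = 0" if "z\<in>Z" for z
 proof (rule A_indep[OF Z _ that])
  fix y assume x: "y\<in>characters H"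
  have "(\<Sum>z\<in>Z. (\<Sum>b\<in>bs z. a' z b * b) * y z) = (\<Sum>z\<in>Z. \<Sum>b\<in>bs z. a' z b * E (z, b) (Bullet, p y))"
   by (intro sum.cong refl) (auto simp: sum_bs sum_distrib_right algebra_simps)
  then show "(\<Sum>z\<in>Z. (\<Sum>b\<in>bs z. a' z b * b) * y z) = 0" using s[of "(Bullet, p y)"] p_char[OF x] by simp
 qed
 obtain z b where zb: "l = (z, b)" "z\<in>Z" "b\<in>bs z" using l FZ by auto
 have "a' z b = 0"
 proof (cases "z\<in>H\<^sub>0")
  case True
  then have e: "a' z 1 + a' z (- of_real q) = 0" "a' z 1 - of_real q * a' z (- of_real q) = 0"
   using 1[OF zb(2)] 2[OF zb(2)] by (auto simp: sum_bs mult.commute)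
  then have "(1 + of_real q) * a' z (- of_real q) = 0" by algebra
  then show ?thesis using e q_complex zb(3) True by (auto simp: bs_def)
 qed (use 1[OF zb(2)] zb(3) in \<open>auto simp: sum_bs bs_def\<close>)
 then show ?thesis using l by (simp add: a'_def zb(1))
qed

definition Er :: "'a\<times>complex \<Rightarrow> tag\<times>('a \<Rightarrow> complex) \<Rightarrow> complex" where "Er i = restrict (E i) (pts X)"

lemma Er_apply: "x\<in>pts X ==> Er i x = E i x"
 by (simp add: Er_def del: topspace_X)

text \<open>For \<open>k \<noteq> h\<close> the function \<open>(y h - y k) * y (hinv H h)\<close>
  integrates against \<omega> to a number of modulus \<open>w\<close>, so the uniform distance is at
  least \<open>w\<close>. For the same \<open>h\<close>, two admissible values differ by
  \<open>1 + q\<close>. The threshold \<open>min (w / 2) 1\<close> lies below both.\<close>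

lemma E_isolated: assumes "i\<in>Ix" shows "\<exists>eps>0. \<forall>j\<in>Ix. (\<forall>x\<in>pts X. dist (E i x) (E j x) < eps) --> j = i"
proof -
 note cm = Mb_cm[OF prob_Mb[OF omega(1)]]
 obtain h c where i: "i = (h, c)" by fastforce
 have h: "h\<in>A.S" "hinv H h\<in>A.S" using assms A.inv_closed by (auto simp: i Ix_def)
 define w where "w = cmod (A.P h (hinv H h) (hunit H))"
 have w: "0 < w" using A.P_unit[OF h] A.inv_inv[OF h(1)] by (simp add: w_def)
 have "j = i" if j: "j\<in>Ix" and lt: "!!x. x\<in>pts X ==> dist (E i x) (E j x) < min (w / 2) 1" for j
 proof -
  obtain k d where jk: "j = (k, d)" by fastforce
  have k: "k\<in>A.S" using j by (simp add: jk Ix_def)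
  have kh: "k = h"
  proof (rule ccontr)
   assume ne: "k ~= h"
   have b: "(%y. y h * y (hinv H h))\<in>bmf A.X" "(%y. y k * y (hinv H h))\<in>bmf A.X" by (intro bmf_mult A.bmf_e h k)+
   have "cmod (cint A.X (%y. y h * y (hinv H h) - y k * y (hinv H h)) \<omega>) <= w / 2 * tv A.X \<omega> (pts A.X)"
   proof (rule cint_norm[OF cm bmf_diff[OF b]])
    fix y assume x: "y\<in>pts A.X"
    have "cmod (y h * y (hinv H h) - y k * y (hinv H h)) = cmod (y h - y k) * cmod (y (hinv H h))"
     by (simp add: norm_mult[symmetric] left_diff_distrib)
    also have "\<dots> <= w / 2 * 1"
     using lt[of "(Circ, y)"] x w A.character_norm[OF _ h(2)] by (intro mult_mono) (auto simp: i jk dist_norm)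
    finally show "cmod (y h * y (hinv H h) - y k * y (hinv H h)) <= w / 2" by simp
   qed (use w in simp)
   moreover have "A.P k (hinv H h) (hunit H) = 0" using ne A.P_unit[OF k h(2)] A.inv_inv[OF h(1)] by auto
   ultimately show False
    using w A.tv_Mb_pos[OF prob_pos[OF omega(1)]] prob_top[OF omega(1)] by (simp add: cint_diff[OF cm b] omega_product h k w_def)
  qed
  have "d = c"
  proof (rule ccontr)
   assume ne: "d ~= c"
   then have H0: "h\<in>H\<^sub>0" using j assms by (auto simp: i jk kh Ix_def bs_def split: if_splits)
   have "dist c d < 1" using lt[of "(Bullet, one)"] one_mem H0 by (simp add: i jk kh)
   moreover have "dist c d = cmod (complex_of_real (1 + q))" using ne H0 j assms
    by (auto simp: i jk kh Ix_def bs_def dist_norm norm_minus_commute simp del: norm_of_real)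
   ultimately show False using q unfolding norm_of_real by simp
  qed
  then show ?thesis by (simp add: i jk kh)
 qed
 then show ?thesis using w by (intro exI[of _ "min (w / 2) 1"]) auto
qed

lemma Er_inj: "inj_on Er Ix"
proof (rule inj_onI)
 fix i j assume ij: "i\<in>Ix" "j\<in>Ix" "Er i = Er j"
 then have "E i x = E j x" if "x\<in>pts X" for x using Er_apply[OF that] by metis
 then show "i = j" using E_isolated[OF ij(1)] ij(2) by auto
qed

lemma cint_put: assumes "u\<in>Mb (C s)" "f\<in>bmf X" shows "cint X f (put' s u) = cint (C s) (%x. f (s, x)) u"
 unfolding put_def by (rule cint_push[OF Mb_cm[OF assms(1)] cont_Pair assms(2)])

section \<open>Determination of all characters\<close>

lemma Er_character: assumes i: "i\<in>Ix" shows "Er i\<in>characters K"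
 unfolding characters_def htop_K
proof (intro CollectI conjI ballI)
 show "Er i\<in>extensional (pts X)" by (simp add: Er_def)
 have "cmap X (Er i)" using E_continuous[OF i] by (rule continuous_map_eq) (rule Er_apply[symmetric])
 then show "Er i\<in>bounded_continuous X" by (rule compact_bc[OF compact_space])
 have u: "hunit K\<in>pts X" using Kh.unit_carrier by (simp only: htop_K)
 show "\<exists>x\<in>pts X. Er i x ~= 0" by (rule bexI[OF _ u]) (simp add: Er_apply[OF u] hunit_K_E[OF i])
 fix x assume x: "x\<in>pts X"
 show "Er i (hinv K x) = cnj (Er i x)" by (simp only: Er_apply x hinv_K_mem hinv_K_E[OF i x])
 fix y assume y: "y\<in>pts X"
 have "cint X (Er i) (pconv K x y) = tK i (hconv K (dirac X x) (dirac X y))" unfolding pconv_def htop_K by (rule cint_cong[OF Er_apply])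
 then show "cint X (Er i) (pconv K x y) = Er i x * Er i y"
  by (simp only: conv_tr[OF i Mb_dirac[OF x] Mb_dirac[OF y]] cint_e_dirac[OF i x] cint_e_dirac[OF i y] Er_apply x y)
qed

lemma evaluation_surj: assumes "f\<in>characters (dual H)" obtains h where "h\<in>A.S" "!!y. y\<in>characters H ==> f y = y h"
proof -
 have "homeomorphic_map (htop H) (htop (dual (dual H))) (%x. \<lambda>y\<in>characters H. y x)"
  using pontryagin by (simp add: pontryagin_def hypergroup_iso_def)
 then have "(%x. \<lambda>y\<in>characters H. y x) ` A.S = pts (htop (dual (dual H)))" by (rule homeomorphic_imp_surjective_map)
 also have "\<dots> = characters (dual H)" by (simp add: dual_def[of "dual H"] dual_with_def)
 finally obtain h where "h\<in>A.S" "f = (\<lambda>y\<in>characters H. y h)" using assms by blast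
 then show thesis using that by auto
qed

text \<open>On the dual of \<open>H\<close>, \<open>f\<close> is a character, hence evaluation at
  some \<open>h\<close>. Products of the trivial character of \<open>H\<^sub>0\<close> with points
  of the dual of \<open>H\<close> reach the whole second component, restriction being surjective; so
  there \<open>f\<close> is fixed by the single number \<open>b\<close>.\<close>

lemma character_Er: assumes f: "f\<in>characters K" shows "f\<in>Er ` Ix"
proof -
 have fb: "f\<in>bounded_continuous X" and fm: "!!x y. x\<in>pts X ==> y\<in>pts X ==> cint X f (hconv K (dirac X x) (dirac X y)) = f x * f y"
  and fi: "!!x. x\<in>pts X ==> f (hinv K x) = cnj (f x)" and fe: "f\<in>extensional (pts X)"
  using f by (auto simp: characters_def htop_K pconv_def)
 have b: "f\<in>bmf X" using fb bc_bmf by blast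
 have cf: "cmap X f" using fb by (simp add: bounded_continuous_def)
 let ?f0 = "\<lambda>z\<in>characters H. f (Circ, z)"
 have "?f0\<in>characters (dual H)"
  unfolding characters_def[of "dual H"]
 proof (intro CollectI conjI ballI)
  have "cmap A.X (%z. f (Circ, z))" using continuous_map_compose[OF cont_Pair[of Circ] cf] by (simp add: o_def)
  then have "cmap A.X ?f0" by (rule continuous_map_eq) simp
  then show "?f0\<in>bounded_continuous A.X" by (rule compact_bc[OF A.compact_space])
  show "\<exists>x\<in>carrier_of (dual H). ?f0 x ~= 0" using Kh.character_unit[OF f] A.hunit_dual_mem by (intro bexI[of _ "hunit (dual H)"]) (auto simp: hunit_K)
  fix z assume x: "z\<in>carrier_of (dual H)"
  show "?f0 (hinv (dual H) z) = cnj (?f0 z)" using fi[of "(Circ, z)"] x A.hinv_dual_mem[of z] by (simp add: hinv_K)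
  fix \<psi> assume y: "\<psi>\<in>carrier_of (dual H)"
  have "cint A.X ?f0 (pconv (dual H) z \<psi>) = cint A.X (%z. f (Circ, z)) (pconv (dual H) z \<psi>)" by (rule cint_cong) simp
  also have "\<dots> = cint X f (put' Circ (pconv (dual H) z \<psi>))" using cint_put[of _ Circ, OF _ b] prob_Mb[OF A.D.pconv_prob[OF x y]] by simp
  also have "\<dots> = f (Circ, z) * f (Circ, \<psi>)" using fm[of "(Circ, z)" "(Circ, \<psi>)"] x y conv_points(1) by simp
  finally show "cint A.X ?f0 (pconv (dual H) z \<psi>) = ?f0 z * ?f0 \<psi>" using x y by simp
 qed simp
 then obtain h where h': "h\<in>A.S" "!!z. z\<in>characters H ==> ?f0 z = z h" by (rule evaluation_surj) (rule that)
 then have h: "h\<in>A.S" "!!z. z\<in>characters H ==> f (Circ, z) = z h" by simp_all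
 define b where "b = f (Bullet, one)"
 have du: "hunit (dual L) = one" by (simp add: B.hunit_dual)
 have f1: "f (Bullet, p z) = z h * b" if x: "z\<in>characters H" for z
 proof -
  have "pconv (dual L) (p z) one = dirac B.X (p z)" using B.D.unit_right[of "p z"] p_char[OF x] by (simp add: du)
  then have "z h * b = cint X f (put' Bullet (dirac B.X (p z)))"
   using fm[of "(Circ, z)" "(Bullet, one)"] x one_mem h(2)[OF x] conv_points(2)[OF x one_mem] by (simp add: b_def)
  also have "\<dots> = f (Bullet, p z)"
   using p_char[OF x] bmf_compose[OF cont_Pair[of Bullet] \<open>f\<in>bmf X\<close>] cint_put[of _ Bullet, OF _ \<open>f\<in>bmf X\<close>] Mb_dirac[of "p z" B.X]
   by (simp add: cint_dirac)
  finally show ?thesis by simp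
 qed
 \<comment> \<open>Squaring the point over the trivial character gives a quadratic equation, whose
   constant term survives only for \<open>h\<close> in \<open>H\<^sub>0\<close>.\<close>
 have bb: "b * b = of_real q * of_bool (h\<in>H\<^sub>0) + of_real (1 - q) * b"
 proof -
  have 1: "pconv (dual L) one one = dirac B.X one" using B.D.unit_right[of one] one_mem by (simp add: du)
  have d: "dirac B.X one\<in>Mb B.X" using one_mem by (intro Mb_dirac) simp
  have fB: "(%x. f (Bullet, x))\<in>bmf B.X" using bmf_compose[OF cont_Pair[of Bullet] \<open>f\<in>bmf X\<close>] by simp
  have "b * b = cint X f (conv2 (dirac B.X one))"
   using fm[of "(Bullet, one)" "(Bullet, one)"] one_mem conv_points(4)[OF one_mem one_mem] 1 by (simp add: b_def)
  also have "\<dots> = of_real q * cint X f (put' Circ (ind (dirac B.X one))) + of_real (1 - q) * cint X f (put' Bullet (dirac B.X one))"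
   unfolding conv2_def using \<open>f\<in>bmf X\<close> put_Mb'[THEN Mb_cm] ind_Mb[OF d] d
   by (simp only: cint_madd cint_mscale cm_scale)
  also have "cint X f (put' Circ (ind (dirac B.X one))) = tA h (ind (dirac B.X one))"
  proof -
   have "cint X f (put' Circ (ind (dirac B.X one))) = cint A.X (%z. f (Circ, z)) (ind (dirac B.X one))"
    using cint_put[of _ Circ, OF _ \<open>f\<in>bmf X\<close>] ind_Mb[OF d] by simp
   also have "\<dots> = tA h (ind (dirac B.X one))" by (rule cint_cong) (simp add: h(2))
   finally show ?thesis .
  qed
  also have "\<dots> = of_bool (h\<in>H\<^sub>0)" using ind_tr[OF d h(1)] B.tr_dirac[of h one] one_mem by auto
  also have "cint X f (put' Bullet (dirac B.X one)) = b"
   using cint_put[of _ Bullet, OF _ \<open>f\<in>bmf X\<close>] d fB one_mem by (simp add: cint_dirac b_def)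
  finally show ?thesis .
 qed
 have bs: "b\<in>bs h"
 proof (cases "h\<in>H\<^sub>0")
  case True
  then have "(b - 1) * (b + of_real q) = 0" using bb by (simp add: algebra_simps)
  then show ?thesis using True by (auto simp: bs_def eq_neg_iff_add_eq_0)
 next
  case False
  then obtain t where s: "t\<in>annihilator H H\<^sub>0" "t h ~= 1" using annihilator_separates[of h] h(1) by blast
  \<comment> \<open>\<open>t\<close> restricts to the trivial character, so multiplying by it fixes
    that point; \<open>t h \<noteq> 1\<close> then forces \<open>b = 0\<close>.\<close>
  have "b = t h * b" using s(1) f1[of t] by (auto simp: annihilator_eq extensions_def b_def)
  then show ?thesis using s(2) False by (simp add: bs_def)
 qed
 have "f = Er (h, b)"
 proof (rule extensionalityI[OF fe])
  fix x assume x: "x\<in>pts X"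
  obtain s z where [simp]: "x = (s, z)" by fastforce
  have "f x = E (h, b) x"
  proof (cases s)
   case Circ then show ?thesis using h(2) x by simp
  next
   case Bullet
   then obtain \<psi> where "\<psi>\<in>characters H" "p \<psi> = z" using x ex_extension[of z] by auto
   then show ?thesis using Bullet f1[of \<psi>] bs by (cases "h\<in>H\<^sub>0") (auto simp: bs_def)
  qed
  then show "f x = Er (h, b) x" using Er_apply[OF x] by simp
 qed (simp add: Er_def)
 then show ?thesis using h(1) bs by (auto simp: Ix_def)
qed

section \<open>The dual as a discrete hypergroup\<close>

lemma characters_K: "characters K = Er ` Ix"
 using Er_character character_Er by blast

abbreviation D' where "D' \<equiv> disc (Er ` Ix)"

text \<open>The union is compact, so uniform neighbourhoods are open for compact convergence, and
  \<open>E_isolated\<close> makes every singleton open.\<close>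

lemma dual_K_discrete: "htop (dual_with K c) = D'"
proof -
 have "openin (compact_convergence_topology X (Er ` Ix)) {f}" if f: "f\<in>Er ` Ix" for f
 proof -
  obtain i where i: "i\<in>Ix" "f = Er i" using f by blast
  obtain eps where e: "0 < eps" "!!j. j\<in>Ix ==> (!!x. x\<in>pts X ==> dist (E i x) (E j x) < eps) ==> j = i"
   using E_isolated[OF i(1)] by blast
  have "{g\<in>Er ` Ix. \<forall>x\<in>pts X. dist (f x) (g x) < eps} <= {f}"
  proof
   fix g assume "g\<in>{g\<in>Er ` Ix. \<forall>x\<in>pts X. dist (f x) (g x) < eps}"
   then obtain j where j: "j\<in>Ix" "g = Er j" "!!x. x\<in>pts X ==> dist (Er i x) (Er j x) < eps" unfolding i(2) by blast
   have "j = i" by (rule e(2)[OF j(1)]) (use j(3) in \<open>simp only: Er_apply\<close>)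
   then show "g\<in>{f}" using i(2) j(2) by simp
  qed
  then show ?thesis using f e(1) compact_space unfolding openin_compact_convergence_topology compact_space_def by blast
 qed
 then show ?thesis unfolding dual_with_def htop_K characters_K by (simp add: discrete_topology_unique[symmetric, of "compact_convergence_topology X (Er ` Ix)"] eq_commute[of "compact_convergence_topology _ _"] discrete_topology_unique)
qed

text \<open>Products of admissible values are 0, 1, \<open>-q\<close> or \<open>q * q\<close>; all
  lie between \<open>-q\<close> and 1, which is exactly where both weights in \<open>wt\<close> are
  nonnegative.\<close>

lemma T_nonneg: assumes "i\<in>Ix" "j\<in>Ix" shows "T i j l\<in>\<real>\<^sub>\<ge>\<^sub>0"
proof -
 obtain h c k d where [simp]: "i = (h, c)" "j = (k, d)" by fastforce
 have "c * d\<in>{0, 1, - of_real q, of_real (q * q)}" using assms by (auto simp: Ix_def bs_def split: if_splits)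
 then obtain t where t: "c * d = of_real t" "t\<in>{0, 1, -q, q * q}" by (metis insert_iff singletonD of_real_0 of_real_1 of_real_minus insertI1 insertI2)
 have "0 <= (q + t) / (1 + q)" "0 <= (1 - t) / (1 + q)" using t(2) q mult_le_one[of q q] by auto
 then have "complex_of_real ((q + t) / (1 + q))\<in>\<real>\<^sub>\<ge>\<^sub>0" "complex_of_real ((1 - t) / (1 + q))\<in>\<real>\<^sub>\<ge>\<^sub>0"
  by (simp_all only: nonneg_Reals_of_real_iff)
 then have "wt (c * d) (snd l)\<in>\<real>\<^sub>\<ge>\<^sub>0" unfolding wt_def t(1) by simp
 then show ?thesis using assms A.P_nonneg[of h k] by (auto simp: T_def Ix_def intro!: nonneg_Reals_mult_I)
qed

lemma T_outside: "i\<in>Ix ==> j\<in>Ix ==> l\<in>Ix ==> l\<notin>NI i j ==> T i j l = 0"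
 using A.N_eq[of "fst i" "fst j"] by (auto simp: T_def NI_def Ix_def)

lemma T_total: assumes "i\<in>Ix" "j\<in>Ix" shows "(\<Sum>l\<in>NI i j. T i j l) = 1"
proof -
 have u: "hunit K\<in>pts X" using Kh.unit_carrier by (simp only: htop_K)
 \<comment> \<open>The product formula is evaluated at the unit, where all the functions
   \<open>E\<close> equal 1.\<close>
 have "1 = (\<Sum>l\<in>NI i j. T i j l * E l (hunit K))" using E_mult[OF assms u] by (simp only: hunit_K_E assms mult_1)
 also have "\<dots> = (\<Sum>l\<in>NI i j. T i j l)" using NI_sub[OF assms] hunit_K_E by (intro sum.cong) auto
 finally show ?thesis by simp
qed

text \<open>The same structure constants on two sets indexed by \<open>Ix\<close>: the characters of \<open>K\<close> and the points of the hyperfield.\<close>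

definition comb :: "('a\<times>complex \<Rightarrow> 'c) \<Rightarrow> 'a\<times>complex \<Rightarrow> 'a\<times>complex \<Rightarrow> 'c cmeasure" where
 "comb g i j = (%A. \<Sum>l\<in>NI i j. T i j l * dirac (disc (g ` Ix)) (g l) A)"

lemma comb_prob: assumes "i\<in>Ix" "j\<in>Ix" shows "comb g i j\<in>M_prob (disc (g ` Ix))"
proof -
 have g: "g l\<in>g ` Ix" if "l\<in>NI i j" for l using that NI_sub[OF assms] by blast
 then have "comb g i j\<in>Mb_pos (disc (g ` Ix))"
  unfolding comb_def by (intro Mb_pos_sum Mb_pos_scale T_nonneg assms prob_pos[OF prob_dirac]) simp_all
 moreover have "comb g i j (g ` Ix) = 1" using g T_total[OF assms] by (simp add: comb_def dirac_def)
 ultimately show ?thesis by (simp add: M_prob_def)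
qed

lemma comb_singleton: assumes "inj_on g Ix" and ij: "i\<in>Ix" "j\<in>Ix" and l: "l\<in>Ix" shows "comb g i j {g l} = T i j l"
proof -
 have "comb g i j {g l} = (\<Sum>k\<in>NI i j. if k = l then T i j l else 0)"
  unfolding comb_def using NI_sub[OF ij] l by (intro sum.cong refl) (auto simp: dirac_def inj_on_eq_iff[OF assms(1)] subset_iff)
 then show ?thesis using finite_NI[OF ij] T_outside[OF ij l] by simp
qed

lemma comb_supp: assumes ij: "i\<in>Ix" "j\<in>Ix" shows "finite (supp (disc (g ` Ix)) (comb g i j))"
proof (rule finite_subset[of _ "g ` NI i j"])
 show "supp (disc (g ` Ix)) (comb g i j) <= g ` NI i j"
  unfolding supp_discrete[OF Mb_cm[OF prob_Mb[OF comb_prob[OF ij]]]]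
  by (auto simp: comb_def dirac_def elim!: sum.not_neutral_contains_not_neutral) (metis imageI)
qed (simp add: finite_NI[OF ij])

definition idx where "idx = the_inv_into Ix Er"

lemma idx: "i\<in>Ix ==> idx (Er i) = i"
 unfolding idx_def by (rule the_inv_into_f_f[OF Er_inj])

definition kc where "kc f g = comb Er (idx f) (idx g)"

lemma kc_Er: "i\<in>Ix ==> j\<in>Ix ==> kc (Er i) (Er j) = comb Er i j"
 by (simp add: kc_def idx)

sublocale Z: discrete_kernel "Er ` Ix" kc
 by unfold_locales (auto simp: kc_Er comb_prob comb_supp)

lemma bmf_D': "x\<in>pts X ==> (%f. f x)\<in>bmf D'"
 by (rule bmf_discreteI[of _ _ 1]) (use Kh.character_norm[unfolded htop_K characters_K] in blast)

lemma ev_dirac: "x\<in>pts X ==> i\<in>Ix ==> cint D' (%f. f x) (dirac D' (Er i)) = E i x"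
 using cint_dirac[OF _ bmf_D'] Er_apply by auto

lemma ev_sum:
 assumes "x\<in>pts X" "!!l. l\<in>F ==> cmeas D' (k l)"
 shows "cint D' (%f. f x) (%A. \<Sum>l\<in>F. a l * k l A) = (\<Sum>l\<in>F. a l * cint D' (%f. f x) (k l))"
 using assms(2) by (subst cint_msum[OF cm_scale bmf_D'[OF assms(1)]]) (auto simp: cint_mscale bmf_D'[OF assms(1)])

lemma ev_comb: "x\<in>pts X ==> i\<in>Ix ==> j\<in>Ix ==> cint D' (%f. f x) (comb Er i j) = E i x * E j x"
 unfolding comb_def using NI_sub[of i j] by (subst ev_sum) (auto simp: E_mult ev_dirac cm_dirac intro!: sum.cong)

lemma ev_kc: "x\<in>pts X ==> i\<in>Ix ==> j\<in>Ix ==> cint D' (%f. f x) (kc (Er i) (Er j)) = E i x * E j x"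
 by (simp only: kc_Er ev_comb)

lemma comb_Er: "i\<in>Ix ==> j\<in>Ix ==> kc (Er i) (Er j)\<in>Mb D'" "i\<in>Ix ==> j\<in>Ix ==> finite (supp D' (kc (Er i) (Er j)))"
 by (simp_all only: kc_Er comb_supp prob_Mb[OF comb_prob])

text \<open>Finite supports involve finitely many characters, and these are linearly independent by
  \<open>E_indep\<close>.\<close>

lemma ev_eqI:
 assumes m: "u\<in>Mb D'" "w\<in>Mb D'" and fin: "finite (supp D' u)" "finite (supp D' w)"
  and ev: "!!x. x\<in>pts X ==> cint D' (%f. f x) u = cint D' (%f. f x) w"
 shows "u = w"
proof (rule Mb_discrete_eqI[OF m])
 note sd = supp_discrete[OF Mb_cm[OF m(1)]] supp_discrete[OF Mb_cm[OF m(2)]]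
 define F where "F = {l\<in>Ix. Er l\<in>supp D' u\<union>supp D' w}"
 have "Er ` F <= supp D' u\<union>supp D' w" "inj_on Er F" using inj_on_subset[OF Er_inj, of F] by (auto simp: F_def)
 moreover from this(1) have "finite (Er ` F)" by (rule finite_subset) (intro finite_UnI fin)
 ultimately have F: "finite F" "F <= Ix" "inj_on Er F" using finite_imageD by (auto simp: F_def)
 have z: "u {f} = 0" "w {f} = 0" if "f\<in>Er ` Ix" "f\<notin>Er ` F" for f using that by (auto simp: F_def sd)
 have e: "cint D' (%f. f x) y = (\<Sum>l\<in>F. y {Er l} * E l x)" if x: "x\<in>pts X" and r: "y\<in>Mb D'" "!!f. f\<in>Er ` Ix ==> f\<notin>Er ` F ==> y {f} = 0" for x y
 proof -
  have "cint D' (%f. f x) y = (\<Sum>f\<in>Er ` F. y {f} * f x)"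
   using F by (intro cint_finite_supp[OF r(1) _ _ r(2) bmf_D'[OF x]]) auto
  then show ?thesis using F(3) Er_apply[OF x] by (simp add: sum.reindex)
 qed
 have "u {Er l} - w {Er l} = 0" if "l\<in>F" for l
 proof (rule E_indep[OF F(1,2) _ that, of "%l. u {Er l} - w {Er l}"])
  fix x assume x: "x\<in>pts X"
  then show "(\<Sum>l\<in>F. (u {Er l} - w {Er l}) * E l x) = 0"
   using ev[OF x] e[OF x m(1) z(1)] e[OF x m(2) z(2)] by (simp add: left_diff_distrib sum_subtractf)
 qed
 then show "u {f} = w {f}" if "f\<in>Er ` Ix" for f using z[OF that] by (cases "f\<in>Er ` F") auto
qed

lemma kc_eqI: "i\<in>Ix ==> j\<in>Ix ==> w\<in>Mb D' ==> finite (supp D' w) ==>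
  (!!x. x\<in>pts X ==> cint D' (%f. f x) w = E i x * E j x) ==> w = kc (Er i) (Er j)"
 by (rule ev_eqI) (simp_all only: ev_kc comb_Er)

lemma kc_commute: "i\<in>Ix ==> j\<in>Ix ==> kc (Er i) (Er j) = kc (Er j) (Er i)"
 by (rule kc_eqI) (simp_all only: ev_kc comb_Er mult.commute)

text \<open>The triple product is again finitely supported, and its evaluations are symmetric in the
  three indices; associativity is read off from this.\<close>

lemma kc_kc:
 assumes i: "i\<in>Ix" "j\<in>Ix" "k\<in>Ix"
 defines "u \<equiv> %A. \<Sum>l\<in>NI i j. T i j l * kc (Er l) (Er k) A"
 shows "Z.conv (kc (Er i) (Er j)) (dirac D' (Er k)) = u" "u\<in>Mb D'" "finite (supp D' u)"
  "x\<in>pts X ==> cint D' (%f. f x) u = E i x * E j x * E k x"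
proof -
 have N: "l\<in>Ix" if "l\<in>NI i j" for l using that NI_sub[OF i(1,2)] by blast
 have kM: "kc (Er l) (Er k)\<in>Mb D'" if "l\<in>NI i j" for l by (rule comb_Er(1)[OF N[OF that] i(3)])
 show m: "u\<in>Mb D'" unfolding u_def by (intro Mb_sum Mb_scale kM)
 have d: "dirac D' (Er l)\<in>Mb D'" if "l\<in>Ix" for l using that by (intro Mb_dirac) simp
 note dc = d[THEN Mb_cm]
 have "Z.conv (%A. \<Sum>l\<in>NI i j. T i j l * dirac D' (Er l) A) (dirac D' (Er k)) A = (\<Sum>l\<in>NI i j. T i j l * Z.conv (dirac D' (Er l)) (dirac D' (Er k)) A)" for A
  by (rule Mb_functional_sum[of D' "%u. Z.conv u (dirac D' (Er k)) A"])
   (use i N in \<open>simp_all add: Z.conv_add_left Z.conv_scale_left Mb_cm dc d finite_NI\<close>)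
 then show "Z.conv (kc (Er i) (Er j)) (dirac D' (Er k)) = u"
  unfolding u_def kc_Er[OF i(1,2)] comb_def using i(3) N by (intro ext) (auto simp: Z.conv_dirac intro!: sum.cong)
 have "supp D' u <= (\<Union>l\<in>NI i j. supp D' (kc (Er l) (Er k)))"
  unfolding supp_discrete[OF Mb_cm[OF m]] using supp_discrete[OF Mb_cm[OF kM]]
  by (auto simp: u_def elim!: sum.not_neutral_contains_not_neutral split: if_splits)
 then show "finite (supp D' u)" by (rule finite_subset) (intro finite_UN_I finite_NI[OF i(1,2)] comb_Er(2) N i(3))
 assume x: "x\<in>pts X"
 have "cint D' (%f. f x) u = (\<Sum>l\<in>NI i j. T i j l * (E l x * E k x))"
  unfolding u_def using N i(3) x by (subst ev_sum[OF x Mb_cm[OF kM]]) (auto intro!: sum.cong simp: ev_kc simp del: topspace_X)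
 also have "\<dots> = E i x * E j x * E k x" unfolding E_mult[OF i(1,2) x] by (simp add: sum_distrib_right mult.assoc)
 finally show "cint D' (%f. f x) u = E i x * E j x * E k x" .
qed

lemma conv_commute_Z: "u\<in>Mb D' ==> w\<in>Mb D' ==> Z.conv u w = Z.conv w u"
 by (rule Z.conv_commute_if) (auto intro: kc_commute)

lemma E_hunit: "x\<in>pts X ==> E (hunit H, 1) x = 1"
 by (cases x; cases "fst x") (auto simp: E_unit simp del: E.simps)

lemma dual_with_simps: "hunit (dual_with K c) = Er (hunit H, 1)" "(h, d)\<in>Ix ==> hinv (dual_with K c) (Er (h, d)) = Er (hinv H h, d)"
proof -
 show "hunit (dual_with K c) = Er (hunit H, 1)" unfolding dual_with_def htop_K Er_def by (auto simp: E_hunit fun_eq_iff restrict_def simp del: topspace_X)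
 show "hinv (dual_with K c) (Er (h, d)) = Er (hinv H h, d)" if "(h, d)\<in>Ix"
  unfolding dual_with_def htop_K using E_cnj[OF that] by (auto simp: Er_def fun_eq_iff restrict_def simp del: topspace_X)
qed

lemma comm_hypergroup_dual: "comm_hypergroup (dual_with K Z.conv)"
proof (rule Z.comm_hypergroupI)
 let ?D = "dual_with K Z.conv"
 show "htop ?D = D'" by (rule dual_K_discrete)
 show "hconv ?D = Z.conv" by (simp add: dual_with_def)
 fix x assume x: "x\<in>Er ` Ix"
 then obtain h c where i: "(h, c)\<in>Ix" "x = Er (h, c)" by auto
 show "hinv ?D x\<in>Er ` Ix" "hinv ?D (hinv ?D x) = x"
  using dual_with_simps(2) i Ix_inv(1)[OF i(1)] A.inv_inv[of h] by (auto simp: Ix_def)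
 have e: "(hunit H, 1)\<in>Ix" by (rule one_Ix[OF unit_L])
 show "kc (hunit ?D) x = dirac D' x"
  unfolding dual_with_simps i(2)
  by (rule kc_eqI[symmetric, OF e i(1)]) (use i(1) in \<open>auto simp: ev_dirac E_hunit supp_dirac Hausdorff_space_discrete_topology Mb_dirac simp del: topspace_X\<close>)
 fix y assume "y\<in>Er ` Ix"
 then obtain k d where j: "(k, d)\<in>Ix" "y = Er (k, d)" by auto
 show "kc x y = kc y x" using i j kc_commute by simp
 show "kc x y {hunit ?D} ~= 0 \<longleftrightarrow> x = hinv ?D y"
 proof -
  have hk: "h\<in>A.S" "k\<in>A.S" using i j by (auto simp: Ix_def)
  have "kc x y {hunit ?D} = A.P h k (hunit H) * ((of_real q + c * d) / (1 + of_real q))"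
   by (simp add: i(2) j(2) dual_with_simps kc_Er i(1) j(1) comb_singleton[OF Er_inj i(1) j(1) e] T_def wt_def)
  \<comment> \<open>Over mutually inverse points \<open>c\<close> and \<open>d\<close> belong to the
    same set of values. Equal values give \<open>q\<close>, \<open>q + 1\<close> or
    \<open>q + q * q\<close>, all nonzero; the mixed pair 1 and \<open>-q\<close> gives 0.\<close>
  moreover have "of_real q + c * d ~= 0 \<longleftrightarrow> d = c" if "h = hinv H k"
  proof -
   have "(h, d)\<in>Ix" using Ix_inv(1)[OF j(1)] that by simp
   moreover have "complex_of_real q * (1 + complex_of_real q) ~= 0" using q_complex by simp
   then have "complex_of_real q + complex_of_real q * complex_of_real q ~= 0" by (simp add: distrib_left)
   ultimately show ?thesis using i(1) Q.one_q by (auto simp: Ix_def bs_def split: if_splits)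
  qed
  moreover have "x = hinv ?D y \<longleftrightarrow> h = hinv H k\<and>d = c"
   using inj_on_eq_iff[OF Er_inj i(1) Ix_inv(1)[OF j(1)]] by (auto simp: i(2) j(2) dual_with_simps(2)[OF j(1)])
  ultimately show ?thesis using A.P_unit[OF hk] q_complex by auto
 qed
 fix z assume "z\<in>Er ` Ix"
 then obtain m b where k: "(m, b)\<in>Ix" "z = Er (m, b)" by auto
 show "kc (hinv ?D x) (hinv ?D y) {hinv ?D z} = kc y x {z}"
 proof -
  note inv = Ix_inv(1)[OF i(1)] Ix_inv(1)[OF j(1)] Ix_inv(1)[OF k(1)]
  have "T (hinv H h, c) (hinv H k, d) (hinv H m, b) = T (k, d) (h, c) (m, b)"
   using i(1) j(1) k(1) A.P_inv[of h k m] by (simp add: T_def Ix_def mult.commute)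
  then show ?thesis
   by (simp only: i(2) j(2) k(2) dual_with_simps(2)[OF i(1)] dual_with_simps(2)[OF j(1)] dual_with_simps(2)[OF k(1)]
     kc_Er[OF inv(1,2)] kc_Er[OF j(1) i(1)] comb_singleton[OF Er_inj inv] comb_singleton[OF Er_inj j(1) i(1) k(1)])
 qed
 note kk = kc_kc[OF i(1) j(1) k(1)] and kk' = kc_kc[OF j(1) k(1) i(1)]
 have d: "dirac D' x\<in>Mb D'" "kc y z\<in>Mb D'" using x Mb_dirac[of x D'] comb_Er(1)[OF j(1) k(1)] by (simp_all add: j(2) k(2))
 \<comment> \<open>With commutativity, associativity becomes invariance of the triple product under
   a cyclic shift.\<close>
 have "Z.conv (kc x y) (dirac D' z) = Z.conv (kc y z) (dirac D' x)"
  unfolding i(2) j(2) k(2) kk(1) kk'(1) by (rule ev_eqI) (simp_all only: kk kk' mult_ac)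
 then show "Z.conv (kc x y) (dirac D' z) = Z.conv (dirac D' x) (kc y z)" using conv_commute_Z[OF d] by simp
qed (simp only: dual_with_simps imageI[OF one_Ix[OF unit_L]])

lemma dual_convolution_Z: "dual_convolution K Z.conv"
 unfolding dual_convolution_def
proof (intro conjI ballI)
 show "hypergroup (dual_with K Z.conv)" using comm_hypergroup_dual by (rule comm_hypergroup.axioms)
 fix f g x assume "f\<in>characters K" "g\<in>characters K" and x: "x\<in>carrier_of K"
 then obtain i j where ij: "i\<in>Ix" "j\<in>Ix" "f = Er i" "g = Er j" by (auto simp: characters_K)
 have xX: "x\<in>pts X" using x by (simp only: htop_K)
 have "pconv (dual_with K Z.conv) f g = kc f g"
  unfolding pconv_def dual_K_discrete using Z.conv_dirac[of f g] ij by (simp add: dual_with_def)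
 then show "f x * g x = cint (htop (dual_with K Z.conv)) (%s. s x) (pconv (dual_with K Z.conv) f g)"
  unfolding dual_K_discrete using ev_kc[OF xX ij(1,2)] Er_apply[OF xX] by (simp add: ij)
qed

lemma strong_K: "strong K"
 using comm_hypergroup_K dual_convolution_Z by (auto simp: strong_def)

text \<open>\<open>dual\<close> uses an arbitrarily chosen dual convolution. On points it is forced:
  products have finite support, compact sets of a discrete space being finite, and evaluations
  determine such measures. Bounded bilinearity extends the agreement to all of
  \<open>Mb\<close>.\<close>

lemma dual_K_conv: assumes m: "u\<in>Mb D'" "w\<in>Mb D'" shows "hconv (dual K) u w = Z.conv u w"
proof -
 define c where "c = (SOME c. dual_convolution K c)"
 have c: "dual_convolution K c" unfolding c_def by (rule someI[of "dual_convolution K", OF dual_convolution_Z])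
 have dK: "dual K = dual_with K c" by (simp add: dual_def c_def)
 interpret U: hypergroup "dual_with K c" using c by (simp add: dual_convolution_def)
 note U = U.conv_closed U.conv_add_left U.conv_add_right U.conv_scale_left U.conv_scale_right U.conv_norm
 note U' = U[unfolded dual_K_discrete]
 let ?c = "hconv (dual_with K c)"
 have pt: "?c (dirac D' f) (dirac D' g) = kc f g" if mem: "f\<in>Er ` Ix" "g\<in>Er ` Ix" for f g
 proof -
  obtain i j where ij: "i\<in>Ix" "j\<in>Ix" "f = Er i" "g = Er j" using mem by blast
  have fg: "f\<in>carrier_of (dual_with K c)" "g\<in>carrier_of (dual_with K c)" using mem by (simp_all add: dual_K_discrete)
  have pe: "?c (dirac D' f) (dirac D' g) = pconv (dual_with K c) f g" by (simp add: pconv_def dual_K_discrete)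
  have "cint D' (%s. s x) (pconv (dual_with K c) f g) = E i x * E j x" if "x\<in>pts X" for x
  proof -
   have "f x * g x = cint (htop (dual_with K c)) (%s. s x) (pconv (dual_with K c) f g)"
    using c ij Er_character that unfolding dual_convolution_def htop_K by blast
   then show ?thesis unfolding dual_K_discrete using Er_apply[OF that] by (simp add: ij)
  qed
  then show ?thesis unfolding ij(3,4) pe[unfolded ij(3,4)] using prob_Mb[OF U.pconv_prob[OF fg]] U.compact_supp[OF fg]
   by (intro kc_eqI[OF ij(1,2)]) (simp_all add: dual_K_discrete compactin_discrete_topology ij del: topspace_X)
 qed
 have "?c u w A = Z.conv u w A" for A
 proof (cases "A <= Er ` Ix")
  case True
  have "bilin (Er ` Ix) (%u w. ?c u w A)"
   unfolding bilin_def Let_def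
  proof (intro conjI ballI allI exI[of _ 1])
   fix u w assume m: "u\<in>Mb D'" "w\<in>Mb D'"
   note cm = Mb_cm[OF U'(1)[OF m]]
   have "cmod (?c u w A) <= tv D' (?c u w) A" using True by (intro norm_le_tv[OF cm]) simp
   also have "\<dots> <= tv D' (?c u w) (Er ` Ix)" by (rule tv_mono[OF cm True])
   also have "\<dots> <= tv D' u (Er ` Ix) * tv D' w (Er ` Ix)" using U'(6)[OF m] by (simp add: Mb_norm_def)
   finally show "cmod (?c u w A) <= 1 * (tv D' u (Er ` Ix) * tv D' w (Er ` Ix))" by simp
  qed (simp_all add: U')
  from Z.conv_mono_eq[OF this m True] pt show ?thesis by simp
 next
  case False
  then show ?thesis using cm_outside[OF Mb_cm[OF U'(1)[OF m]], of A] Z.conv_outside by simp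
 qed
 then show ?thesis by (auto simp: dK)
qed

section \<open>The hyperfield hypergroup in coordinates\<close>

abbreviation \<psi> where "\<psi> \<equiv> phi_hat H\<^sub>0"

abbreviation HF where "HF \<equiv> hyperfield_hypergroup Q.G \<psi> H"

definition gf :: "'a\<times>complex \<Rightarrow> 'a\<times>two_point cmeasure" where "gf i = (fst i, Q.gm (snd i))"

abbreviation DR where "DR \<equiv> disc (gf ` Ix)"

lemma gf_inj: "inj_on gf Ix"
 by (auto simp: inj_on_def gf_def Q.gm_inj)

text \<open>The Haar measure of the trivial subhypergroup is \<open>gm 1\<close>, that of the whole
  is \<open>gm 0\<close>, and convolution multiplies parameters. The parameters over
  \<open>l\<close> thus run through \<open>bs l\<close>, the values of the characters with first
  index \<open>l\<close>.\<close>

lemma coset: "coset_measure Q.G \<psi> l g = Q.gm (if l\<in>H\<^sub>0 then Q.v g else 0)"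
 by (simp add: coset_measure_def phi_hat_def Q.Haar_trivial Q.Haar_full Q.G_simps Q.dirac_gm Q.conv_gm)

lemma coset_range: "coset_measure Q.G \<psi> l ` UNIV = Q.gm ` bs l"
proof -
 have u: "UNIV = {Ell0, Ell1}" by (auto intro: two_point.exhaust)
 show ?thesis unfolding u by (simp add: coset bs_def)
qed

lemma hyperfield_topology_discrete: "hyperfield_topology Q.G \<psi> H = DR"
proof -
 have q: "openin (quotient_topology Q.D2 f) V \<longleftrightarrow> V <= f ` UNIV" for f :: "two_point \<Rightarrow> two_point cmeasure" and V
  by (simp add: openin_quotient_topology)
 have "pts (quotient_topology Q.D2 f) = f ` UNIV" for f :: "two_point \<Rightarrow> two_point cmeasure"
  using q[of f] openin_subset[of "quotient_topology Q.D2 f" "f ` UNIV"] openin_topspace[of "quotient_topology Q.D2 f"] by blast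
 then have "openin (hyperfield_topology Q.G \<psi> H) U \<longleftrightarrow> U <= Sigma A.S (%l. Q.gm ` bs l)" for U
  unfolding hyperfield_topology_def openin_sum_topology Q.G_simps q by (auto simp: coset_range o_def)
 moreover have "Sigma A.S (%l. Q.gm ` bs l) = gf ` Ix" by (force simp: gf_def Ix_def)
 ultimately show ?thesis by (simp add: topology_eq)
qed

lemma hyperfield_integral:
 assumes P: "P\<in>Mb DR" and k: "k\<in>A.S"
 shows "cint DR (%(l, r). if l = k then r A else 0) P = (\<Sum>b\<in>bs k. Q.gm b A * P {gf (k, b)})"
proof -
 note cm = Mb_cm[OF P]
 have B: "{gf (k, b)}\<in>bor DR" if "b\<in>bs k" for b using that k by (auto simp: Ix_def)
 have "cint DR (%(l, r). if l = k then r A else 0) P = cint DR (%x. \<Sum>b\<in>bs k. Q.gm b A * of_bool (x\<in>{gf (k, b)})) P"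
 proof (rule cint_cong)
  fix x assume "x\<in>pts DR"
  then obtain l c where x: "x = gf (l, c)" "c\<in>bs l" by (auto simp: Ix_def)
  then show "(case x of (l, r) \<Rightarrow> if l = k then r A else 0) = (\<Sum>b\<in>bs k. Q.gm b A * of_bool (x\<in>{gf (k, b)}))"
   by (auto simp: gf_def Q.gm_inj of_bool_def if_distrib cong: if_cong)
 qed
 also have "\<dots> = (\<Sum>b\<in>bs k. Q.gm b A * P {gf (k, b)})"
  by (subst cint_sum[OF cm bmf_mult[OF bmf_const bmf_indicator[OF B]]], assumption)
   (intro sum.cong refl, simp only: cint_scale[OF cm bmf_indicator[OF B]] cint_indicator[OF cm B])
 finally show ?thesis .
qed

text \<open>The weights \<open>wt t\<close> are the barycentric coordinates of \<open>gm t\<close>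
  with respect to the points over \<open>k\<close>: \<open>gm\<close> is affine in its parameter,
  and the weights have sum 1 and mean \<open>t\<close>.\<close>

lemma gm_wt: "k\<in>H\<^sub>0\<or>t = 0 ==> (\<Sum>b\<in>bs k. wt t b * Q.gm b A) = Q.gm t A"
 unfolding Q.gm_def[of t] using q_complex by (auto simp: sum_bs wt_def Q.gm_points) (simp add: Q.gm_def)

text \<open>The prescribed barycentre splits over the points \<open>k\<close>; within each fibre the
  coordinates of \<open>gm_wt\<close> reproduce it, and they are unique because the points of a
  fibre are affinely independent.\<close>

lemma hyperfield_pconv_eq: assumes i: "i\<in>Ix" and j: "j\<in>Ix" shows "hyperfield_pconv Q.G \<psi> H (gf i) (gf j) = comb gf i j"
proof -
 let ?R = "%P. P\<in>Mb DR\<and>(\<forall>k\<in>A.S. \<forall>A\<in>bor (htop Q.G). cint DR (%(l, r). if l = k then r A else 0) P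
  = hconv Q.G (Q.gm (snd i)) (Q.gm (snd j)) A * pconv H (fst i) (fst j) {k})"
 have "(THE P. ?R P) = comb gf i j"
 proof (rule the_equality)
  have m: "comb gf i j\<in>Mb DR" by (rule prob_Mb[OF comb_prob[OF i j]])
  have "cint DR (%(l, r). if l = k then r A else 0) (comb gf i j) = Q.gm (snd i * snd j) A * A.P (fst i) (fst j) k" if k: "k\<in>A.S" for k A
  proof -
   have "(\<Sum>b\<in>bs k. Q.gm b A * comb gf i j {gf (k, b)}) = A.P (fst i) (fst j) k * (\<Sum>b\<in>bs k. wt (snd i * snd j) b * Q.gm b A)"
    using k by (auto simp: sum_distrib_left comb_singleton[OF gf_inj i j] Ix_def T_def intro!: sum.cong)
   also have "\<dots> = A.P (fst i) (fst j) k * Q.gm (snd i * snd j) A"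
   proof (cases "k\<in>H\<^sub>0\<or>snd i * snd j = 0")
    case False
    \<comment> \<open>A nonzero product of values puts both points into \<open>H\<^sub>0\<close>,
      whose products give no mass to a \<open>k\<close> outside.\<close>
    then have "fst i\<in>H\<^sub>0" "fst j\<in>H\<^sub>0" using Ix_zero[of "fst i" "snd i"] Ix_zero[of "fst j" "snd j"] i j by auto
    then have "A.P (fst i) (fst j) k = 0" using N_sub[of "fst i" "fst j"] A.N_eq[of "fst i" "fst j"] False k sub_subset by auto
    then show ?thesis by simp
   qed (simp add: gm_wt)
   finally show ?thesis unfolding hyperfield_integral[OF m k] by (simp add: mult.commute)
  qed
  then show "?R (comb gf i j)" using m by (simp add: Q.G_simps Q.conv_gm A.P_def)
  fix P assume P: "?R P"
  then have mP: "P\<in>Mb DR" by blast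
  have e: "(\<Sum>b\<in>bs k. Q.gm b A * P {gf (k, b)}) = (\<Sum>b\<in>bs k. Q.gm b A * comb gf i j {gf (k, b)})" if k: "k\<in>A.S" for k A
  proof -
   have "A\<in>bor (htop Q.G)" by (simp add: Q.G_simps)
   then have "cint DR (%(l, r). if l = k then r A else 0) P = cint DR (%(l, r). if l = k then r A else 0) (comb gf i j)"
    using P \<open>?R (comb gf i j)\<close> k by simp
   then show ?thesis by (simp only: hyperfield_integral[OF mP k] hyperfield_integral[OF m k])
  qed
  show "P = comb gf i j"
  proof (rule Mb_discrete_eqI[OF mP m])
   fix x assume "x\<in>gf ` Ix"
   then obtain k b where k: "k\<in>A.S" "b\<in>bs k" "x = gf (k, b)" by (auto simp: Ix_def)
   \<comment> \<open>Over \<open>H\<^sub>0\<close> the fibre consists of the point masses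
     \<open>gm 1\<close> and \<open>gm (-q)\<close>, told apart by the singletons; elsewhere it is
     one point and the total mass decides.\<close>
   show "P {x} = comb gf i j {x}" using k(2,3) e[OF k(1), of "{Ell0}"] e[OF k(1), of "{Ell1}"] e[OF k(1), of UNIV] q_complex
    by (cases "k\<in>H\<^sub>0") (auto simp: sum_bs bs_def Q.gm_singleton)
  qed
 qed
 then show ?thesis unfolding hyperfield_pconv_def hyperfield_topology_discrete gf_def by simp
qed

sublocale R: discrete_kernel "gf ` Ix" "hyperfield_pconv Q.G \<psi> H"
 by unfold_locales (auto simp: hyperfield_pconv_eq comb_prob comb_supp)

lemma HF_simps: "htop HF = DR" "hconv HF = R.conv" "hunit HF = gf (hunit H, 1)" "(h, c)\<in>Ix ==> hinv HF (gf (h, c)) = gf (hinv H h, c)"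
proof -
 show "htop HF = DR" "hconv HF = R.conv" "hunit HF = gf (hunit H, 1)"
  by (simp_all add: hyperfield_hypergroup_def hyperfield_topology_discrete coset unit_L gf_def Q.G_simps Q.v_def)
 have "measure_inv Q.G u = u" for u by (simp add: measure_inv_def push_def Q.G_simps)
 then show "hinv HF (gf (h, c)) = gf (hinv H h, c)" by (simp add: hyperfield_hypergroup_def gf_def)
qed

section \<open>The isomorphism\<close>

definition iso where "iso f = gf (idx f)"

lemma iso_Er: "i\<in>Ix ==> iso (Er i) = gf i"
 by (simp add: iso_def idx)

lemma continuous_iso: "continuous_map D' DR iso"
 by (auto simp: iso_Er)

text \<open>Both convolutions are iterated integrals of kernels with the same structure constants,
  so a change of variables in each integral suffices.\<close>

lemma iso_conv:
 assumes m: "u\<in>Mb D'" "w\<in>Mb D'"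
 shows "push D' DR iso (Z.conv u w) = R.conv (push D' DR iso u) (push D' DR iso w)"
proof
 fix A
 show "push D' DR iso (Z.conv u w) A = R.conv (push D' DR iso u) (push D' DR iso w) A"
 proof (cases "A <= gf ` Ix")
  case True
  note cm = Mb_cm[OF m(1)] Mb_cm[OF m(2)]
  note cp = cm_push[OF cm(1) continuous_iso] cm_push[OF cm(2) continuous_iso]
  let ?c = "%x y. hyperfield_pconv Q.G \<psi> H x y A"
  have "R.conv (push D' DR iso u) (push D' DR iso w) A = cint DR (%x. cint DR (?c x) (push D' DR iso w)) (push D' DR iso u)"
   using R.conv_apply[OF True] by (simp add: R.it_def)
  also have "\<dots> = cint D' (%x. cint DR (?c (iso x)) (push D' DR iso w)) u"
   by (rule cint_push[OF cm(1) continuous_iso R.bd_inner_bmf[OF R.bd_c[OF True] cp(2)]])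
  also have "\<dots> = cint D' (%x. cint D' (%y. kc x y (iso -` A\<inter>Er ` Ix)) w) u"
  proof (rule cint_cong)
   fix x assume "x\<in>pts D'"
   then obtain i where i: "i\<in>Ix" "x = Er i" by auto
   have "cint DR (?c (iso x)) (push D' DR iso w) = cint D' (%y. ?c (iso x) (iso y)) w"
    by (rule cint_push[OF cm(2) continuous_iso R.bd_bmf[OF R.bd_c[OF True]]]) (use i iso_Er in auto)
   also have "\<dots> = cint D' (%y. kc x y (iso -` A\<inter>Er ` Ix)) w"
   proof (rule cint_cong)
    fix y assume "y\<in>pts D'"
    then obtain j where j: "j\<in>Ix" "y = Er j" by auto
    have "comb gf i j A = comb Er i j (iso -` A\<inter>Er ` Ix)"
     unfolding comb_def
    proof (rule sum.cong[OF refl])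
     fix l assume "l\<in>NI i j"
     then have l: "l\<in>Ix" using NI_sub[OF i(1) j(1)] by blast
     have "dirac DR (gf l) A = dirac D' (Er l) (iso -` A\<inter>Er ` Ix)" using True l by (simp add: dirac_def iso_Er)
     then show "T i j l * dirac DR (gf l) A = T i j l * dirac D' (Er l) (iso -` A\<inter>Er ` Ix)" by simp
    qed
    then show "?c (iso x) (iso y) = kc x y (iso -` A\<inter>Er ` Ix)" using i j by (simp add: iso_Er hyperfield_pconv_eq kc_Er)
   qed
   finally show "cint DR (?c (iso x)) (push D' DR iso w) = cint D' (%y. kc x y (iso -` A\<inter>Er ` Ix)) w" .
  qed
  also have "\<dots> = push D' DR iso (Z.conv u w) A" using True Z.conv_apply[of "iso -` A\<inter>Er ` Ix" u w] by (simp add: push_def Z.it_def)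
  finally show ?thesis by simp
 qed (simp add: push_def R.conv_outside)
qed

lemma hypergroup_iso_dual_K: "hypergroup_iso iso (dual K) HF"
proof -
 have h: "htop (dual K) = D'" "htop HF = DR" unfolding dual_def by (rule dual_K_discrete HF_simps(1))+
 show ?thesis unfolding hypergroup_iso_def h
 proof (intro conjI ballI)
  have "homeomorphic_maps D' DR iso (%x. Er (the_inv_into Ix gf x))"
   by (auto simp: homeomorphic_maps_def iso_Er the_inv_into_f_f[OF gf_inj])
  then show "homeomorphic_map D' DR iso" by (rule homeomorphic_maps_imp_map)
  show "iso (hunit (dual K)) = hunit HF" unfolding dual_def dual_with_simps HF_simps by (rule iso_Er[OF one_Ix[OF unit_L]])
  fix u assume m: "u\<in>Mb D'"
  have ii: "iso (hinv (dual K) f) = hinv HF (iso f)" "hinv (dual K) f\<in>Er ` Ix" if "f\<in>Er ` Ix" for f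
   using that Ix_inv(1) unfolding dual_def by (auto simp: dual_with_simps HF_simps iso_Er)
  show "push D' DR iso (measure_inv (dual K) u) = measure_inv HF (push D' DR iso u)"
  proof
   fix A
   have "(hinv (dual K) -` (iso -` A\<inter>Er ` Ix)\<inter>Er ` Ix) = iso -` (hinv HF -` A\<inter>gf ` Ix)\<inter>Er ` Ix"
   proof (rule set_eqI)
    fix f
    have "iso f\<in>gf ` Ix" if "f\<in>Er ` Ix" using that iso_Er by auto
    then show "f\<in>hinv (dual K) -` (iso -` A\<inter>Er ` Ix)\<inter>Er ` Ix \<longleftrightarrow> f\<in>iso -` (hinv HF -` A\<inter>gf ` Ix)\<inter>Er ` Ix"
     using ii by (cases "f\<in>Er ` Ix") simp_all
   qed
   then show "push D' DR iso (measure_inv (dual K) u) A = measure_inv HF (push D' DR iso u) A"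
    by (simp add: measure_inv_def push_def h)
  qed
  fix w assume "w\<in>Mb D'"
  then show "push D' DR iso (hconv (dual K) u w) = hconv HF (push D' DR iso u) (push D' DR iso w)"
   using m by (simp add: dual_K_conv HF_simps iso_conv)
 qed
qed

text \<open>For the last condition: if \<open>k\<close> lies outside \<open>H\<^sub>0\<close>, then
  \<open>i\<close> and \<open>j\<close> cannot both lie in it, so one of \<open>\<psi> i\<close> and
  \<open>\<psi> j\<close> is already the whole two-point hypergroup.\<close>

lemma hyperfield_psi: "hyperfield Q.G \<psi> H"
proof (intro hyperfield.intro hyperfield_axioms.intro)
 show "comm_hypergroup Q.G" by (rule Q.comm_hypergroup_G)
 show "comm_hypergroup H" by unfold_locales
 show "discrete_hypergroup H" by (rule discrete_H)
 have u: "UNIV = {Ell0, Ell1}" by (auto intro: two_point.exhaust)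
 show "subhypergroup Q.G (\<psi> l)" for l
  using supp_dirac[of Q.D2 Ell0] by (auto simp: subhypergroup_def phi_hat_def Q.G_simps pconv_def Q.Z.conv_dirac Q.zk_def u[symmetric] Hausdorff_space_discrete_topology)
 show "compactin (htop Q.G) (\<psi> l)" for l by (auto simp: Q.G_simps compactin_discrete_topology phi_hat_def)
 show "\<psi> (hunit H) = {hunit Q.G}" using unit_L by (simp add: phi_hat_def Q.G_simps)
 show "\<psi> (hinv H l) = \<psi> l" if "l\<in>A.S" for l
  using that inv_L[of l] inv_L[of "hinv H l"] A.inv_inv[of l] by (auto simp: phi_hat_def)
 show "\<psi> k <= generated_subhypergroup Q.G (\<psi> i) (\<psi> j)"
  if "i\<in>A.S" "j\<in>A.S" "k\<in>supp (htop H) (pconv H i j)" for i j k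
  using that N_sub[of i j] by (auto simp: phi_hat_def generated_subhypergroup_def A.N_def)
qed

end

text \<open>The first two conjuncts give the isomorphism its meaning: the right-hand side is built
  from a genuine hyperfield, and \<open>dual\<close>, defined by choice, is a true dual because the
  union is strong.\<close>

theorem theorem5p3:
  fixes H :: "'a hypergroup_data" and H\<^sub>0 :: "'a set" and q :: real
  assumes "pontryagin H" and "discrete_hypergroup H"
    and "subhypergroup H H\<^sub>0" and "strong (subhypergroup_of H H\<^sub>0)"
    and "compactin (htop (dual H)) (annihilator H H\<^sub>0)"
    and "0 < q" and "q \<le> 1"
  shows "hyperfield (Zq2 q) (phi_hat H\<^sub>0) H
    \<and> strong (dual_union_hypergroup H H\<^sub>0 q)
    \<and> dual (dual_union_hypergroup H H\<^sub>0 q) \<cong>\<^sub>h hyperfield_hypergroup (Zq2 q) (phi_hat H\<^sub>0) H"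
proof -
  interpret union_dual H H\<^sub>0 q
    using assms by unfold_locales simp_all
  show ?thesis
    using hyperfield_psi strong_K hypergroup_iso_dual_K by (auto simp: hypergroup_isomorphic_def)
qed

end
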